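(* For any fixed $\beta > 1$ and $r \in (0, \beta^{-1})$, we have $$\sup_{n \ge 1} \mathbb{E}\left[\widetilde{V}_n^\beta(Q)^r \right] < \infty.$$
   Context: Let $d\ge 1$, $\gamma_c := \sqrt{2d}$, $Q := (0,1)^d$. Let $\rho:\mathbb{R}^d\to[0,\infty)$ be a positive definite, rotationally symmetric function with $\rho(0)=1$, $\rho\in C_c^\infty(\mathbb{R}^d)$ and $\mathrm{supp}(\rho)\subset B(0,R/2)$ for some $R>0$. Let $X$ be the associated $\star$-scale invariant field, i.e. the centred Gaussian field on $\mathbb{R}^d$ with covariance $\int_0^\infty \rho(e^u(x-y))\,du$, and let $(X_t)_{t\ge 0}$ be its martingale decomposition: a jointly Gaussian family of centred continuous random fields on $\mathbb{R}^d$ with $\mathbb{E}[X_s(x)X_t(y)] = \int_0^{\min(s,t)}\rho(e^u(x-y))\,du$ (so that $X_t-X_s$ is independent of $\mathcal{F}_s := \sigma(X_u(x): u\le s, x\in\mathbb{R}^d)$ for $s<t$). The critical Gaussian multiplicative chaos $M$ is the random measure $$M(dx) := \lim_{t\to\infty} \sqrt{t}\, e^{\gamma_c X_t(x) - dt}\,dx,$$ where the limit holds in probability with respect to the weak$^*$ topology. For $n\in\mathbb{N}$ put $\mathcal{J}_n := \{0,\dots,n-1\}^d$ and, for $\mathbf{j}\in\mathcal{J}_n$, $Q_{n,\mathbf{j}} := n^{-1}(\mathbf{j}+(0,1)^d)$. Write $\ell(n) := \log n$ and $$\widetilde V_n^\beta(Q) := \ell(n)^{\beta/2}\sum_{\mathbf{j}\in\mathcal{J}_n}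 M(Q_{n,\mathbf{j}})^\beta .$$ *)

theory Defs
  imports "HOL-Probability.Probability"
begin

section \<open>The seed covariance\<close>

text \<open>\<open>Ck k f\<close>: all derivatives of \<open>f\<close> up to order \<open>k\<close> exist and are continuous.\<close>

fun Ck :: "nat \<Rightarrow> ('a::euclidean_space \<Rightarrow> real) \<Rightarrow> bool" where
  "Ck 0 f \<longleftrightarrow> continuous_on UNIV f"
| "Ck (Suc k) f \<longleftrightarrow> (\<forall>x. f differentiable (at x)) \<and>
     (\<forall>v. Ck k (\<lambda>x. frechet_derivative f (at x) v))"

definition smooth :: "('a::euclidean_space \<Rightarrow> real) \<Rightarrow> bool" where
  "smooth f \<longleftrightarrow> (\<forall>k. Ck k f)"

definition supp :: "('a::euclidean_space \<Rightarrow> real) \<Rightarrow> 'a set" where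
  "supp f = closure {x. f x \<noteq> 0}"

definition positive_definite :: "('a::euclidean_space \<Rightarrow> real) \<Rightarrow> bool" where
  "positive_definite f \<longleftrightarrow>
     (\<forall>A c. finite A \<longrightarrow> 0 \<le> (\<Sum>x\<in>A. \<Sum>y\<in>A. c x * c y * f (x - y)))"

text \<open>Invariance is required under the full orthogonal group, so that the notion is not void
  in dimension one.\<close>

definition rotationally_symmetric :: "('a::euclidean_space \<Rightarrow> real) \<Rightarrow> bool" where
  "rotationally_symmetric f \<longleftrightarrow> (\<forall>T. orthogonal_transformation T \<longrightarrow> (\<forall>x. f (T x) = f x))"

definition seed_covariance :: "('a::euclidean_space \<Rightarrow> real) \<Rightarrow> bool" where
  "seed_covariance \<rho> \<longleftrightarrow>
     (\<forall>x. 0 \<le> \<rho> x) \<and> positive_definite \<rho> \<and> rotationally_symmetric \<rho> \<and> \<rho> 0 = 1 \<and>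
     smooth \<rho> \<and> compact (supp \<rho>) \<and> (\<exists>R>0. supp \<rho> \<subseteq> ball 0 (R / 2))"

section \<open>The martingale decomposition of the star-scale invariant field\<close>

text \<open>Degenerate (almost surely constant) variables count as Gaussian; for instance the field
  below vanishes almost surely at time 0.\<close>

definition gaussian :: "'w measure \<Rightarrow> ('w \<Rightarrow> real) \<Rightarrow> bool" where
  "gaussian P Y \<longleftrightarrow> Y \<in> borel_measurable P \<and>
     ((\<exists>\<mu>. \<exists>\<sigma>>0. distributed P lborel Y (\<lambda>y. ennreal (normal_density \<mu> \<sigma> y))) \<or>
      (\<exists>\<mu>. AE \<omega> in P. Y \<omega> = \<mu>))"

definition jointly_gaussian :: "'w measure \<Rightarrow> 'i set \<Rightarrow> ('i \<Rightarrow> 'w \<Rightarrow> real) \<Rightarrow> bool" where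
  "jointly_gaussian P I Y \<longleftrightarrow>
     (\<forall>F c. finite F \<and> F \<subseteq> I \<longrightarrow> gaussian P (\<lambda>\<omega>. \<Sum>i\<in>F. c i * Y i \<omega>))"

text \<open>\<open>X t \<omega> x\<close> is the value at the point \<open>x\<close> of the field with cutoff \<open>t \<ge> 0\<close>. Its covariance
  is the truncation at level \<open>t\<close> of \<open>\<integral>\<^sub>0\<^sup>\<infinity> \<rho> (e\<^sup>u (x - y)) du\<close>, which diverges on the diagonal.
  The log-correlated limit field exists only as a random distribution; it is determined by the
  family \<open>X\<close> and does not enter the construction of the chaos.\<close>

definition star_scale_martingale_decomposition ::
    "'w measure \<Rightarrow> ('a::euclidean_space \<Rightarrow> real) \<Rightarrow> (real \<Rightarrow> 'w \<Rightarrow> 'a \<Rightarrow> real) \<Rightarrow> bool" where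
  "star_scale_martingale_decomposition P \<rho> X \<longleftrightarrow>
     jointly_gaussian P ({0..} \<times> UNIV) (\<lambda>(t, x) \<omega>. X t \<omega> x) \<and>
     (\<forall>t\<ge>0. \<forall>\<omega>\<in>space P. continuous_on UNIV (X t \<omega>)) \<and>
     (\<forall>t\<ge>0. \<forall>x. (LINT \<omega>|P. X t \<omega> x) = 0) \<and>
     (\<forall>s\<ge>0. \<forall>t\<ge>0. \<forall>x y. (LINT \<omega>|P. X s \<omega> x * X t \<omega> y) =
        (LINT u:{0..min s t}|lborel. \<rho> (exp u *\<^sub>R (x - y))))"

section \<open>The critical multiplicative chaos\<close>

definition random_measure :: "'w measure \<Rightarrow> ('w \<Rightarrow> 'a::euclidean_space measure) \<Rightarrow> bool" where
  "random_measure P M \<longleftrightarrow>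
     (\<forall>\<omega>\<in>space P. sets (M \<omega>) = sets borel \<and> (\<forall>K. compact K \<longrightarrow> emeasure (M \<omega>) K < \<infinity>)) \<and>
     (\<forall>B\<in>sets borel. (\<lambda>\<omega>. emeasure (M \<omega>) B) \<in> borel_measurable P)"

definition Cc :: "('a::euclidean_space \<Rightarrow> real) set" where
  "Cc = {\<phi>. continuous_on UNIV \<phi> \<and> compact (supp \<phi>)}"

text \<open>Locally finite measures are viewed in the dual of \<open>Cc\<close>. The basic weak-star neighbourhoods
  of a measure are given by finitely many test functions and a tolerance \<open>\<epsilon>\<close>; the event below
  says that \<open>N t \<omega>\<close> lies outside such a neighbourhood of \<open>M \<omega>\<close>.\<close>

definition weak_star_limit_in_probability ::
    "'w measure \<Rightarrow> (real \<Rightarrow> 'w \<Rightarrow> 'a::euclidean_space measure) \<Rightarrow> ('w \<Rightarrow> 'a measure) \<Rightarrow> bool" where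
  "weak_star_limit_in_probability P N M \<longleftrightarrow>
     (\<forall>\<Phi> \<epsilon>. finite \<Phi> \<and> \<Phi> \<subseteq> Cc \<and> \<epsilon> > 0 \<longrightarrow>
        ((\<lambda>t. measure P {\<omega>\<in>space P.
            \<exists>\<phi>\<in>\<Phi>. \<epsilon> \<le> \<bar>(LINT x|N t \<omega>. \<phi> x) - (LINT x|M \<omega>. \<phi> x)\<bar>}) \<longlongrightarrow> 0) at_top)"

definition critical_gamma :: "'d::finite itself \<Rightarrow> real" where
  "critical_gamma _ = sqrt (2 * real CARD('d))"

definition critical_approx ::
    "(real \<Rightarrow> 'w \<Rightarrow> real ^ 'd \<Rightarrow> real) \<Rightarrow> real \<Rightarrow> 'w \<Rightarrow> (real ^ 'd::finite) measure" where
  "critical_approx X t \<omega> = density lborel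
     (\<lambda>x. ennreal (sqrt t * exp (critical_gamma TYPE('d) * X t \<omega> x - real CARD('d) * t)))"

definition critical_chaos ::
    "'w measure \<Rightarrow> (real \<Rightarrow> 'w \<Rightarrow> real ^ 'd \<Rightarrow> real) \<Rightarrow> ('w \<Rightarrow> (real ^ 'd::finite) measure) \<Rightarrow> bool" where
  "critical_chaos P X M \<longleftrightarrow>
     random_measure P M \<and> weak_star_limit_in_probability P (critical_approx X) M"

section \<open>Renormalised power variation\<close>

definition unit_cube :: "(real ^ 'd::finite) set" where
  "unit_cube = {x. \<forall>i. 0 < x $ i \<and> x $ i < 1}"

definition cube_indices :: "nat \<Rightarrow> (nat ^ 'd::finite) set" where
  "cube_indices n = {j. \<forall>i. j $ i < n}"

definition subcube :: "nat \<Rightarrow> nat ^ 'd \<Rightarrow> (real ^ 'd::finite) set" where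
  "subcube n j = (\<lambda>y. (1 / real n) *\<^sub>R ((\<chi> i. real (j $ i)) + y)) ` unit_cube"

text \<open>For \<open>\<beta> > 0\<close> the prefactor vanishes at \<open>n = 1\<close>, in agreement with \<open>0 powr a = 0\<close>.\<close>

definition renormalised_variation ::
    "('w \<Rightarrow> (real ^ 'd::finite) measure) \<Rightarrow> real \<Rightarrow> nat \<Rightarrow> 'w \<Rightarrow> real" where
  "renormalised_variation M \<beta> n \<omega> =
     ln (real n) powr (\<beta> / 2) * (\<Sum>j\<in>cube_indices n. measure (M \<omega>) (subcube n j) powr \<beta>)"

end

theory Submission
  imports Defs
begin

text \<open>
  At integer times \<open>k\<close> put \<open>S k x = X k x - \<gamma> * k\<close>. Under the tilt by \<open>exp (\<gamma> * X k x - dim * k)\<close> the process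
  \<open>S\<close> becomes a Gaussian random walk without drift, whose probability of staying below a barrier at
  height \<open>l\<close> for \<open>a\<close> steps is of order \<open>(1 + l) / sqrt a\<close>. Hence the expected number of cells of side
  \<open>exp (- k)\<close> in which \<open>S\<close> first exceeds \<open>lam\<close> is summable in \<open>k\<close> and of order \<open>exp (- \<gamma> * lam)\<close>, while
  the mass carried by the points that stay below \<open>lam\<close> has second moment of order \<open>exp (\<gamma> * lam)\<close>; each
  point of a cube of side \<open>exp (- a)\<close> contributes the survival factor \<open>(1 + l) / sqrt a\<close> on the event that \<open>S\<close> has
  stayed below \<open>l\<close> up to time \<open>a\<close>.

  With \<open>exp (\<gamma> * lam) = w\<close>, Chebyshev's inequality bounds the probability that the cube has mass above \<open>w\<close>
  by a multiple of \<open>exp (- dim * a) * (1 + l) / (w * sqrt a)\<close>. For \<open>n \<approx> exp a\<close> there are about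
  \<open>exp (dim * a)\<close> cubes. Since \<open>\<beta> > 1\<close>, the sum of the \<open>\<beta>\<close>-th powers has, up to a constant, the tail of the
  largest of them. So \<open>sqrt a\<close> times the \<open>\<beta>\<close>-norm of the masses exceeds \<open>z\<close> with probability
  \<open>O ((1 + l) / z)\<close> on the barrier event, whose complement has probability \<open>O (exp (- \<gamma> * l))\<close>. The choice
  \<open>exp (\<gamma> * l) = z\<close> yields the tail \<open>(1 + ln z) / z\<close> uniformly in \<open>n\<close>, hence bounded moments of every order
  \<open>\<beta> * r < 1\<close>.
\<close>

text \<open>The tilt computes expectations at a single point, but the barrier has to hold at every
  point of a cube. A crossing somewhere in a cell is therefore charged to the volume of the points
  within 1 of the crossing level, and the random constant of this comparison is a Sobolev-type sum
  whose moments are computed layer by layer under the tilt. The normalisation \<open>sqrt T\<close>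
  is the second obstacle. A pair of points that separates at scale k contributes T / (T + 1 - k),
  which is bounded for k \<le> T / 2 but not near T. There the three-halves decay of the killed walk
  makes the contribution vanish, so the mass estimates hold for T large depending on all parameters,
  with bounds free of T; this suffices for the weak limit. Tails of the cube masses enter at all
  levels w > 0, so \<open>lam\<close> may be negative or below l, and the estimates after time a
  must admit starting points above the barrier. Independence comes only from Gaussian orthogonality;
  correlated factors are always separated by elementary inequalities between products and
  squares.\<close>

lemma std_normal_density_exp:
  "std_normal_density n * exp (\<theta> * n) = exp (\<theta>\<^sup>2 / 2) * normal_density \<theta> 1 n"
proof -
  have "- n\<^sup>2 / 2 + \<theta> * n = \<theta>\<^sup>2 / 2 + - (n - \<theta>)\<^sup>2 / 2"
    by (simp add: power2_eq_square field_simps)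
  then show ?thesis
    by (simp add: normal_density_def flip: exp_add)
qed

lemma integrable_std_normal_exp: "integrable lborel (\<lambda>n. std_normal_density n * exp (\<theta> * n))"
  unfolding std_normal_density_exp by simp

lemma integral_std_normal_exp: "(LINT n|lborel. std_normal_density n * exp (\<theta> * n)) = exp (\<theta>\<^sup>2 / 2)"
  unfolding std_normal_density_exp by simp

lemma nn_integral_std_normal_exp:
  "(\<integral>\<^sup>+n. ennreal (std_normal_density n * exp (\<theta> * n)) \<partial>lborel) = ennreal (exp (\<theta>\<^sup>2 / 2))"
  by (subst nn_integral_eq_integral[OF integrable_std_normal_exp])
     (simp_all add: integral_std_normal_exp)

lemma nn_integral_std_normal: "(\<integral>\<^sup>+n. ennreal (std_normal_density n) \<partial>lborel) = 1"
  using nn_integral_std_normal_exp[of 0] by simp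

lemma integral_std_normal_ge_half:
  "1 / 2 \<le> (LINT n|lborel. std_normal_density n * indicator {0<..} n)"
proof -
  have int: "integrable lborel (\<lambda>n. std_normal_density n * indicator A n)" if "A \<in> sets borel" for A
    by (rule Bochner_Integration.integrable_bound[of _ std_normal_density])
       (use that in \<open>auto simp: indicator_def\<close>)
  have "(LINT n|lborel. std_normal_density n * indicator {..0} n) =
      (LINT n|lborel. std_normal_density n * indicator {0..} n)"
    by (subst lborel_integral_real_affine[of "-1" _ 0]) (auto simp: indicator_def normal_density_def)
  also have "\<dots> = (LINT n|lborel. std_normal_density n * indicator {0<..} n)"
    by (rule integral_cong_AE) (use AE_lborel_singleton[of 0] in \<open>auto elim!: eventually_mono simp: indicator_def\<close>)
  finally have "(LINT n|lborel. std_normal_density n * indicator {..0} n) =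
    (LINT n|lborel. std_normal_density n * indicator {0<..} n)" .
  moreover have "(LINT n|lborel. std_normal_density n * indicator {..0} n) +
     (LINT n|lborel. std_normal_density n * indicator {0<..} n) = (LINT n|lborel. std_normal_density n)"
    by (subst Bochner_Integration.integral_add[symmetric, OF int int])
       (auto intro!: Bochner_Integration.integral_cong simp: indicator_def simp del: integral_normal_density)
  ultimately show ?thesis by simp
qed

section \<open>Gaussian random walk below a barrier\<close>

text \<open>In terms of the distance \<open>y\<close> to the barrier, this function is a strict supersolution for the
  killed walk: one step lowers it by a multiple of \<open>exp (- \<kappa> * (y + 3))\<close>. The case of small \<open>\<kappa>\<close> gives the
  survival probability, that of fixed \<open>\<kappa>\<close> the Green function bound. The shift by 3 absorbs the
  overshoot at the barrier.\<close>

definition barrier_fun :: "real \<Rightarrow> real \<Rightarrow> real" where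
  "barrier_fun \<kappa> y = 1 - exp (- \<kappa> * (y + 3))"

lemma barrier_fun_nonneg: "0 \<le> \<kappa> \<Longrightarrow> -3 \<le> y \<Longrightarrow> 0 \<le> barrier_fun \<kappa> y"
  by (simp add: barrier_fun_def mult_nonneg_nonneg)

lemma barrier_fun_le_1: "barrier_fun \<kappa> y \<le> 1"
  by (simp add: barrier_fun_def)

lemma barrier_fun_le_linear: "barrier_fun \<kappa> y \<le> \<kappa> * (y + 3)"
  using exp_ge_add_one_self[of "- \<kappa> * (y + 3)"] by (simp add: barrier_fun_def)

lemma integrable_barrier_fun: "integrable lborel (\<lambda>n. std_normal_density n * barrier_fun \<kappa> (y - n))"
proof -
  have "(\<lambda>n. std_normal_density n * barrier_fun \<kappa> (y - n)) =
      (\<lambda>n. std_normal_density n - exp (- \<kappa> * (y + 3)) * (std_normal_density n * exp (\<kappa> * n)))"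
    by (auto simp: barrier_fun_def fun_eq_iff algebra_simps simp flip: exp_add)
  then show ?thesis using integrable_std_normal_exp by auto
qed

lemma integrable_barrier_fun_indicator:
  assumes [measurable]: "A \<in> sets borel"
  shows "integrable lborel (\<lambda>n. std_normal_density n * (indicator A n * barrier_fun \<kappa> (y - n)))"
  by (rule Bochner_Integration.integrable_bound[OF integrable_barrier_fun[of \<kappa> y]])
     (auto simp: indicator_def barrier_fun_def)

lemma integral_barrier_fun:
  "(LINT n|lborel. std_normal_density n * barrier_fun \<kappa> (y - n)) =
    1 - exp (\<kappa>\<^sup>2 / 2) * exp (- \<kappa> * (y + 3))"
proof -
  have "(\<lambda>n. std_normal_density n * barrier_fun \<kappa> (y - n)) =
      (\<lambda>n. std_normal_density n - exp (- \<kappa> * (y + 3)) * (std_normal_density n * exp (\<kappa> * n)))"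
    by (auto simp: barrier_fun_def fun_eq_iff algebra_simps simp flip: exp_add)
  then show ?thesis using integrable_std_normal_exp by (auto simp: integral_std_normal_exp)
qed

text \<open>The overshoot of a Gaussian step beyond a level \<open>y \<ge> 0\<close> is stochastically largest for
  \<open>y = 0\<close>, where its exponential moment of order \<open>\<kappa>\<close> is at most \<open>exp (3 * \<kappa>)\<close>.\<close>

lemma integral_barrier_fun_overshoot_nonneg:
  assumes "0 \<le> y" "0 < \<kappa>" "\<kappa> \<le> 1"
  shows "0 \<le> (LINT n|lborel. std_normal_density n * (indicator {y<..} n * barrier_fun \<kappa> (y - n)))"
proof -
  let ?g = "\<lambda>u. barrier_fun \<kappa> (- u)"
  have int0: "integrable lborel (\<lambda>n. std_normal_density n * (indicator {0<..} n * ?g n))"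
    using integrable_barrier_fun_indicator[of "{0<..}" \<kappa> 0] by simp
  have exp1: "(LINT n|lborel. std_normal_density n * exp n * indicator {0<..} n) \<le> 2"
  proof -
    have "(LINT n|lborel. std_normal_density n * exp n * indicator {0<..} n)
        \<le> (LINT n|lborel. std_normal_density n * exp n)"
      using integrable_std_normal_exp[of 1]
      by (intro integral_mono Bochner_Integration.integrable_bound[OF integrable_std_normal_exp[of 1]])
         (auto simp: indicator_def)
    also have "\<dots> = exp (1/2)" using integral_std_normal_exp[of 1] by simp
    also have "\<dots> \<le> 2" using exp_bound_half[of "1/2::real"] by simp
    finally show ?thesis .
  qed
  have ints: "integrable lborel (\<lambda>n. std_normal_density n * indicator {0<..} n)"
     "integrable lborel (\<lambda>n. std_normal_density n * exp n * indicator {0<..} n)"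
    by (rule Bochner_Integration.integrable_bound[OF integrable_std_normal_exp[of 0]]
             Bochner_Integration.integrable_bound[OF integrable_std_normal_exp[of 1]];
        auto simp: indicator_def)+
  have pos: "0 \<le> (LINT n|lborel. std_normal_density n * (indicator {0<..} n * ?g n))"
  proof -
    \<comment> \<open>Convexity on the segment from 0 to u reduces every rate \<kappa> \<le> 1 to
      the exponential moment of order 1.\<close>
    have cvx: "exp (\<kappa> * u) \<le> 1 + \<kappa> * (exp u - 1)" for u :: real
    proof -
      have "exp ((1 - \<kappa>) *\<^sub>R 0 + \<kappa> *\<^sub>R u) \<le> (1 - \<kappa>) * exp 0 + \<kappa> * exp u"
        by (rule convex_onD[OF exp_convex]) (use assms in auto)
      then show ?thesis by (simp add: algebra_simps)
    qed
    have e3: "exp (- 3 * \<kappa>) * (1 + 3 * \<kappa>) \<le> 1"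
    proof -
      have "exp (- 3 * \<kappa>) * (1 + 3 * \<kappa>) \<le> exp (- 3 * \<kappa>) * exp (3 * \<kappa>)"
        by (intro mult_left_mono exp_ge_add_one_self) auto
      then show ?thesis by (simp flip: exp_add)
    qed
    have "0 \<le> (1 - exp (- 3 * \<kappa>) * (1 + 3 * \<kappa>)) / 2" using e3 by simp
    \<comment> \<open>Mass at least 1/2 and exponential moment at most 2 on the half-line combine to
      the factor 1 + 3 * \<kappa>. This fixes the shift 3 in \<open>barrier_fun\<close>.\<close>
    also have "\<dots> = (1 - exp (- 3 * \<kappa>) * (1 - \<kappa>)) * (1/2) - \<kappa> * exp (- 3 * \<kappa>) * 2"
      by (simp add: field_simps)
    also have "\<dots> \<le> (1 - exp (- 3 * \<kappa>) * (1 - \<kappa>)) * (LINT n|lborel. std_normal_density n * indicator {0<..} n)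
        - \<kappa> * exp (- 3 * \<kappa>) * (LINT n|lborel. std_normal_density n * exp n * indicator {0<..} n)"
    proof (intro diff_mono mult_left_mono integral_std_normal_ge_half exp1)
      have "exp (- 3 * \<kappa>) * (1 - \<kappa>) \<le> 1 * 1" by (intro mult_mono) (use assms in auto)
      then show "0 \<le> 1 - exp (- 3 * \<kappa>) * (1 - \<kappa>)" by simp
    qed (use assms in auto)
    also have "\<dots> = (LINT n|lborel. (1 - exp (- 3 * \<kappa>) * (1 - \<kappa>)) * (std_normal_density n * indicator {0<..} n)
        - \<kappa> * exp (- 3 * \<kappa>) * (std_normal_density n * exp n * indicator {0<..} n))"
      using ints by simp
    also have "\<dots> \<le> (LINT n|lborel. std_normal_density n * (indicator {0<..} n * ?g n))"
    proof (rule integral_mono[OF _ int0])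
      fix n
      have "?g n = 1 - exp (- 3 * \<kappa>) * exp (\<kappa> * n)"
        by (simp add: barrier_fun_def algebra_simps flip: exp_add)
      also have "\<dots> \<ge> 1 - exp (- 3 * \<kappa>) * (1 + \<kappa> * (exp n - 1))"
        by (intro diff_left_mono mult_left_mono cvx) auto
      finally have "std_normal_density n * (indicator {0<..} n * (1 - exp (- 3 * \<kappa>) * (1 + \<kappa> * (exp n - 1))))
          \<le> std_normal_density n * (indicator {0<..} n * ?g n)"
        by (intro mult_left_mono) auto
      then show "(1 - exp (- 3 * \<kappa>) * (1 - \<kappa>)) * (std_normal_density n * indicator {0<..} n)
        - \<kappa> * exp (- 3 * \<kappa>) * (std_normal_density n * exp n * indicator {0<..} n)
         \<le> std_normal_density n * (indicator {0<..} n * ?g n)"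
        by (simp add: algebra_simps)
    qed (use ints in auto)
    finally show ?thesis .
  qed
  have "0 \<le> exp (- 3 * y - y\<^sup>2 / 2) * (LINT n|lborel. std_normal_density n * (indicator {0<..} n * ?g n))"
    using pos by simp
  also have "\<dots> = (LINT n|lborel. exp (- 3 * y - y\<^sup>2 / 2) * (std_normal_density n * (indicator {0<..} n * ?g n)))"
    by simp
  also have "\<dots> \<le> (LINT n|lborel. std_normal_density (y + n) * (indicator {0<..} n * ?g n))"
  proof (rule integral_mono)
    fix n
    have sd: "std_normal_density (y + n) = std_normal_density n * (exp (- y * n) * exp (- y\<^sup>2 / 2))"
      by (simp add: normal_density_def flip: exp_add) (simp add: power2_eq_square field_simps)
    \<comment> \<open>Translation by y multiplies the density by exp (- y * n), up to a constant.
      This ratio decreases in n, and \<open>?g\<close> is nonnegative up to n = 3 and nonpositive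
      beyond, so replacing the ratio by its value at 3 can only lower the integral.\<close>
    have "0 \<le> (exp (- y * n) - exp (- 3 * y)) * ?g n"
    proof (cases "n \<le> 3")
      case True
      then have "n * y \<le> 3 * y" using assms by (intro mult_right_mono) auto
      then have "0 \<le> exp (- y * n) - exp (- 3 * y)" by (simp add: mult.commute)
      moreover have "0 \<le> ?g n" using True assms by (intro barrier_fun_nonneg) auto
      ultimately show ?thesis by (rule mult_nonneg_nonneg)
    next
      case False
      then have "3 * y \<le> n * y" using assms by (intro mult_right_mono) auto
      then have "exp (- y * n) - exp (- 3 * y) \<le> 0" by (simp add: mult.commute)
      moreover have "?g n \<le> 0" using False assms by (simp add: barrier_fun_def mult_nonneg_nonpos)
      ultimately show ?thesis by (rule mult_nonpos_nonpos)
    qed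
    then have "0 \<le> exp (- y\<^sup>2 / 2) * std_normal_density n * indicator {0<..} n * ((exp (- y * n) - exp (- 3 * y)) * ?g n)"
      by (intro mult_nonneg_nonneg[of "exp (- y\<^sup>2 / 2) * std_normal_density n * indicator {0<..} n"]) auto
    moreover have "exp (- 3 * y - y\<^sup>2 / 2) = exp (- 3 * y) * exp (- y\<^sup>2 / 2)"
      by (simp flip: exp_add)
    ultimately show "exp (- 3 * y - y\<^sup>2 / 2) * (std_normal_density n * (indicator {0<..} n * ?g n))
       \<le> std_normal_density (y + n) * (indicator {0<..} n * ?g n)"
      unfolding sd by (simp only: algebra_simps)
  next
    have "integrable lborel (\<lambda>n. std_normal_density (y + 1 * n) * (indicator {y<..} (y + 1 * n) * barrier_fun \<kappa> (y - (y + 1 * n))))"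
      using integrable_barrier_fun_indicator[of "{y<..}" \<kappa> y] by (rule lborel_integrable_real_affine) auto
    also have "(\<lambda>n. std_normal_density (y + 1 * n) * (indicator {y<..} (y + 1 * n) * barrier_fun \<kappa> (y - (y + 1 * n)))) =
       (\<lambda>n. std_normal_density (y + n) * (indicator {0<..} n * ?g n))"
      by (auto simp: indicator_def)
    finally show "integrable lborel (\<lambda>n. std_normal_density (y + n) * (indicator {0<..} n * ?g n))" .
  qed (use int0 in auto)
  also have "\<dots> = (LINT n|lborel. std_normal_density n * (indicator {y<..} n * barrier_fun \<kappa> (y - n)))"
    by (subst lborel_integral_real_affine[of 1 _ y]) (auto simp: indicator_def)
  finally show ?thesis .
qed

text \<open>Over the whole line a step multiplies the exponential in \<open>barrier_fun\<close> by
  exp (\<kappa> ^ 2 / 2), which is the stated drop. The part beyond the barrier has nonnegative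
  integral and may be discarded.\<close>

lemma integral_barrier_fun_le:
  assumes "0 \<le> y" "0 < \<kappa>" "\<kappa> \<le> 1"
  shows "(LINT n|lborel. std_normal_density n * (indicator {..y} n * barrier_fun \<kappa> (y - n))) \<le>
    barrier_fun \<kappa> y - (exp (\<kappa>\<^sup>2 / 2) - 1) * exp (- \<kappa> * (y + 3))"
proof -
  have "(LINT n|lborel. std_normal_density n * (indicator {..y} n * barrier_fun \<kappa> (y - n))) +
      (LINT n|lborel. std_normal_density n * (indicator {y<..} n * barrier_fun \<kappa> (y - n))) =
      (LINT n|lborel. std_normal_density n * barrier_fun \<kappa> (y - n))"
    by (subst Bochner_Integration.integral_add[symmetric, OF integrable_barrier_fun_indicator integrable_barrier_fun_indicator])
       (auto intro!: Bochner_Integration.integral_cong simp: indicator_def)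
  then show ?thesis
    using integral_barrier_fun_overshoot_nonneg[OF assms] integral_barrier_fun[of \<kappa> y]
    by (simp add: barrier_fun_def algebra_simps)
qed

text \<open>The right-hand side dominates the integral of a nonnegative function. Since
  \<open>ennreal\<close> sends negative reals to 0, sums can be split there only with this sign at
  hand.\<close>

lemma barrier_fun_drift_nonneg:
  assumes "0 \<le> y" "0 < \<kappa>" "\<kappa> \<le> 1"
  shows "0 \<le> barrier_fun \<kappa> y - (exp (\<kappa>\<^sup>2 / 2) - 1) * exp (- \<kappa> * (y + 3))"
proof -
  have "0 \<le> (LINT n|lborel. std_normal_density n * (indicator {..y} n * barrier_fun \<kappa> (y - n)))"
    by (intro integral_nonneg_AE AE_I2) (use assms in \<open>auto simp: indicator_def intro!: barrier_fun_nonneg mult_nonneg_nonneg\<close>)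
  then show ?thesis using integral_barrier_fun_le[OF assms] by linarith
qed

text \<open>Transition operator of the Gaussian walk killed above b. The position is tested after
  the step, so the starting point itself may lie above b.\<close>

definition kstep :: "real \<Rightarrow> (real \<Rightarrow> ennreal) \<Rightarrow> real \<Rightarrow> ennreal" where
  "kstep b g s = (\<integral>\<^sup>+n. ennreal (std_normal_density n) * (indicator {..b} (s + n) * g (s + n)) \<partial>lborel)"

lemma measurable_kstep[measurable (raw)]:
  assumes [measurable]: "g \<in> borel_measurable borel"
  shows "kstep b g \<in> borel_measurable borel"
  unfolding kstep_def by measurable

lemma measurable_kstep_pow[measurable (raw)]:
  "g \<in> borel_measurable borel \<Longrightarrow> (kstep b ^^ k) g \<in> borel_measurable borel"
  by (induction k) auto

lemma kstep_mono: "(\<And>s. s \<le> b \<Longrightarrow> g s \<le> h s) \<Longrightarrow> kstep b g s \<le> kstep b h s"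
  unfolding kstep_def by (intro nn_integral_mono) (auto simp: indicator_def intro!: mult_left_mono)

lemma kstep_cmult:
  assumes [measurable]: "g \<in> borel_measurable borel"
  shows "kstep b (\<lambda>s. c * g s) s = c * kstep b g s"
  unfolding kstep_def by (subst nn_integral_cmult[symmetric]) (auto simp: mult_ac)

lemma kstep_add:
  assumes [measurable]: "g \<in> borel_measurable borel" "h \<in> borel_measurable borel"
  shows "kstep b (\<lambda>s. g s + h s) s = kstep b g s + kstep b h s"
  unfolding kstep_def by (subst nn_integral_add[symmetric]) (auto simp: distrib_left)

lemma kstep_const_le: "kstep b (\<lambda>_. c) s \<le> c"
proof -
  have "kstep b (\<lambda>_. c) s \<le> (\<integral>\<^sup>+n. ennreal (std_normal_density n) * c \<partial>lborel)"
    unfolding kstep_def by (intro nn_integral_mono mult_left_mono) (auto simp: indicator_def)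
  also have "\<dots> = c" by (simp add: nn_integral_multc nn_integral_std_normal)
  finally show ?thesis .
qed

lemma kstep_pow_const_le: "(kstep b ^^ k) (\<lambda>_. c) s \<le> c"
proof (induction k arbitrary: s)
  case (Suc k)
  have "(kstep b ^^ Suc k) (\<lambda>_. c) s \<le> kstep b (\<lambda>_. c) s"
    using Suc by (auto intro!: kstep_mono)
  then show ?case using kstep_const_le order_trans by blast
qed simp

lemma kstep_barrier_fun_le:
  assumes "s \<le> b" "0 < \<kappa>" "\<kappa> \<le> 1"
  shows "kstep b (\<lambda>s. ennreal (barrier_fun \<kappa> (b - s))) s \<le>
    ennreal (barrier_fun \<kappa> (b - s) - (exp (\<kappa>\<^sup>2 / 2) - 1) * exp (- \<kappa> * (b - s + 3)))"
proof -
  have "kstep b (\<lambda>s. ennreal (barrier_fun \<kappa> (b - s))) s =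
    (\<integral>\<^sup>+n. ennreal (std_normal_density n * (indicator {..b - s} n * barrier_fun \<kappa> (b - s - n))) \<partial>lborel)"
    unfolding kstep_def
    by (intro nn_integral_cong) (auto simp: indicator_def ennreal_mult' algebra_simps)
  also have "\<dots> = ennreal (LINT n|lborel. std_normal_density n * (indicator {..b - s} n * barrier_fun \<kappa> (b - s - n)))"
    by (rule nn_integral_eq_integral[OF integrable_barrier_fun_indicator])
       (use assms in \<open>auto simp: indicator_def intro!: barrier_fun_nonneg AE_I2 mult_nonneg_nonneg\<close>)
  finally show ?thesis
    using integral_barrier_fun_le[of "b - s" \<kappa>] assms by (simp add: ennreal_leI)
qed

text \<open>With \<kappa> = 1 / sqrt k, the function 110 * \<open>barrier_fun\<close> + (1 - j / k)
  dominates the probability of surviving j steps. At distance at least 1 / \<kappa> it exceeds 1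
  already; closer to the barrier, the drop of \<open>barrier_fun\<close> in one step pays for the
  decrease 1 / k of the linear term. At j = k only \<open>barrier_fun\<close> remains, and it is at
  most linear.\<close>

lemma kstep_pow_one_le:
  assumes "1 \<le> k" "s \<le> b"
  shows "(kstep b ^^ k) (\<lambda>_. 1) s \<le> ennreal (110 * (b - s + 3) / sqrt k)"
proof -
  define \<kappa> where "\<kappa> = 1 / sqrt k"
  have \<kappa>: "0 < \<kappa>" "\<kappa> \<le> 1" "\<kappa>\<^sup>2 = 1 / k" using assms by (auto simp: \<kappa>_def field_simps)
  have step: "(kstep b ^^ j) (\<lambda>_. 1) s \<le> ennreal (110 * barrier_fun \<kappa> (b - s) + (1 - real j / real k))"
    if "j \<le> k" "s \<le> b" for j s
    using that
  proof (induction j arbitrary: s)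
    case 0
    then show ?case using barrier_fun_nonneg[of \<kappa> "b - s"] \<kappa> by simp
  next
    case (Suc j)
    note bn = barrier_fun_nonneg[of \<kappa> "b - s"]
    show ?case
    proof (cases "1 / \<kappa> \<le> b - s")
      case True
      then have "1 \<le> \<kappa> * (b - s)" using \<kappa> by (simp add: field_simps)
      then have "exp (- \<kappa> * (b - s + 3)) \<le> exp (-1)" using \<kappa> by (simp add: algebra_simps)
      also have "exp (- 1::real) \<le> 1/2" using exp_ge_add_one_self[of "1::real"] by (simp add: exp_minus field_simps)
      finally have "1 \<le> 110 * barrier_fun \<kappa> (b - s)" by (simp add: barrier_fun_def)
      moreover have "real (Suc j) / real k \<le> 1" using Suc.prems by simp
      ultimately have "1 \<le> 110 * barrier_fun \<kappa> (b - s) + (1 - real (Suc j) / real k)" by linarith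
      then have "ennreal 1 \<le> ennreal (110 * barrier_fun \<kappa> (b - s) + (1 - real (Suc j) / real k))"
        by (rule ennreal_leI)
      then show ?thesis using kstep_pow_const_le[where c=1, of "Suc j" b s] by (auto intro: order_trans)
    next
      case False
      \<comment> \<open>Within distance 1 / \<kappa> of the barrier the exponent is at least - (1 +
        3 * \<kappa>) \<ge> -4. The constant 110 is twice 55, an upper bound for exp 4.\<close>
      have bound: "1 / k \<le> 110 * ((exp (\<kappa>\<^sup>2 / 2) - 1) * exp (- \<kappa> * (b - s + 3)))"
      proof -
        have "\<kappa> * (b - s) \<le> 1" using False \<kappa> by (simp add: field_simps)
        then have "exp (-4) \<le> exp (- \<kappa> * (b - s + 3))" using \<kappa> by (simp add: algebra_simps)
        moreover have "\<kappa>\<^sup>2 / 2 \<le> exp (\<kappa>\<^sup>2 / 2) - 1"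
          using exp_ge_add_one_self[of "\<kappa>\<^sup>2 / 2"] by linarith
        ultimately have "(\<kappa>\<^sup>2 / 2) * exp (-4) \<le> (exp (\<kappa>\<^sup>2 / 2) - 1) * exp (- \<kappa> * (b - s + 3))"
          by (intro mult_mono) auto
        moreover have "exp (4::real) \<le> 55"
        proof -
          have "exp (4::real) = exp 1 ^ 4" by (simp flip: exp_of_nat_mult)
          also have "\<dots> \<le> 2.72 ^ 4" by (intro power_mono) (use e_less_272 in auto)
          finally show ?thesis by (simp add: power_divide)
        qed
        then have "2 \<le> 110 * exp (-4::real)" by (simp add: exp_minus field_simps)
        then have "(\<kappa>\<^sup>2 / 2) * 2 \<le> (\<kappa>\<^sup>2 / 2) * (110 * exp (-4))"
          by (rule mult_left_mono) auto
        ultimately show ?thesis using \<kappa> by linarith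
      qed
      have "(kstep b ^^ Suc j) (\<lambda>_. 1) s \<le>
          kstep b (\<lambda>s. 110 * ennreal (barrier_fun \<kappa> (b - s)) + ennreal (1 - real j / real k)) s"
      proof (simp, rule kstep_mono)
        fix t assume "t \<le> b"
        then have "(kstep b ^^ j) (\<lambda>_. 1) t \<le> ennreal (110 * barrier_fun \<kappa> (b - t) + (1 - real j / real k))"
          using Suc by auto
        also have "\<dots> = 110 * ennreal (barrier_fun \<kappa> (b - t)) + ennreal (1 - real j / real k)"
          using Suc.prems \<kappa> \<open>t \<le> b\<close> barrier_fun_nonneg[of \<kappa> "b - t"]
          by (subst ennreal_plus) (auto simp: ennreal_mult divide_le_eq)
        finally show "(kstep b ^^ j) (\<lambda>_. 1) t \<le> \<dots>" .
      qed
      also have "\<dots> = 110 * kstep b (\<lambda>s. ennreal (barrier_fun \<kappa> (b - s))) s + kstep b (\<lambda>_. ennreal (1 - real j / real k)) s"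
        by (subst kstep_add; (subst kstep_cmult)?) (simp_all add: barrier_fun_def)
      also have "\<dots> \<le> 110 * ennreal (barrier_fun \<kappa> (b - s) - (exp (\<kappa>\<^sup>2 / 2) - 1) * exp (- \<kappa> * (b - s + 3))) +
          ennreal (1 - real j / real k)"
        by (intro add_mono mult_left_mono kstep_barrier_fun_le kstep_const_le) (use Suc \<kappa> in auto)
      also have "\<dots> \<le> ennreal (110 * barrier_fun \<kappa> (b - s) + (1 - real (Suc j) / real k))"
      proof (cases "0 \<le> barrier_fun \<kappa> (b - s) - (exp (\<kappa>\<^sup>2 / 2) - 1) * exp (- \<kappa> * (b - s + 3))")
        case True
        have "110 * ennreal (barrier_fun \<kappa> (b - s) - (exp (\<kappa>\<^sup>2 / 2) - 1) * exp (- \<kappa> * (b - s + 3))) + ennreal (1 - real j / real k)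
           = ennreal (110 * (barrier_fun \<kappa> (b - s) - (exp (\<kappa>\<^sup>2 / 2) - 1) * exp (- \<kappa> * (b - s + 3))) + (1 - real j / real k))"
        proof -
          have m: "110 * ennreal x = ennreal (110 * x)" for x by (simp add: ennreal_mult')
          have "real j / real k \<le> 1" using Suc.prems by simp
          then show ?thesis unfolding m using True by (subst ennreal_plus) auto
        qed
        also have "\<dots> \<le> ennreal (110 * barrier_fun \<kappa> (b - s) + (1 - real (Suc j) / real k))"
          using bound by (intro ennreal_leI) (auto simp: algebra_simps add_divide_distrib)
        finally show ?thesis .
      next
        case False
        then show ?thesis using barrier_fun_drift_nonneg[of "b - s" \<kappa>] Suc.prems \<kappa> by auto
      qed
      finally show ?thesis .
    qed
  qed
  have "(kstep b ^^ k) (\<lambda>_. 1) s \<le> ennreal (110 * barrier_fun \<kappa> (b - s))"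
    using step[of k s] assms by auto
  also have "\<dots> \<le> ennreal (110 * (\<kappa> * (b - s + 3)))"
    using barrier_fun_le_linear by (intro ennreal_leI mult_left_mono) auto
  finally show ?thesis by (simp add: \<kappa>_def)
qed

text \<open>Normalised so that one step lowers
  \<open>green_const \<kappa> * barrier_fun \<kappa> (b - s)\<close> by at least exp (\<kappa> * (s
  - b)).\<close>

definition green_const :: "real \<Rightarrow> real" where
  "green_const \<kappa> = exp (3 * \<kappa>) / (exp (\<kappa>\<^sup>2 / 2) - 1)"

lemma green_const_pos: "0 < \<kappa> \<Longrightarrow> 0 < green_const \<kappa>"
  by (simp add: green_const_def)

lemma kstep_sum:
  assumes [measurable]: "\<And>i. i \<in> I \<Longrightarrow> g i \<in> borel_measurable borel"
  shows "kstep b (\<lambda>s. \<Sum>i\<in>I. g i s) s = (\<Sum>i\<in>I. kstep b (g i) s)"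
  unfolding kstep_def by (subst nn_integral_sum[symmetric]) (auto simp: sum_distrib_left)

text \<open>Green function bound: the partial sums satisfy u (n + 1) = e + \<open>kstep\<close> u n,
  where e is the exponential, and the supersolution
  \<open>green_const \<kappa> * barrier_fun \<kappa>\<close> dominates them by induction on
  n.\<close>

lemma sum_kstep_pow_exp_le:
  assumes "0 < \<kappa>" "\<kappa> \<le> 1"
  shows "(\<Sum>k<n. (kstep b ^^ Suc k) (\<lambda>s. ennreal (exp (\<kappa> * (s - b)))) s) \<le> ennreal (green_const \<kappa>)"
proof -
  let ?e = "\<lambda>s. ennreal (exp (\<kappa> * (s - b)))"
  have C: "0 < green_const \<kappa>" using assms by (rule_tac green_const_pos)
  have Ce: "green_const \<kappa> * ((exp (\<kappa>\<^sup>2 / 2) - 1) * exp (- \<kappa> * (b - s + 3))) = exp (\<kappa> * (s - b))" for s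
  proof -
    have "exp (\<kappa>\<^sup>2 / 2) - 1 \<noteq> 0" using assms by simp
    then show ?thesis by (simp add: green_const_def field_simps flip: exp_add)
  qed
  have main: "(\<Sum>k<n. (kstep b ^^ k) ?e s) \<le> ennreal (green_const \<kappa> * barrier_fun \<kappa> (b - s))" if "s \<le> b" for n s
    using that
  proof (induction n arbitrary: s)
    case (Suc n)
    have "(\<Sum>k<Suc n. (kstep b ^^ k) ?e s) = ?e s + (\<Sum>k<n. kstep b ((kstep b ^^ k) ?e) s)"
      by (subst sum.lessThan_Suc_shift) simp
    also have "\<dots> = ?e s + kstep b (\<lambda>s. \<Sum>k<n. (kstep b ^^ k) ?e s) s"
      by (subst kstep_sum) auto
    also have "\<dots> \<le> ?e s + kstep b (\<lambda>s. green_const \<kappa> * ennreal (barrier_fun \<kappa> (b - s))) s"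
      using Suc.IH C by (intro add_left_mono kstep_mono) (auto simp: ennreal_mult')
    also have "\<dots> = ?e s + green_const \<kappa> * kstep b (\<lambda>s. ennreal (barrier_fun \<kappa> (b - s))) s"
      by (subst kstep_cmult) (auto simp: barrier_fun_def)
    also have "\<dots> \<le> ?e s + green_const \<kappa> * ennreal (barrier_fun \<kappa> (b - s) - (exp (\<kappa>\<^sup>2 / 2) - 1) * exp (- \<kappa> * (b - s + 3)))"
      by (intro add_left_mono mult_left_mono kstep_barrier_fun_le) (use Suc assms in auto)
    also have "\<dots> = ennreal (green_const \<kappa> * barrier_fun \<kappa> (b - s))"
    proof -
      have "0 \<le> barrier_fun \<kappa> (b - s) - (exp (\<kappa>\<^sup>2 / 2) - 1) * exp (- \<kappa> * (b - s + 3))"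
        using barrier_fun_drift_nonneg[of "b - s" \<kappa>] Suc.prems assms by auto
      then have "?e s + green_const \<kappa> * ennreal (barrier_fun \<kappa> (b - s) - (exp (\<kappa>\<^sup>2 / 2) - 1) * exp (- \<kappa> * (b - s + 3))) =
        ennreal (exp (\<kappa> * (s - b)) + green_const \<kappa> * (barrier_fun \<kappa> (b - s) - (exp (\<kappa>\<^sup>2 / 2) - 1) * exp (- \<kappa> * (b - s + 3))))"
        using C by (subst ennreal_plus) (auto simp: ennreal_mult')
      also have "exp (\<kappa> * (s - b)) + green_const \<kappa> * (barrier_fun \<kappa> (b - s) - (exp (\<kappa>\<^sup>2 / 2) - 1) * exp (- \<kappa> * (b - s + 3)))
        = green_const \<kappa> * barrier_fun \<kappa> (b - s)"
        using Ce[of s] by (simp only: right_diff_distrib)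
      finally show ?thesis .
    qed
    finally show ?case .
  qed simp
  \<comment> \<open>The sum starts with the first power of \<open>kstep\<close>, and this outer step
    evaluates only below b. The bound thus extends to all starting points s, including those above
    b.\<close>
  have "(\<Sum>k<n. (kstep b ^^ Suc k) ?e s) = kstep b (\<lambda>s. \<Sum>k<n. (kstep b ^^ k) ?e s) s"
    by (subst kstep_sum) auto
  also have "\<dots> \<le> kstep b (\<lambda>_. ennreal (green_const \<kappa>)) s"
  proof (rule kstep_mono)
    fix t assume "t \<le> b"
    from main[OF this, of n] show "(\<Sum>k<n. (kstep b ^^ k) ?e t) \<le> ennreal (green_const \<kappa>)"
      using mult_left_mono[OF barrier_fun_le_1, of "green_const \<kappa>" \<kappa> "b - t"] C
      by (auto intro: order_trans ennreal_leI)
  qed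
  also have "\<dots> \<le> ennreal (green_const \<kappa>)" by (rule kstep_const_le)
  finally show ?thesis .
qed

section \<open>Reversibility and local bounds for the killed walk\<close>

lemma kstep_eq_convolution:
  assumes [measurable]: "g \<in> borel_measurable borel"
  shows "kstep b g s = (\<integral>\<^sup>+t. ennreal (std_normal_density (t - s)) * (indicator {..b} t * g t) \<partial>lborel)"
  unfolding kstep_def by (subst nn_integral_real_affine[of _ 1 "-s"]) auto

text \<open>The Gaussian kernel is even, so the killed walk is reversible for Lebesgue measure on
  the half-line. Time reversal exchanges the final function with the initial one.\<close>

lemma kstep_symmetric:
  assumes [measurable]: "g \<in> borel_measurable borel" "h \<in> borel_measurable borel"
  shows "(\<integral>\<^sup>+s. indicator {..b} s * h s * kstep b g s \<partial>lborel) = (\<integral>\<^sup>+s. indicator {..b} s * g s * kstep b h s \<partial>lborel)"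
proof -
  have "(\<integral>\<^sup>+s. indicator {..b} s * h s * kstep b g s \<partial>lborel) =
    (\<integral>\<^sup>+s. \<integral>\<^sup>+t. indicator {..b} s * h s * (ennreal (std_normal_density (t - s)) * (indicator {..b} t * g t)) \<partial>lborel \<partial>lborel)"
    by (subst kstep_eq_convolution) (auto simp: nn_integral_cmult)
  also have "\<dots> = (\<integral>\<^sup>+t. \<integral>\<^sup>+s. indicator {..b} s * h s * (ennreal (std_normal_density (t - s)) * (indicator {..b} t * g t)) \<partial>lborel \<partial>lborel)"
    by (rule lborel_pair.Fubini') measurable
  also have "\<dots> = (\<integral>\<^sup>+t. \<integral>\<^sup>+s. indicator {..b} t * g t * (ennreal (std_normal_density (s - t)) * (indicator {..b} s * h s)) \<partial>lborel \<partial>lborel)"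
  proof (intro nn_integral_cong)
    fix s t :: real
    have "std_normal_density (t - s) = std_normal_density (s - t)" by (simp add: normal_density_def power2_commute)
    then show "indicator {..b} s * h s * (ennreal (std_normal_density (t - s)) * (indicator {..b} t * g t)) =
      indicator {..b} t * g t * (ennreal (std_normal_density (s - t)) * (indicator {..b} s * h s))"
      by (simp add: mult_ac)
  qed
  also have "\<dots> = (\<integral>\<^sup>+s. indicator {..b} s * g s * kstep b h s \<partial>lborel)"
    by (intro nn_integral_cong, subst kstep_eq_convolution) (auto simp: nn_integral_cmult)
  finally show ?thesis .
qed

lemma kstep_pow_symmetric:
  assumes [measurable]: "g \<in> borel_measurable borel" "h \<in> borel_measurable borel"
  shows "(\<integral>\<^sup>+s. indicator {..b} s * h s * (kstep b ^^ k) g s \<partial>lborel) =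
    (\<integral>\<^sup>+s. indicator {..b} s * g s * (kstep b ^^ k) h s \<partial>lborel)"
  using assms(2)
proof (induction k arbitrary: h)
  case (Suc k)
  have [measurable]: "h \<in> borel_measurable borel" by fact
  have "(\<integral>\<^sup>+s. indicator {..b} s * h s * (kstep b ^^ Suc k) g s \<partial>lborel) =
    (\<integral>\<^sup>+s. indicator {..b} s * (kstep b ^^ k) g s * kstep b h s \<partial>lborel)"
    using kstep_symmetric[of "(kstep b ^^ k) g" h b] by simp
  also have "\<dots> = (\<integral>\<^sup>+s. indicator {..b} s * kstep b h s * (kstep b ^^ k) g s \<partial>lborel)"
    by (simp add: mult_ac)
  also have "\<dots> = (\<integral>\<^sup>+s. indicator {..b} s * g s * (kstep b ^^ k) (kstep b h) s \<partial>lborel)"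
    by (rule Suc.IH) auto
  finally show ?case by (simp add: funpow_swap1)
qed (auto simp: mult_ac)

text \<open>Only the killing at the last step is kept; the k Gaussian steps then convolve to a
  normal law of variance k.\<close>

lemma kstep_pow_le_convolution:
  assumes [measurable]: "g \<in> borel_measurable borel" and "1 \<le> k"
  shows "(kstep b ^^ k) g s \<le> (\<integral>\<^sup>+t. ennreal (normal_density 0 (sqrt k) (t - s)) * (indicator {..b} t * g t) \<partial>lborel)"
  using \<open>1 \<le> k\<close>
proof (induction k arbitrary: s rule: dec_induct)
  case base
  show ?case by (simp add: kstep_eq_convolution)
next
  case (step k)
  have "(kstep b ^^ Suc k) g s = (\<integral>\<^sup>+u. ennreal (std_normal_density (u - s)) * (indicator {..b} u * (kstep b ^^ k) g u) \<partial>lborel)"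
    by (simp add: kstep_eq_convolution)
  also have "\<dots> \<le> (\<integral>\<^sup>+u. ennreal (std_normal_density (u - s)) * (\<integral>\<^sup>+t. ennreal (normal_density 0 (sqrt k) (t - u)) * (indicator {..b} t * g t) \<partial>lborel) \<partial>lborel)"
    using step.IH by (intro nn_integral_mono mult_left_mono) (auto simp: indicator_def)
  also have "\<dots> = (\<integral>\<^sup>+u. \<integral>\<^sup>+t. ennreal (std_normal_density (u - s)) * (ennreal (normal_density 0 (sqrt k) (t - u)) * (indicator {..b} t * g t)) \<partial>lborel \<partial>lborel)"
    by (simp add: nn_integral_cmult)
  also have "\<dots> = (\<integral>\<^sup>+t. \<integral>\<^sup>+u. ennreal (std_normal_density (u - s)) * (ennreal (normal_density 0 (sqrt k) (t - u)) * (indicator {..b} t * g t)) \<partial>lborel \<partial>lborel)"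
    by (rule lborel_pair.Fubini') measurable
  also have "\<dots> = (\<integral>\<^sup>+t. (\<integral>\<^sup>+u. ennreal (normal_density 0 (sqrt k) (t - u) * std_normal_density (u - s)) \<partial>lborel) * (indicator {..b} t * g t) \<partial>lborel)"
    by (subst nn_integral_multc[symmetric]) (auto simp: ennreal_mult mult_ac)
  also have "\<dots> = (\<integral>\<^sup>+t. ennreal (normal_density 0 (sqrt (Suc k)) (t - s)) * (indicator {..b} t * g t) \<partial>lborel)"
  proof (intro nn_integral_cong)
    fix t
    have "(\<integral>\<^sup>+u. ennreal (normal_density 0 (sqrt k) (t - u) * std_normal_density (u - s)) \<partial>lborel) =
       (\<integral>\<^sup>+u. ennreal (normal_density 0 (sqrt k) (t - s - u) * std_normal_density u) \<partial>lborel)"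
      by (subst nn_integral_real_affine[of _ 1 s]) (auto simp: algebra_simps)
    also have "\<dots> = ennreal (normal_density 0 (sqrt (Suc k)) (t - s))"
      using fun_cong[OF conv_normal_density_zero_mean[of "sqrt k" 1], of "t - s"] step.hyps by (simp add: add.commute)
    finally show "(\<integral>\<^sup>+u. ennreal (normal_density 0 (sqrt k) (t - u) * std_normal_density (u - s)) \<partial>lborel) * (indicator {..b} t * g t) =
      ennreal (normal_density 0 (sqrt (Suc k)) (t - s)) * (indicator {..b} t * g t)" by simp
  qed
  finally show ?case .
qed

lemma kstep_pow_le_integral:
  assumes [measurable]: "g \<in> borel_measurable borel" and "1 \<le> k"
  shows "(kstep b ^^ k) g s \<le> ennreal (1 / sqrt k) * (\<integral>\<^sup>+t. indicator {..b} t * g t \<partial>lborel)"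
proof -
  have "normal_density 0 (sqrt k) x \<le> 1 / sqrt k" for x
  proof -
    have "normal_density 0 (sqrt k) x \<le> 1 / sqrt (2 * pi * k) * 1"
      unfolding normal_density_def using assms by (intro mult_mono) auto
    also have "\<dots> \<le> 1 / sqrt k"
    proof -
      have "1 \<le> sqrt (2 * pi)" using pi_gt3 by (intro real_sqrt_ge_one) simp
      then have "1 * sqrt k \<le> sqrt (2 * pi) * sqrt k" by (intro mult_right_mono) auto
      then show ?thesis using assms by (auto intro!: divide_left_mono simp: real_sqrt_mult)
    qed
    finally show ?thesis .
  qed
  then have "(\<integral>\<^sup>+t. ennreal (normal_density 0 (sqrt k) (t - s)) * (indicator {..b} t * g t) \<partial>lborel) \<le>
     (\<integral>\<^sup>+t. ennreal (1 / sqrt k) * (indicator {..b} t * g t) \<partial>lborel)"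
    by (intro nn_integral_mono mult_right_mono ennreal_leI) auto
  then show ?thesis using kstep_pow_le_convolution[OF assms, of b s] by (simp add: nn_integral_cmult)
qed

text \<open>The innermost operator is the last step: the value at s is the expectation of g at time
  i + m for the walk that is at s at time i and stays below f at the times i + 1 to i + m.\<close>

fun kchain :: "(nat \<Rightarrow> real) \<Rightarrow> nat \<Rightarrow> nat \<Rightarrow> (real \<Rightarrow> ennreal) \<Rightarrow> real \<Rightarrow> ennreal" where
  "kchain f i 0 g = g"
| "kchain f i (Suc m) g = kchain f i m (kstep (f (Suc (i + m))) g)"

lemma measurable_kchain [measurable (raw)]:
  "g \<in> borel_measurable borel \<Longrightarrow> kchain f i m g \<in> borel_measurable borel"
  by (induction m arbitrary: g) auto

section \<open>Gaussian spaces\<close>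

text \<open>Uniqueness of characteristic functions for a signed weight. The weight D has mean 0 and
  is bounded by 1, so 1 + D is a probability density; the laws of Z with and without this density
  have the same characteristic function, hence agree.\<close>

lemma (in prob_space) fourier_vanish_real:
  fixes D :: "'a \<Rightarrow> real"
  assumes [measurable]: "Z \<in> borel_measurable M" "D \<in> borel_measurable M" and B[measurable]: "B \<in> sets borel"
    and bd: "\<And>\<omega>. \<omega> \<in> space M \<Longrightarrow> \<bar>D \<omega>\<bar> \<le> 1"
    and vanish: "\<And>u. (CLINT \<omega>|M. iexp (u * Z \<omega>) * complex_of_real (D \<omega>)) = 0"
  shows "(LINT \<omega>|M. indicator B (Z \<omega>) * D \<omega>) = 0"
proof -
  have ie: "integrable M (\<lambda>\<omega>. iexp (u * Z \<omega>))" for u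
    by (rule integrable_const_bound[of _ 1]) auto
  have iD: "integrable M (\<lambda>\<omega>. iexp (u * Z \<omega>) * complex_of_real (D \<omega>))" for u
    by (rule integrable_const_bound[of _ 1]) (auto simp: norm_mult bd)
  have iDr: "integrable M D" by (rule integrable_const_bound[of _ 1]) (auto simp: bd)
  have D0: "(LINT \<omega>|M. D \<omega>) = 0"
  proof -
    have "complex_of_real (LINT \<omega>|M. D \<omega>) = 0" using vanish[of 0] by simp
    then show ?thesis by simp
  qed
  define N where "N = density M (\<lambda>\<omega>. ennreal (1 + D \<omega>))"
  have pos: "AE \<omega> in M. 0 \<le> 1 + D \<omega>" 
  proof (rule AE_I2)
    fix \<omega> assume "\<omega> \<in> space M"
    from bd[OF this] show "0 \<le> 1 + D \<omega>" by linarith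
  qed
  have [measurable_cong, simp]: "sets N = sets M" "space N = space M" by (simp_all add: N_def)
  interpret N: prob_space N
  proof
    have "emeasure N (space N) = (\<integral>\<^sup>+\<omega>. ennreal (1 + D \<omega>) \<partial>M)"
      by (simp add: N_def emeasure_density cong: nn_integral_cong_simp)
    also have "\<dots> = ennreal (LINT \<omega>|M. 1 + D \<omega>)"
      by (rule nn_integral_eq_integral) (use iDr pos in auto)
    also have "\<dots> = 1" using iDr D0 by (simp add: prob_space)
    finally show "emeasure N (space N) = 1" .
  qed
  interpret m1: real_distribution "distr M borel Z" by (rule real_distribution_distr) simp
  interpret m2: real_distribution "distr N borel Z" by (rule N.real_distribution_distr) simp
  have "char (distr M borel Z) = char (distr N borel Z)"
  proof
    fix u
    have "char (distr N borel Z) u = (CLINT \<omega>|N. iexp (u * Z \<omega>))"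
      by (simp add: char_def integral_distr)
    also have "\<dots> = (CLINT \<omega>|M. (1 + D \<omega>) *\<^sub>R iexp (u * Z \<omega>))"
      unfolding N_def by (rule integral_density) (use pos in auto)
    also have "\<dots> = (CLINT \<omega>|M. iexp (u * Z \<omega>) + iexp (u * Z \<omega>) * complex_of_real (D \<omega>))"
      by (simp add: scaleR_conv_of_real algebra_simps)
    also have "\<dots> = (CLINT \<omega>|M. iexp (u * Z \<omega>))"
      by (subst Bochner_Integration.integral_add[OF ie iD]) (use vanish in auto)
    finally show "char (distr M borel Z) u = char (distr N borel Z) u"
      by (simp add: char_def integral_distr)
  qed
  then have eq: "distr M borel Z = distr N borel Z"
    by (intro Levy_uniqueness) (auto intro: m1.real_distribution_axioms m2.real_distribution_axioms)
  have "measure M (Z -` B \<inter> space M) = measure N (Z -` B \<inter> space M)"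
    using arg_cong[OF eq, of "\<lambda>m. measure m B"] B by (simp add: measure_distr)
  moreover have "measure N (Z -` B \<inter> space M) = (LINT \<omega>|N. indicator B (Z \<omega>))"
  proof -
    have "(LINT \<omega>|N. indicator B (Z \<omega>) :: real) = (LINT \<omega>|N. indicator (Z -` B \<inter> space M) \<omega>)"
      by (intro Bochner_Integration.integral_cong) (auto simp: indicator_def)
    then show ?thesis using B by simp
  qed
  moreover have "(LINT \<omega>|N. indicator B (Z \<omega>) :: real) = (LINT \<omega>|M. (1 + D \<omega>) *\<^sub>R indicator B (Z \<omega>))"
    unfolding N_def by (rule integral_density) (use pos B in auto)
  moreover have "(LINT \<omega>|M. (1 + D \<omega>) *\<^sub>R indicator B (Z \<omega>)) =
     (LINT \<omega>|M. indicator B (Z \<omega>)) + (LINT \<omega>|M. indicator B (Z \<omega>) * D \<omega>)"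
    by (subst Bochner_Integration.integral_add[symmetric])
       (auto simp: algebra_simps indicator_def bd intro!: integrable_const_bound[of _ 1])
  moreover have "(LINT \<omega>|M. indicator B (Z \<omega>) :: real) = measure M (Z -` B \<inter> space M)"
  proof -
    have "(LINT \<omega>|M. indicator B (Z \<omega>) :: real) = (LINT \<omega>|M. indicator (Z -` B \<inter> space M) \<omega>)"
      by (intro Bochner_Integration.integral_cong) (auto simp: indicator_def)
    then show ?thesis using B by simp
  qed
  ultimately show ?thesis by linarith
qed

text \<open>Reduction to real and imaginary part. The hypothesis passes to the conjugate of D
  because conjugation turns the frequency u into - u.\<close>

lemma (in prob_space) fourier_vanish:
  fixes D :: "'a \<Rightarrow> complex"
  assumes [measurable]: "Z \<in> borel_measurable M" "D \<in> borel_measurable M" and B[measurable]: "B \<in> sets borel"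
    and bd: "\<And>\<omega>. \<omega> \<in> space M \<Longrightarrow> norm (D \<omega>) \<le> 1"
    and vanish: "\<And>u. (CLINT \<omega>|M. iexp (u * Z \<omega>) * D \<omega>) = 0"
  shows "(CLINT \<omega>|M. indicator B (Z \<omega>) * D \<omega>) = 0"
proof -
  have [measurable]: "cnj \<in> borel_measurable borel"
    by (intro borel_measurable_continuous_onI continuous_intros)
  have int: "integrable M (\<lambda>\<omega>. iexp (u * Z \<omega>) * D \<omega>)" for u
    by (rule integrable_const_bound[of _ 1]) (auto simp: norm_mult bd)
  have int': "integrable M (\<lambda>\<omega>. iexp (u * Z \<omega>) * cnj (D \<omega>))" for u
    by (rule integrable_const_bound[of _ 1]) (auto simp: norm_mult bd)
  have cv: "(CLINT \<omega>|M. iexp (u * Z \<omega>) * cnj (D \<omega>)) = 0" for u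
  proof -
    have "(CLINT \<omega>|M. iexp (u * Z \<omega>) * cnj (D \<omega>)) = (CLINT \<omega>|M. cnj (iexp ((- u) * Z \<omega>) * D \<omega>))"
      by (intro Bochner_Integration.integral_cong) (auto simp: exp_cnj)
    also have "\<dots> = cnj (CLINT \<omega>|M. iexp ((- u) * Z \<omega>) * D \<omega>)" by (rule Bochner_Integration.integral_cnj)
    finally show ?thesis using vanish[of "-u"] by simp
  qed
  have re: "(LINT \<omega>|M. indicator B (Z \<omega>) * Re (D \<omega>)) = 0"
  proof (rule fourier_vanish_real)
    fix u
    have "(CLINT \<omega>|M. iexp (u * Z \<omega>) * complex_of_real (Re (D \<omega>))) =
      (CLINT \<omega>|M. (iexp (u * Z \<omega>) * D \<omega> + iexp (u * Z \<omega>) * cnj (D \<omega>)) / 2)"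
      by (intro Bochner_Integration.integral_cong) (auto simp: complex_add_cnj simp flip: distrib_left)
    also have "\<dots> = ((CLINT \<omega>|M. iexp (u * Z \<omega>) * D \<omega>) + (CLINT \<omega>|M. iexp (u * Z \<omega>) * cnj (D \<omega>))) / 2"
      by (subst Bochner_Integration.integral_add[OF int int', symmetric]) simp
    finally show "(CLINT \<omega>|M. iexp (u * Z \<omega>) * complex_of_real (Re (D \<omega>))) = 0"
      by (simp only: vanish cv) simp
  qed (auto intro: order_trans[OF abs_Re_le_cmod bd])
  have im: "(LINT \<omega>|M. indicator B (Z \<omega>) * Im (D \<omega>)) = 0"
  proof (rule fourier_vanish_real)
    fix u
    have "(CLINT \<omega>|M. iexp (u * Z \<omega>) * complex_of_real (Im (D \<omega>))) =
      (CLINT \<omega>|M. (iexp (u * Z \<omega>) * D \<omega> - iexp (u * Z \<omega>) * cnj (D \<omega>)) * (- \<i> / 2))"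
    proof (intro Bochner_Integration.integral_cong refl)
      fix \<omega>
      have "complex_of_real (Im (D \<omega>)) = (D \<omega> - cnj (D \<omega>)) * (- \<i> / 2)" by (simp add: complex_eq_iff)
      then show "iexp (u * Z \<omega>) * complex_of_real (Im (D \<omega>)) =
          (iexp (u * Z \<omega>) * D \<omega> - iexp (u * Z \<omega>) * cnj (D \<omega>)) * (- \<i> / 2)"
        by (simp only: mult.assoc right_diff_distrib left_diff_distrib)
    qed
    also have "\<dots> = ((CLINT \<omega>|M. iexp (u * Z \<omega>) * D \<omega>) - (CLINT \<omega>|M. iexp (u * Z \<omega>) * cnj (D \<omega>))) * (- \<i> / 2)"
      by (subst Bochner_Integration.integral_diff[OF int int', symmetric]) simp
    finally show "(CLINT \<omega>|M. iexp (u * Z \<omega>) * complex_of_real (Im (D \<omega>))) = 0"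
      by (simp only: vanish cv) simp
  qed (auto intro: order_trans[OF abs_Im_le_cmod bd])
  have "integrable M (\<lambda>\<omega>. indicator B (Z \<omega>) * D \<omega>)"
    by (rule integrable_const_bound[of _ 1]) (auto simp: norm_mult indicator_def bd)
  moreover have "Re (indicator B (Z \<omega>) * D \<omega>) = indicator B (Z \<omega>) * Re (D \<omega>)"
      "Im (indicator B (Z \<omega>) * D \<omega>) = indicator B (Z \<omega>) * Im (D \<omega>)" for \<omega>
    by (auto simp: indicator_def)
  ultimately show ?thesis using re im by (intro complex_eqI) (simp_all only: integral_Re[symmetric] integral_Im[symmetric] zero_complex.sel)
qed

locale gaussian_space = prob_space +
  fixes H :: "('a \<Rightarrow> real) set"
  assumes gaussian_H: "Y \<in> H \<Longrightarrow> gaussian M Y"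
    and mean_H: "Y \<in> H \<Longrightarrow> (LINT \<omega>|M. Y \<omega>) = 0"
    and add_H: "Y \<in> H \<Longrightarrow> Z \<in> H \<Longrightarrow> (\<lambda>\<omega>. Y \<omega> + Z \<omega>) \<in> H"
    and scale_H: "Y \<in> H \<Longrightarrow> (\<lambda>\<omega>. c * Y \<omega>) \<in> H"
begin

lemma diff_H: "Y \<in> H \<Longrightarrow> Z \<in> H \<Longrightarrow> (\<lambda>\<omega>. Y \<omega> - Z \<omega>) \<in> H"
  using add_H[OF _ scale_H[of Z "-1"], of Y] by simp

lemma measurable_H: "Y \<in> H \<Longrightarrow> Y \<in> borel_measurable M"
  using gaussian_H by (auto simp: gaussian_def)

definition var :: "('a \<Rightarrow> real) \<Rightarrow> real" where
  "var Y = (LINT \<omega>|M. Y \<omega> * Y \<omega>)"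

lemma var_nonneg: "0 \<le> var Y"
  by (simp add: var_def)

lemma H_cases:
  assumes "Y \<in> H"
  obtains (degenerate) "AE \<omega> in M. Y \<omega> = 0" "var Y = 0"
  | (normal) "0 < var Y" "distributed M lborel Y (normal_density 0 (sqrt (var Y)))"
proof -
  have [measurable]: "Y \<in> borel_measurable M" using measurable_H assms by auto
  from gaussian_H[OF assms] consider \<mu> \<sigma> where "\<sigma> > 0" "distributed M lborel Y (normal_density \<mu> \<sigma>)"
    | \<mu> where "AE \<omega> in M. Y \<omega> = \<mu>"
    unfolding gaussian_def by blast
  then show ?thesis
  proof cases
    case (1 \<mu> \<sigma>)
    then have "\<mu> = 0" using normal_distributed_expectation[of \<sigma> Y \<mu>] mean_H[OF assms] by simp
    moreover have "var Y = \<sigma>\<^sup>2"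
      using normal_distributed_variance[OF 1] mean_H[OF assms] by (simp add: var_def power2_eq_square)
    ultimately show ?thesis using 1 normal by simp
  next
    case (2 \<mu>)
    have "(LINT \<omega>|M. Y \<omega>) = (LINT \<omega>|M. \<mu>)" by (rule integral_cong_AE) (use 2 in auto)
    then have "\<mu> = 0" using mean_H[OF assms] by (simp add: prob_space)
    with 2 have "AE \<omega> in M. Y \<omega> = 0" by simp
    moreover from this have "var Y = (LINT \<omega>|M. 0)"
      unfolding var_def by (intro integral_cong_AE) auto
    ultimately show ?thesis using degenerate by simp
  qed
qed

text \<open>Written as a scaled standard normal variable, so that the degenerate case
  \<open>var Y = 0\<close> is included without a separate statement.\<close>

lemma law_H:
  assumes Y: "Y \<in> H" and [measurable]: "g \<in> borel_measurable borel"
  shows "(\<integral>\<^sup>+\<omega>. g (Y \<omega>) \<partial>M) = (\<integral>\<^sup>+n. ennreal (std_normal_density n) * g (sqrt (var Y) * n) \<partial>lborel)"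
proof -
  have [measurable]: "Y \<in> borel_measurable M" using measurable_H Y by auto
  from Y show ?thesis
  proof (cases rule: H_cases)
    case degenerate
    have "(\<integral>\<^sup>+\<omega>. g (Y \<omega>) \<partial>M) = (\<integral>\<^sup>+\<omega>. g 0 \<partial>M)"
      by (rule nn_integral_cong_AE) (use degenerate in auto)
    also have "\<dots> = (\<integral>\<^sup>+n. ennreal (std_normal_density n) * g 0 \<partial>lborel)"
      by (simp add: emeasure_space_1 nn_integral_multc nn_integral_std_normal)
    finally show ?thesis using degenerate by simp
  next
    case normal
    have "(\<integral>\<^sup>+\<omega>. g (Y \<omega>) \<partial>M) = (\<integral>\<^sup>+y. ennreal (normal_density 0 (sqrt (var Y)) y) * g y \<partial>lborel)"
      using distributed_nn_integral[OF normal(2), of g] by simp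
    also have "\<dots> = (\<integral>\<^sup>+n. ennreal (sqrt (var Y)) * (ennreal (normal_density 0 (sqrt (var Y)) (sqrt (var Y) * n)) * g (sqrt (var Y) * n)) \<partial>lborel)"
      using normal by (subst nn_integral_real_affine[of _ "sqrt (var Y)" 0]) (auto simp: nn_integral_cmult)
    also have "\<dots> = (\<integral>\<^sup>+n. ennreal (std_normal_density n) * g (sqrt (var Y) * n) \<partial>lborel)"
    proof (intro nn_integral_cong)
      fix n
      have "sqrt (var Y) * normal_density 0 (sqrt (var Y)) (sqrt (var Y) * n) = std_normal_density n"
        using normal(1) by (simp add: normal_density_def real_sqrt_mult power_mult_distrib)
      then have "ennreal (sqrt (var Y)) * ennreal (normal_density 0 (sqrt (var Y)) (sqrt (var Y) * n)) = ennreal (std_normal_density n)"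
        using var_nonneg by (subst ennreal_mult[symmetric]) auto
      then show "ennreal (sqrt (var Y)) * (ennreal (normal_density 0 (sqrt (var Y)) (sqrt (var Y) * n)) * g (sqrt (var Y) * n)) =
         ennreal (std_normal_density n) * g (sqrt (var Y) * n)"
        by (simp add: mult.assoc[symmetric])
    qed
    finally show ?thesis .
  qed
qed

lemma distr_H:
  assumes Y: "Y \<in> H"
  shows "distr M borel Y = distr std_normal_distribution borel (\<lambda>n. sqrt (var Y) * n)"
proof (rule measure_eqI)
  have [measurable]: "Y \<in> borel_measurable M" using measurable_H Y by auto
  fix A :: "real set" assume "A \<in> sets (distr M borel Y)"
  then have [measurable]: "A \<in> sets borel" by simp
  have "emeasure (distr M borel Y) A = (\<integral>\<^sup>+y. indicator A y \<partial>distr M borel Y)" by simp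
  also have "\<dots> = (\<integral>\<^sup>+\<omega>. indicator A (Y \<omega>) \<partial>M)"
    by (rule nn_integral_distr) auto
  also have "\<dots> = (\<integral>\<^sup>+n. indicator A (sqrt (var Y) * n) \<partial>std_normal_distribution)"
    by (subst law_H[OF Y]) (auto simp: nn_integral_density)
  also have "\<dots> = (\<integral>\<^sup>+y. indicator A y \<partial>distr std_normal_distribution borel (\<lambda>n. sqrt (var Y) * n))"
    by (rule nn_integral_distr[symmetric]) auto
  also have "\<dots> = emeasure (distr std_normal_distribution borel (\<lambda>n. sqrt (var Y) * n)) A" by simp
  finally show "emeasure (distr M borel Y) A = emeasure (distr std_normal_distribution borel (\<lambda>n. sqrt (var Y) * n)) A" .
qed simp

lemma iexp_H:
  assumes Y: "Y \<in> H"
  shows "(CLINT \<omega>|M. iexp (Y \<omega>)) = complex_of_real (exp (- var Y / 2))"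
proof -
  have [measurable]: "Y \<in> borel_measurable M" using measurable_H Y by auto
  have "(CLINT \<omega>|M. iexp (Y \<omega>)) = (CLINT y|distr M borel Y. iexp y)"
    by (simp add: integral_distr)
  also have "\<dots> = char std_normal_distribution (sqrt (var Y))"
    unfolding distr_H[OF Y] by (simp add: integral_distr char_def)
  finally show ?thesis using var_nonneg by (simp add: char_std_normal_distribution)
qed

lemma exp_H:
  assumes Y: "Y \<in> H"
  shows "(\<integral>\<^sup>+\<omega>. ennreal (exp (\<theta> * Y \<omega>)) \<partial>M) = ennreal (exp (\<theta>\<^sup>2 * var Y / 2))"
  using nn_integral_std_normal_exp[of "\<theta> * sqrt (var Y)"] var_nonneg[of Y]
  by (subst law_H[OF Y]) (simp_all add: ennreal_mult mult.assoc power_mult_distrib)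

lemma integrable_product_H:
  assumes "Y \<in> H" "Z \<in> H"
  shows "integrable M (\<lambda>\<omega>. Y \<omega> * Z \<omega>)"
proof -
  have [measurable]: "Y \<in> borel_measurable M" "Z \<in> borel_measurable M" using measurable_H assms by auto
  have sq: "integrable M (\<lambda>\<omega>. W \<omega> * W \<omega>)" if W: "W \<in> H" for W
    using W
  proof (cases rule: H_cases)
    case degenerate
    have [measurable]: "W \<in> borel_measurable M" using measurable_H W by auto
    have "integrable M (\<lambda>\<omega>. W \<omega> * W \<omega>) \<longleftrightarrow> integrable M (\<lambda>\<omega>. 0::real)"
      by (intro integrable_cong_AE) (use degenerate in auto)
    then show ?thesis by simp
  next
    case normal
    \<comment> \<open>The Bochner integral of a function that is not integrable is 0, so a positive
      second moment already proves integrability.\<close>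
    then show ?thesis unfolding var_def using not_integrable_integral_eq by force
  qed
  show ?thesis
  proof (rule Bochner_Integration.integrable_bound)
    show "integrable M (\<lambda>\<omega>. Y \<omega> * Y \<omega> + Z \<omega> * Z \<omega>)" using sq assms by simp
    show "AE \<omega> in M. norm (Y \<omega> * Z \<omega>) \<le> norm (Y \<omega> * Y \<omega> + Z \<omega> * Z \<omega>)"
    proof (rule AE_I2)
      fix \<omega>
      have "2 * (\<bar>Y \<omega>\<bar> * \<bar>Z \<omega>\<bar>) \<le> Y \<omega> * Y \<omega> + Z \<omega> * Z \<omega>"
        using sum_squares_bound[of "\<bar>Y \<omega>\<bar>" "\<bar>Z \<omega>\<bar>"] by (simp add: power2_eq_square)
      moreover have "0 \<le> \<bar>Y \<omega>\<bar> * \<bar>Z \<omega>\<bar>" by simp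
      ultimately show "norm (Y \<omega> * Z \<omega>) \<le> norm (Y \<omega> * Y \<omega> + Z \<omega> * Z \<omega>)"
        unfolding real_norm_def abs_mult by linarith
    qed
  qed simp
qed

definition orthogonal_to :: "('a \<Rightarrow> real) \<Rightarrow> ('a \<Rightarrow> real) set" where
  "orthogonal_to Y = {Z \<in> H. (LINT \<omega>|M. Y \<omega> * Z \<omega>) = 0}"

lemma orthogonal_to_add: "Z \<in> orthogonal_to Y \<Longrightarrow> W \<in> orthogonal_to Y \<Longrightarrow> Y \<in> H \<Longrightarrow> (\<lambda>\<omega>. Z \<omega> + W \<omega>) \<in> orthogonal_to Y"
  by (auto simp: orthogonal_to_def add_H distrib_left integrable_product_H)

lemma orthogonal_to_scale: "Z \<in> orthogonal_to Y \<Longrightarrow> (\<lambda>\<omega>. c * Z \<omega>) \<in> orthogonal_to Y"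
  by (auto simp: orthogonal_to_def scale_H mult.left_commute[of _ c])

text \<open>The conditions form a list, so that intersections are concatenations and independence
  can be proved by removing one condition at a time.\<close>

definition cylinder :: "(('a \<Rightarrow> real) \<times> real set) list \<Rightarrow> 'a set" where
  "cylinder zs = {\<omega> \<in> space M. \<forall>(Z, B) \<in> set zs. Z \<omega> \<in> B}"

definition cylinders :: "('a \<Rightarrow> real) set \<Rightarrow> 'a set set" where
  "cylinders K = {cylinder zs | zs. set zs \<subseteq> K \<times> sets borel}"

text \<open>The \<open>\<sigma>\<close>-algebra generated by all elements of the Gaussian space orthogonal to \<open>Y\<close>;
  it is independent of \<open>Y\<close>.\<close>

definition orth :: "('a \<Rightarrow> real) \<Rightarrow> 'a measure" where
  "orth Y = sigma (space M) (cylinders (orthogonal_to Y))"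

lemma cylinders_subset: "cylinders K \<subseteq> Pow (space M)"
  by (auto simp: cylinders_def cylinder_def)

lemma cylinder_events:
  assumes "set zs \<subseteq> H \<times> sets borel"
  shows "cylinder zs \<in> events"
  using assms
proof (induction zs)
  case (Cons zb zs)
  obtain Z B where zb: "zb = (Z, B)" by (cases zb)
  have [measurable]: "Z \<in> borel_measurable M" "B \<in> sets borel" "cylinder zs \<in> events"
    using Cons zb measurable_H by auto
  have "cylinder (zb # zs) = (Z -` B \<inter> space M) \<inter> cylinder zs"
    by (auto simp: cylinder_def zb)
  also have "\<dots> \<in> events" by measurable
  finally show ?case .
qed (auto simp: cylinder_def)

lemma space_orth [simp]: "space (orth Y) = space M"
  by (simp add: orth_def space_measure_of cylinders_subset)

lemma sets_orth: "sets (orth Y) = sigma_sets (space M) (cylinders (orthogonal_to Y))"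
  by (simp add: orth_def cylinders_subset)

lemma cylinders_orthogonal_events: "cylinders (orthogonal_to Y) \<subseteq> events"
  by (auto simp: cylinders_def orthogonal_to_def intro!: cylinder_events)

lemma sets_orth_subset: "sets (orth Y) \<subseteq> events"
  unfolding sets_orth by (rule sets.sigma_sets_subset[OF cylinders_orthogonal_events])

lemma measurable_orth_id: "(\<lambda>\<omega>. \<omega>) \<in> measurable M (orth Y)"
  using sets_orth_subset[of Y] by (intro measurableI) (auto simp: sets.Int_space_eq2 subset_eq)

lemma measurable_from_orth: "f \<in> measurable (orth Y) N \<Longrightarrow> f \<in> measurable M N"
  by (rule measurable_compose[OF measurable_orth_id])

lemma measurable_orthI:
  assumes "Z \<in> orthogonal_to Y"
  shows "Z \<in> borel_measurable (orth Y)"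
proof (rule measurableI)
  fix B :: "real set" assume "B \<in> sets borel"
  then have "cylinder [(Z, B)] \<in> cylinders (orthogonal_to Y)"
    using assms by (auto simp: cylinders_def intro!: exI[of _ "[(Z, B)]"])
  moreover have "cylinder [(Z, B)] = Z -` B \<inter> space (orth Y)" by (auto simp: cylinder_def)
  ultimately show "Z -` B \<inter> space (orth Y) \<in> sets (orth Y)" unfolding sets_orth by auto
qed auto

lemma Int_stable_cylinders: "Int_stable (cylinders K)"
proof (rule Int_stableI)
  fix a b assume "a \<in> cylinders K" "b \<in> cylinders K"
  then obtain xs ys where "a = cylinder xs" "b = cylinder ys" "set xs \<subseteq> K \<times> sets borel" "set ys \<subseteq> K \<times> sets borel"
    by (auto simp: cylinders_def)
  moreover from this have "a \<inter> b = cylinder (xs @ ys)" by (auto simp: cylinder_def)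
  ultimately show "a \<inter> b \<in> cylinders K" by (auto simp: cylinders_def intro!: exI[of _ "xs @ ys"])
qed

text \<open>Every combination of Y and V lies in the Gaussian space, and its characteristic function
  depends only on its second moment, which is additive for orthogonal elements.\<close>

lemma iexp_orthogonal_add:
  assumes "Y \<in> H" "V \<in> orthogonal_to Y"
  shows "(CLINT \<omega>|M. iexp (s * Y \<omega>) * iexp (V \<omega>)) = (CLINT \<omega>|M. iexp (s * Y \<omega>)) * (CLINT \<omega>|M. iexp (V \<omega>))"
proof -
  have V: "V \<in> H" "(LINT \<omega>|M. Y \<omega> * V \<omega>) = 0" using assms by (auto simp: orthogonal_to_def)
  have "var (\<lambda>\<omega>. s * Y \<omega> + V \<omega>) = (LINT \<omega>|M. s * Y \<omega> * (s * Y \<omega>) + V \<omega> * V \<omega> + 2 * s * (Y \<omega> * V \<omega>))"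
    unfolding var_def by (intro Bochner_Integration.integral_cong) (auto simp: algebra_simps)
  also have "\<dots> = var (\<lambda>\<omega>. s * Y \<omega>) + var V"
    using integrable_product_H[OF scale_H[OF assms(1)] scale_H[OF assms(1)], of s s] integrable_product_H[OF V(1) V(1)]
      integrable_product_H[OF assms(1) V(1)] V(2)
    by (simp add: var_def)
  finally have v: "var (\<lambda>\<omega>. s * Y \<omega> + V \<omega>) = var (\<lambda>\<omega>. s * Y \<omega>) + var V" .
  have e: "exp (- (x + y) / 2) = exp (- x / 2) * exp (- y / 2)" for x y :: real
    by (simp add: field_simps flip: exp_add)
  have "(CLINT \<omega>|M. iexp (s * Y \<omega>) * iexp (V \<omega>)) = (CLINT \<omega>|M. iexp (s * Y \<omega> + V \<omega>))"
    by (intro Bochner_Integration.integral_cong) (auto simp: distrib_left simp flip: exp_add)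
  also have "\<dots> = exp (- var (\<lambda>\<omega>. s * Y \<omega>) / 2) * exp (- var V / 2)"
    unfolding iexp_H[OF add_H[OF scale_H[OF assms(1)] V(1)]] v e by simp
  also have "\<dots> = (CLINT \<omega>|M. iexp (s * Y \<omega>)) * (CLINT \<omega>|M. iexp (V \<omega>))"
    using iexp_H[OF scale_H[OF assms(1)], of s] iexp_H[OF V(1)] by simp
  finally show ?thesis .
qed

text \<open>The conditions on the cylinder are introduced one by one. For a new condition on Z, the
  induction hypothesis with V + u * Z for every u says that a Fourier transform in Z vanishes, and
  \<open>fourier_vanish\<close> turns the exponentials into the indicator of the condition. The free
  V is what keeps the induction going.\<close>

lemma iexp_cylinder_vanish:
  assumes Y: "Y \<in> H" and "V \<in> orthogonal_to Y" "set zs \<subseteq> orthogonal_to Y \<times> sets borel"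
  shows "(CLINT \<omega>|M. (iexp (s * Y \<omega>) - (CLINT \<omega>|M. iexp (s * Y \<omega>))) * (indicator (cylinder zs) \<omega> * iexp (V \<omega>))) = 0"
  using assms(2,3)
proof (induction zs arbitrary: V)
  case Nil
  have [measurable]: "Y \<in> borel_measurable M" "V \<in> borel_measurable M"
    using measurable_H assms Nil by (auto simp: orthogonal_to_def)
  have int: "integrable M (\<lambda>\<omega>. iexp (s * Y \<omega>) * iexp (V \<omega>))" "integrable M (\<lambda>\<omega>. c * iexp (V \<omega>))" for c
    by (intro integrable_const_bound[of _ 1] integrable_mult_right; auto simp: norm_mult)+
  have "(CLINT \<omega>|M. (iexp (s * Y \<omega>) - (CLINT \<omega>|M. iexp (s * Y \<omega>))) * (indicator (cylinder []) \<omega> * iexp (V \<omega>))) =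
     (CLINT \<omega>|M. iexp (s * Y \<omega>) * iexp (V \<omega>) - (CLINT \<omega>|M. iexp (s * Y \<omega>)) * iexp (V \<omega>))"
    by (intro Bochner_Integration.integral_cong) (auto simp: cylinder_def left_diff_distrib)
  also have "\<dots> = 0"
    by (subst Bochner_Integration.integral_diff[OF int(1) int(2)])
       (simp only: iexp_orthogonal_add[OF Y Nil(1)] integral_mult_right_zero diff_self)
  finally show ?case .
next
  case (Cons zb zs)
  obtain Z B where zb: "zb = (Z, B)" by (cases zb)
  have Z: "Z \<in> orthogonal_to Y" and B[measurable]: "B \<in> sets borel" and zs: "set zs \<subseteq> orthogonal_to Y \<times> sets borel"
    using Cons zb by auto
  have [measurable]: "Y \<in> borel_measurable M" "V \<in> borel_measurable M" "Z \<in> borel_measurable M" "cylinder zs \<in> events"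
    using measurable_H assms Cons Z zs by (auto simp: orthogonal_to_def intro!: cylinder_events)
  define c where "c = (CLINT \<omega>|M. iexp (s * Y \<omega>))"
  have c: "norm c \<le> 1"
    using iexp_H[OF scale_H[OF Y], of s] var_nonneg[of "\<lambda>\<omega>. s * Y \<omega>"] by (simp add: c_def)
  \<comment> \<open>The factor 1/2 brings the weight into the unit disc, as
    \<open>fourier_vanish\<close> requires: the centred exponential is bounded by 2.\<close>
  define D where "D = (\<lambda>\<omega>. (iexp (s * Y \<omega>) - c) * (indicator (cylinder zs) \<omega> * iexp (V \<omega>)) / 2)"
  have [measurable]: "D \<in> borel_measurable M" unfolding D_def by measurable
  have "(CLINT \<omega>|M. indicator B (Z \<omega>) * D \<omega>) = 0"
  proof (rule fourier_vanish)
    fix \<omega> show "norm (D \<omega>) \<le> 1"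
    proof -
      have "norm (iexp (s * Y \<omega>) - c) \<le> 2" using c norm_triangle_ineq4[of "iexp (s * Y \<omega>)" c] by simp
      then show ?thesis by (auto simp: D_def norm_mult norm_divide indicator_def)
    qed
  next
    fix u
    have V': "(\<lambda>\<omega>. V \<omega> + u * Z \<omega>) \<in> orthogonal_to Y"
      using orthogonal_to_add[OF Cons(2) orthogonal_to_scale[OF Z] Y] .
    have "(CLINT \<omega>|M. iexp (u * Z \<omega>) * D \<omega>) =
      (CLINT \<omega>|M. (iexp (s * Y \<omega>) - c) * (indicator (cylinder zs) \<omega> * iexp (V \<omega> + u * Z \<omega>)) / 2)"
      by (intro Bochner_Integration.integral_cong) (auto simp: D_def distrib_left exp_add)
    also have "\<dots> = 0" using Cons.IH[OF V' zs] by (simp add: c_def)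
    finally show "(CLINT \<omega>|M. iexp (u * Z \<omega>) * D \<omega>) = 0" .
  qed auto
  moreover have "(CLINT \<omega>|M. (iexp (s * Y \<omega>) - c) * (indicator (cylinder (zb # zs)) \<omega> * iexp (V \<omega>))) =
      (CLINT \<omega>|M. 2 * (indicator B (Z \<omega>) * D \<omega>))"
    by (intro Bochner_Integration.integral_cong) (auto simp: D_def cylinder_def zb indicator_def)
  ultimately show ?case by (simp add: c_def)
qed

text \<open>The last exponential, that of Y itself, is replaced by an indicator in the same
  way.\<close>

lemma prob_H_cylinder:
  assumes Y: "Y \<in> H" and zs: "set zs \<subseteq> orthogonal_to Y \<times> sets borel" and A[measurable]: "A \<in> sets borel"
  shows "prob ((Y -` A \<inter> space M) \<inter> cylinder zs) = prob (Y -` A \<inter> space M) * prob (cylinder zs)"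
proof -
  have [measurable]: "Y \<in> borel_measurable M" "cylinder zs \<in> events"
    using measurable_H assms by (auto simp: orthogonal_to_def intro!: cylinder_events)
  let ?E = "cylinder zs"
  define D where "D = (\<lambda>\<omega>. indicator ?E \<omega> - prob ?E)"
  have [measurable]: "D \<in> borel_measurable M" unfolding D_def by measurable
  have zero: "(\<lambda>\<omega>. 0) \<in> orthogonal_to Y"
    using scale_H[OF Y, of 0] by (auto simp: orthogonal_to_def)
  have ie: "integrable M (\<lambda>\<omega>. iexp (s * Y \<omega>) * indicator ?E \<omega>)" "integrable M (\<lambda>\<omega>. iexp (s * Y \<omega>) * c)"
    "integrable M (\<lambda>\<omega>. c * indicator ?E \<omega>)" for c s
    by (intro integrable_mult_left integrable_mult_right integrable_const_bound[of _ 1];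
        auto simp: norm_mult indicator_def)+
  have "(LINT \<omega>|M. indicator A (Y \<omega>) * D \<omega>) = 0"
  proof (rule fourier_vanish_real)
    fix \<omega> show "\<bar>D \<omega>\<bar> \<le> 1" using prob_le_1[of ?E] by (auto simp: D_def indicator_def)
  next
    fix s
    define c where "c = (CLINT \<omega>|M. iexp (s * Y \<omega>))"
    have "0 = (CLINT \<omega>|M. (iexp (s * Y \<omega>) - c) * (indicator ?E \<omega> * iexp 0))"
      using iexp_cylinder_vanish[OF Y zero zs, of s] by (simp add: c_def)
    also have "\<dots> = (CLINT \<omega>|M. iexp (s * Y \<omega>) * indicator ?E \<omega> - c * indicator ?E \<omega>)"
      by (intro Bochner_Integration.integral_cong) (auto simp: left_diff_distrib)
    also have "\<dots> = (CLINT \<omega>|M. iexp (s * Y \<omega>) * indicator ?E \<omega>) - (CLINT \<omega>|M. c * indicator ?E \<omega>)"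
      by (rule Bochner_Integration.integral_diff[OF ie(1) ie(3)])
    also have "(CLINT \<omega>|M. c * indicator ?E \<omega>) = c * (CLINT \<omega>|M. complex_of_real (indicator ?E \<omega>))"
      by (simp only: integral_mult_right_zero of_real_indicator)
    also have "\<dots> = c * prob ?E"
      by (subst integral_complex_of_real) (simp add: emeasure_eq_measure)
    also have "\<dots> = (CLINT \<omega>|M. iexp (s * Y \<omega>) * prob ?E)"
      unfolding c_def by (rule integral_mult_left_zero[symmetric])
    also have "(CLINT \<omega>|M. iexp (s * Y \<omega>) * indicator ?E \<omega>) - (CLINT \<omega>|M. iexp (s * Y \<omega>) * prob ?E)
       = (CLINT \<omega>|M. iexp (s * Y \<omega>) * indicator ?E \<omega> - iexp (s * Y \<omega>) * prob ?E)"
      by (rule Bochner_Integration.integral_diff[symmetric, OF ie(1) ie(2)])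
    also have "\<dots> = (CLINT \<omega>|M. iexp (s * Y \<omega>) * complex_of_real (D \<omega>))"
      by (intro Bochner_Integration.integral_cong) (auto simp: D_def indicator_def algebra_simps)
    finally show "(CLINT \<omega>|M. iexp (s * Y \<omega>) * complex_of_real (D \<omega>)) = 0" by simp
  qed auto
  also have "(LINT \<omega>|M. indicator A (Y \<omega>) * D \<omega>) =
      (LINT \<omega>|M. indicator ((Y -` A \<inter> space M) \<inter> ?E) \<omega> - prob ?E * indicator (Y -` A \<inter> space M) \<omega>)"
    by (intro Bochner_Integration.integral_cong) (auto simp: D_def indicator_def)
  also have "\<dots> = prob ((Y -` A \<inter> space M) \<inter> ?E) - prob ?E * prob (Y -` A \<inter> space M)"
    by (subst Bochner_Integration.integral_diff) (auto simp: emeasure_eq_measure)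
  finally show ?thesis by simp
qed

lemma prob_orth:
  assumes Y: "Y \<in> H" and E: "E \<in> sets (orth Y)" and A: "A \<in> sets borel"
  shows "prob (E \<inter> (Y -` A \<inter> space M)) = prob E * prob (Y -` A \<inter> space M)"
proof -
  have Ym[measurable]: "Y \<in> borel_measurable M" using measurable_H Y by auto
  let ?B = "{Y -` A \<inter> space M | A. A \<in> sets borel}"
  have "indep_set (cylinders (orthogonal_to Y)) ?B"
  proof (rule indep_setI)
    fix a b assume "a \<in> cylinders (orthogonal_to Y)" "b \<in> ?B"
    then show "prob (a \<inter> b) = prob a * prob b"
      using prob_H_cylinder[OF Y] by (auto simp: cylinders_def Int_commute)
  qed (use cylinders_orthogonal_events in auto)
  moreover have "Int_stable ?B"
  proof (rule Int_stableI)
    fix a b assume "a \<in> ?B" "b \<in> ?B"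
    then obtain A1 A2 where "a = Y -` A1 \<inter> space M" "b = Y -` A2 \<inter> space M" "A1 \<in> sets borel" "A2 \<in> sets borel" by auto
    then show "a \<inter> b \<in> ?B" by (auto intro!: exI[of _ "A1 \<inter> A2"])
  qed
  ultimately have i: "indep_set (sets (orth Y)) (sigma_sets (space M) ?B)"
    unfolding sets_orth by (rule indep_set_sigma_sets[OF _ Int_stable_cylinders])
  show ?thesis
    by (rule indep_setD[OF i]) (use E A in auto)
qed

text \<open>Independence in the form used for the walk: Y is integrated out against its normal law
  while everything measurable for \<open>orth Y\<close> is frozen.\<close>

lemma nn_integral_orth:
  assumes Y: "Y \<in> H" and F: "(\<lambda>(\<omega>, n). F \<omega> n) \<in> borel_measurable (orth Y \<Otimes>\<^sub>M borel)"
  shows "(\<integral>\<^sup>+\<omega>. F \<omega> (Y \<omega>) \<partial>M) =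
    (\<integral>\<^sup>+\<omega>. (\<integral>\<^sup>+n. ennreal (std_normal_density n) * F \<omega> (sqrt (var Y) * n) \<partial>lborel) \<partial>M)"
proof -
  note [measurable] = measurable_H[OF Y] measurable_orth_id[of Y] F
  have eq: "distr M (orth Y \<Otimes>\<^sub>M borel) (\<lambda>\<omega>. (\<omega>, Y \<omega>)) = distr M (orth Y) (\<lambda>\<omega>. \<omega>) \<Otimes>\<^sub>M distr M borel Y"
  proof (rule pair_measure_eqI[symmetric])
    fix E A assume "E \<in> sets (distr M (orth Y) (\<lambda>\<omega>. \<omega>))" "A \<in> sets (distr M borel Y)"
    then have E: "E \<in> sets (orth Y)" "E \<in> events" and A: "A \<in> sets borel"
      using sets_orth_subset[of Y] by auto
    have "(\<lambda>\<omega>. (\<omega>, Y \<omega>)) -` (E \<times> A) \<inter> space M = E \<inter> (Y -` A \<inter> space M)" by auto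
    moreover have "(\<lambda>\<omega>. \<omega>) -` E \<inter> space M = E" using sets.sets_into_space[OF E(2)] by auto
    ultimately show "emeasure (distr M (orth Y) (\<lambda>\<omega>. \<omega>)) E * emeasure (distr M borel Y) A =
      emeasure (distr M (orth Y \<Otimes>\<^sub>M borel) (\<lambda>\<omega>. (\<omega>, Y \<omega>))) (E \<times> A)"
      using E A prob_orth[OF Y E(1) A]
      by (simp add: emeasure_distr emeasure_eq_measure ennreal_mult)
  qed (auto intro!: prob_space_imp_sigma_finite prob_space_distr)
  interpret d: prob_space "distr M borel Y" by (rule prob_space_distr) simp
  have "(\<integral>\<^sup>+\<omega>. F \<omega> (Y \<omega>) \<partial>M) = (\<integral>\<^sup>+p. (case p of (\<omega>, n) \<Rightarrow> F \<omega> n) \<partial>distr M (orth Y \<Otimes>\<^sub>M borel) (\<lambda>\<omega>. (\<omega>, Y \<omega>)))"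
    by (subst nn_integral_distr) auto
  also have "\<dots> = (\<integral>\<^sup>+\<omega>. (\<integral>\<^sup>+n. F \<omega> n \<partial>distr M borel Y) \<partial>distr M (orth Y) (\<lambda>\<omega>. \<omega>))"
    unfolding eq by (subst d.nn_integral_fst[symmetric]) auto
  also have "\<dots> = (\<integral>\<^sup>+\<omega>. (\<integral>\<^sup>+n. F \<omega> n \<partial>distr M borel Y) \<partial>M)"
  proof (rule nn_integral_distr[OF measurable_orth_id])
    have "(\<lambda>\<omega>. \<integral>\<^sup>+n. (case (\<omega>, n) of (\<omega>, n) \<Rightarrow> F \<omega> n) \<partial>distr M borel Y) \<in> borel_measurable (orth Y)"
      by (rule d.borel_measurable_nn_integral_fst) simp
    then show "(\<lambda>\<omega>. \<integral>\<^sup>+n. F \<omega> n \<partial>distr M borel Y) \<in> borel_measurable (distr M (orth Y) (\<lambda>\<omega>. \<omega>))" by simp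
  qed
  also have "\<dots> = (\<integral>\<^sup>+\<omega>. (\<integral>\<^sup>+n. ennreal (std_normal_density n) * F \<omega> (sqrt (var Y) * n) \<partial>lborel) \<partial>M)"
  proof (rule nn_integral_cong)
    fix \<omega> assume "\<omega> \<in> space M"
    then have [measurable]: "F \<omega> \<in> borel_measurable borel"
      using measurable_Pair2[OF F, of \<omega>] by simp
    have "(\<integral>\<^sup>+n. F \<omega> n \<partial>distr M borel Y) = (\<integral>\<^sup>+\<omega>'. F \<omega> (Y \<omega>') \<partial>M)"
      by (simp add: nn_integral_distr)
    then show "(\<integral>\<^sup>+n. F \<omega> n \<partial>distr M borel Y) = (\<integral>\<^sup>+n. ennreal (std_normal_density n) * F \<omega> (sqrt (var Y) * n) \<partial>lborel)"
      using law_H[OF Y, of "F \<omega>"] by simp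
  qed
  finally show ?thesis .
qed

lemma nn_integral_orth_mult:
  assumes Y: "Y \<in> H" and h: "h \<in> borel_measurable (orth Y)" and [measurable]: "g \<in> borel_measurable borel"
  shows "(\<integral>\<^sup>+\<omega>. h \<omega> * g (Y \<omega>) \<partial>M) = (\<integral>\<^sup>+\<omega>. h \<omega> \<partial>M) * (\<integral>\<^sup>+\<omega>. g (Y \<omega>) \<partial>M)"
proof -
  note [measurable] = h measurable_from_orth[OF h]
  have "(\<integral>\<^sup>+\<omega>. h \<omega> * g (Y \<omega>) \<partial>M) =
    (\<integral>\<^sup>+\<omega>. (\<integral>\<^sup>+n. ennreal (std_normal_density n) * (h \<omega> * g (sqrt (var Y) * n)) \<partial>lborel) \<partial>M)"
    by (rule nn_integral_orth[OF Y]) measurable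
  also have "\<dots> = (\<integral>\<^sup>+\<omega>. h \<omega> * (\<integral>\<^sup>+\<omega>. g (Y \<omega>) \<partial>M) \<partial>M)"
    by (subst law_H[OF Y]) (auto simp: nn_integral_cmult[symmetric] mult_ac)
  finally show ?thesis by (simp add: nn_integral_multc)
qed

end

lemma (in prob_space) gaussian_integrable:
  assumes "gaussian M Y"
  shows "integrable M Y"
proof -
  have [measurable]: "Y \<in> borel_measurable M" using assms by (simp add: gaussian_def)
  from assms consider \<mu> \<sigma> where "\<sigma> > 0" "distributed M lborel Y (normal_density \<mu> \<sigma>)"
    | \<mu> where "AE \<omega> in M. Y \<omega> = \<mu>"
    unfolding gaussian_def by blast
  then show ?thesis
  proof cases
    case (1 \<mu> \<sigma>)
    then show ?thesis
      using integrable_normal_moment_nz_1[of \<sigma> \<mu>] distributed_integrable[OF 1(2), of "\<lambda>x. x"] by simp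
  next
    case (2 \<mu>)
    have "integrable M Y \<longleftrightarrow> integrable M (\<lambda>\<omega>. \<mu>)"
      by (intro integrable_cong_AE) (use 2 in auto)
    then show ?thesis by simp
  qed
qed

section \<open>The layers of a star-scale invariant field\<close>

locale star_field = prob_space P for P :: "'w measure" +
  fixes \<rho> :: "'a::euclidean_space \<Rightarrow> real" and X :: "real \<Rightarrow> 'w \<Rightarrow> 'a \<Rightarrow> real"
  assumes seed: "seed_covariance \<rho>"
    and decomposition: "star_scale_martingale_decomposition P \<rho> X"
begin

definition field_span :: "('w \<Rightarrow> real) set" where
  "field_span = {Y. \<exists>F c. finite F \<and> F \<subseteq> {0..} \<times> UNIV \<and> Y = (\<lambda>\<omega>. \<Sum>i\<in>F. c i * X (fst i) \<omega> (snd i))}"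

lemma gaussian_field_span: "Y \<in> field_span \<Longrightarrow> gaussian P Y"
  using decomposition
  unfolding star_scale_martingale_decomposition_def jointly_gaussian_def field_span_def
  by (auto simp: case_prod_beta)

lemma field_span_sum:
  "finite F \<Longrightarrow> F \<subseteq> {0..} \<times> UNIV \<Longrightarrow> (\<lambda>\<omega>. \<Sum>i\<in>F. c i * X (fst i) \<omega> (snd i)) \<in> field_span"
  by (auto simp: field_span_def)

lemma X_span: "0 \<le> t \<Longrightarrow> (\<lambda>\<omega>. X t \<omega> x) \<in> field_span"
  using field_span_sum[of "{(t, x)}" "\<lambda>_. 1"] by simp

lemma mean_X: "0 \<le> t \<Longrightarrow> (LINT \<omega>|P. X t \<omega> x) = 0"
  using decomposition by (auto simp: star_scale_martingale_decomposition_def)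

lemma continuous_X: "0 \<le> t \<Longrightarrow> \<omega> \<in> space P \<Longrightarrow> continuous_on UNIV (X t \<omega>)"
  using decomposition by (auto simp: star_scale_martingale_decomposition_def)

definition cov :: "real \<Rightarrow> 'a \<Rightarrow> real" where
  "cov t z = (LINT u:{0..t}|lborel. \<rho> (exp u *\<^sub>R z))"

lemma covariance_X: "0 \<le> s \<Longrightarrow> 0 \<le> t \<Longrightarrow> (LINT \<omega>|P. X s \<omega> x * X t \<omega> y) = cov (min s t) (x - y)"
  using decomposition by (auto simp: star_scale_martingale_decomposition_def cov_def)

sublocale gaussian_space P field_span
proof
  fix Y assume Y: "Y \<in> field_span"
  show "gaussian P Y" by (rule gaussian_field_span[OF Y])
  from Y obtain F c where F: "finite F" "F \<subseteq> {0..} \<times> UNIV" "Y = (\<lambda>\<omega>. \<Sum>i\<in>F. c i * X (fst i) \<omega> (snd i))"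
    by (auto simp: field_span_def)
  have "(LINT \<omega>|P. Y \<omega>) = (\<Sum>i\<in>F. LINT \<omega>|P. c i * X (fst i) \<omega> (snd i))"
    unfolding F(3) using F(2)
    by (intro Bochner_Integration.integral_sum integrable_mult_right gaussian_integrable gaussian_field_span X_span) auto
  also have "\<dots> = 0" using F(2) by (intro sum.neutral) (auto simp: mean_X)
  finally show "(LINT \<omega>|P. Y \<omega>) = 0" .
  show "(\<lambda>\<omega>. c * Y \<omega>) \<in> field_span" for c
    using field_span_sum[OF F(1,2), of "\<lambda>i. c * _ i"] unfolding F(3) by (simp add: sum_distrib_left mult.assoc)
  fix Z assume "Z \<in> field_span"
  then obtain G e where G: "finite G" "G \<subseteq> {0..} \<times> UNIV" "Z = (\<lambda>\<omega>. \<Sum>i\<in>G. e i * X (fst i) \<omega> (snd i))"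
    by (auto simp: field_span_def)
  have "(\<Sum>i\<in>F. c i * X (fst i) \<omega> (snd i)) + (\<Sum>i\<in>G. e i * X (fst i) \<omega> (snd i)) =
     (\<Sum>i\<in>F \<union> G. ((if i \<in> F then c i else 0) + (if i \<in> G then e i else 0)) * X (fst i) \<omega> (snd i))" for \<omega>
  proof -
    have "(\<Sum>i\<in>F. c i * X (fst i) \<omega> (snd i)) = (\<Sum>i\<in>F \<union> G. (if i \<in> F then c i else 0) * X (fst i) \<omega> (snd i))"
      by (rule sum.mono_neutral_cong_left) (use F G in auto)
    moreover have "(\<Sum>i\<in>G. e i * X (fst i) \<omega> (snd i)) = (\<Sum>i\<in>F \<union> G. (if i \<in> G then e i else 0) * X (fst i) \<omega> (snd i))"
      by (rule sum.mono_neutral_cong_left) (use F G in auto)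
    ultimately show ?thesis by (simp only: sum.distrib distrib_right)
  qed
  then show "(\<lambda>\<omega>. Y \<omega> + Z \<omega>) \<in> field_span"
    unfolding F(3) G(3) using F G by (auto intro!: field_span_sum)
qed

lemma rho_nonneg: "0 \<le> \<rho> z" and rho_zero: "\<rho> 0 = 1"
  using seed by (auto simp: seed_covariance_def)

lemma rho_Ck: "Ck k \<rho>"
  using seed by (auto simp: seed_covariance_def smooth_def)

lemma continuous_rho: "continuous_on UNIV \<rho>"
  using rho_Ck[of 0] by simp

lemma rho_vanish: "\<exists>R>0. \<forall>z. R \<le> norm z \<longrightarrow> \<rho> z = 0"
proof -
  obtain R where R: "R > 0" "supp \<rho> \<subseteq> ball 0 (R / 2)" using seed by (auto simp: seed_covariance_def)
  have "\<rho> z = 0" if "R / 2 \<le> norm z" for z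
  proof (rule ccontr)
    assume "\<rho> z \<noteq> 0"
    then have "z \<in> supp \<rho>" unfolding supp_def using closure_subset[of "{x. \<rho> x \<noteq> 0}"] by auto
    then have "z \<in> ball 0 (R / 2)" using R(2) by (rule subsetD[rotated])
    then show False using that by simp
  qed
  then show ?thesis using R by (intro exI[of _ "R / 2"]) auto
qed

definition corr_range :: real where "corr_range = (SOME R. R > 0 \<and> (\<forall>z. R \<le> norm z \<longrightarrow> \<rho> z = 0))"

lemma corr_range_pos: "0 < corr_range" and rho_corr_range: "corr_range \<le> norm z \<Longrightarrow> \<rho> z = 0"
  using someI_ex[OF rho_vanish] unfolding corr_range_def by blast+

text \<open>Near 0 the bound is differentiability at 0. Away from 0 it is the trivial 1 - \<rho> z
  \<le> 1 \<le> norm z / d, since \<rho> is nonnegative.\<close>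

lemma rho_modulus: "\<exists>C>0. \<forall>z. 1 - \<rho> z \<le> C * norm z"
proof -
  have "\<rho> differentiable (at 0)" using rho_Ck[of 1] by simp
  then obtain D where D: "(\<rho> has_derivative D) (at 0)" by (auto simp: differentiable_def)
  then obtain d where d: "d > 0" "\<And>y. norm y < d \<Longrightarrow> norm (\<rho> y - \<rho> 0 - D y) \<le> 1 * norm y"
    using D[unfolded has_derivative_at_alt, THEN conjunct2, rule_format, of 1] by auto
  obtain K where K: "K > 0" "\<And>y. norm (D y) \<le> norm y * K"
    using bounded_linear.pos_bounded[OF has_derivative_bounded_linear[OF D]] by auto
  have "1 - \<rho> z \<le> (K + 1 + 1 / d) * norm z" for z
  proof (cases "norm z < d")
    case True
    have "1 - \<rho> z \<le> norm z * K + norm z"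
      using d(2)[OF True] K(2)[of z] rho_zero unfolding real_norm_def by linarith
    also have "\<dots> \<le> (K + 1 + 1 / d) * norm z" using d by (simp add: algebra_simps)
    finally show ?thesis .
  next
    case False
    then have "1 \<le> (1 / d) * norm z" using d by simp
    also have "\<dots> \<le> (K + 1 + 1 / d) * norm z" using K by (intro mult_right_mono) auto
    finally show ?thesis using rho_nonneg[of z] by linarith
  qed
  then show ?thesis using K d by (intro exI[of _ "K + 1 + 1 / d"]) (auto intro!: add_pos_pos)
qed

definition modulus :: real where "modulus = (SOME C. C > 0 \<and> (\<forall>z. 1 - \<rho> z \<le> C * norm z))"

lemma modulus_pos: "0 < modulus" and rho_ge: "1 - \<rho> z \<le> modulus * norm z"
  using someI_ex[OF rho_modulus] unfolding modulus_def by blast+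

lemma set_integrable_rho: "set_integrable lborel {s..t} (\<lambda>u. \<rho> (exp u *\<^sub>R z))"
  by (rule borel_integrable_atLeastAtMost')
     (intro continuous_on_compose2[OF continuous_rho] continuous_intros subset_UNIV)

lemma cov_diff:
  assumes "0 \<le> s" "s \<le> t"
  shows "cov t z - cov s z = (LINT u:{s<..t}|lborel. \<rho> (exp u *\<^sub>R z))"
proof -
  have "{0..t} = {0..s} \<union> {s<..t}" using assms by auto
  moreover have "(LINT u:{0..s} \<union> {s<..t}|lborel. \<rho> (exp u *\<^sub>R z)) =
      (LINT u:{0..s}|lborel. \<rho> (exp u *\<^sub>R z)) + (LINT u:{s<..t}|lborel. \<rho> (exp u *\<^sub>R z))"
    by (intro set_integral_Un set_integrable_subset[OF set_integrable_rho[of s t z]] set_integrable_rho) auto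
  ultimately show ?thesis unfolding cov_def by simp
qed

lemma cov_diff_zero: "0 \<le> s \<Longrightarrow> s \<le> t \<Longrightarrow> cov t 0 - cov s 0 = t - s"
  by (simp add: cov_diff rho_zero set_lebesgue_integral_def)

text \<open>Beyond the scale s the rescaled separation exp u * norm z stays outside the support of
  \<rho>, so layers after s are uncorrelated at the two points.\<close>

lemma cov_diff_far:
  assumes "0 \<le> s" "s \<le> t" "corr_range \<le> exp s * norm z"
  shows "cov t z = cov s z"
proof -
  have "(LINT u:{s<..t}|lborel. \<rho> (exp u *\<^sub>R z)) = (LINT u:{s<..t}|lborel. 0)"
  proof (rule set_lebesgue_integral_cong)
    show "\<forall>u. u \<in> {s<..t} \<longrightarrow> \<rho> (exp u *\<^sub>R z) = 0"
    proof (intro allI impI rho_corr_range)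
      fix u assume "u \<in> {s<..t}"
      then have "exp s * norm z \<le> exp u * norm z" by (intro mult_right_mono) auto
      then show "corr_range \<le> norm (exp u *\<^sub>R z)" using assms by simp
    qed
  qed simp
  then show ?thesis using cov_diff[OF assms(1,2), of z] by (simp add: set_lebesgue_integral_def)
qed

lemma cov_diff_ge:
  assumes "0 \<le> s" "s \<le> t"
  shows "(t - s) - modulus * exp t * norm z * (t - s) \<le> cov t z - cov s z"
proof -
  have "(LINT u:{s<..t}|lborel. 1 - modulus * exp t * norm z) \<le> (LINT u:{s<..t}|lborel. \<rho> (exp u *\<^sub>R z))"
  proof (rule set_integral_mono)
    fix u assume u: "u \<in> {s<..t}"
    have "1 - \<rho> (exp u *\<^sub>R z) \<le> modulus * (exp u * norm z)"
      using rho_ge[of "exp u *\<^sub>R z"] by simp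
    also have "\<dots> \<le> modulus * (exp t * norm z)"
      using u modulus_pos by (intro mult_left_mono mult_right_mono) auto
    finally show "1 - modulus * exp t * norm z \<le> \<rho> (exp u *\<^sub>R z)" by (simp add: mult.assoc)
  next
    show "set_integrable lborel {s<..t} (\<lambda>u. \<rho> (exp u *\<^sub>R z))"
      by (rule set_integrable_subset[OF set_integrable_rho[of s t z]]) auto
    show "set_integrable lborel {s<..t} (\<lambda>u. 1 - modulus * exp t * norm z)"
      by (rule set_integrable_subset[of _ "{s..t}"]) (auto intro: borel_integrable_atLeastAtMost')
  qed
  then show ?thesis using assms by (simp add: cov_diff algebra_simps set_lebesgue_integral_def)
qed

definition inc :: "nat \<Rightarrow> nat \<Rightarrow> 'a \<Rightarrow> 'w \<Rightarrow> real" where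
  "inc i k x \<omega> = X (real k) \<omega> x - X (real i) \<omega> x"

lemma inc_span: "inc i k x \<in> field_span"
  unfolding inc_def by (intro diff_H X_span) auto

lemma covariance_inc_X:
  "(LINT \<omega>|P. inc i k x \<omega> * X (real j) \<omega> y) = cov (real (min k j)) (x - y) - cov (real (min i j)) (x - y)"
proof -
  have "(LINT \<omega>|P. inc i k x \<omega> * X (real j) \<omega> y) =
      (LINT \<omega>|P. X (real k) \<omega> x * X (real j) \<omega> y) - (LINT \<omega>|P. X (real i) \<omega> x * X (real j) \<omega> y)"
    unfolding inc_def left_diff_distrib
    by (intro Bochner_Integration.integral_diff integrable_product_H X_span) auto
  then show ?thesis by (simp add: covariance_X of_nat_min)
qed

lemma X_orthogonal_inc:
  assumes "j \<le> i" "i \<le> k"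
  shows "(\<lambda>\<omega>. X (real j) \<omega> y) \<in> orthogonal_to (inc i k x)"
  using assms by (auto simp: orthogonal_to_def X_span covariance_inc_X min_absorb2)

text \<open>Here the time j of the second point is arbitrary. The whole path at y, including its
  future, is therefore frozen while the increments at x beyond scale i are integrated out.\<close>

lemma X_orthogonal_inc_far:
  assumes "i \<le> k" "corr_range \<le> exp (real i) * norm (x - y)"
  shows "(\<lambda>\<omega>. X (real j) \<omega> y) \<in> orthogonal_to (inc i k x)"
proof (cases "j \<le> i")
  case False
  then have "cov (real (min k j)) (x - y) = cov (real i) (x - y)"
    using assms by (intro cov_diff_far) auto
  then show ?thesis using False assms by (auto simp: orthogonal_to_def X_span covariance_inc_X min_absorb1)
qed (use X_orthogonal_inc assms in auto)

lemma covariance_inc: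
  assumes "i \<le> k"
  shows "(LINT \<omega>|P. inc i k x \<omega> * inc i k y \<omega>) = cov (real k) (x - y) - cov (real i) (x - y)"
proof -
  have "(LINT \<omega>|P. inc i k x \<omega> * inc i k y \<omega>) =
      (LINT \<omega>|P. inc i k x \<omega> * X (real k) \<omega> y) - (LINT \<omega>|P. inc i k x \<omega> * X (real i) \<omega> y)"
    unfolding inc_def[of i k y] right_diff_distrib
    by (intro Bochner_Integration.integral_diff integrable_product_H X_span inc_span) auto
  then show ?thesis using assms by (simp add: covariance_inc_X min_absorb2)
qed

lemma var_inc: "i \<le> k \<Longrightarrow> var (inc i k x) = real k - real i"
  by (simp add: var_def covariance_inc cov_diff_zero)

lemma var_inc_diff_le:
  assumes "i \<le> k"
  shows "var (\<lambda>\<omega>. inc i k x \<omega> - inc i k y \<omega>) \<le> 2 * modulus * exp (real k) * norm (x - y) * (real k - real i)"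
proof -
  have "var (\<lambda>\<omega>. inc i k x \<omega> - inc i k y \<omega>) =
      (LINT \<omega>|P. inc i k x \<omega> * inc i k x \<omega> + inc i k y \<omega> * inc i k y \<omega> - 2 * (inc i k x \<omega> * inc i k y \<omega>))"
    unfolding var_def by (intro Bochner_Integration.integral_cong) (auto simp: algebra_simps)
  also have "\<dots> = 2 * (real k - real i) - 2 * (cov (real k) (x - y) - cov (real i) (x - y))"
    using integrable_product_H[OF inc_span inc_span, of i k _ i k] assms
    by (simp add: covariance_inc cov_diff_zero)
  also have "\<dots> \<le> 2 * modulus * exp (real k) * norm (x - y) * (real k - real i)"
    using cov_diff_ge[of "real i" "real k" "x - y"] assms by (simp add: algebra_simps)
  finally show ?thesis .
qed

lemma X_zero_AE: "AE \<omega> in P. X 0 \<omega> x = 0"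
proof -
  have "var (\<lambda>\<omega>. X 0 \<omega> x) = 0"
    unfolding var_def covariance_X[OF order_refl order_refl] cov_def by (simp add: set_lebesgue_integral_def)
  from X_span[OF order_refl, of x] show ?thesis
  proof (cases rule: H_cases)
    case degenerate
    then show ?thesis by simp
  next
    case normal
    then show ?thesis using \<open>var (\<lambda>\<omega>. X 0 \<omega> x) = 0\<close> by linarith
  qed
qed

lemma measurable_X[measurable]: "0 \<le> t \<Longrightarrow> (\<lambda>\<omega>. X t \<omega> x) \<in> borel_measurable P"
  using measurable_H X_span by blast

section \<open>Paths below a barrier\<close>

definition \<gamma> :: real where "\<gamma> = sqrt (2 * real DIM('a))"

definition dim :: real where "dim = real DIM('a)"

lemma gamma_sq: "\<gamma>\<^sup>2 / 2 = dim" "\<gamma> * \<gamma> = 2 * dim"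
  by (simp_all add: \<gamma>_def dim_def)

lemma dim_ge_1: "1 \<le> dim"
  using DIM_positive[where 'a='a] by (simp add: dim_def)

lemma gamma_ge: "sqrt 2 \<le> \<gamma>" "1 \<le> \<gamma>"
proof -
  have "sqrt 2 \<le> sqrt (2 * dim)" using dim_ge_1 by (intro real_sqrt_le_mono) simp
  then show "sqrt 2 \<le> \<gamma>" by (simp add: \<gamma>_def dim_def)
  moreover have "1 \<le> sqrt (2::real)" by simp
  ultimately show "1 \<le> \<gamma>" by linarith
qed

definition S :: "nat \<Rightarrow> 'a \<Rightarrow> 'w \<Rightarrow> real" where
  "S k x \<omega> = X (real k) \<omega> x - \<gamma> * real k"

text \<open>At time k this is the density of the approximating measure without the factor
  \<open>sqrt k\<close>. It has mean 1 because \<gamma> * \<gamma> / 2 = \<open>dim\<close>.\<close>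

definition L :: "nat \<Rightarrow> 'a \<Rightarrow> 'w \<Rightarrow> ennreal" where
  "L k x \<omega> = ennreal (exp (\<gamma> * X (real k) \<omega> x - dim * real k))"

definition stay :: "(nat \<Rightarrow> real) \<Rightarrow> nat \<Rightarrow> 'a \<Rightarrow> 'w \<Rightarrow> ennreal" where
  "stay f k x \<omega> = (\<Prod>j\<in>{1..k}. indicator {..f j} (S j x \<omega>))"

lemma stay_0 [simp]: "stay f 0 x \<omega> = 1"
  by (simp add: stay_def)

lemma stay_Suc: "stay f (Suc k) x \<omega> = stay f k x \<omega> * indicator {..f (Suc k)} (S (Suc k) x \<omega>)"
  by (simp add: stay_def)

lemma stay_eq: "stay f k x \<omega> = (if \<forall>j\<in>{1..k}. S j x \<omega> \<le> f j then 1 else 0)"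
  by (induction k) (auto simp: stay_Suc atLeastAtMostSuc_conv)

lemma stay_antimono: "i \<le> k \<Longrightarrow> stay f k x \<omega> \<le> stay f i x \<omega>"
  by (auto simp: stay_eq)

lemma measurable_S [measurable]: "S k x \<in> borel_measurable P"
  unfolding S_def by measurable

lemma measurable_L [measurable]: "L k x \<in> borel_measurable P"
  unfolding L_def by measurable

lemma measurable_stay [measurable]: "stay f k x \<in> borel_measurable P"
  unfolding stay_def by measurable

lemma measurable_X_orth:
  "j \<le> i \<Longrightarrow> i \<le> k \<Longrightarrow> (\<lambda>\<omega>. X (real j) \<omega> y) \<in> borel_measurable (orth (inc i k x))"
  by (intro measurable_orthI X_orthogonal_inc)

lemma measurable_S_orth: "j \<le> i \<Longrightarrow> i \<le> k \<Longrightarrow> S j y \<in> borel_measurable (orth (inc i k x))"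
  using measurable_X_orth unfolding S_def by measurable

lemma measurable_L_orth: "j \<le> i \<Longrightarrow> i \<le> k \<Longrightarrow> L j y \<in> borel_measurable (orth (inc i k x))"
  using measurable_X_orth unfolding L_def by measurable

lemma measurable_stay_orth: "j \<le> i \<Longrightarrow> i \<le> k \<Longrightarrow> stay f j y \<in> borel_measurable (orth (inc i k x))"
proof (induction j)
  case (Suc j)
  then have [measurable]: "S (Suc j) y \<in> borel_measurable (orth (inc i k x))"
     "stay f j y \<in> borel_measurable (orth (inc i k x))"
    using measurable_S_orth[of "Suc j" i k y x] by auto
  show ?case unfolding stay_Suc by measurable
next
  case 0
  have "stay f 0 y = (\<lambda>_. 1)" by (simp add: fun_eq_iff)
  then show ?case by simp
qed

lemma measurable_far_orth:
  assumes "i \<le> k" "corr_range \<le> exp (real i) * norm (x - y)"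
  shows "S j y \<in> borel_measurable (orth (inc i k x))" "L j y \<in> borel_measurable (orth (inc i k x))"
    "stay f j y \<in> borel_measurable (orth (inc i k x))"
proof -
  have X: "(\<lambda>\<omega>. X (real j) \<omega> y) \<in> borel_measurable (orth (inc i k x))" for j
    using assms by (intro measurable_orthI X_orthogonal_inc_far)
  have S: "S j y \<in> borel_measurable (orth (inc i k x))" for j using X[of j] unfolding S_def by measurable
  show "S j y \<in> borel_measurable (orth (inc i k x))" by (rule S)
  show "L j y \<in> borel_measurable (orth (inc i k x))" using X[of j] unfolding L_def by measurable
  show "stay f j y \<in> borel_measurable (orth (inc i k x))"
    using S unfolding stay_def by measurable
qed

text \<open>Under the exponential tilt by \<open>L\<close> the drift of \<open>S\<close> disappears.\<close>

lemma nn_integral_tilt: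
  assumes [measurable]: "G \<in> borel_measurable borel"
  shows "(\<integral>\<^sup>+n. ennreal (std_normal_density n) * (ennreal (exp (\<gamma> * n - dim)) * G (n - \<gamma>)) \<partial>lborel) =
    (\<integral>\<^sup>+n. ennreal (std_normal_density n) * G n \<partial>lborel)"
proof -
  have "(\<integral>\<^sup>+n. ennreal (std_normal_density n) * (ennreal (exp (\<gamma> * n - dim)) * G (n - \<gamma>)) \<partial>lborel) =
    (\<integral>\<^sup>+n. ennreal (std_normal_density (\<gamma> + n)) * (ennreal (exp (\<gamma> * (\<gamma> + n) - dim)) * G n) \<partial>lborel)"
    by (subst nn_integral_real_affine[of _ 1 \<gamma>]) auto
  also have "\<dots> = (\<integral>\<^sup>+n. ennreal (std_normal_density n) * G n \<partial>lborel)"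
  proof (intro nn_integral_cong)
    fix n
    have "std_normal_density (\<gamma> + n) * exp (\<gamma> * (\<gamma> + n) - dim) = std_normal_density n"
      using gamma_sq by (simp add: normal_density_def power2_eq_square algebra_simps flip: exp_add)
        (simp add: field_simps)
    then have "ennreal (std_normal_density (\<gamma> + n)) * ennreal (exp (\<gamma> * (\<gamma> + n) - dim)) = ennreal (std_normal_density n)"
      by (subst ennreal_mult[symmetric]) auto
    then show "ennreal (std_normal_density (\<gamma> + n)) * (ennreal (exp (\<gamma> * (\<gamma> + n) - dim)) * G n) = ennreal (std_normal_density n) * G n"
      by (simp add: mult.assoc[symmetric])
  qed
  finally show ?thesis .
qed

text \<open>The factor h is anything that does not see the increment of x, such as the complete
  weight of a distant point. This generality is what makes the two-point estimate a repetition of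
  the one-point computation.\<close>

lemma nn_integral_path_step:
  assumes h: "h \<in> borel_measurable (orth (inc k (Suc k) x))" and [measurable]: "g \<in> borel_measurable borel"
  shows "(\<integral>\<^sup>+\<omega>. h \<omega> * (L (Suc k) x \<omega> * stay f (Suc k) x \<omega> * g (S (Suc k) x \<omega>)) \<partial>P) =
    (\<integral>\<^sup>+\<omega>. h \<omega> * (L k x \<omega> * stay f k x \<omega> * kstep (f (Suc k)) g (S k x \<omega>)) \<partial>P)"
proof -
  let ?Y = "inc k (Suc k) x"
  have o[measurable]: "S k x \<in> borel_measurable (orth ?Y)" "L k x \<in> borel_measurable (orth ?Y)"
    "stay f k x \<in> borel_measurable (orth ?Y)"
    by (rule measurable_S_orth measurable_L_orth measurable_stay_orth; simp)+
  note [measurable] = h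
  define F where "F = (\<lambda>\<omega> n. h \<omega> * L k x \<omega> * stay f k x \<omega> *
    (ennreal (exp (\<gamma> * n - dim)) * (indicator {..f (Suc k)} (S k x \<omega> + (n - \<gamma>)) * g (S k x \<omega> + (n - \<gamma>)))))"
  have F: "(\<lambda>(\<omega>, n). F \<omega> n) \<in> borel_measurable (orth ?Y \<Otimes>\<^sub>M borel)"
    unfolding F_def by measurable
  have "h \<omega> * (L (Suc k) x \<omega> * stay f (Suc k) x \<omega> * g (S (Suc k) x \<omega>)) = F \<omega> (?Y \<omega>)" for \<omega>
  proof -
    have "L (Suc k) x \<omega> = L k x \<omega> * ennreal (exp (\<gamma> * ?Y \<omega> - dim))"
      unfolding L_def inc_def by (subst ennreal_mult[symmetric]) (auto simp: algebra_simps simp flip: exp_add)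
    moreover have "S (Suc k) x \<omega> = S k x \<omega> + (?Y \<omega> - \<gamma>)"
      unfolding S_def inc_def by (simp add: algebra_simps)
    ultimately show ?thesis unfolding F_def stay_Suc by (simp add: mult_ac)
  qed
  then have "(\<integral>\<^sup>+\<omega>. h \<omega> * (L (Suc k) x \<omega> * stay f (Suc k) x \<omega> * g (S (Suc k) x \<omega>)) \<partial>P) = (\<integral>\<^sup>+\<omega>. F \<omega> (?Y \<omega>) \<partial>P)"
    by simp
  also have "\<dots> = (\<integral>\<^sup>+\<omega>. (\<integral>\<^sup>+n. ennreal (std_normal_density n) * F \<omega> n \<partial>lborel) \<partial>P)"
    using nn_integral_orth[OF inc_span F] var_inc[of k "Suc k" x] by simp
  also have "\<dots> = (\<integral>\<^sup>+\<omega>. h \<omega> * (L k x \<omega> * stay f k x \<omega> * kstep (f (Suc k)) g (S k x \<omega>)) \<partial>P)"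
  proof (intro nn_integral_cong)
    fix \<omega>
    have "(\<integral>\<^sup>+n. ennreal (std_normal_density n) * F \<omega> n \<partial>lborel) = h \<omega> * L k x \<omega> * stay f k x \<omega> *
      (\<integral>\<^sup>+n. ennreal (std_normal_density n) * (ennreal (exp (\<gamma> * n - dim)) *
        (indicator {..f (Suc k)} (S k x \<omega> + (n - \<gamma>)) * g (S k x \<omega> + (n - \<gamma>)))) \<partial>lborel)"
      unfolding F_def by (subst nn_integral_cmult[symmetric]) (auto simp: mult_ac)
    also have "\<dots> = h \<omega> * L k x \<omega> * stay f k x \<omega> * kstep (f (Suc k)) g (S k x \<omega>)"
      unfolding kstep_def
      by (subst nn_integral_tilt[of "\<lambda>n. indicator {..f (Suc k)} (S k x \<omega> + n) * g (S k x \<omega> + n)"]) auto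
    finally show "(\<integral>\<^sup>+n. ennreal (std_normal_density n) * F \<omega> n \<partial>lborel) =
      h \<omega> * (L k x \<omega> * stay f k x \<omega> * kstep (f (Suc k)) g (S k x \<omega>))" by (simp add: mult_ac)
  qed
  finally show ?thesis .
qed

lemma nn_integral_path:
  assumes "\<And>j. i \<le> j \<Longrightarrow> j < i + m \<Longrightarrow> h \<in> borel_measurable (orth (inc j (Suc j) x))"
    and "g \<in> borel_measurable borel"
  shows "(\<integral>\<^sup>+\<omega>. h \<omega> * (L (i + m) x \<omega> * stay f (i + m) x \<omega> * g (S (i + m) x \<omega>)) \<partial>P) =
    (\<integral>\<^sup>+\<omega>. h \<omega> * (L i x \<omega> * stay f i x \<omega> * kchain f i m g (S i x \<omega>)) \<partial>P)"
  using assms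
proof (induction m arbitrary: g)
  case (Suc m)
  have "(\<integral>\<^sup>+\<omega>. h \<omega> * (L (i + Suc m) x \<omega> * stay f (i + Suc m) x \<omega> * g (S (i + Suc m) x \<omega>)) \<partial>P) =
     (\<integral>\<^sup>+\<omega>. h \<omega> * (L (i + m) x \<omega> * stay f (i + m) x \<omega> * kstep (f (Suc (i + m))) g (S (i + m) x \<omega>)) \<partial>P)"
    using nn_integral_path_step[of h "i + m" x g f] Suc.prems by simp
  also have "\<dots> = (\<integral>\<^sup>+\<omega>. h \<omega> * (L i x \<omega> * stay f i x \<omega> * kchain f i m (kstep (f (Suc (i + m))) g) (S i x \<omega>)) \<partial>P)"
    by (rule Suc.IH) (use Suc.prems in auto)
  finally show ?case by simp
qed simp

text \<open>The many-to-one formula: the tilted, killed path at a point is the driftless killed walk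
  started at 0, as X vanishes almost surely at time 0.\<close>

lemma nn_integral_one_point:
  assumes "g \<in> borel_measurable borel"
  shows "(\<integral>\<^sup>+\<omega>. L k x \<omega> * stay f k x \<omega> * g (S k x \<omega>) \<partial>P) = kchain f 0 k g 0"
proof -
  have "(\<integral>\<^sup>+\<omega>. L k x \<omega> * stay f k x \<omega> * g (S k x \<omega>) \<partial>P) =
     (\<integral>\<^sup>+\<omega>. 1 * (L 0 x \<omega> * stay f 0 x \<omega> * kchain f 0 k g (S 0 x \<omega>)) \<partial>P)"
    using nn_integral_path[of 0 k "\<lambda>_. 1" x g f] assms by simp
  also have "\<dots> = (\<integral>\<^sup>+\<omega>. kchain f 0 k g 0 \<partial>P)"
    by (rule nn_integral_cong_AE) (use X_zero_AE[of x] in \<open>auto elim!: eventually_mono simp: L_def S_def\<close>)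
  finally show ?thesis by (simp add: emeasure_space_1)
qed

end

section \<open>The walk under the two-level barrier\<close>

lemma kchain_add: "kchain f i (m + n) g = kchain f i m (kchain f (i + m) n g)"
  by (induction n arbitrary: g) (auto simp: add.assoc)

lemma kchain_const:
  "(\<And>j. i < j \<Longrightarrow> j \<le> i + m \<Longrightarrow> f j = b) \<Longrightarrow> kchain f i m g = (kstep b ^^ m) g"
  by (induction m arbitrary: g) (auto simp: funpow_swap1)

lemma kchain_mono: "(\<And>s. g s \<le> h s) \<Longrightarrow> kchain f i m g s \<le> kchain f i m h s"
proof (induction m arbitrary: g h)
  case (Suc m)
  show ?case unfolding kchain.simps by (rule Suc.IH) (rule kstep_mono, rule Suc.prems)
qed simp

lemma kchain_cmult:
  "g \<in> borel_measurable borel \<Longrightarrow> kchain f i m (\<lambda>s. c * g s) s = c * kchain f i m g s"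
proof (induction m arbitrary: g)
  case (Suc m)
  have "kstep (f (Suc (i + m))) (\<lambda>s. c * g s) = (\<lambda>s. c * kstep (f (Suc (i + m))) g s)"
    using Suc.prems by (intro ext kstep_cmult)
  then show ?case using Suc by simp
qed simp

lemma kchain_sum:
  "(\<And>j. j \<in> I \<Longrightarrow> g j \<in> borel_measurable borel) \<Longrightarrow>
    kchain f i m (\<lambda>s. \<Sum>j\<in>I. g j s) s = (\<Sum>j\<in>I. kchain f i m (g j) s)"
proof (induction m arbitrary: g)
  case (Suc m)
  have "kstep (f (Suc (i + m))) (\<lambda>s. \<Sum>j\<in>I. g j s) = (\<lambda>s. \<Sum>j\<in>I. kstep (f (Suc (i + m))) (g j) s)"
    using Suc.prems by (intro ext kstep_sum) auto
  then show ?case using Suc by simp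
qed simp

text \<open>Up to time a the level l is common to all cubes and guaranteed on a global event;
  afterwards \<open>lam\<close> is the truncation level of a single cube of side exp (- a).\<close>

definition barrier :: "nat \<Rightarrow> real \<Rightarrow> real \<Rightarrow> nat \<Rightarrow> real" where
  "barrier a l lam j = (if j \<le> a then l else lam)"

lemma kchain_barrier_before: "k \<le> a \<Longrightarrow> kchain (barrier a l lam) 0 k g = (kstep l ^^ k) g"
  by (rule kchain_const) (auto simp: barrier_def)

lemma kchain_barrier_after:
  "a \<le> i \<Longrightarrow> kchain (barrier a l lam) i m g = (kstep lam ^^ m) g"
  by (rule kchain_const) (auto simp: barrier_def)

text \<open>The survival bound with k + 1 under the root covers k = 0, where the trivial bound 1 is
  used. The factor 500 comes from 1.5 * 110 * (l + 3) \<le> 500 * (1 + l).\<close>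

lemma kstep_pow_one_le_sqrt_Suc:
  assumes "0 \<le> l"
  shows "(kstep l ^^ k) (\<lambda>_. 1) 0 \<le> ennreal (500 * (1 + l) / sqrt (real k + 1))"
proof (cases "k = 0")
  case True
  have "ennreal 1 \<le> ennreal (500 * (1 + l))" using assms by (intro ennreal_leI) simp
  then show ?thesis using True by simp
next
  case False
  have "110 * (l + 3) / sqrt k \<le> 500 * (1 + l) / sqrt (real k + 1)"
  proof -
    have "sqrt (real k + 1) \<le> sqrt (2 * real k)" using False by (intro real_sqrt_le_mono) simp
    also have "\<dots> \<le> 1.5 * sqrt k"
      unfolding real_sqrt_mult by (intro mult_right_mono real_le_lsqrt) (auto simp: power2_eq_square)
    finally have "110 * (l + 3) * sqrt (real k + 1) \<le> 110 * (l + 3) * (1.5 * sqrt k)"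
      using assms by (intro mult_left_mono) auto
    also have "\<dots> \<le> 500 * (1 + l) * sqrt k"
      using assms mult_nonneg_nonneg[OF assms, of "sqrt k"] by (simp add: algebra_simps)
    finally show ?thesis using False by (simp add: field_simps)
  qed
  then show ?thesis
    using kstep_pow_one_le[of k 0 l] False assms by (auto intro: order_trans ennreal_leI)
qed

abbreviation exp_below :: "real \<Rightarrow> real \<Rightarrow> real \<Rightarrow> ennreal" where
  "exp_below \<kappa> lam \<equiv> \<lambda>s. ennreal (exp (\<kappa> * (s - lam)))"

text \<open>After time a the Green function bound holds uniformly in the position at time a, so the
  a steps before it contribute exactly their survival probability below l.\<close>

lemma sum_kchain_exp_le:
  assumes "0 \<le> l" "0 < \<kappa>" "\<kappa> \<le> 1"
  shows "(\<Sum>m<n. kchain (barrier a l lam) 0 (a + Suc m) (exp_below \<kappa> lam) 0) \<le>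
    ennreal (green_const \<kappa> * (500 * (1 + l) / sqrt (real a + 1)))"
proof -
  have "(\<Sum>m<n. kchain (barrier a l lam) 0 (a + Suc m) (exp_below \<kappa> lam) 0) =
    kchain (barrier a l lam) 0 a (\<lambda>s. \<Sum>m<n. (kstep lam ^^ Suc m) (exp_below \<kappa> lam) s) 0"
    by (subst kchain_sum) (auto simp: kchain_add kchain_barrier_after simp del: add_Suc_right kchain.simps)
  also have "\<dots> \<le> kchain (barrier a l lam) 0 a (\<lambda>s. ennreal (green_const \<kappa>) * 1) 0"
    using sum_kstep_pow_exp_le[OF assms(2,3), where n = n and b = lam] by (intro kchain_mono) simp
  also have "\<dots> = ennreal (green_const \<kappa>) * (kstep l ^^ a) (\<lambda>_. 1) 0"
    by (subst kchain_cmult) (auto simp: kchain_barrier_before)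
  also have "\<dots> \<le> ennreal (green_const \<kappa>) * ennreal (500 * (1 + l) / sqrt (real a + 1))"
    by (intro mult_left_mono kstep_pow_one_le_sqrt_Suc assms) simp
  also have "\<dots> = ennreal (green_const \<kappa> * (500 * (1 + l) / sqrt (real a + 1)))"
    using green_const_pos[OF assms(2)] assms(1) by (intro ennreal_mult[symmetric]) auto
  finally show ?thesis .
qed

lemma kstep_antimono:
  assumes "\<And>s t. s \<le> t \<Longrightarrow> h t \<le> h s" "s \<le> t"
  shows "kstep b h t \<le> kstep b h s"
  unfolding kstep_def
  by (intro nn_integral_mono mult_left_mono mult_mono) (use assms in \<open>auto simp: indicator_def\<close>)

lemma kstep_pow_one_antimono: "s \<le> t \<Longrightarrow> (kstep b ^^ k) (\<lambda>_. 1) t \<le> (kstep b ^^ k) (\<lambda>_. 1) s"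
  by (induction k arbitrary: s t) (auto intro!: kstep_antimono)

text \<open>A higher start survives with smaller probability, so starts above b are compared with b
  itself. The absolute value makes the bound valid for every start.\<close>

lemma kstep_pow_one_le_abs:
  assumes "1 \<le> k"
  shows "(kstep b ^^ k) (\<lambda>_. 1) s \<le> ennreal (110 / sqrt k) * ennreal (\<bar>b - s\<bar> + 3)"
proof (cases "s \<le> b")
  case True
  then have "ennreal (110 * (b - s + 3) / sqrt k) = ennreal (110 / sqrt k) * ennreal (\<bar>b - s\<bar> + 3)"
    by (subst ennreal_mult[symmetric]) auto
  then show ?thesis using kstep_pow_one_le[OF assms True] by simp
next
  case False
  then have "(kstep b ^^ k) (\<lambda>_. 1) s \<le> (kstep b ^^ k) (\<lambda>_. 1) b"
    by (intro kstep_pow_one_antimono) auto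
  also have "\<dots> \<le> ennreal (110 * (b - b + 3) / sqrt k)" by (rule kstep_pow_one_le[OF assms]) simp
  also have "\<dots> \<le> ennreal (110 / sqrt k * (\<bar>b - s\<bar> + 3))" 
  proof (rule ennreal_leI)
    have "110 * (b - b + 3) / sqrt k \<le> 110 * (\<bar>b - s\<bar> + 3) / sqrt k"
      by (intro divide_right_mono) auto
    then show "110 * (b - b + 3) / sqrt k \<le> 110 / sqrt k * (\<bar>b - s\<bar> + 3)" by simp
  qed
  also have "\<dots> = ennreal (110 / sqrt k) * ennreal (\<bar>b - s\<bar> + 3)"
    by (rule ennreal_mult) auto
  finally show ?thesis .
qed

lemma nn_integral_exp_below_linear_finite:
  assumes "0 < \<kappa>"
  shows "(\<integral>\<^sup>+s. indicator {..b} s * (exp_below \<kappa> b s * ennreal (b - s + 3)) \<partial>lborel) < \<infinity>"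
proof -
  \<comment> \<open>Half of the exponential absorbs the linear factor; K is the resulting
    constant.\<close>
  define K where "K = 3 + 2 / \<kappa>"
  have lin: "u + 3 \<le> K * exp (\<kappa> / 2 * u)" if "0 \<le> u" for u
  proof -
    have "\<kappa> / 2 * u \<le> exp (\<kappa> / 2 * u)" using exp_ge_add_one_self[of "\<kappa> / 2 * u"] by linarith
    then have "(2 / \<kappa>) * (\<kappa> / 2 * u) \<le> (2 / \<kappa>) * exp (\<kappa> / 2 * u)" using assms by (intro mult_left_mono) auto
    moreover have "(2 / \<kappa>) * (\<kappa> / 2 * u) = u" using assms by simp
    moreover have "1 \<le> exp (\<kappa> / 2 * u)" using that assms by simp
    moreover have "K * exp (\<kappa> / 2 * u) = 3 * exp (\<kappa> / 2 * u) + 2 / \<kappa> * exp (\<kappa> / 2 * u)"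
      by (simp add: K_def distrib_right)
    ultimately show ?thesis by linarith
  qed
  have "(\<integral>\<^sup>+s. indicator {..b} s * (exp_below \<kappa> b s * ennreal (b - s + 3)) \<partial>lborel) =
    (\<integral>\<^sup>+u. indicator {..b} (b - u) * (ennreal (exp (\<kappa> * (b - u - b))) * ennreal (b - (b - u) + 3)) \<partial>lborel)"
    by (subst nn_integral_real_affine[of _ "-1" b]) auto
  also have "\<dots> \<le> (\<integral>\<^sup>+u. ennreal (K * exp (- u * (\<kappa> / 2))) * indicator {0..} u \<partial>lborel)"
  proof (intro nn_integral_mono)
    fix u :: real
    show "indicator {..b} (b - u) * (ennreal (exp (\<kappa> * (b - u - b))) * ennreal (b - (b - u) + 3))
      \<le> ennreal (K * exp (- u * (\<kappa> / 2))) * indicator {0..} u"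
    proof (cases "0 \<le> u")
      case True
      have "exp (\<kappa> * (- u)) * (u + 3) \<le> exp (\<kappa> * (- u)) * (K * exp (\<kappa> / 2 * u))"
        using lin[OF True] by (intro mult_left_mono) auto
      also have "\<dots> = K * (exp (\<kappa> * (- u)) * exp (\<kappa> / 2 * u))" by (simp only: mult_ac)
      also have "exp (\<kappa> * (- u)) * exp (\<kappa> / 2 * u) = exp (- u * (\<kappa> / 2))"
      proof -
        have "\<kappa> * (- u) + \<kappa> / 2 * u = - u * (\<kappa> / 2)" by (simp add: field_simps)
        then show ?thesis by (simp only: exp_add[symmetric])
      qed
      finally have "ennreal (exp (\<kappa> * (- u)) * (u + 3)) \<le> ennreal (K * exp (- u * (\<kappa> / 2)))"
        by (rule ennreal_leI)
      moreover have "ennreal (exp (\<kappa> * (- u)) * (u + 3)) = ennreal (exp (\<kappa> * (- u))) * ennreal (u + 3)"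
        using True by (intro ennreal_mult) auto
      moreover have "\<kappa> * (b - u - b) = \<kappa> * (- u)" "b - (b - u) + 3 = u + 3" by simp_all
      ultimately show ?thesis using True by (simp del: ennreal_plus)
    qed auto
  qed
  also have "\<dots> < \<infinity>"
  proof -
    have K: "0 \<le> K / (\<kappa> / 2)" using assms by (simp add: K_def)
    interpret e: prob_space "density lborel (exponential_density (\<kappa> / 2))"
      by (rule prob_space_exponential_density) (use assms in simp)
    have "(\<integral>\<^sup>+u. ennreal (K * exp (- u * (\<kappa> / 2))) * indicator {0..} u \<partial>lborel) =
      (\<integral>\<^sup>+u. ennreal (K / (\<kappa> / 2)) * ennreal (exponential_density (\<kappa> / 2) u) \<partial>lborel)"
      using K assms by (intro nn_integral_cong) (auto simp: exponential_density_def indicator_def ennreal_mult[symmetric])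
    also have "\<dots> = ennreal (K / (\<kappa> / 2)) * (\<integral>\<^sup>+u. ennreal (exponential_density (\<kappa> / 2) u) \<partial>lborel)"
      by (intro nn_integral_cmult) auto
    also have "(\<integral>\<^sup>+u. ennreal (exponential_density (\<kappa> / 2) u) \<partial>lborel) = 1"
      using e.emeasure_space_1 by (simp add: emeasure_density)
    finally show ?thesis by simp
  qed
  finally show ?thesis .
qed

text \<open>The three-halves decay of a killed walk that ends near the barrier. The j steps are cut
  into thirds, each giving a factor 1 / sqrt (j div 3): survival in the first, the sup bound on the
  Gaussian density in the middle, and, after time reversal, survival again in the last, where the
  exponential makes the integral over end points finite.\<close>

lemma kstep_pow_exp_below_le:
  assumes "0 < \<kappa>"
  obtains C where "0 \<le> C" "\<And>j s. 3 \<le> j \<Longrightarrow>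
    (kstep b ^^ j) (exp_below \<kappa> b) s \<le> ennreal (C / sqrt (real (j div 3)) ^ 3) * ennreal (\<bar>b - s\<bar> + 3)"
proof -
  define I where "I = (\<integral>\<^sup>+s. indicator {..b} s * (exp_below \<kappa> b s * ennreal (b - s + 3)) \<partial>lborel)"
  have I: "I < \<infinity>" unfolding I_def by (rule nn_integral_exp_below_linear_finite[OF assms])
  have "(kstep b ^^ j) (exp_below \<kappa> b) s \<le> ennreal (110 * (110 * enn2real I) / sqrt (real (j div 3)) ^ 3) * ennreal (\<bar>b - s\<bar> + 3)"
    if j: "3 \<le> j" for j s
  proof -
    define m where "m = j div 3"
    define m' where "m' = j - 2 * m"
    have m: "1 \<le> m" "m \<le> m'" "j = m + (m + m')" using j by (auto simp: m_def m'_def)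
    have inner: "(kstep b ^^ (m + m')) (exp_below \<kappa> b) t \<le> ennreal (110 * enn2real I / real m)" for t
    proof -
      have "(\<integral>\<^sup>+s. indicator {..b} s * (kstep b ^^ m') (exp_below \<kappa> b) s \<partial>lborel) =
          (\<integral>\<^sup>+s. indicator {..b} s * exp_below \<kappa> b s * (kstep b ^^ m') (\<lambda>_. 1) s \<partial>lborel)"
        using kstep_pow_symmetric[of "exp_below \<kappa> b" "\<lambda>_. 1" b m'] by simp
      also have "\<dots> \<le> (\<integral>\<^sup>+s. ennreal (110 / sqrt m) * (indicator {..b} s * (exp_below \<kappa> b s * ennreal (b - s + 3))) \<partial>lborel)"
      proof (intro nn_integral_mono)
        fix s
        show "indicator {..b} s * exp_below \<kappa> b s * (kstep b ^^ m') (\<lambda>_. 1) s \<le>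
          ennreal (110 / sqrt m) * (indicator {..b} s * (exp_below \<kappa> b s * ennreal (b - s + 3)))"
        proof (cases "s \<le> b")
          case True
          have "(kstep b ^^ m') (\<lambda>_. 1) s \<le> ennreal (110 * (b - s + 3) / sqrt m')"
            by (rule kstep_pow_one_le) (use m True in auto)
          also have "\<dots> \<le> ennreal (110 / sqrt m * (b - s + 3))"
          proof (rule ennreal_leI)
            have "110 * (b - s + 3) / sqrt m' \<le> 110 * (b - s + 3) / sqrt m"
              using m True by (intro divide_left_mono) auto
            then show "110 * (b - s + 3) / sqrt m' \<le> 110 / sqrt m * (b - s + 3)" by simp
          qed
          also have "\<dots> = ennreal (110 / sqrt m) * ennreal (b - s + 3)"
            using True by (intro ennreal_mult) auto
          finally have "exp_below \<kappa> b s * (kstep b ^^ m') (\<lambda>_. 1) s \<le>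
            exp_below \<kappa> b s * (ennreal (110 / sqrt m) * ennreal (b - s + 3))" by (rule mult_left_mono) simp
          then show ?thesis using True by (simp add: mult_ac)
        qed simp
      qed
      also have "\<dots> = ennreal (110 / sqrt m) * I"
        unfolding I_def by (rule nn_integral_cmult) auto
      also have "I = ennreal (enn2real I)" using I by simp
      finally have J: "(\<integral>\<^sup>+s. indicator {..b} s * (kstep b ^^ m') (exp_below \<kappa> b) s \<partial>lborel) \<le>
        ennreal (110 / sqrt m) * ennreal (enn2real I)" .
      have "(kstep b ^^ (m + m')) (exp_below \<kappa> b) t \<le>
          ennreal (1 / sqrt m) * (\<integral>\<^sup>+s. indicator {..b} s * (kstep b ^^ m') (exp_below \<kappa> b) s \<partial>lborel)"
        unfolding funpow_add comp_def by (rule kstep_pow_le_integral) (use m in auto)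
      also have "\<dots> \<le> ennreal (1 / sqrt m) * (ennreal (110 / sqrt m) * ennreal (enn2real I))"
        by (intro mult_left_mono J) simp
      also have "\<dots> = ennreal (110 * enn2real I / real m)"
        using m by (simp add: ennreal_mult[symmetric])
      finally show ?thesis .
    qed
    have "(kstep b ^^ j) (exp_below \<kappa> b) s = (kstep b ^^ m) ((kstep b ^^ (m + m')) (exp_below \<kappa> b)) s"
      by (subst m(3), subst funpow_add) simp
    also have "\<dots> \<le> (kstep b ^^ m) (\<lambda>_. ennreal (110 * enn2real I / real m)) s"
    proof -
      have "kchain (\<lambda>_. b) 0 m ((kstep b ^^ (m + m')) (exp_below \<kappa> b)) s \<le> kchain (\<lambda>_. b) 0 m (\<lambda>_. ennreal (110 * enn2real I / real m)) s"
        by (rule kchain_mono) (rule inner)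
      then show ?thesis by (simp add: kchain_const[of 0 m "\<lambda>_. b" b])
    qed
    also have "\<dots> = ennreal (110 * enn2real I / real m) * (kstep b ^^ m) (\<lambda>_. 1) s"
      using kchain_cmult[of "\<lambda>_. 1" "\<lambda>_. b" 0 m "ennreal (110 * enn2real I / real m)" s]
      by (simp add: kchain_const[of 0 m "\<lambda>_. b" b])
    also have "\<dots> \<le> ennreal (110 * enn2real I / real m) * (ennreal (110 / sqrt m) * ennreal (\<bar>b - s\<bar> + 3))"
      by (intro mult_left_mono kstep_pow_one_le_abs m) simp
    also have "\<dots> = ennreal (110 * (110 * enn2real I) / sqrt (real m) ^ 3) * ennreal (\<bar>b - s\<bar> + 3)"
    proof -
      have "sqrt (real m) ^ 3 = real m * sqrt m" by (simp add: power3_eq_cube)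
      then have "ennreal (110 * enn2real I / real m) * ennreal (110 / sqrt m) = ennreal (110 * (110 * enn2real I) / sqrt (real m) ^ 3)"
        by (subst ennreal_mult[symmetric]) (auto simp: mult_ac)
      then show ?thesis by (simp only: mult.assoc[symmetric])
    qed
    finally show ?thesis unfolding m_def .
  qed
  then show ?thesis by (intro that[of "110 * (110 * enn2real I)"]) auto
qed

lemma borel_measurable_cosh [measurable]: "(cosh :: real \<Rightarrow> real) \<in> borel_measurable borel"
  by (intro borel_measurable_continuous_onI continuous_intros)

text \<open>The hyperbolic cosine dominates linear functions and is an eigenfunction of the free
  Gaussian step with eigenvalue exp (1 / 2). It controls the distance from the barrier after a fixed
  number of steps.\<close>

lemma kstep_pow_cosh_le: "(kstep b ^^ k) (\<lambda>s. ennreal (cosh s)) s \<le> ennreal (exp (real k / 2) * cosh s)"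
proof (induction k arbitrary: s)
  case (Suc k)
  have one: "kstep b (\<lambda>s. ennreal (cosh s)) s \<le> ennreal (exp (1 / 2) * cosh s)" for s
  proof -
    have "kstep b (\<lambda>s. ennreal (cosh s)) s \<le> (\<integral>\<^sup>+n. ennreal (std_normal_density n * cosh (s + n)) \<partial>lborel)"
      unfolding kstep_def by (intro nn_integral_mono) (auto simp: indicator_def ennreal_mult)
    also have "\<dots> = (\<integral>\<^sup>+n. ennreal (exp s / 2) * ennreal (std_normal_density n * exp (1 * n)) +
        ennreal (exp (- s) / 2) * ennreal (std_normal_density n * exp (-1 * n)) \<partial>lborel)"
      by (intro nn_integral_cong)
         (simp add: cosh_field_def ennreal_mult[symmetric] ennreal_plus[symmetric] exp_add exp_minus exp_diff field_simps del: ennreal_plus)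
    also have "\<dots> = ennreal (exp s / 2) * ennreal (exp (1\<^sup>2 / 2)) + ennreal (exp (- s) / 2) * ennreal (exp ((-1)\<^sup>2 / 2))"
      by (subst nn_integral_add) (auto simp: nn_integral_cmult nn_integral_std_normal_exp[of 1, simplified] nn_integral_std_normal_exp[of "-1", simplified])
    also have "\<dots> = ennreal (exp (1 / 2) * cosh s)"
      by (simp add: cosh_field_def ennreal_mult[symmetric] ennreal_plus[symmetric] field_simps del: ennreal_plus)
    finally show ?thesis .
  qed
  have "(kstep b ^^ Suc k) (\<lambda>s. ennreal (cosh s)) s \<le> kstep b (\<lambda>s. ennreal (exp (real k / 2)) * ennreal (cosh s)) s"
    using Suc by (auto intro!: kstep_mono simp: ennreal_mult)
  also have "\<dots> = ennreal (exp (real k / 2)) * kstep b (\<lambda>s. ennreal (cosh s)) s"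
    by (rule kstep_cmult) simp
  also have "\<dots> \<le> ennreal (exp (real k / 2)) * ennreal (exp (1 / 2) * cosh s)"
    by (intro mult_left_mono one) simp
  also have "\<dots> = ennreal (exp (real (Suc k) / 2) * cosh s)"
  proof -
    have "exp (real k / 2) * exp (1 / 2) = exp (real (Suc k) / 2)"
      by (simp add: add_divide_distrib flip: exp_add)
    then have "exp (real k / 2) * (exp (1 / 2) * cosh s) = exp (real (Suc k) / 2) * cosh s"
      by (simp only: mult.assoc[symmetric])
    then show ?thesis by (subst ennreal_mult[symmetric]) auto
  qed
  finally show ?case .
qed simp

text \<open>The constant grows with a and \<open>lam\<close>, which is acceptable because the
  estimate is used only in the limit of large j with these fixed.\<close>

lemma kchain_exp_decay:
  assumes "0 < \<kappa>"
  obtains C where "0 \<le> C" "\<And>j. 3 \<le> j \<Longrightarrow>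
    kchain (barrier a l lam) 0 (a + j) (exp_below \<kappa> lam) 0 \<le> ennreal (C / sqrt (real (j div 3)) ^ 3)"
proof -
  obtain C where C: "0 \<le> C" "\<And>j s. 3 \<le> j \<Longrightarrow>
    (kstep lam ^^ j) (exp_below \<kappa> lam) s \<le> ennreal (C / sqrt (real (j div 3)) ^ 3) * ennreal (\<bar>lam - s\<bar> + 3)"
    using kstep_pow_exp_below_le[OF assms] by metis
  define K where "K = \<bar>lam\<bar> + 5"
  have "kchain (barrier a l lam) 0 (a + j) (exp_below \<kappa> lam) 0 \<le> ennreal (C * K * exp (real a / 2) / sqrt (real (j div 3)) ^ 3)"
    if j: "3 \<le> j" for j
  proof -
    let ?c = "C / sqrt (real (j div 3)) ^ 3"
    have c: "0 \<le> ?c" using C by simp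
    have lin: "\<bar>lam - s\<bar> + 3 \<le> K * cosh s" for s
    proof -
      have "2 * cosh s = exp s + exp (- s)" by (simp add: cosh_field_def)
      then have "\<bar>s\<bar> \<le> 2 * cosh s"
        using exp_ge_add_one_self[of s] exp_ge_add_one_self[of "-s"] exp_gt_zero[of s] exp_gt_zero[of "-s"]
        by linarith
      moreover have "\<bar>lam\<bar> + 3 \<le> (\<bar>lam\<bar> + 3) * cosh s" using cosh_real_ge_1[of s] mult_left_mono[of 1 "cosh s" "\<bar>lam\<bar> + 3"] by simp
      moreover have "K * cosh s = (\<bar>lam\<bar> + 3) * cosh s + 2 * cosh s" by (simp add: K_def algebra_simps)
      ultimately show ?thesis using abs_triangle_ineq4[of lam s] by linarith
    qed
    have "kchain (barrier a l lam) 0 (a + j) (exp_below \<kappa> lam) 0 =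
      kchain (barrier a l lam) 0 a ((kstep lam ^^ j) (exp_below \<kappa> lam)) 0"
      by (simp add: kchain_add kchain_barrier_after)
    also have "\<dots> \<le> kchain (barrier a l lam) 0 a (\<lambda>s. ennreal (?c * K) * ennreal (cosh s)) 0"
    proof (rule kchain_mono)
      fix s
      have "(kstep lam ^^ j) (exp_below \<kappa> lam) s \<le> ennreal ?c * ennreal (\<bar>lam - s\<bar> + 3)" by (rule C(2)[OF j])
      also have "\<dots> \<le> ennreal ?c * ennreal (K * cosh s)" using lin by (intro mult_left_mono ennreal_leI) auto
      also have "\<dots> = ennreal (?c * K) * ennreal (cosh s)"
      proof -
        have "0 \<le> K" by (simp add: K_def)
        then show ?thesis using c mult_nonneg_nonneg[OF c \<open>0 \<le> K\<close>]
          by (subst (1 2) ennreal_mult[symmetric]) (auto simp: mult.assoc)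
      qed
      finally show "(kstep lam ^^ j) (exp_below \<kappa> lam) s \<le> \<dots>" .
    qed
    also have "\<dots> = ennreal (?c * K) * (kstep l ^^ a) (\<lambda>s. ennreal (cosh s)) 0"
      by (subst kchain_cmult) (auto simp: kchain_barrier_before)
    also have "\<dots> \<le> ennreal (?c * K) * ennreal (exp (real a / 2) * cosh 0)"
      by (intro mult_left_mono kstep_pow_cosh_le) simp
    also have "\<dots> = ennreal (C * K * exp (real a / 2) / sqrt (real (j div 3)) ^ 3)"
      using c C(1) by (subst ennreal_mult[symmetric]) (auto simp: K_def)
    finally show ?thesis .
  qed
  moreover have "0 \<le> C * K * exp (real a / 2)" using C by (simp add: K_def)
  ultimately show ?thesis using that by blast
qed

lemma sum_inverse_le_ln: "1 \<le> T \<Longrightarrow> (\<Sum>k\<in>{1..T}. 1 / real k) \<le> 1 + ln (real T)"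
proof (induction T rule: dec_induct)
  case (step n)
  have "ln (real n / real (Suc n)) \<le> real n / real (Suc n) - 1"
    using step.hyps by (intro ln_le_minus_one) auto
  also have "\<dots> = - 1 / real (Suc n)" by (simp add: field_simps)
  also have "ln (real n / real (Suc n)) = ln (real n) - ln (real (Suc n))"
    using step.hyps by (simp add: ln_div)
  finally show ?case using step.IH by (simp add: atLeastAtMostSuc_conv)
qed simp

text \<open>For k \<le> T / 2 the weight T / (T + 1 - k) is at most 2, and the Green function bound
  gives twice its value. For k > T / 2 the three-halves decay leaves T * T powr (- 3/2) times a
  harmonic sum, which tends to 0. Only the threshold depends on the constant of the decay, not the
  final bound.\<close>

lemma weighted_green_eventually:
  fixes a :: nat and l lam :: real
  assumes "0 \<le> l"
  defines "G \<equiv> \<lambda>k. kchain (barrier a l lam) 0 k (exp_below (1/2) lam) 0"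
  shows "\<exists>T0. \<forall>T\<ge>T0. ennreal (real T) * (\<Sum>k\<in>{a<..T}. ennreal (1 / (real T + 1 - real k)) * G k) \<le>
    ennreal (3 * (green_const (1/2) * (500 * (1 + l) / sqrt (real a + 1))))"
proof -
  define B where "B = green_const (1/2) * (500 * (1 + l) / sqrt (real a + 1))"
  have B: "0 < B" unfolding B_def using green_const_pos[of "1/2"] assms by auto
  obtain C where C: "0 \<le> C" "\<And>j. 3 \<le> j \<Longrightarrow> G (a + j) \<le> ennreal (C / sqrt (real (j div 3)) ^ 3)"
    unfolding G_def using kchain_exp_decay[of "1/2" a l lam] by (metis half_gt_zero_iff zero_less_one)
  \<comment> \<open>The first entry ensures k - a \<ge> 12 and (k - a) div 3 \<ge> T / 24 for k > T
    / 2. The second bounds the late part, at most C * 5 * 120 divided by the fourth root of T, by B: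
    5 from 1 + ln T \<le> 5 * q and 120 from the cube of sqrt 24.\<close>
  define T0 where "T0 = max (4 * a + 24) (nat \<lceil>(C * 5 * 120 / B) ^ 4\<rceil>)"
  have "ennreal (real T) * (\<Sum>k\<in>{a<..T}. ennreal (1 / (real T + 1 - real k)) * G k) \<le> ennreal (3 * B)"
    if T: "T0 \<le> T" for T
  proof -
    have T1: "4 * a + 24 \<le> T" "(C * 5 * 120 / B) ^ 4 \<le> real T"
      using T by (auto simp: T0_def nat_ceiling_le_eq)
    let ?E = "{k \<in> {a<..T}. 2 * k \<le> T}" and ?F = "{k \<in> {a<..T}. T < 2 * k}"
    have early: "ennreal (real T) * (\<Sum>k\<in>?E. ennreal (1 / (real T + 1 - real k)) * G k) \<le> ennreal (2 * B)"
    proof -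
      have "ennreal (real T) * (\<Sum>k\<in>?E. ennreal (1 / (real T + 1 - real k)) * G k) =
        (\<Sum>k\<in>?E. ennreal (real T) * (ennreal (1 / (real T + 1 - real k)) * G k))"
        by (rule sum_distrib_left)
      also have "\<dots> \<le> (\<Sum>k\<in>?E. ennreal 2 * G k)"
      proof (rule sum_mono)
        fix k assume k: "k \<in> ?E"
        then have "2 * real k \<le> real T" by auto
        then have "ennreal (real T * (1 / (real T + 1 - real k))) \<le> ennreal 2"
          by (intro ennreal_leI) (simp add: field_simps)
        moreover have "ennreal (real T * (1 / (real T + 1 - real k))) = ennreal (real T) * ennreal (1 / (real T + 1 - real k))"
          using k by (intro ennreal_mult) auto
        ultimately show "ennreal (real T) * (ennreal (1 / (real T + 1 - real k)) * G k) \<le> ennreal 2 * G k"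
          unfolding mult.assoc[symmetric] by (intro mult_right_mono) auto
      qed
      also have "\<dots> \<le> (\<Sum>k\<in>{a<..T}. ennreal 2 * G k)" by (rule sum_mono2) auto
      also have "\<dots> = ennreal 2 * (\<Sum>k\<in>{a<..T}. G k)" by (rule sum_distrib_left[symmetric])
      also have "(\<Sum>k\<in>{a<..T}. G k) = (\<Sum>m<T - a. G (a + Suc m))"
        by (rule sum.reindex_bij_witness[of _ "\<lambda>m. a + Suc m" "\<lambda>k. k - Suc a"]) auto
      also have "ennreal 2 * \<dots> \<le> ennreal 2 * ennreal B"
        unfolding G_def B_def by (intro mult_left_mono sum_kchain_exp_le) (use assms in auto)
      also have "ennreal 2 * ennreal B = ennreal (2 * B)" using B by (intro ennreal_mult[symmetric]) auto
      finally show ?thesis .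
    qed
    have late: "ennreal (real T) * (\<Sum>k\<in>?F. ennreal (1 / (real T + 1 - real k)) * G k) \<le> ennreal B"
    proof -
      define c where "c = C / sqrt (real T / 24) ^ 3"
      have c: "0 \<le> c" using C by (simp add: c_def)
      have "G k \<le> ennreal c" if k: "k \<in> ?F" for k
      proof -
        have "12 \<le> k - a" "real T / 24 \<le> real ((k - a) div 3)" using k T1(1) by (auto simp: field_simps) 
        then have "C / sqrt (real ((k - a) div 3)) ^ 3 \<le> c"
          unfolding c_def using T1 C by (intro divide_left_mono power_mono mult_pos_pos zero_less_power) auto
        then show ?thesis using C(2)[of "k - a"] k \<open>12 \<le> k - a\<close> by (auto intro: order_trans ennreal_leI)
      qed
      then have "ennreal (real T) * (\<Sum>k\<in>?F. ennreal (1 / (real T + 1 - real k)) * G k) \<le>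
        ennreal (real T) * (\<Sum>k\<in>?F. ennreal (1 / (real T + 1 - real k)) * ennreal c)"
        by (intro mult_left_mono sum_mono) auto
      also have "\<dots> \<le> ennreal (real T) * (\<Sum>k\<in>{1..T}. ennreal (1 / (real T + 1 - real k)) * ennreal c)"
        by (intro mult_left_mono sum_mono2) auto
      also have "\<dots> = ennreal (real T * (\<Sum>k\<in>{1..T}. 1 / (real T + 1 - real k) * c))"
      proof -
        have "(\<Sum>k\<in>{1..T}. ennreal (1 / (real T + 1 - real k)) * ennreal c) = (\<Sum>k\<in>{1..T}. ennreal (1 / (real T + 1 - real k) * c))"
          using c by (intro sum.cong refl ennreal_mult[symmetric]) auto
        also have "\<dots> = ennreal (\<Sum>k\<in>{1..T}. 1 / (real T + 1 - real k) * c)"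
          using c by (intro sum_ennreal) auto
        finally show ?thesis using c by (simp only: ennreal_mult[symmetric] sum_nonneg of_nat_0_le_iff ennreal_mult')
      qed
      also have "(\<Sum>k\<in>{1..T}. 1 / (real T + 1 - real k) * c) = (\<Sum>k\<in>{1..T}. 1 / real k) * c"
        unfolding sum_distrib_right
        by (rule sum.reindex_bij_witness[of _ "\<lambda>k. T + 1 - k" "\<lambda>k. T + 1 - k"]) (auto simp: of_nat_diff)
      also have "ennreal (real T * ((\<Sum>k\<in>{1..T}. 1 / real k) * c)) \<le> ennreal B"
      proof (rule ennreal_leI)
        define q where "q = sqrt (sqrt (real T))"
        have q2: "q\<^sup>2 = sqrt (real T)" by (simp add: q_def)
        have "q ^ 4 = (q\<^sup>2)\<^sup>2" by simp
        also have "\<dots> = real T" unfolding q2 by simp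
        finally have q: "1 \<le> q" "q ^ 4 = real T" "q\<^sup>2 = sqrt (real T)"
          using T1 q2 by (auto simp: q_def)
        have "ln (real T) = 4 * ln q" using q by (simp flip: q(2) add: ln_realpow)
        also have "\<dots> \<le> 4 * q" using ln_le_minus_one[of q] q by simp
        finally have "1 + ln (real T) \<le> 5 * q" using q by simp
        then have "(\<Sum>k\<in>{1..T}. 1 / real k) \<le> 5 * q" using sum_inverse_le_ln[of T] T1 by linarith
        then have "real T * ((\<Sum>k\<in>{1..T}. 1 / real k) * c) \<le> real T * (5 * q * c)"
          using c by (intro mult_left_mono mult_right_mono) auto
        also have "\<dots> \<le> C * 5 * 120 / q"
        proof -
          have "sqrt 24 \<le> (5::real)" by (intro real_le_lsqrt) auto
          then have s24: "sqrt 24 ^ 3 \<le> (120::real)" by (simp add: power3_eq_cube)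
          have "c = C * sqrt 24 ^ 3 / (q\<^sup>2) ^ 3"
            by (simp add: c_def q(3) real_sqrt_divide power_divide)
          then have "real T * (5 * q * c) = C * 5 * sqrt 24 ^ 3 / q"
            using q(1) unfolding q(2)[symmetric] by (simp add: field_simps eval_nat_numeral)
          also have "\<dots> \<le> C * 5 * 120 / q"
            using s24 q(1) C(1) by (intro divide_right_mono mult_left_mono) auto
          finally show ?thesis .
        qed
        also have "\<dots> \<le> B"
        proof -
          have "C * 5 * 120 / B \<le> q"
            by (rule power_le_imp_le_base[of _ 3]) (use T1(2) q in auto)
          then show ?thesis using q B by (simp add: field_simps)
        qed
        finally show "real T * ((\<Sum>k\<in>{1..T}. 1 / real k) * c) \<le> B" .
      qed
      finally show ?thesis .
    qed
    have "(\<Sum>k\<in>{a<..T}. ennreal (1 / (real T + 1 - real k)) * G k) =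
      (\<Sum>k\<in>?E. ennreal (1 / (real T + 1 - real k)) * G k) + (\<Sum>k\<in>?F. ennreal (1 / (real T + 1 - real k)) * G k)"
      by (subst sum.union_disjoint[symmetric]) (auto intro!: sum.cong)
    then have "ennreal (real T) * (\<Sum>k\<in>{a<..T}. ennreal (1 / (real T + 1 - real k)) * G k) \<le> ennreal (2 * B) + ennreal B"
      using early late by (simp add: distrib_left add_mono)
    also have "\<dots> = ennreal (3 * B)" using B by (subst ennreal_plus[symmetric]) auto
    finally show ?thesis .
  qed
  then show ?thesis unfolding B_def by blast
qed

lemma measurable_kchain_compose [measurable (raw)]:
  assumes "g \<in> borel_measurable borel" "h \<in> borel_measurable M"
  shows "(\<lambda>x. kchain f i m g (h x)) \<in> borel_measurable M"
  using measurable_compose[OF assms(2) measurable_kchain[OF assms(1)]] .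

lemma ennreal_mult_le_sum_squares: "a * b \<le> a * a + b * (b :: ennreal)"
proof (cases "a \<le> b")
  case True
  then have "a * b \<le> b * b" by (rule mult_right_mono) simp
  then show ?thesis by (simp add: add_increasing)
next
  case False
  then have "a * b \<le> a * a" by (intro mult_left_mono) auto
  then show ?thesis by (simp add: add_increasing2)
qed

section \<open>Joint measurability\<close>

definition grid_approx :: "nat \<Rightarrow> 'a::euclidean_space \<Rightarrow> 'a" where
  "grid_approx n x = (\<Sum>b\<in>Basis. (real_of_int \<lfloor>real (Suc n) * (x \<bullet> b)\<rfloor> / real (Suc n)) *\<^sub>R b)"

lemma grid_approx_inner: "b \<in> Basis \<Longrightarrow> grid_approx n x \<bullet> b = real_of_int \<lfloor>real (Suc n) * (x \<bullet> b)\<rfloor> / real (Suc n)"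
  by (simp add: grid_approx_def inner_sum_left inner_Basis if_distrib[of "\<lambda>u. _ * u"] sum.If_cases Int_def cong: if_cong)

lemma measurable_grid_approx [measurable]: "grid_approx n \<in> borel_measurable borel"
  unfolding grid_approx_def by measurable

lemma countable_range_grid_approx: "countable (range (grid_approx n :: 'a::euclidean_space \<Rightarrow> 'a))"
proof (rule countable_subset)
  let ?f = "\<lambda>v. \<Sum>b\<in>Basis. (real_of_int (v b) / real (Suc n)) *\<^sub>R (b :: 'a)"
  show "countable (?f ` (Basis \<rightarrow>\<^sub>E (UNIV :: int set)))"
    by (intro countable_image countable_PiE) auto
  show "range (grid_approx n) \<subseteq> ?f ` (Basis \<rightarrow>\<^sub>E (UNIV :: int set))"
  proof
    fix z :: 'a assume "z \<in> range (grid_approx n)"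
    then obtain x where x: "z = grid_approx n x" by auto
    then have "z = ?f (\<lambda>b\<in>Basis. \<lfloor>real (Suc n) * (x \<bullet> b)\<rfloor>)" by (simp add: grid_approx_def)
    then show "z \<in> ?f ` (Basis \<rightarrow>\<^sub>E (UNIV :: int set))"
      by (intro image_eqI[where x = "\<lambda>b\<in>Basis. \<lfloor>real (Suc n) * (x \<bullet> b)\<rfloor>"]) auto
  qed
qed

lemma tendsto_grid_approx: "(\<lambda>n. grid_approx n x) \<longlonglongrightarrow> x"
  unfolding tendsto_componentwise_iff[of _ x]
proof
  fix b :: 'a assume b: "b \<in> Basis"
  have "(\<lambda>n. grid_approx n x \<bullet> b - x \<bullet> b) \<longlonglongrightarrow> 0"
  proof (rule Lim_null_comparison)
    show "\<forall>\<^sub>F n in sequentially. norm (grid_approx n x \<bullet> b - x \<bullet> b) \<le> 1 / real (Suc n)"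
    proof (rule always_eventually, rule allI)
      fix n
      have "\<bar>real_of_int \<lfloor>real (Suc n) * (x \<bullet> b)\<rfloor> - real (Suc n) * (x \<bullet> b)\<bar> \<le> 1" by linarith
      then have "\<bar>real_of_int \<lfloor>real (Suc n) * (x \<bullet> b)\<rfloor> - real (Suc n) * (x \<bullet> b)\<bar> / real (Suc n) \<le> 1 / real (Suc n)"
        by (intro divide_right_mono) auto
      moreover have "\<bar>real_of_int \<lfloor>real (Suc n) * (x \<bullet> b)\<rfloor> - real (Suc n) * (x \<bullet> b)\<bar> / real (Suc n) =
          \<bar>real_of_int \<lfloor>real (Suc n) * (x \<bullet> b)\<rfloor> / real (Suc n) - x \<bullet> b\<bar>"
        by (subst abs_div_pos) (auto simp: diff_divide_distrib simp del: of_nat_Suc)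
      ultimately show "norm (grid_approx n x \<bullet> b - x \<bullet> b) \<le> 1 / real (Suc n)"
        using grid_approx_inner[OF b, of n x] by (simp del: of_nat_Suc)
    qed
    show "(\<lambda>n. 1 / real (Suc n)) \<longlonglongrightarrow> 0" using LIMSEQ_inverse_real_of_nat by (simp add: inverse_eq_divide)
  qed
  then show "(\<lambda>n. grid_approx n x \<bullet> b) \<longlonglongrightarrow> x \<bullet> b" by (rule Lim_transform[OF tendsto_const, of _ _ _ , rotated, simplified]) 
qed

text \<open>A function measurable in one variable and continuous in the other is jointly measurable:
  it is the limit of its compositions with \<open>grid_approx\<close>, which takes countably many
  values.\<close>

lemma measurable_pair_continuous:
  fixes f :: "'w \<Rightarrow> 'a::euclidean_space \<Rightarrow> real"
  assumes m: "\<And>x. (\<lambda>\<omega>. f \<omega> x) \<in> borel_measurable M" and c: "\<And>\<omega>. \<omega> \<in> space M \<Longrightarrow> continuous_on UNIV (f \<omega>)"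
  shows "(\<lambda>p. f (fst p) (snd p)) \<in> borel_measurable (M \<Otimes>\<^sub>M borel)"
proof (rule borel_measurable_LIMSEQ_real)
  fix p :: "'w \<times> 'a" assume "p \<in> space (M \<Otimes>\<^sub>M borel)"
  then have "isCont (f (fst p)) (snd p)"
    using c[of "fst p"] by (auto simp: space_pair_measure continuous_on_eq_continuous_at)
  then show "(\<lambda>n. f (fst p) (grid_approx n (snd p))) \<longlonglongrightarrow> f (fst p) (snd p)"
    by (rule isCont_tendsto_compose) (rule tendsto_grid_approx)
next
  fix n
  have "(\<lambda>p. grid_approx n (snd p)) \<in> measurable (M \<Otimes>\<^sub>M borel) (count_space (range (grid_approx n :: 'a \<Rightarrow> 'a)))"
    by (subst measurable_count_space_eq_countable[OF countable_range_grid_approx])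
       (auto intro!: measurable_sets measurable_compose[OF measurable_snd])
  then show "(\<lambda>p. f (fst p) (grid_approx n (snd p))) \<in> borel_measurable (M \<Otimes>\<^sub>M borel)"
    by (rule measurable_compose_countable'[where f = "\<lambda>z p. f (fst p) z", rotated])
       (auto intro: countable_range_grid_approx measurable_compose[OF measurable_fst m])
qed

context star_field
begin

lemma measurable_X_pair: "0 \<le> t \<Longrightarrow> (\<lambda>p. X t (fst p) (snd p)) \<in> borel_measurable (P \<Otimes>\<^sub>M borel)"
  by (rule measurable_pair_continuous) (auto intro: continuous_X)

lemma measurable_S_pair [measurable]: "(\<lambda>p. S k (snd p) (fst p)) \<in> borel_measurable (P \<Otimes>\<^sub>M borel)"
  using measurable_X_pair[of "real k"] unfolding S_def by measurable

lemma measurable_L_pair [measurable]: "(\<lambda>p. L k (snd p) (fst p)) \<in> borel_measurable (P \<Otimes>\<^sub>M borel)"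
  using measurable_X_pair[of "real k"] unfolding L_def by measurable

lemma measurable_stay_pair [measurable]: "(\<lambda>p. stay f k (snd p) (fst p)) \<in> borel_measurable (P \<Otimes>\<^sub>M borel)"
  unfolding stay_def by measurable

section \<open>Second moment of the truncated mass\<close>

text \<open>The value at scale \<open>k\<close> of a pair of points that decorrelate after scale \<open>k\<close>.\<close>

definition pair_weight :: "(nat \<Rightarrow> real) \<Rightarrow> nat \<Rightarrow> nat \<Rightarrow> real \<Rightarrow> ennreal" where
  "pair_weight f k T s = ennreal (exp (\<gamma> * s)) * (kchain f k (T - k) (\<lambda>_. 1) s * kchain f k (T - k) (\<lambda>_. 1) s)"

lemma measurable_pair_weight [measurable]: "pair_weight f k T \<in> borel_measurable borel"
  unfolding pair_weight_def by measurable

text \<open>In a square of L one factor serves as the tilt. The other becomes exp (dim * k), to be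
  cancelled by the volume of a ball of radius exp (- k), and a function of S.\<close>

lemma L_eq: "L k x \<omega> = ennreal (exp (dim * real k)) * ennreal (exp (\<gamma> * S k x \<omega>))"
proof -
  have "\<gamma> * X (real k) \<omega> x - dim * real k = dim * real k + \<gamma> * S k x \<omega>"
    using gamma_sq(2) by (simp add: S_def algebra_simps)
  then show ?thesis by (simp add: L_def exp_add ennreal_mult mult.commute[of dim])
qed

text \<open>After scale k the increments at each point are orthogonal to the field at the other, so
  both futures are integrated out in turn and leave survival probabilities depending on the values
  at time k. If k = T there is no future, hence the conditional hypothesis.\<close>

lemma two_point_le:
  assumes k: "k \<le> T" and far: "k < T \<Longrightarrow> corr_range \<le> exp (real k) * norm (x - y)"
  shows "(\<integral>\<^sup>+\<omega>. (L T x \<omega> * stay f T x \<omega>) * (L T y \<omega> * stay f T y \<omega>) \<partial>P) \<le>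
    2 * (ennreal (exp (dim * real k)) * kchain f 0 k (pair_weight f k T) 0)"
proof -
  let ?v = "kchain f k (T - k) (\<lambda>_. 1)"
  have farj: "corr_range \<le> exp (real j) * norm (x - y)" "corr_range \<le> exp (real j) * norm (y - x)" if "k \<le> j" "j < T" for j
  proof -
    have "exp (real k) * norm (x - y) \<le> exp (real j) * norm (x - y)"
      using that by (intro mult_right_mono) auto
    then show "corr_range \<le> exp (real j) * norm (x - y)" "corr_range \<le> exp (real j) * norm (y - x)"
      using far that by (auto simp: norm_minus_commute)
  qed
  define a where "a x = (\<lambda>\<omega>. L k x \<omega> * stay f k x \<omega> * ?v (S k x \<omega>))" for x
  have am [measurable]: "a x \<in> borel_measurable P" for x unfolding a_def by measurable
  have 1: "(\<integral>\<^sup>+\<omega>. (L T y \<omega> * stay f T y \<omega>) * (L (k + (T - k)) x \<omega> * stay f (k + (T - k)) x \<omega> * (\<lambda>_. 1) (S (k + (T - k)) x \<omega>)) \<partial>P) =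
    (\<integral>\<^sup>+\<omega>. (L T y \<omega> * stay f T y \<omega>) * (L k x \<omega> * stay f k x \<omega> * ?v (S k x \<omega>)) \<partial>P)"
  proof (rule nn_integral_path)
    fix j assume "k \<le> j" "j < k + (T - k)"
    then have f: "corr_range \<le> exp (real j) * norm (x - y)" using farj by auto
    have [measurable]: "L T y \<in> borel_measurable (orth (inc j (Suc j) x))" "stay f T y \<in> borel_measurable (orth (inc j (Suc j) x))"
      using measurable_far_orth[OF _ f, of "Suc j"] by auto
    show "(\<lambda>\<omega>. L T y \<omega> * stay f T y \<omega>) \<in> borel_measurable (orth (inc j (Suc j) x))" by measurable
  qed simp
  have 2: "(\<integral>\<^sup>+\<omega>. a x \<omega> * (L (k + (T - k)) y \<omega> * stay f (k + (T - k)) y \<omega> * (\<lambda>_. 1) (S (k + (T - k)) y \<omega>)) \<partial>P) =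
    (\<integral>\<^sup>+\<omega>. a x \<omega> * (L k y \<omega> * stay f k y \<omega> * ?v (S k y \<omega>)) \<partial>P)"
  proof (rule nn_integral_path)
    fix j assume j: "k \<le> j" "j < k + (T - k)"
    then have f: "corr_range \<le> exp (real j) * norm (y - x)" using farj by auto
    have [measurable]: "L k x \<in> borel_measurable (orth (inc j (Suc j) y))" "stay f k x \<in> borel_measurable (orth (inc j (Suc j) y))"
       "S k x \<in> borel_measurable (orth (inc j (Suc j) y))"
      using measurable_far_orth[OF _ f, of "Suc j"] by auto
    show "a x \<in> borel_measurable (orth (inc j (Suc j) y))" unfolding a_def by measurable
  qed simp
  have "(\<integral>\<^sup>+\<omega>. (L T x \<omega> * stay f T x \<omega>) * (L T y \<omega> * stay f T y \<omega>) \<partial>P) = (\<integral>\<^sup>+\<omega>. a x \<omega> * a y \<omega> \<partial>P)"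
    using 1 2 k by (simp add: a_def mult_ac)
  \<comment> \<open>Up to scale k the points are correlated. Bounding the product by the squares
    reduces to one-point expectations, at the cost of the factor 2.\<close>
  also have "\<dots> \<le> (\<integral>\<^sup>+\<omega>. a x \<omega> * a x \<omega> + a y \<omega> * a y \<omega> \<partial>P)"
    by (intro nn_integral_mono ennreal_mult_le_sum_squares)
  also have "\<dots> = (\<integral>\<^sup>+\<omega>. a x \<omega> * a x \<omega> \<partial>P) + (\<integral>\<^sup>+\<omega>. a y \<omega> * a y \<omega> \<partial>P)"
    by (rule nn_integral_add) auto
  also have "\<dots> = 2 * (ennreal (exp (dim * real k)) * kchain f 0 k (pair_weight f k T) 0)"
  proof -
    have "(\<integral>\<^sup>+\<omega>. a x \<omega> * a x \<omega> \<partial>P) = ennreal (exp (dim * real k)) * kchain f 0 k (pair_weight f k T) 0" for x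
    proof -
      have "(\<integral>\<^sup>+\<omega>. a x \<omega> * a x \<omega> \<partial>P) =
        (\<integral>\<^sup>+\<omega>. ennreal (exp (dim * real k)) * (L k x \<omega> * stay f k x \<omega> * pair_weight f k T (S k x \<omega>)) \<partial>P)"
      proof (intro nn_integral_cong)
        fix \<omega>
        have "stay f k x \<omega> * stay f k x \<omega> = stay f k x \<omega>" by (simp add: stay_eq)
        then show "a x \<omega> * a x \<omega> = ennreal (exp (dim * real k)) * (L k x \<omega> * stay f k x \<omega> * pair_weight f k T (S k x \<omega>))"
          unfolding a_def pair_weight_def by (subst (2) L_eq) (simp add: mult_ac, simp add: mult.assoc[symmetric])
      qed
      then show ?thesis by (simp add: nn_integral_cmult nn_integral_one_point)
    qed
    then show ?thesis by (simp add: mult_2)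
  qed
  finally show ?thesis .
qed

text \<open>The decorrelation scale depends on the pair. Summing over all scales with the indicator
  of the matching ball removes this dependence, so that the integral over y can be taken scale by
  scale.\<close>

lemma two_point_sum_le:
  assumes "a < T" "norm (x - y) \<le> B * exp (- real a)" "0 \<le> B"
  shows "(\<integral>\<^sup>+\<omega>. (L T x \<omega> * stay f T x \<omega>) * (L T y \<omega> * stay f T y \<omega>) \<partial>P) \<le>
    (\<Sum>k\<in>{a<..T}. indicator (cball x (exp 1 * max B corr_range * exp (- real k))) y *
      (2 * (ennreal (exp (dim * real k)) * kchain f 0 k (pair_weight f k T) 0)))"
    (is "?I \<le> (\<Sum>k\<in>_. ?w k)")
proof -
  let ?R = "exp 1 * max B corr_range"
  define Q where "Q = (\<lambda>k. a < k \<and> corr_range \<le> exp (real k) * norm (x - y))"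
  define k where "k = (if \<exists>j\<le>T. Q j then LEAST j. Q j else T)"
  have k: "a < k" "k \<le> T" "k < T \<Longrightarrow> corr_range \<le> exp (real k) * norm (x - y)"
    and kR: "norm (x - y) \<le> ?R * exp (- real k)"
  proof -
    \<comment> \<open>The distance is controlled by the failure of decorrelation one scale earlier,
      or by the diameter of the cube when k = a + 1. The factor \<open>exp 1\<close> pays for the
      shift by one scale.\<close>
    have *: "norm (x - y) \<le> ?R * exp (- real k)" if "a < k" "\<not> Q (k - 1)" for k
    proof (cases "k = Suc a")
      case True
      have "B * exp (- real a) = exp 1 * B * exp (- real k)"
        using True by (simp add: exp_add[symmetric] mult.commute mult.left_commute flip: mult.assoc)
      also have "\<dots> \<le> ?R * exp (- real k)" by (intro mult_right_mono mult_left_mono) auto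
      finally show ?thesis using assms by simp
    next
      case False
      then have "exp (real (k - 1)) * norm (x - y) < corr_range" using that by (auto simp: Q_def)
      then have "norm (x - y) < corr_range * exp (- real (k - 1))" by (simp add: exp_minus field_simps)
      also have "exp (- real (k - 1)) = exp 1 * exp (- real k)"
        using that by (simp add: of_nat_diff flip: exp_add)
      also have "corr_range * (exp 1 * exp (- real k)) \<le> ?R * exp (- real k)"
        by (simp add: mult_ac mult_left_mono)
      finally show ?thesis by simp
    qed
    have "a < k \<and> k \<le> T \<and> (k < T \<longrightarrow> corr_range \<le> exp (real k) * norm (x - y)) \<and> \<not> Q (k - 1)"
    proof (cases "\<exists>j\<le>T. Q j")
      case True
      then obtain j where j: "j \<le> T" "Q j" by auto
      have k': "k = (LEAST j. Q j)" using True by (simp add: k_def)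
      have "Q k" unfolding k' using j(2) by (rule LeastI)
      moreover have "k \<le> T" unfolding k' using Least_le[of Q j] j by simp
      moreover have "\<not> Q (k - 1)" using not_less_Least[of "k - 1" Q] \<open>Q k\<close> unfolding k'[symmetric] by (auto simp: Q_def)
      ultimately show ?thesis by (auto simp: Q_def)
    next
      case False
      then show ?thesis using assms by (auto simp: k_def)
    qed
    then show "a < k" "k \<le> T" "k < T \<Longrightarrow> corr_range \<le> exp (real k) * norm (x - y)" "norm (x - y) \<le> ?R * exp (- real k)"
      using * by auto
  qed
  have "?I \<le> 2 * (ennreal (exp (dim * real k)) * kchain f 0 k (pair_weight f k T) 0)"
    by (rule two_point_le[OF k(2,3)])
  also have "\<dots> = ?w k" using kR by (simp add: dist_norm)
  also have "\<dots> \<le> (\<Sum>k\<in>{a<..T}. ?w k)"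
    by (rule member_le_sum) (use k in auto)
  finally show ?thesis .
qed

text \<open>The square of the 160 in \<open>survival_le\<close>, and the 9 from squaring u + 3 \<le>
  3 * exp (u / 3).\<close>

definition second_const :: real where "second_const = 9 * 160\<^sup>2"

text \<open>Again m + 1 under the root admits m = 0, the pairs that separate at the last scale. The
  factor 160 exceeds 29/20 * 110.\<close>

lemma survival_le:
  assumes "s \<le> lam"
  shows "(kstep lam ^^ m) (\<lambda>_. 1) s \<le> ennreal (160 * (lam - s + 3) / sqrt (real m + 1))"
proof (cases "m = 0")
  case True
  have "ennreal 1 \<le> ennreal (160 * (lam - s + 3))" using assms by (intro ennreal_leI) simp
  then show ?thesis using True by simp
next
  case False
  have "110 * (lam - s + 3) / sqrt m \<le> 160 * (lam - s + 3) / sqrt (real m + 1)"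
  proof -
    have "sqrt (real m + 1) \<le> sqrt (2 * real m)" using False by (intro real_sqrt_le_mono) simp
    also have "\<dots> \<le> 29 / 20 * sqrt m"
      unfolding real_sqrt_mult by (intro mult_right_mono real_le_lsqrt) (auto simp: power2_eq_square)
    finally have "110 * sqrt (real m + 1) \<le> 160 * sqrt m" using real_sqrt_ge_zero[of "real m", OF of_nat_0_le_iff] by linarith
    then have "(lam - s + 3) * (110 * sqrt (real m + 1)) \<le> (lam - s + 3) * (160 * sqrt m)"
      using assms by (intro mult_left_mono) auto
    then show ?thesis using False by (simp add: field_simps)
  qed
  then show ?thesis using kstep_pow_one_le[of m s lam] False assms by (auto intro: order_trans ennreal_leI)
qed

text \<open>The two survival factors grow at most like exp (2/3 * (lam - s)), while exp (\<gamma> *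
  s) decays below \<open>lam\<close> at rate \<gamma> \<ge> sqrt 2 \<ge> 7/6 = 2/3 + 1/2. The
  remaining rate 1/2 is the one summed by the Green function.\<close>

lemma pair_weight_barrier_le:
  assumes "a \<le> k" "k \<le> T" "s \<le> lam"
  shows "pair_weight (barrier a l lam) k T s \<le>
    ennreal (second_const * exp (\<gamma> * lam) * (1 / (real T + 1 - real k))) * exp_below (1/2) lam s"
proof -
  let ?m = "T - k" and ?u = "lam - s"
  have m: "real ?m + 1 = real T + 1 - real k" using assms by (simp add: of_nat_diff)
  have "pair_weight (barrier a l lam) k T s \<le> ennreal (exp (\<gamma> * s)) *
    (ennreal (160 * (?u + 3) / sqrt (real ?m + 1)) * ennreal (160 * (?u + 3) / sqrt (real ?m + 1)))"
    unfolding pair_weight_def kchain_barrier_after[OF assms(1)]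
    by (intro mult_left_mono mult_mono survival_le assms) auto
  also have "\<dots> = ennreal (exp (\<gamma> * s) * (160 * (?u + 3) / sqrt (real ?m + 1) * (160 * (?u + 3) / sqrt (real ?m + 1))))"
    using assms by (subst ennreal_mult[symmetric], simp, simp, subst ennreal_mult[symmetric]) auto
  also have "\<dots> \<le> ennreal (second_const * exp (\<gamma> * lam) * (1 / (real T + 1 - real k)) * exp (1/2 * (s - lam)))"
  proof (rule ennreal_leI)
    have "?u + 3 \<le> 3 * exp (?u / 3)" using exp_ge_add_one_self[of "?u / 3"] by (simp add: field_simps)
    then have "(?u + 3) * (?u + 3) \<le> (3 * exp (?u / 3)) * (3 * exp (?u / 3))"
      using assms by (intro mult_mono) auto
    also have "\<dots> = 9 * exp (2 / 3 * ?u)" by (simp flip: exp_add)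
    finally have sq: "(?u + 3) * (?u + 3) \<le> 9 * exp (2 / 3 * ?u)" .
    have g: "7 / 6 \<le> \<gamma>"
    proof -
      have "7 / 6 \<le> sqrt (2::real)" by (rule real_le_rsqrt) (simp add: power2_eq_square)
      then show ?thesis using gamma_ge by linarith
    qed
    have "exp (\<gamma> * s) * (160 * (?u + 3) / sqrt (real ?m + 1) * (160 * (?u + 3) / sqrt (real ?m + 1))) =
      160\<^sup>2 / (real ?m + 1) * (exp (\<gamma> * s) * ((?u + 3) * (?u + 3)))"
      by (simp add: power2_eq_square) (simp add: algebra_simps)
    also have "\<dots> \<le> 160\<^sup>2 / (real ?m + 1) * (exp (\<gamma> * s) * (9 * exp (2 / 3 * ?u)))"
      by (intro mult_left_mono sq) auto
    also have "\<dots> = 160\<^sup>2 / (real ?m + 1) * 9 * exp (\<gamma> * s + 2 / 3 * ?u)" by (simp add: exp_add)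
    also have "\<dots> \<le> 160\<^sup>2 / (real ?m + 1) * 9 * exp (\<gamma> * lam + 1/2 * (s - lam))"
    proof -
      have "7 / 6 * ?u \<le> \<gamma> * ?u" using g assms by (intro mult_right_mono) auto
      moreover have "\<gamma> * lam + 1/2 * (s - lam) = \<gamma> * s + 2 / 3 * ?u + (\<gamma> * ?u - 7 / 6 * ?u)"
        by (simp add: field_simps)
      ultimately have "\<gamma> * s + 2 / 3 * ?u \<le> \<gamma> * lam + 1/2 * (s - lam)" by simp
      then show ?thesis by (intro mult_left_mono) auto
    qed
    also have "\<dots> = second_const * exp (\<gamma> * lam) * (1 / (real T + 1 - real k)) * exp (1/2 * (s - lam))"
      unfolding m exp_add by (simp add: second_const_def)
    finally show "exp (\<gamma> * s) * (160 * (?u + 3) / sqrt (real ?m + 1) * (160 * (?u + 3) / sqrt (real ?m + 1))) \<le> \<dots>" .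
  qed
  also have "\<dots> = ennreal (second_const * exp (\<gamma> * lam) * (1 / (real T + 1 - real k))) * exp_below (1/2) lam s"
    using assms by (intro ennreal_mult) (auto simp: second_const_def)
  finally show ?thesis .
qed

lemma kchain_pair_weight_le:
  assumes "a < k" "k \<le> T"
  shows "kchain (barrier a l lam) 0 k (pair_weight (barrier a l lam) k T) 0 \<le>
    ennreal (second_const * exp (\<gamma> * lam) * (1 / (real T + 1 - real k))) * kchain (barrier a l lam) 0 k (exp_below (1/2) lam) 0"
proof -
  \<comment> \<open>Exposes the last \<open>kstep\<close>. Its barrier is \<open>lam\<close> because
    k > a, so the bound on \<open>pair_weight\<close> is needed only at positions up to
    \<open>lam\<close>.\<close>
  obtain k' where k': "k = Suc k'" using assms by (cases k) auto
  let ?f = "barrier a l lam" and ?c = "ennreal (second_const * exp (\<gamma> * lam) * (1 / (real T + 1 - real k)))"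
  have f: "?f k = lam" using assms by (simp add: barrier_def)
  have "kchain ?f 0 k (pair_weight ?f k T) 0 \<le> kchain ?f 0 k (\<lambda>s. ?c * exp_below (1/2) lam s) 0"
    unfolding k' kchain.simps
    by (intro kchain_mono kstep_mono pair_weight_barrier_le) (use assms f k' in auto)
  also have "\<dots> = ?c * kchain ?f 0 k (exp_below (1/2) lam) 0" by (rule kchain_cmult) simp
  finally show ?thesis .
qed

definition trunc_mass :: "(nat \<Rightarrow> real) \<Rightarrow> nat \<Rightarrow> 'a set \<Rightarrow> 'w \<Rightarrow> ennreal" where
  "trunc_mass f T c \<omega> = (\<integral>\<^sup>+x. indicator c x * (L T x \<omega> * stay f T x \<omega>) \<partial>lborel)"

lemma measurable_L_lborel: "\<omega> \<in> space P \<Longrightarrow> (\<lambda>x. L k x \<omega>) \<in> borel_measurable borel"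
  and measurable_stay_lborel: "\<omega> \<in> space P \<Longrightarrow> (\<lambda>x. stay f k x \<omega>) \<in> borel_measurable borel"
  and measurable_S_lborel: "\<omega> \<in> space P \<Longrightarrow> (\<lambda>x. S k x \<omega>) \<in> borel_measurable borel"
  using measurable_Pair2[OF measurable_L_pair] measurable_Pair2[OF measurable_stay_pair]
    measurable_Pair2[OF measurable_S_pair] by auto

lemma measurable_trunc_mass [measurable]:
  assumes [measurable]: "c \<in> sets borel"
  shows "trunc_mass f T c \<in> borel_measurable P"
proof -
  have "(\<lambda>\<omega>. \<integral>\<^sup>+x. (\<lambda>p. indicator c (snd p) * (L T (snd p) (fst p) * stay f T (snd p) (fst p))) (\<omega>, x) \<partial>lborel) \<in> borel_measurable P"
    by (rule lborel.borel_measurable_nn_integral_fst) measurable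
  then show ?thesis unfolding trunc_mass_def[abs_def] by simp
qed

text \<open>The ball of radius R * exp (- k) has volume of order exp (- dim * k), which cancels the
  factor exp (dim * k) of the two-point bound. Each scale then contributes only an expectation for
  the walk.\<close>

lemma second_moment_le:
  fixes c :: "'a set"
  assumes "a < T" "0 \<le> B" and [measurable]: "c \<in> sets borel"
    and diam: "\<And>x y. x \<in> c \<Longrightarrow> y \<in> c \<Longrightarrow> norm (x - y) \<le> B * exp (- real a)"
  shows "(\<integral>\<^sup>+\<omega>. trunc_mass f T c \<omega> * trunc_mass f T c \<omega> \<partial>P) \<le>
    emeasure lborel c * (\<Sum>k\<in>{a<..T}. ennreal (2 * unit_ball_vol dim * (exp 1 * max B corr_range) ^ DIM('a)) *
      kchain f 0 k (pair_weight f k T) 0)"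
proof -
  let ?R = "exp 1 * max B corr_range"
  have R: "0 \<le> ?R" using corr_range_pos by simp
  let ?F = "\<lambda>x \<omega>. L T x \<omega> * stay f T x \<omega>"
  let ?q = "\<lambda>k. kchain f 0 k (pair_weight f k T) 0"
  interpret PL: pair_sigma_finite P lborel ..
  have [measurable]: "(\<lambda>p. ?F (snd p) (fst p)) \<in> borel_measurable (P \<Otimes>\<^sub>M borel)" by measurable
  have "(\<integral>\<^sup>+\<omega>. trunc_mass f T c \<omega> * trunc_mass f T c \<omega> \<partial>P) =
    (\<integral>\<^sup>+\<omega>. (\<integral>\<^sup>+x. indicator c x * (?F x \<omega> * trunc_mass f T c \<omega>) \<partial>lborel) \<partial>P)"
  proof (rule nn_integral_cong)
    fix \<omega> assume "\<omega> \<in> space P"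
    note [measurable] = measurable_L_lborel[OF this] measurable_stay_lborel[OF this]
    show "trunc_mass f T c \<omega> * trunc_mass f T c \<omega> = (\<integral>\<^sup>+x. indicator c x * (?F x \<omega> * trunc_mass f T c \<omega>) \<partial>lborel)"
      by (subst (1) trunc_mass_def) (subst nn_integral_multc[symmetric], auto simp: mult_ac)
  qed
  also have "\<dots> = (\<integral>\<^sup>+x. (\<integral>\<^sup>+\<omega>. indicator c x * (?F x \<omega> * trunc_mass f T c \<omega>) \<partial>P) \<partial>lborel)"
    by (rule PL.Fubini'[symmetric]) (unfold case_prod_beta, measurable)
  also have "\<dots> = (\<integral>\<^sup>+x. indicator c x * (\<integral>\<^sup>+\<omega>. (\<integral>\<^sup>+y. indicator c y * (?F x \<omega> * ?F y \<omega>) \<partial>lborel) \<partial>P) \<partial>lborel)"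
  proof (rule nn_integral_cong)
    fix x
    have "(\<integral>\<^sup>+\<omega>. indicator c x * (?F x \<omega> * trunc_mass f T c \<omega>) \<partial>P) = indicator c x * (\<integral>\<^sup>+\<omega>. ?F x \<omega> * trunc_mass f T c \<omega> \<partial>P)"
      by (rule nn_integral_cmult) auto
    also have "(\<integral>\<^sup>+\<omega>. ?F x \<omega> * trunc_mass f T c \<omega> \<partial>P) = (\<integral>\<^sup>+\<omega>. (\<integral>\<^sup>+y. indicator c y * (?F x \<omega> * ?F y \<omega>) \<partial>lborel) \<partial>P)"
    proof (rule nn_integral_cong)
      fix \<omega> assume "\<omega> \<in> space P"
      note [measurable] = measurable_L_lborel[OF this] measurable_stay_lborel[OF this]
      show "?F x \<omega> * trunc_mass f T c \<omega> = (\<integral>\<^sup>+y. indicator c y * (?F x \<omega> * ?F y \<omega>) \<partial>lborel)"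
        unfolding trunc_mass_def by (subst nn_integral_cmult[symmetric]) (auto simp: mult_ac)
    qed
    finally show "(\<integral>\<^sup>+\<omega>. indicator c x * (?F x \<omega> * trunc_mass f T c \<omega>) \<partial>P) =
      indicator c x * (\<integral>\<^sup>+\<omega>. (\<integral>\<^sup>+y. indicator c y * (?F x \<omega> * ?F y \<omega>) \<partial>lborel) \<partial>P)" .
  qed
  also have "\<dots> = (\<integral>\<^sup>+x. indicator c x * (\<integral>\<^sup>+y. indicator c y * (\<integral>\<^sup>+\<omega>. ?F x \<omega> * ?F y \<omega> \<partial>P) \<partial>lborel) \<partial>lborel)"
  proof (intro nn_integral_cong arg_cong2[where f = "(*)"] refl)
    fix x
    have "(\<integral>\<^sup>+\<omega>. (\<integral>\<^sup>+y. indicator c y * (?F x \<omega> * ?F y \<omega>) \<partial>lborel) \<partial>P) = (\<integral>\<^sup>+y. (\<integral>\<^sup>+\<omega>. indicator c y * (?F x \<omega> * ?F y \<omega>) \<partial>P) \<partial>lborel)"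
      by (rule PL.Fubini'[symmetric]) (unfold case_prod_beta, measurable)
    also have "\<dots> = (\<integral>\<^sup>+y. indicator c y * (\<integral>\<^sup>+\<omega>. ?F x \<omega> * ?F y \<omega> \<partial>P) \<partial>lborel)"
      by (intro nn_integral_cong nn_integral_cmult) auto
    finally show "(\<integral>\<^sup>+\<omega>. (\<integral>\<^sup>+y. indicator c y * (?F x \<omega> * ?F y \<omega>) \<partial>lborel) \<partial>P) = \<dots>" .
  qed
  also have "\<dots> \<le> (\<integral>\<^sup>+x. indicator c x * (\<Sum>k\<in>{a<..T}. ennreal (2 * unit_ball_vol dim * ?R ^ DIM('a)) * ?q k) \<partial>lborel)"
  proof (rule nn_integral_mono)
    fix x
    show "indicator c x * (\<integral>\<^sup>+y. indicator c y * (\<integral>\<^sup>+\<omega>. ?F x \<omega> * ?F y \<omega> \<partial>P) \<partial>lborel) \<le>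
      indicator c x * (\<Sum>k\<in>{a<..T}. ennreal (2 * unit_ball_vol dim * ?R ^ DIM('a)) * ?q k)"
    proof (cases "x \<in> c")
      case True
      have "(\<integral>\<^sup>+y. indicator c y * (\<integral>\<^sup>+\<omega>. ?F x \<omega> * ?F y \<omega> \<partial>P) \<partial>lborel) \<le>
        (\<integral>\<^sup>+y. (\<Sum>k\<in>{a<..T}. indicator (cball x (?R * exp (- real k))) y * (2 * (ennreal (exp (dim * real k)) * ?q k))) \<partial>lborel)"
        using two_point_sum_le[OF assms(1) diam[OF True] assms(2)]
        by (intro nn_integral_mono) (auto simp: indicator_def)
      also have "\<dots> = (\<Sum>k\<in>{a<..T}. emeasure lborel (cball x (?R * exp (- real k))) * (2 * (ennreal (exp (dim * real k)) * ?q k)))"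
      proof -
        have [measurable]: "cball z r \<in> sets borel" for z :: 'a and r by simp
        show ?thesis by (subst nn_integral_sum) (auto simp: nn_integral_multc)
      qed
      also have "\<dots> = (\<Sum>k\<in>{a<..T}. ennreal (2 * unit_ball_vol dim * ?R ^ DIM('a)) * ?q k)"
      proof (rule sum.cong[OF refl])
        fix k
        have "emeasure lborel (cball x (?R * exp (- real k))) = ennreal (unit_ball_vol dim * (?R * exp (- real k)) ^ DIM('a))"
          unfolding dim_def using R by (subst emeasure_cball) auto
        moreover have "ennreal (unit_ball_vol dim * (?R * exp (- real k)) ^ DIM('a)) * (2 * ennreal (exp (dim * real k))) =
          ennreal (2 * unit_ball_vol dim * ?R ^ DIM('a))"
        proof -
          have e: "exp (- real k) ^ DIM('a) * exp (dim * real k) = 1"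
            by (simp add: dim_def flip: exp_of_nat_mult exp_add)
          have u: "0 \<le> unit_ball_vol dim" by (simp add: dim_def)
          have "ennreal (unit_ball_vol dim * (?R * exp (- real k)) ^ DIM('a)) * (ennreal 2 * ennreal (exp (dim * real k))) =
            ennreal (unit_ball_vol dim * (?R * exp (- real k)) ^ DIM('a) * (2 * exp (dim * real k)))"
            using R u by (subst ennreal_mult[symmetric], simp, simp, subst ennreal_mult[symmetric]) auto
          also have "unit_ball_vol dim * (?R * exp (- real k)) ^ DIM('a) * (2 * exp (dim * real k)) =
            2 * unit_ball_vol dim * ?R ^ DIM('a) * (exp (- real k) ^ DIM('a) * exp (dim * real k))"
            by (simp only: power_mult_distrib mult_ac)
          finally show ?thesis unfolding e by simp
        qed
        ultimately show "emeasure lborel (cball x (?R * exp (- real k))) * (2 * (ennreal (exp (dim * real k)) * ?q k)) =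
          ennreal (2 * unit_ball_vol dim * ?R ^ DIM('a)) * ?q k"
          by (simp add: mult.assoc[symmetric])
      qed
      finally show ?thesis using True by simp
    qed simp
  qed
  also have "\<dots> = emeasure lborel c * (\<Sum>k\<in>{a<..T}. ennreal (2 * unit_ball_vol dim * ?R ^ DIM('a)) * ?q k)"
    by (subst nn_integral_multc) auto
  finally show ?thesis .
qed

definition second_moment_const :: "real \<Rightarrow> real" where
  "second_moment_const B = 2 * unit_ball_vol dim * (exp 1 * max B corr_range) ^ DIM('a) * second_const * (3 * green_const (1/2) * 500)"

lemma second_moment_const_nonneg: "0 \<le> B \<Longrightarrow> 0 \<le> second_moment_const B"
  unfolding second_moment_const_def dim_def second_const_def
  using green_const_pos[of "1/2"] by (intro mult_nonneg_nonneg zero_le_power) auto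

text \<open>The factor T is the square of the normalisation \<open>sqrt T\<close>. It meets the
  weights 1 / (T + 1 - k) from the two survival probabilities after scale k.\<close>

lemma second_moment_eventually:
  fixes c :: "'a set"
  assumes "0 \<le> B" "0 \<le> l" and [measurable]: "c \<in> sets borel"
    and diam: "\<And>x y. x \<in> c \<Longrightarrow> y \<in> c \<Longrightarrow> norm (x - y) \<le> B * exp (- real a)"
  shows "\<exists>T0. \<forall>T\<ge>T0. (\<integral>\<^sup>+\<omega>. ennreal (real T) * (trunc_mass (barrier a l lam) T c \<omega> * trunc_mass (barrier a l lam) T c \<omega>) \<partial>P) \<le>
    emeasure lborel c * ennreal (second_moment_const B * exp (\<gamma> * lam) * ((1 + l) / sqrt (real a + 1)))"
proof -
  let ?f = "barrier a l lam"
  let ?G = "\<lambda>k. kchain (barrier a l lam) 0 k (exp_below (1/2) lam) 0"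
  obtain T0 where T0: "\<And>T. T0 \<le> T \<Longrightarrow> ennreal (real T) * (\<Sum>k\<in>{a<..T}. ennreal (1 / (real T + 1 - real k)) * ?G k) \<le>
    ennreal (3 * (green_const (1/2) * (500 * (1 + l) / sqrt (real a + 1))))"
    using weighted_green_eventually[OF assms(2), of a lam] by blast
  define V where "V = 2 * unit_ball_vol dim * (exp 1 * max B corr_range) ^ DIM('a)"
  have V: "0 \<le> V" unfolding V_def dim_def using corr_range_pos by (intro mult_nonneg_nonneg zero_le_power) auto
  define K where "K = V * (second_const * exp (\<gamma> * lam))"
  have K: "0 \<le> K" using V by (simp add: K_def second_const_def)
  have "(\<integral>\<^sup>+\<omega>. ennreal (real T) * (trunc_mass ?f T c \<omega> * trunc_mass ?f T c \<omega>) \<partial>P) \<le>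
    emeasure lborel c * ennreal (second_moment_const B * exp (\<gamma> * lam) * ((1 + l) / sqrt (real a + 1)))"
    if T: "max T0 (Suc a) \<le> T" for T
  proof -
    have "(\<integral>\<^sup>+\<omega>. ennreal (real T) * (trunc_mass ?f T c \<omega> * trunc_mass ?f T c \<omega>) \<partial>P) =
      ennreal (real T) * (\<integral>\<^sup>+\<omega>. trunc_mass ?f T c \<omega> * trunc_mass ?f T c \<omega> \<partial>P)"
      by (rule nn_integral_cmult) measurable
    also have "\<dots> \<le> ennreal (real T) * (emeasure lborel c * (\<Sum>k\<in>{a<..T}. ennreal V * kchain ?f 0 k (pair_weight ?f k T) 0))"
      unfolding V_def using T by (intro mult_left_mono second_moment_le) (use assms in auto)
    also have "\<dots> \<le> ennreal (real T) * (emeasure lborel c * (\<Sum>k\<in>{a<..T}. ennreal K * (ennreal (1 / (real T + 1 - real k)) * ?G k)))"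
    proof (intro mult_left_mono sum_mono)
      fix k assume k: "k \<in> {a<..T}"
      have "ennreal V * kchain ?f 0 k (pair_weight ?f k T) 0 \<le>
        ennreal V * (ennreal (second_const * exp (\<gamma> * lam) * (1 / (real T + 1 - real k))) * ?G k)"
        using k by (intro mult_left_mono kchain_pair_weight_le) auto
      also have "ennreal V * (ennreal (second_const * exp (\<gamma> * lam) * (1 / (real T + 1 - real k))) * ?G k) =
         ennreal K * (ennreal (1 / (real T + 1 - real k)) * ?G k)"
      proof -
        have k': "0 \<le> 1 / (real T + 1 - real k)" "0 \<le> second_const * exp (\<gamma> * lam)" using k by (auto simp: second_const_def)
        have "ennreal (second_const * exp (\<gamma> * lam) * (1 / (real T + 1 - real k))) = ennreal (second_const * exp (\<gamma> * lam)) * ennreal (1 / (real T + 1 - real k))"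
          by (rule ennreal_mult[OF k'(2,1)])
        moreover have "ennreal K = ennreal V * ennreal (second_const * exp (\<gamma> * lam))"
          unfolding K_def by (rule ennreal_mult[OF V k'(2)])
        ultimately show ?thesis by (simp only: mult.assoc)
      qed
      finally show "ennreal V * kchain ?f 0 k (pair_weight ?f k T) 0 \<le> ennreal K * (ennreal (1 / (real T + 1 - real k)) * ?G k)" .
    qed auto
    also have "\<dots> = emeasure lborel c * (ennreal K * (ennreal (real T) * (\<Sum>k\<in>{a<..T}. ennreal (1 / (real T + 1 - real k)) * ?G k)))"
      by (simp only: sum_distrib_left[symmetric] mult_ac)
    also have "\<dots> \<le> emeasure lborel c * (ennreal K * ennreal (3 * (green_const (1/2) * (500 * (1 + l) / sqrt (real a + 1)))))"
      using T by (intro mult_left_mono T0) auto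
    also have "ennreal K * ennreal (3 * (green_const (1/2) * (500 * (1 + l) / sqrt (real a + 1)))) =
      ennreal (K * (3 * (green_const (1/2) * (500 * (1 + l) / sqrt (real a + 1)))))"
      using K green_const_pos[of "1/2"] assms by (intro ennreal_mult[symmetric]) auto
    also have "K * (3 * (green_const (1/2) * (500 * (1 + l) / sqrt (real a + 1)))) =
      second_moment_const B * exp (\<gamma> * lam) * ((1 + l) / sqrt (real a + 1))"
      by (simp add: K_def V_def second_moment_const_def)
    finally show ?thesis .
  qed
  then show ?thesis by blast
qed

end

section \<open>Chaining on dyadic cubes\<close>

text \<open>Half-open, so that the cells of a mesh partition the cube and each point has a unique
  cell.\<close>

definition hcube :: "'a::euclidean_space \<Rightarrow> real \<Rightarrow> 'a set" where
  "hcube p s = {x. \<forall>b\<in>Basis. p \<bullet> b \<le> x \<bullet> b \<and> x \<bullet> b < p \<bullet> b + s}"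

definition idx :: "nat \<Rightarrow> ('a::euclidean_space \<Rightarrow> nat) set" where
  "idx N = Basis \<rightarrow>\<^sub>E {..<N}"

definition vert :: "'a::euclidean_space \<Rightarrow> real \<Rightarrow> ('a \<Rightarrow> nat) \<Rightarrow> 'a" where
  "vert p s v = p + s *\<^sub>R (\<Sum>b\<in>Basis. real (v b) *\<^sub>R b)"

lemma vert_inner: "b \<in> Basis \<Longrightarrow> vert p s v \<bullet> b = p \<bullet> b + s * real (v b)"
  by (simp add: vert_def inner_add_left inner_sum_left inner_Basis if_distrib[of "\<lambda>u. _ * u"] sum.If_cases Int_def cong: if_cong)

lemma finite_idx [simp]: "finite (idx N)"
  by (simp add: idx_def finite_PiE)

lemma card_idx: "card (idx N :: ('a::euclidean_space \<Rightarrow> nat) set) = N ^ DIM('a)"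
  by (simp add: idx_def card_PiE)

lemma hcube_borel [measurable]: "hcube p s \<in> sets borel"
  unfolding hcube_def by measurable

lemma emeasure_hcube:
  fixes p :: "'a::euclidean_space"
  assumes "0 \<le> s"
  shows "emeasure lborel (hcube p s) = ennreal (s ^ DIM('a))"
proof (rule antisym)
  let ?q = "p + s *\<^sub>R (\<Sum>b\<in>Basis. b)"
  have q: "?q \<bullet> b = p \<bullet> b + s" if "b \<in> Basis" for b
    using that by (simp add: inner_add_left)
  have le: "p \<bullet> b \<le> ?q \<bullet> b" if "b \<in> Basis" for b using q[OF that] assms by simp
  have prod: "(\<Prod>b\<in>Basis. (?q - p) \<bullet> b) = s ^ DIM('a)"
    by simp
  have "emeasure lborel (hcube p s) \<le> emeasure lborel (cbox p ?q)"
    by (rule emeasure_mono) (auto simp: hcube_def mem_box q less_imp_le)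
  also have "\<dots> = ennreal (s ^ DIM('a))" using emeasure_lborel_cbox[of p ?q] le prod by simp
  finally show "emeasure lborel (hcube p s) \<le> ennreal (s ^ DIM('a))" .
  have "ennreal (s ^ DIM('a)) = emeasure lborel (box p ?q)" using emeasure_lborel_box[of p ?q] le prod by simp
  also have "\<dots> \<le> emeasure lborel (hcube p s)"
    by (rule emeasure_mono) (auto simp: hcube_def mem_box q less_imp_le)
  finally show "ennreal (s ^ DIM('a)) \<le> emeasure lborel (hcube p s)" .
qed

definition cell_of :: "'a::euclidean_space \<Rightarrow> real \<Rightarrow> nat \<Rightarrow> 'a \<Rightarrow> 'a \<Rightarrow> nat" where
  "cell_of p s N x = (\<lambda>b\<in>Basis. nat \<lfloor>(x \<bullet> b - p \<bullet> b) * real N / s\<rfloor>)"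

lemma rescale_less_iff: "0 < s \<Longrightarrow> 0 < N \<Longrightarrow> t * real N / s < real N \<longleftrightarrow> t < s"
  by (simp add: pos_divide_less_eq mult.commute)

lemma cell_of_bounds:
  assumes "x \<in> hcube p s" "0 < s" "0 < N" "b \<in> Basis"
  shows "real (cell_of p s N x b) \<le> (x \<bullet> b - p \<bullet> b) * real N / s"
    "(x \<bullet> b - p \<bullet> b) * real N / s < real (cell_of p s N x b) + 1" "cell_of p s N x b < N"
proof -
  have "0 \<le> x \<bullet> b - p \<bullet> b" "x \<bullet> b - p \<bullet> b < s" using assms by (auto simp: hcube_def)
  then have r: "0 \<le> (x \<bullet> b - p \<bullet> b) * real N / s" "(x \<bullet> b - p \<bullet> b) * real N / s < real N"
    using rescale_less_iff[OF assms(2,3)] assms by auto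
  have c: "real (cell_of p s N x b) = real_of_int \<lfloor>(x \<bullet> b - p \<bullet> b) * real N / s\<rfloor>"
    using r assms(4) by (simp add: cell_of_def)
  show "real (cell_of p s N x b) \<le> (x \<bullet> b - p \<bullet> b) * real N / s"
    "(x \<bullet> b - p \<bullet> b) * real N / s < real (cell_of p s N x b) + 1" unfolding c by linarith+
  then show "cell_of p s N x b < N" using r by linarith
qed

lemma cell_of_idx: "x \<in> hcube p s \<Longrightarrow> 0 < s \<Longrightarrow> 0 < N \<Longrightarrow> cell_of p s N x \<in> idx N"
  using cell_of_bounds(3)[of x p s N] by (auto simp: idx_def cell_of_def)

lemma mem_hcube_vert_iff:
  assumes "0 < s" "0 < N"
  shows "x \<in> hcube (vert p (s / real N) v) (s / real N) \<longleftrightarrow>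
    (\<forall>b\<in>Basis. real (v b) \<le> (x \<bullet> b - p \<bullet> b) * real N / s \<and> (x \<bullet> b - p \<bullet> b) * real N / s < real (v b) + 1)"
  unfolding hcube_def mem_Collect_eq using assms by (intro ball_cong refl) (simp add: vert_inner field_simps)

lemma mem_hcube_cell_of:
  "x \<in> hcube p s \<Longrightarrow> 0 < s \<Longrightarrow> 0 < N \<Longrightarrow> x \<in> hcube (vert p (s / real N) (cell_of p s N x)) (s / real N)"
  by (auto simp: mem_hcube_vert_iff cell_of_bounds)

lemma hcube_vert_subset:
  assumes "0 < s" "0 < N" "v \<in> idx N"
  shows "hcube (vert p (s / real N) v) (s / real N) \<subseteq> hcube p s"
proof
  fix x assume "x \<in> hcube (vert p (s / real N) v) (s / real N)"
  then have x: "real (v b) \<le> (x \<bullet> b - p \<bullet> b) * real N / s" "(x \<bullet> b - p \<bullet> b) * real N / s < real (v b) + 1" if "b \<in> Basis" for b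
    using that assms by (auto simp: mem_hcube_vert_iff)
  show "x \<in> hcube p s"
    unfolding hcube_def
  proof (intro CollectI ballI)
    fix b :: 'a assume b: "b \<in> Basis"
    have "v b < N" using assms b by (auto simp: idx_def)
    then have "(x \<bullet> b - p \<bullet> b) * real N / s < real N" using x(2)[OF b] by linarith
    moreover have "0 \<le> (x \<bullet> b - p \<bullet> b) * real N / s" using x(1)[OF b] by (rule order_trans[rotated]) simp
    ultimately have "x \<bullet> b - p \<bullet> b < s" "0 \<le> x \<bullet> b - p \<bullet> b"
      using rescale_less_iff[OF assms(1,2)] assms by (auto simp: zero_le_divide_iff zero_le_mult_iff)
    then show "p \<bullet> b \<le> x \<bullet> b \<and> x \<bullet> b < p \<bullet> b + s" by simp
  qed
qed

lemma cell_of_unique: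
  assumes "0 < s" "0 < N" "v \<in> idx N" "x \<in> hcube (vert p (s / real N) v) (s / real N)"
  shows "cell_of p s N x = v"
proof
  fix b
  show "cell_of p s N x b = v b"
  proof (cases "b \<in> Basis")
    case True
    then have "real (v b) \<le> (x \<bullet> b - p \<bullet> b) * real N / s" "(x \<bullet> b - p \<bullet> b) * real N / s < real (v b) + 1"
      using assms by (auto simp: mem_hcube_vert_iff)
    then have "\<lfloor>(x \<bullet> b - p \<bullet> b) * real N / s\<rfloor> = int (v b)" by (intro floor_unique) auto
    then show ?thesis using True by (simp add: cell_of_def)
  next
    case False
    then show ?thesis using assms(3) by (auto simp: idx_def cell_of_def PiE_def extensional_def)
  qed
qed

text \<open>Equality is claimed for the vertices and not for the index functions, which take an
  unspecified value outside \<open>Basis\<close>.\<close>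

lemma cell_of_double:
  assumes "x \<in> hcube p s" "0 < s" "0 < N"
  obtains e where "e \<in> idx 2" "vert p (s / real (2 * N)) (cell_of p s (2 * N) x) =
    vert p (s / real (2 * N)) (\<lambda>b. 2 * cell_of p s N x b + e b)"
proof
  let ?e = "\<lambda>b\<in>Basis. cell_of p s (2 * N) x b - 2 * cell_of p s N x b"
  have *: "2 * cell_of p s N x b \<le> cell_of p s (2 * N) x b \<and> cell_of p s (2 * N) x b < 2 * cell_of p s N x b + 2"
    if b: "b \<in> Basis" for b
  proof -
    define t where "t = (x \<bullet> b - p \<bullet> b) * real N / s"
    have t2: "(x \<bullet> b - p \<bullet> b) * real (2 * N) / s = 2 * t" by (simp add: t_def)
    have "real (cell_of p s N x b) \<le> t" "t < real (cell_of p s N x b) + 1"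
      unfolding t_def by (rule cell_of_bounds(1,2)[OF assms b])+
    then have "real (2 * cell_of p s N x b) \<le> (x \<bullet> b - p \<bullet> b) * real (2 * N) / s"
      "(x \<bullet> b - p \<bullet> b) * real (2 * N) / s < real (2 * cell_of p s N x b + 2)"
      unfolding t2 by simp_all
    moreover have "real (cell_of p s (2 * N) x b) \<le> (x \<bullet> b - p \<bullet> b) * real (2 * N) / s"
      "(x \<bullet> b - p \<bullet> b) * real (2 * N) / s < real (cell_of p s (2 * N) x b + 1)"
      using cell_of_bounds(1,2)[OF assms(1,2) _ b, of "2 * N"] assms(3) by auto
    ultimately have "real (2 * cell_of p s N x b) < real (cell_of p s (2 * N) x b + 1)"
      "real (cell_of p s (2 * N) x b) < real (2 * cell_of p s N x b + 2)" by linarith+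
    then show ?thesis unfolding of_nat_less_iff by auto
  qed
  show "?e \<in> idx 2" using * by (fastforce simp: idx_def)
  have "(\<Sum>b\<in>Basis. real (cell_of p s (2 * N) x b) *\<^sub>R b) = (\<Sum>b\<in>Basis. real (2 * cell_of p s N x b + ?e b) *\<^sub>R b)"
    by (rule sum.cong[OF refl]) (use * in \<open>simp del: of_nat_add\<close>)
  then show "vert p (s / real (2 * N)) (cell_of p s (2 * N) x) =
    vert p (s / real (2 * N)) (\<lambda>b. 2 * cell_of p s N x b + ?e b)" unfolding vert_def by simp
qed

lemma dist_vert_cell_of_le:
  fixes x :: "'a::euclidean_space"
  assumes "x \<in> hcube p s" "0 < s" "0 < N"
  shows "dist (vert p (s / real N) (cell_of p s N x)) x \<le> real DIM('a) * (s / real N)"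
proof -
  have "norm (vert p (s / real N) (cell_of p s N x) - x) \<le> (\<Sum>b\<in>Basis. \<bar>(vert p (s / real N) (cell_of p s N x) - x) \<bullet> b\<bar>)"
    by (rule norm_le_l1)
  also have "\<dots> \<le> (\<Sum>b\<in>(Basis :: 'a set). s / real N)"
  proof (rule sum_mono)
    fix b :: 'a assume b: "b \<in> Basis"
    have "vert p (s / real N) (cell_of p s N x) \<bullet> b \<le> x \<bullet> b \<and> x \<bullet> b < vert p (s / real N) (cell_of p s N x) \<bullet> b + s / real N"
      using mem_hcube_cell_of[OF assms] b by (auto simp: hcube_def)
    then show "\<bar>(vert p (s / real N) (cell_of p s N x) - x) \<bullet> b\<bar> \<le> s / real N" by (simp add: inner_diff_left)
  qed
  finally show ?thesis by (simp add: dist_norm)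
qed

text \<open>A Sobolev-type sum over dyadic increments; its finiteness yields Hoelder continuity of
  order \<open>1/8\<close> on the cube.\<close>

definition dyadic_energy :: "'a::euclidean_space \<Rightarrow> real \<Rightarrow> ('a \<Rightarrow> real) \<Rightarrow> ennreal" where
  "dyadic_energy p s f = (\<Sum>h. \<Sum>v\<in>idx (2 ^ h). \<Sum>e\<in>idx 2. ennreal (2 ^ (DIM('a) * h) *
     \<bar>f (vert p (s / 2 ^ h) v) - f (vert p (s / 2 ^ Suc h) (\<lambda>b. 2 * v b + e b))\<bar> ^ (8 * DIM('a))))"

text \<open>The ratio of Hoelder order 1/8 for one halving of the side: its power 8 * DIM is 2 to
  the power - DIM, the inverse of the weight of \<open>dyadic_energy\<close> per level.\<close>

definition chain_ratio :: real where "chain_ratio = root 8 (1 / 2)"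

lemma chain_ratio: "0 < chain_ratio" "chain_ratio < 1" "chain_ratio ^ 8 = 1 / 2"
proof -
  show "0 < chain_ratio" "chain_ratio ^ 8 = 1 / 2" by (simp_all add: chain_ratio_def)
  show "chain_ratio < 1" unfolding chain_ratio_def by (subst real_root_lt_1_iff) auto
qed

lemma dyadic_step_le:
  fixes f :: "'a::euclidean_space \<Rightarrow> real"
  assumes x: "x \<in> hcube p s" "0 < s" and fin: "dyadic_energy p s f = ennreal \<Theta>" "0 \<le> \<Theta>"
  shows "\<bar>f (vert p (s / 2 ^ h) (cell_of p s (2 ^ h) x)) - f (vert p (s / 2 ^ Suc h) (cell_of p s (2 ^ Suc h) x))\<bar> \<le>
    root (8 * DIM('a)) \<Theta> * chain_ratio ^ h" (is "?D \<le> _")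
proof -
  have D8: "0 < 8 * DIM('a)" by simp
  obtain e where e: "e \<in> idx 2" "vert p (s / real (2 * 2 ^ h)) (cell_of p s (2 * 2 ^ h) x) =
    vert p (s / real (2 * 2 ^ h)) (\<lambda>b. 2 * cell_of p s (2 ^ h) x b + e b)"
    by (rule cell_of_double[OF x, of "2 ^ h"]) auto
  let ?t = "\<lambda>v e. ennreal (2 ^ (DIM('a) * h) *
     \<bar>f (vert p (s / 2 ^ h) v) - f (vert p (s / 2 ^ Suc h) (\<lambda>b. 2 * v b + e b))\<bar> ^ (8 * DIM('a)))"
  have "ennreal (2 ^ (DIM('a) * h) * ?D ^ (8 * DIM('a))) = ?t (cell_of p s (2 ^ h) x) e"
    using e(2) by simp
  also have "\<dots> \<le> (\<Sum>e\<in>idx 2. ?t (cell_of p s (2 ^ h) x) e)" by (rule member_le_sum) (use e in auto)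
  also have "\<dots> \<le> (\<Sum>v\<in>idx (2 ^ h). \<Sum>e\<in>idx 2. ?t v e)"
    by (rule member_le_sum[where f = "\<lambda>v. \<Sum>e\<in>idx 2. ?t v e"]) (use cell_of_idx[OF x, of "2 ^ h"] in auto)
  also have "\<dots> \<le> dyadic_energy p s f"
    unfolding dyadic_energy_def using sum_le_suminf[of "\<lambda>h. \<Sum>v\<in>idx (2 ^ h). \<Sum>e\<in>idx 2. ennreal (2 ^ (DIM('a) * h) *
     \<bar>f (vert p (s / 2 ^ h) v) - f (vert p (s / 2 ^ Suc h) (\<lambda>b. 2 * v b + e b))\<bar> ^ (8 * DIM('a)))" "{h}"] by simp
  finally have "2 ^ (DIM('a) * h) * ?D ^ (8 * DIM('a)) \<le> \<Theta>" using fin by (simp add: ennreal_le_iff)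
  then have "?D ^ (8 * DIM('a)) \<le> \<Theta> * (1 / 2) ^ (DIM('a) * h)"
    by (simp add: power_divide field_simps)
  also have "(1 / 2 :: real) ^ (DIM('a) * h) = (chain_ratio ^ h) ^ (8 * DIM('a))"
    by (simp add: chain_ratio(3)[symmetric] power_mult[symmetric] mult_ac)
  also have "\<Theta> * (chain_ratio ^ h) ^ (8 * DIM('a)) = (root (8 * DIM('a)) \<Theta> * chain_ratio ^ h) ^ (8 * DIM('a))"
    using real_root_pow_pos2[OF D8 fin(2)] by (simp only: power_mult_distrib)
  finally show ?thesis
    using D8 fin chain_ratio by (subst (asm) power_mono_iff) (auto intro!: mult_nonneg_nonneg real_root_ge_zero)
qed

text \<open>The increments along the dyadic vertices leading to x form a geometric series;
  continuity identifies the limit.\<close>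

lemma dyadic_modulus:
  fixes f :: "'a::euclidean_space \<Rightarrow> real"
  assumes x: "x \<in> hcube p s" "0 < s" and fin: "dyadic_energy p s f = ennreal \<Theta>" "0 \<le> \<Theta>" and cont: "isCont f x"
  shows "\<bar>f (vert p (s / 2 ^ H) (cell_of p s (2 ^ H) x)) - f x\<bar> \<le>
    root (8 * DIM('a)) \<Theta> * chain_ratio ^ H / (1 - chain_ratio)"
proof -
  let ?z = "\<lambda>h. vert p (s / 2 ^ h) (cell_of p s (2 ^ h) x)"
  let ?\<theta> = "root (8 * DIM('a)) \<Theta>"
  have \<theta>: "0 \<le> ?\<theta>" using fin by (intro real_root_ge_zero)
  have r1: "0 < 1 - chain_ratio" using chain_ratio by simp
  have fin_step: "\<bar>f (?z H) - f (?z (H + m))\<bar> \<le> ?\<theta> * chain_ratio ^ H * (1 - chain_ratio ^ m) / (1 - chain_ratio)" for m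
  proof (induction m)
    case (Suc m)
    have "\<bar>f (?z H) - f (?z (H + Suc m))\<bar> \<le> \<bar>f (?z H) - f (?z (H + m))\<bar> + \<bar>f (?z (H + m)) - f (?z (Suc (H + m)))\<bar>"
      by simp
    also have "\<dots> \<le> ?\<theta> * chain_ratio ^ H * (1 - chain_ratio ^ m) / (1 - chain_ratio) + ?\<theta> * chain_ratio ^ (H + m)"
      by (intro add_mono Suc dyadic_step_le x fin)
    also have "\<dots> = ?\<theta> * chain_ratio ^ H * (1 - chain_ratio ^ Suc m) / (1 - chain_ratio)"
      using r1 by (simp add: field_simps power_add)
    finally show ?case .
  qed simp
  have zlim: "(\<lambda>m. ?z (H + m)) \<longlonglongrightarrow> x"
  proof -
    have "(\<lambda>h. dist (?z h) x) \<longlonglongrightarrow> 0"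
    proof (rule Lim_null_comparison)
      show "\<forall>\<^sub>F h in sequentially. norm (dist (?z h) x) \<le> real DIM('a) * s * (1/2) ^ h"
        using dist_vert_cell_of_le[OF x, of "2 ^ _"] by (intro always_eventually allI) (simp add: power_divide)
      show "(\<lambda>h. real DIM('a) * s * (1/2) ^ h) \<longlonglongrightarrow> 0"
        by (intro tendsto_mult_right_zero LIMSEQ_realpow_zero) auto
    qed
    then have "?z \<longlonglongrightarrow> x" by (rule tendsto_dist_iff[THEN iffD2])
    from LIMSEQ_ignore_initial_segment[OF this, of H] show ?thesis unfolding add.commute[of H] .
  qed
  have "(\<lambda>m. \<bar>f (?z H) - f (?z (H + m))\<bar>) \<longlonglongrightarrow> \<bar>f (?z H) - f x\<bar>"
    by (rule tendsto_rabs[OF tendsto_diff[OF tendsto_const isCont_tendsto_compose[OF cont zlim]]])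
  then show ?thesis
  proof (rule LIMSEQ_le_const2, intro exI allI impI)
    fix m
    have "?\<theta> * chain_ratio ^ H * (1 - chain_ratio ^ m) / (1 - chain_ratio) \<le> ?\<theta> * chain_ratio ^ H * 1 / (1 - chain_ratio)"
      using r1 \<theta> chain_ratio by (intro divide_right_mono mult_left_mono) auto
    then show "\<bar>f (?z H) - f (?z (H + m))\<bar> \<le> ?\<theta> * chain_ratio ^ H / (1 - chain_ratio)"
      using fin_step[of m] by simp
  qed
qed

text \<open>Comes from the minimal level H in \<open>cube_volume_le_dyadic_energy\<close>: the
  failed condition at level H - 1 gives the power of 2 / (1 - chain_ratio), and passing from H - 1
  to H costs 2 per coordinate.\<close>

definition chain_const :: "'a::euclidean_space itself \<Rightarrow> real" where
  "chain_const _ = 2 ^ DIM('a) * (2 / (1 - chain_ratio)) ^ (8 * DIM('a))"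

lemma chain_const_ge_1: "1 \<le> chain_const TYPE('a::euclidean_space)"
proof -
  have "1 \<le> 2 / (1 - chain_ratio)" using chain_ratio by (simp add: field_simps)
  then have "1 * 1 \<le> (2::real) ^ DIM('a) * (2 / (1 - chain_ratio)) ^ (8 * DIM('a))"
    by (intro mult_mono one_le_power) auto
  then show ?thesis by (simp add: chain_const_def)
qed

text \<open>On a dyadic cell around x small enough for the modulus of continuity, f stays above f x
  - 1. The largest such cell is smaller than the cube only by a factor in volume that is linear in
  the energy; this linearity makes the first moment of the energy sufficient later on.\<close>

lemma cube_volume_le_dyadic_energy:
  fixes f :: "'a::euclidean_space \<Rightarrow> real"
  assumes x: "x \<in> hcube p s" "0 < s" and cont: "continuous_on UNIV f"
  shows "ennreal (s ^ DIM('a)) \<le> ennreal (chain_const TYPE('a)) * (1 + dyadic_energy p s f) *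
    emeasure lborel {y \<in> hcube p s. f x - 1 \<le> f y}" (is "_ \<le> _ * emeasure lborel ?E")
proof -
  have contx: "isCont f y" for y using cont by (simp add: continuous_on_eq_continuous_at)
  have [measurable]: "f \<in> borel_measurable borel" using cont by (rule borel_measurable_continuous_onI)
  have Em: "?E \<in> sets borel" by measurable
  have vi: "cell_of p s (2 ^ H) x \<in> idx (2 ^ H)" for H by (rule cell_of_idx[OF x]) simp
  have subset: "hcube (vert p (s / real (2 ^ H)) (cell_of p s (2 ^ H) x)) (s / real (2 ^ H)) \<subseteq> hcube p s" for H
    by (rule hcube_vert_subset[OF x(2) _ vi]) simp
  have same: "y \<in> hcube p s" "cell_of p s (2 ^ H) y = cell_of p s (2 ^ H) x"
    if "y \<in> hcube (vert p (s / real (2 ^ H)) (cell_of p s (2 ^ H) x)) (s / real (2 ^ H))" for H y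
    using that subset by (auto intro: cell_of_unique[OF x(2) _ vi])
  have sub: "ennreal ((s / 2 ^ H) ^ DIM('a)) \<le> emeasure lborel ?E"
    if "\<And>y. y \<in> hcube (vert p (s / real (2 ^ H)) (cell_of p s (2 ^ H) x)) (s / real (2 ^ H)) \<Longrightarrow> f x - 1 \<le> f y" for H
  proof -
    have "ennreal ((s / 2 ^ H) ^ DIM('a)) = emeasure lborel (hcube (vert p (s / real (2 ^ H)) (cell_of p s (2 ^ H) x)) (s / real (2 ^ H)))"
      using x by (simp add: emeasure_hcube)
    also have "\<dots> \<le> emeasure lborel ?E"
      using that subset[of H] Em by (intro emeasure_mono) auto
    finally show ?thesis .
  qed
  show ?thesis
  proof (cases "dyadic_energy p s f")
    \<comment> \<open>With infinite energy it is enough that the volume is positive, and this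
      follows from plain continuity.\<close>
    case top
    obtain d where d: "d > 0" "\<And>y. dist y x < d \<Longrightarrow> dist (f y) (f x) < 1"
      using contx[of x] unfolding continuous_at_eps_delta by (metis zero_less_one)
    obtain H where H: "real DIM('a) * s * 2 * (1/2) ^ H < d"
    proof -
      have "(\<lambda>H. real DIM('a) * s * 2 * (1/2) ^ H) \<longlonglongrightarrow> 0"
        by (intro tendsto_mult_right_zero LIMSEQ_realpow_zero) auto
      then have "\<forall>\<^sub>F H in sequentially. real DIM('a) * s * 2 * (1/2) ^ H < d" using d(1) by (rule order_tendstoD)
      then show ?thesis using that by (auto dest: eventually_happens)
    qed
    have "f x - 1 \<le> f y" if y: "y \<in> hcube (vert p (s / real (2 ^ H)) (cell_of p s (2 ^ H) x)) (s / real (2 ^ H))" for y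
    proof -
      have yc: "y \<in> hcube p s" "cell_of p s (2 ^ H) y = cell_of p s (2 ^ H) x"
        using same[OF y] by auto
      have "dist y x \<le> dist (vert p (s / real (2 ^ H)) (cell_of p s (2 ^ H) x)) y + dist (vert p (s / real (2 ^ H)) (cell_of p s (2 ^ H) x)) x"
        by (rule dist_triangle3)
      also have "\<dots> \<le> real DIM('a) * (s / real (2 ^ H)) + real DIM('a) * (s / real (2 ^ H))"
        using dist_vert_cell_of_le[OF yc(1) x(2), of "2 ^ H"] dist_vert_cell_of_le[OF x, of "2 ^ H"] yc(2) by (intro add_mono) auto
      also have "\<dots> = real DIM('a) * s * 2 * (1/2) ^ H" by (simp add: power_divide)
      finally have "dist y x < d" using H by simp
      then show ?thesis using d(2)[of y] by (simp add: dist_real_def)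
    qed
    then have "0 < emeasure lborel ?E"
      using sub[of H] x by (auto intro: less_le_trans[rotated])
    then show ?thesis using top chain_const_ge_1[where 'a='a] by (auto simp: ennreal_mult_top ennreal_top_mult)
  next
    case (real \<Theta>)
    let ?\<theta> = "root (8 * DIM('a)) \<Theta>" and ?A = "2 / (1 - chain_ratio)"
    have A: "1 \<le> ?A" using chain_ratio by (simp add: field_simps)
    have \<theta>: "0 \<le> ?\<theta>" using real by (intro real_root_ge_zero)
    have osc: "f x - 1 \<le> f y" if H: "?A * ?\<theta> * chain_ratio ^ H \<le> 1"
      and y: "y \<in> hcube (vert p (s / real (2 ^ H)) (cell_of p s (2 ^ H) x)) (s / real (2 ^ H))" for H y
    proof -
      have yc: "y \<in> hcube p s" "cell_of p s (2 ^ H) y = cell_of p s (2 ^ H) x"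
        using same[OF y] by auto
      have "\<bar>f (vert p (s / 2 ^ H) (cell_of p s (2 ^ H) x)) - f x\<bar> \<le> ?\<theta> * chain_ratio ^ H / (1 - chain_ratio)"
        "\<bar>f (vert p (s / 2 ^ H) (cell_of p s (2 ^ H) x)) - f y\<bar> \<le> ?\<theta> * chain_ratio ^ H / (1 - chain_ratio)"
        using dyadic_modulus[OF x _ _ contx, of \<Theta> H] dyadic_modulus[OF yc(1) x(2) _ _ contx, of \<Theta> H] real yc(2) by auto
      moreover have "?A * ?\<theta> * chain_ratio ^ H = 2 * (?\<theta> * chain_ratio ^ H / (1 - chain_ratio))" by simp
      ultimately show ?thesis using H by linarith
    qed
    define H where "H = (LEAST H. ?A * ?\<theta> * chain_ratio ^ H \<le> 1)"
    have ex: "\<exists>H. ?A * ?\<theta> * chain_ratio ^ H \<le> 1"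
    proof -
      have "(\<lambda>H. ?A * ?\<theta> * chain_ratio ^ H) \<longlonglongrightarrow> 0"
        using chain_ratio by (intro tendsto_mult_right_zero LIMSEQ_realpow_zero) auto
      then have "\<forall>\<^sub>F H in sequentially. ?A * ?\<theta> * chain_ratio ^ H < 1" by (rule order_tendstoD) simp
      then show ?thesis by (auto dest!: eventually_happens intro: less_imp_le)
    qed
    have H: "?A * ?\<theta> * chain_ratio ^ H \<le> 1" unfolding H_def using ex by (rule LeastI_ex)
    have bound: "2 ^ (DIM('a) * H) \<le> chain_const TYPE('a) * (1 + \<Theta>)"
    proof (cases H)
      case 0
      then show ?thesis using chain_const_ge_1[where 'a='a] real mult_mono[of 1 "chain_const TYPE('a)" 1 "1 + \<Theta>"] by simp
    next
      case (Suc h)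
      then have "\<not> ?A * ?\<theta> * chain_ratio ^ h \<le> 1" using not_less_Least[of h "\<lambda>H. ?A * ?\<theta> * chain_ratio ^ H \<le> 1"] H_def by auto
      then have "1 \<le> (?A * ?\<theta> * chain_ratio ^ h) ^ (8 * DIM('a))" by (intro one_le_power) simp
      also have "\<dots> = ?A ^ (8 * DIM('a)) * \<Theta> * (chain_ratio ^ h) ^ (8 * DIM('a))"
        using real_root_pow_pos2[of "8 * DIM('a)" \<Theta>] real by (simp only: power_mult_distrib) simp
      also have "(chain_ratio ^ h) ^ (8 * DIM('a)) = (1 / 2) ^ (DIM('a) * h)"
        by (simp add: chain_ratio(3)[symmetric] power_mult[symmetric] mult_ac)
      finally have "1 \<le> ?A ^ (8 * DIM('a)) * \<Theta> * (1 / 2) ^ (DIM('a) * h)" .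
      moreover have "2 ^ k \<le> W" if "1 \<le> W * (1 / 2) ^ k" for W :: real and k
        using that by (simp add: power_divide field_simps)
      ultimately have "2 ^ (DIM('a) * h) \<le> ?A ^ (8 * DIM('a)) * \<Theta>" by blast
      then have "2 ^ DIM('a) * 2 ^ (DIM('a) * h) \<le> 2 ^ DIM('a) * (?A ^ (8 * DIM('a)) * \<Theta>)" by (intro mult_left_mono) auto
      also have "\<dots> \<le> chain_const TYPE('a) * (1 + \<Theta>)"
        using chain_const_ge_1[where 'a='a] by (simp add: chain_const_def distrib_left)
      finally show ?thesis by (simp add: Suc power_add)
    qed
    have "ennreal (s ^ DIM('a)) = ennreal (2 ^ (DIM('a) * H) * (s / 2 ^ H) ^ DIM('a))"
      by (simp add: power_divide power_mult[symmetric] mult.commute)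
    also have "\<dots> \<le> ennreal (chain_const TYPE('a) * (1 + \<Theta>) * (s / 2 ^ H) ^ DIM('a))"
      using bound x by (intro ennreal_leI mult_right_mono) auto
    also have "\<dots> = ennreal (chain_const TYPE('a)) * (1 + dyadic_energy p s f) * ennreal ((s / 2 ^ H) ^ DIM('a))"
      using real x chain_const_ge_1[where 'a='a] by (simp add: ennreal_mult)
    also have "\<dots> \<le> ennreal (chain_const TYPE('a)) * (1 + dyadic_energy p s f) * emeasure lborel ?E"
      by (intro mult_left_mono sub osc[OF H]) auto
    finally show ?thesis .
  qed
qed

section \<open>Layers under the exponential tilt\<close>

text \<open>The sum is at most W times the largest ratio of a term to its weight, and the power of
  the largest is at most the sum of the powers.\<close>

lemma sum_abs_power_le:
  fixes \<eta> w :: "'i \<Rightarrow> real"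
  assumes "finite I" "\<And>i. i \<in> I \<Longrightarrow> 0 < w i" "sum w I \<le> W" and that: "0 < p"
  shows "\<bar>\<Sum>i\<in>I. \<eta> i\<bar> ^ p \<le> W ^ p * (\<Sum>i\<in>I. (\<bar>\<eta> i\<bar> / w i) ^ p)"
proof (cases "I = {}")
  case True
  then show ?thesis using that by (simp add: power_0_left)
next
  case False
  define m where "m = Max ((\<lambda>i. \<bar>\<eta> i\<bar> / w i) ` I)"
  obtain j where j: "j \<in> I" "m = \<bar>\<eta> j\<bar> / w j"
  proof -
    have "m \<in> (\<lambda>i. \<bar>\<eta> i\<bar> / w i) ` I" unfolding m_def using assms False by (intro Max_in) auto
    then show ?thesis using that by (elim imageE)
  qed
  have m0: "0 \<le> m" using j assms by (auto simp: less_imp_le)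
  have le: "\<bar>\<eta> i\<bar> / w i \<le> m" if "i \<in> I" for i unfolding m_def using assms that by (intro Max_ge) auto
  have "\<bar>\<Sum>i\<in>I. \<eta> i\<bar> \<le> (\<Sum>i\<in>I. \<bar>\<eta> i\<bar>)" by (rule sum_abs)
  also have "\<dots> \<le> (\<Sum>i\<in>I. m * w i)"
    using le assms(2) by (intro sum_mono) (simp add: pos_divide_le_eq)
  also have "\<dots> = m * sum w I" by (simp add: sum_distrib_left)
  also have "\<dots> \<le> m * W" using assms m0 by (intro mult_left_mono) auto
  finally have "\<bar>\<Sum>i\<in>I. \<eta> i\<bar> ^ p \<le> (m * W) ^ p" by (intro power_mono) auto
  also have "\<dots> = W ^ p * (\<bar>\<eta> j\<bar> / w j) ^ p" by (simp only: j(2) power_mult_distrib mult.commute)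
  also have "\<dots> \<le> W ^ p * (\<Sum>i\<in>I. (\<bar>\<eta> i\<bar> / w i) ^ p)"
  proof (intro mult_left_mono)
    show "(\<bar>\<eta> j\<bar> / w j) ^ p \<le> (\<Sum>i\<in>I. (\<bar>\<eta> i\<bar> / w i) ^ p)"
      using assms j by (intro member_le_sum) (auto simp: less_imp_le)
    have "0 \<le> sum w I" using assms by (intro sum_nonneg) (auto simp: less_imp_le)
    then show "0 \<le> W ^ p" using assms by auto
  qed
  finally show ?thesis .
qed

definition abs_moment :: "nat \<Rightarrow> real" where
  "abs_moment q = (LINT n|lborel. std_normal_density n * \<bar>n\<bar> ^ q)"

lemma abs_moment_nonneg: "0 \<le> abs_moment q"
  by (simp add: abs_moment_def)

lemma nn_integral_abs_moment:
  "(\<integral>\<^sup>+n. ennreal (std_normal_density n * \<bar>n\<bar> ^ q) \<partial>lborel) = ennreal (abs_moment q)"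
  unfolding abs_moment_def by (rule nn_integral_eq_integral[OF integrable_std_normal_moment_abs]) auto

lemma (in gaussian_space) abs_moment_H_le:
  assumes Y: "Y \<in> H" and v: "var Y \<le> v"
  shows "(\<integral>\<^sup>+\<omega>. ennreal (\<bar>Y \<omega>\<bar> ^ (2 * q)) \<partial>M) \<le> ennreal (abs_moment (2 * q) * v ^ q)"
proof -
  have "(\<integral>\<^sup>+\<omega>. ennreal (\<bar>Y \<omega>\<bar> ^ (2 * q)) \<partial>M) = (\<integral>\<^sup>+n. ennreal (var Y ^ q) * ennreal (std_normal_density n * \<bar>n\<bar> ^ (2 * q)) \<partial>lborel)"
  proof -
    have "\<bar>sqrt (var Y) * n\<bar> ^ (2 * q) = var Y ^ q * \<bar>n\<bar> ^ (2 * q)" for n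
      using var_nonneg[of Y] by (simp add: power_mult power_mult_distrib)
    then show ?thesis
      using var_nonneg[of Y] by (subst law_H[OF Y]) (auto intro!: nn_integral_cong simp: ennreal_mult mult_ac)
  qed
  also have "\<dots> = ennreal (abs_moment (2 * q) * var Y ^ q)"
  proof -
    have "(\<integral>\<^sup>+n. ennreal (var Y ^ q) * ennreal (std_normal_density n * \<bar>n\<bar> ^ (2 * q)) \<partial>lborel) =
      ennreal (var Y ^ q) * ennreal (abs_moment (2 * q))"
      by (subst nn_integral_cmult, measurable) (simp only: nn_integral_abs_moment)
    then show ?thesis
      using var_nonneg[of Y] abs_moment_nonneg by (simp only: ennreal_mult' zero_le_power mult.commute)
  qed
  also have "\<dots> \<le> ennreal (abs_moment (2 * q) * v ^ q)"
    using v var_nonneg[of Y] abs_moment_nonneg by (intro ennreal_leI mult_left_mono power_mono)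
  finally show ?thesis .
qed

lemma mult_le_weighted_squares:
  fixes u v t :: real
  assumes "0 < t"
  shows "u * v \<le> u\<^sup>2 / t + t * v\<^sup>2"
proof -
  have "0 \<le> (u / t - v)\<^sup>2 * t" using assms by simp
  also have "\<dots> = u\<^sup>2 / t + t * v\<^sup>2 - 2 * (u * v)"
    using assms by (simp add: power2_eq_square field_simps)
  finally have "2 * (u * v) \<le> u\<^sup>2 / t + t * v\<^sup>2" by simp
  moreover have "0 \<le> u\<^sup>2 / t + t * v\<^sup>2" using assms by simp
  ultimately show ?thesis by linarith
qed

context star_field
begin

lemma measurable_past:
  assumes "\<And>j. j \<le> i \<Longrightarrow> (\<lambda>\<omega>. X (real j) \<omega> y) \<in> borel_measurable N"
  shows "S i y \<in> borel_measurable N" "L i y \<in> borel_measurable N" "stay f i y \<in> borel_measurable N"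
proof -
  have S: "S j y \<in> borel_measurable N" if "j \<le> i" for j
    using assms[OF that] unfolding S_def by measurable
  show "S i y \<in> borel_measurable N" by (rule S) simp
  show "L i y \<in> borel_measurable N" using assms[of i] unfolding L_def by measurable
  have "j \<le> i \<Longrightarrow> stay f j y \<in> borel_measurable N" for j
  proof (induction j)
    case 0
    have "stay f 0 y = (\<lambda>_. 1)" by (simp add: fun_eq_iff)
    then show ?case by simp
  next
    case (Suc j)
    then have [measurable]: "stay f j y \<in> borel_measurable N" "S (Suc j) y \<in> borel_measurable N"
      using S by auto
    show ?case unfolding stay_Suc by measurable
  qed
  then show "stay f i y \<in> borel_measurable N" by simp
qed

lemma X_orthogonal_inc_diff:
  assumes "j \<le> i" "i \<le> k"
  shows "(\<lambda>\<omega>. X (real j) \<omega> y) \<in> orthogonal_to (\<lambda>\<omega>. inc i k z \<omega> - inc i k z' \<omega>)"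
proof -
  have "(LINT \<omega>|P. (inc i k z \<omega> - inc i k z' \<omega>) * X (real j) \<omega> y) =
      (LINT \<omega>|P. inc i k z \<omega> * X (real j) \<omega> y) - (LINT \<omega>|P. inc i k z' \<omega> * X (real j) \<omega> y)"
    unfolding left_diff_distrib
    by (intro Bochner_Integration.integral_diff integrable_product_H inc_span X_span) auto
  also have "\<dots> = 0" using assms by (simp add: covariance_inc_X min_absorb2)
  finally show ?thesis by (simp add: orthogonal_to_def X_span)
qed

definition tilted :: "(nat \<Rightarrow> real) \<Rightarrow> nat \<Rightarrow> real \<Rightarrow> real \<Rightarrow> 'a \<Rightarrow> 'w \<Rightarrow> ennreal" where
  "tilted f i \<kappa> lam y \<omega> = L i y \<omega> * stay f i y \<omega> * ennreal (exp (\<kappa> * (S i y \<omega> - lam)))"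

text \<open>Here \<open>exp 1\<close> pays for the slack of 1 below the crossing level,
  \<open>abs_moment\<close> for the difference to be estimated, and the last term bounds the
  exponential moment of twice the increment in the same layer.\<close>

definition tilt_const :: "nat \<Rightarrow> real" where
  "tilt_const p = exp 1 * (abs_moment (2 * p) + exp (2 * (\<gamma> + 1)\<^sup>2))"

text \<open>Isolates layer i, whose increment at y is correlated with the difference estimated in
  \<open>tilted_moment_le\<close>, from the past and from the later layers.\<close>

lemma tilt_split:
  assumes i: "i < k"
  shows "L k y \<omega> * ennreal (exp (\<kappa> * (S k y \<omega> - lam))) =
    L i y \<omega> * ennreal (exp (\<kappa> * (S i y \<omega> - lam))) *
    ennreal (exp ((\<gamma> + \<kappa>) * inc i (Suc i) y \<omega> - (dim + \<kappa> * \<gamma>))) *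
    ennreal (exp ((\<gamma> + \<kappa>) * inc (Suc i) k y \<omega> - (dim + \<kappa> * \<gamma>) * real (k - Suc i)))"
proof -
  have k: "real k = real i + 1 + real (k - Suc i)" using i by (simp add: of_nat_diff)
  have "\<gamma> * X (real k) \<omega> y - dim * real k + \<kappa> * (S k y \<omega> - lam) =
    \<gamma> * X (real i) \<omega> y - dim * real i + \<kappa> * (S i y \<omega> - lam) +
    ((\<gamma> + \<kappa>) * inc i (Suc i) y \<omega> - (dim + \<kappa> * \<gamma>)) +
    ((\<gamma> + \<kappa>) * inc (Suc i) k y \<omega> - (dim + \<kappa> * \<gamma>) * real (k - Suc i))"
    unfolding S_def inc_def by (subst (2 3) k) (simp add: algebra_simps)
  then show ?thesis
    unfolding L_def by (simp add: ennreal_mult[symmetric] flip: exp_add)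
qed

text \<open>Moments of the difference in layer i, weighted by a near crossing at scale k. The
  indicator of the crossing is replaced by exp (\<kappa> * (S - lam)) and the barrier is dropped
  between i and k. The past, layer i and the later layers then become three independent blocks.
  Freeing the path for k - Suc i steps costs exp (\<kappa> ^ 2 / 2) each.\<close>

lemma tilted_moment_le:
  assumes \<kappa>: "0 \<le> \<kappa>" "\<kappa> \<le> 1" and i: "i < k" and v: "var (\<lambda>\<omega>. inc i (Suc i) z \<omega> - inc i (Suc i) z' \<omega>) \<le> v" "0 < v"
  shows "(\<integral>\<^sup>+\<omega>. ennreal (\<bar>inc i (Suc i) z \<omega> - inc i (Suc i) z' \<omega>\<bar> ^ (2 * p)) *
      (L k y \<omega> * stay f (k - 1) y \<omega> * indicator {lam - 1..} (S k y \<omega>)) \<partial>P) \<le>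
    ennreal (tilt_const (2 * p) * exp (\<kappa>\<^sup>2 * real (k - Suc i) / 2) * v ^ p) *
      kchain f 0 i (\<lambda>s. ennreal (exp (\<kappa> * (s - lam)))) 0"
proof -
  define \<eta> where "\<eta> = (\<lambda>\<omega>. inc i (Suc i) z \<omega> - inc i (Suc i) z' \<omega>)"
  define \<theta> where "\<theta> = \<gamma> + \<kappa>"
  define c where "c = dim + \<kappa> * \<gamma>"
  define m where "m = k - Suc i"
  define V where "V = v ^ p"
  let ?h = "tilted f i \<kappa> lam y"
  have V: "0 < V" using v by (simp add: V_def)
  have \<theta>0: "0 \<le> \<theta>" "\<theta> \<le> \<gamma> + 1" using \<kappa> gamma_ge by (auto simp: \<theta>_def)
  have \<theta>c: "\<theta>\<^sup>2 / 2 - c = \<kappa>\<^sup>2 / 2"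
    using gamma_sq by (simp add: \<theta>_def c_def power2_eq_square algebra_simps add_divide_distrib)
  have c0: "0 \<le> c" using dim_ge_1 gamma_ge \<kappa> by (simp add: c_def)
  have \<eta>H: "\<eta> \<in> field_span" unfolding \<eta>_def by (intro diff_H inc_span)
  have [measurable]: "\<eta> \<in> borel_measurable P" using measurable_H[OF \<eta>H] .
  have [measurable]: "inc a b x \<in> borel_measurable P" for a b x using measurable_H[OF inc_span] .
  have hP [measurable]: "?h \<in> borel_measurable P" unfolding tilted_def by measurable
  have h_inc: "?h \<in> borel_measurable (orth (inc i (Suc i) y))"
  proof -
    note [measurable] = measurable_past[OF measurable_X_orth[of _ i "Suc i" y y], of i, simplified]
    show ?thesis unfolding tilted_def by measurable
  qed
  have h_\<eta>: "?h \<in> borel_measurable (orth \<eta>)"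
  proof -
    have "(\<lambda>\<omega>. X (real j) \<omega> y) \<in> borel_measurable (orth \<eta>)" if "j \<le> i" for j
      unfolding \<eta>_def using that by (intro measurable_orthI X_orthogonal_inc_diff) auto
    note [measurable] = measurable_past[OF this, of i]
    show ?thesis unfolding tilted_def by measurable
  qed
  have g_inc: "(\<lambda>\<omega>. ?h \<omega> * ennreal (\<bar>\<eta> \<omega>\<bar> ^ (2 * p) * exp (\<theta> * inc i (Suc i) y \<omega> - c))) \<in> borel_measurable (orth (inc (Suc i) k y))"
  proof -
    have X: "(\<lambda>\<omega>. X (real j) \<omega> x) \<in> borel_measurable (orth (inc (Suc i) k y))" if "j \<le> Suc i" for j x
      using that i by (intro measurable_X_orth) auto
    note [measurable] = measurable_past[OF X, of i]
    have [measurable]: "inc i (Suc i) x \<in> borel_measurable (orth (inc (Suc i) k y))" for x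
      using X[of "Suc i" x] X[of i x] unfolding inc_def by measurable
    show ?thesis unfolding tilted_def \<eta>_def by measurable
  qed
  have inner: "(\<integral>\<^sup>+\<omega>. ?h \<omega> * ennreal (\<bar>\<eta> \<omega>\<bar> ^ (2 * p) * exp (\<theta> * inc i (Suc i) y \<omega> - c)) \<partial>P) \<le>
    ennreal ((abs_moment (2 * (2 * p)) + exp (2 * (\<gamma> + 1)\<^sup>2)) * V) * (\<integral>\<^sup>+\<omega>. ?h \<omega> \<partial>P)"
  proof -
    have "(\<integral>\<^sup>+\<omega>. ?h \<omega> * ennreal (\<bar>\<eta> \<omega>\<bar> ^ (2 * p) * exp (\<theta> * inc i (Suc i) y \<omega> - c)) \<partial>P) \<le>
      (\<integral>\<^sup>+\<omega>. ennreal (1 / V) * (?h \<omega> * ennreal (\<bar>\<eta> \<omega>\<bar> ^ (2 * (2 * p)))) + ennreal V * (?h \<omega> * ennreal (exp ((2 * \<theta>) * inc i (Suc i) y \<omega>))) \<partial>P)"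
    proof (rule nn_integral_mono)
      fix \<omega>
      have "\<bar>\<eta> \<omega>\<bar> ^ (2 * p) * exp (\<theta> * inc i (Suc i) y \<omega> - c) \<le> \<bar>\<eta> \<omega>\<bar> ^ (2 * p) * exp (\<theta> * inc i (Suc i) y \<omega>)"
        using c0 by (intro mult_left_mono) auto
      \<comment> \<open>The difference and the increment at y lie in the same layer and are
        correlated, so their product is split into squares. The weight V is the order of magnitude
        of the moment, which makes both terms of order V.\<close>
      also have "\<dots> \<le> (\<bar>\<eta> \<omega>\<bar> ^ (2 * p))\<^sup>2 / V + V * (exp (\<theta> * inc i (Suc i) y \<omega>))\<^sup>2"
        by (rule mult_le_weighted_squares[OF V])
      also have "\<dots> = (1 / V) * \<bar>\<eta> \<omega>\<bar> ^ (2 * (2 * p)) + V * exp ((2 * \<theta>) * inc i (Suc i) y \<omega>)"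
        by (simp add: power_mult[symmetric] mult_ac flip: exp_double)
      finally have "ennreal (\<bar>\<eta> \<omega>\<bar> ^ (2 * p) * exp (\<theta> * inc i (Suc i) y \<omega> - c)) \<le>
        ennreal (1 / V) * ennreal (\<bar>\<eta> \<omega>\<bar> ^ (2 * (2 * p))) + ennreal V * ennreal (exp ((2 * \<theta>) * inc i (Suc i) y \<omega>))"
        using V by (simp only: ennreal_mult[symmetric] ennreal_plus[symmetric] ennreal_leI divide_nonneg_nonneg less_imp_le mult_nonneg_nonneg zero_le_power abs_ge_zero exp_ge_zero zero_le_one)
      then have "?h \<omega> * ennreal (\<bar>\<eta> \<omega>\<bar> ^ (2 * p) * exp (\<theta> * inc i (Suc i) y \<omega> - c)) \<le>
        ?h \<omega> * (ennreal (1 / V) * ennreal (\<bar>\<eta> \<omega>\<bar> ^ (2 * (2 * p))) + ennreal V * ennreal (exp ((2 * \<theta>) * inc i (Suc i) y \<omega>)))"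
        by (rule mult_left_mono) simp
      then show "?h \<omega> * ennreal (\<bar>\<eta> \<omega>\<bar> ^ (2 * p) * exp (\<theta> * inc i (Suc i) y \<omega> - c)) \<le>
        ennreal (1 / V) * (?h \<omega> * ennreal (\<bar>\<eta> \<omega>\<bar> ^ (2 * (2 * p)))) + ennreal V * (?h \<omega> * ennreal (exp ((2 * \<theta>) * inc i (Suc i) y \<omega>)))"
        by (simp only: distrib_left mult_ac)
    qed
    also have "\<dots> = ennreal (1 / V) * ((\<integral>\<^sup>+\<omega>. ?h \<omega> \<partial>P) * (\<integral>\<^sup>+\<omega>. ennreal (\<bar>\<eta> \<omega>\<bar> ^ (2 * (2 * p))) \<partial>P)) +
       ennreal V * ((\<integral>\<^sup>+\<omega>. ?h \<omega> \<partial>P) * (\<integral>\<^sup>+\<omega>. ennreal (exp ((2 * \<theta>) * inc i (Suc i) y \<omega>)) \<partial>P))"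
      by (subst nn_integral_add, measurable, subst (1 2) nn_integral_cmult, measurable)
         (subst nn_integral_orth_mult[OF \<eta>H h_\<eta>, of "\<lambda>n. ennreal (\<bar>n\<bar> ^ (2 * (2 * p)))"], measurable,
          subst nn_integral_orth_mult[OF inc_span h_inc, of "\<lambda>n. ennreal (exp ((2 * \<theta>) * n))"], auto)
    also have "\<dots> \<le> ennreal (1 / V) * ((\<integral>\<^sup>+\<omega>. ?h \<omega> \<partial>P) * ennreal (abs_moment (2 * (2 * p)) * v ^ (2 * p))) +
       ennreal V * ((\<integral>\<^sup>+\<omega>. ?h \<omega> \<partial>P) * ennreal (exp (2 * (\<gamma> + 1)\<^sup>2)))"
    proof (intro add_mono mult_left_mono)
      show "(\<integral>\<^sup>+\<omega>. ennreal (\<bar>\<eta> \<omega>\<bar> ^ (2 * (2 * p))) \<partial>P) \<le> ennreal (abs_moment (2 * (2 * p)) * v ^ (2 * p))"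
        by (rule abs_moment_H_le[OF \<eta>H]) (use v in \<open>simp add: \<eta>_def\<close>)
      have "\<theta>\<^sup>2 \<le> (\<gamma> + 1)\<^sup>2" using \<theta>0 by (intro power_mono)
      then show "(\<integral>\<^sup>+\<omega>. ennreal (exp ((2 * \<theta>) * inc i (Suc i) y \<omega>)) \<partial>P) \<le> ennreal (exp (2 * (\<gamma> + 1)\<^sup>2))"
        by (subst exp_H[OF inc_span]) (auto simp: var_inc power_mult_distrib)
    qed auto
    also have "\<dots> = ennreal ((abs_moment (2 * (2 * p)) + exp (2 * (\<gamma> + 1)\<^sup>2)) * V) * (\<integral>\<^sup>+\<omega>. ?h \<omega> \<partial>P)"
    proof -
      have "ennreal (1 / V) * ennreal (abs_moment (2 * (2 * p)) * v ^ (2 * p)) = ennreal (abs_moment (2 * (2 * p)) * V)"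
      proof -
        have "v ^ (2 * p) = V * V" by (simp add: V_def power_add[symmetric] mult_2)
        then show ?thesis using V abs_moment_nonneg by (subst ennreal_mult[symmetric]) auto
      qed
      moreover have "ennreal V * ennreal (exp (2 * (\<gamma> + 1)\<^sup>2)) = ennreal (exp (2 * (\<gamma> + 1)\<^sup>2) * V)"
        using V by (subst ennreal_mult[symmetric]) (auto simp: mult.commute)
      moreover have "ennreal ((abs_moment (2 * (2 * p)) + exp (2 * (\<gamma> + 1)\<^sup>2)) * V) =
         ennreal (abs_moment (2 * (2 * p)) * V) + ennreal (exp (2 * (\<gamma> + 1)\<^sup>2) * V)"
        using V abs_moment_nonneg by (subst ennreal_plus[symmetric]) (auto simp: distrib_right)
      moreover have "b * (I * c) = (b * c) * I" for b c I :: ennreal by (simp add: mult_ac)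
      ultimately show ?thesis by (simp only: distrib_right)
    qed
    finally show ?thesis .
  qed
  have h_eq: "(\<integral>\<^sup>+\<omega>. ?h \<omega> \<partial>P) = kchain f 0 i (\<lambda>s. ennreal (exp (\<kappa> * (s - lam)))) 0"
    unfolding tilted_def by (rule nn_integral_one_point) simp
  have "(\<integral>\<^sup>+\<omega>. ennreal (\<bar>\<eta> \<omega>\<bar> ^ (2 * p)) * (L k y \<omega> * stay f (k - 1) y \<omega> * indicator {lam - 1..} (S k y \<omega>)) \<partial>P) \<le>
    (\<integral>\<^sup>+\<omega>. ennreal (exp \<kappa>) * ((?h \<omega> * ennreal (\<bar>\<eta> \<omega>\<bar> ^ (2 * p) * exp (\<theta> * inc i (Suc i) y \<omega> - c))) *
       ennreal (exp (\<theta> * inc (Suc i) k y \<omega> - c * real m))) \<partial>P)"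
  proof (rule nn_integral_mono)
    fix \<omega>
    have ind: "(indicator {lam - 1..} (S k y \<omega>) :: ennreal) \<le> ennreal (exp \<kappa>) * ennreal (exp (\<kappa> * (S k y \<omega> - lam)))"
    proof (cases "lam - 1 \<le> S k y \<omega>")
      case True
      then have "0 \<le> \<kappa> * (S k y \<omega> - lam + 1)" using \<kappa> by (intro mult_nonneg_nonneg) auto
      then have "1 \<le> exp \<kappa> * exp (\<kappa> * (S k y \<omega> - lam))"
        unfolding exp_add[symmetric] by (simp add: algebra_simps)
      then have "ennreal 1 \<le> ennreal (exp \<kappa> * exp (\<kappa> * (S k y \<omega> - lam)))" by (rule ennreal_leI)
      then show ?thesis using True by (simp add: ennreal_mult)
    qed simp
    have st: "stay f (k - 1) y \<omega> \<le> stay f i y \<omega>" using i by (intro stay_antimono) auto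
    have "L k y \<omega> * stay f (k - 1) y \<omega> * indicator {lam - 1..} (S k y \<omega>) \<le>
      L k y \<omega> * stay f i y \<omega> * (ennreal (exp \<kappa>) * ennreal (exp (\<kappa> * (S k y \<omega> - lam))))"
      by (intro mult_mono ind st) auto
    also have "\<dots> = ennreal (exp \<kappa>) * (stay f i y \<omega> * (L k y \<omega> * ennreal (exp (\<kappa> * (S k y \<omega> - lam)))))"
      by (simp only: mult_ac)
    also have "\<dots> = ennreal (exp \<kappa>) * (?h \<omega> * ennreal (exp (\<theta> * inc i (Suc i) y \<omega> - c)) * ennreal (exp (\<theta> * inc (Suc i) k y \<omega> - c * real m)))"
      unfolding tilt_split[OF i] tilted_def \<theta>_def c_def m_def by (simp only: mult_ac)
    finally have "ennreal (\<bar>\<eta> \<omega>\<bar> ^ (2 * p)) * (L k y \<omega> * stay f (k - 1) y \<omega> * indicator {lam - 1..} (S k y \<omega>)) \<le>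
      ennreal (\<bar>\<eta> \<omega>\<bar> ^ (2 * p)) * (ennreal (exp \<kappa>) * (?h \<omega> * ennreal (exp (\<theta> * inc i (Suc i) y \<omega> - c)) * ennreal (exp (\<theta> * inc (Suc i) k y \<omega> - c * real m))))"
      by (rule mult_left_mono) simp
    also have "\<dots> = ennreal (exp \<kappa>) * ((?h \<omega> * ennreal (\<bar>\<eta> \<omega>\<bar> ^ (2 * p) * exp (\<theta> * inc i (Suc i) y \<omega> - c))) *
       ennreal (exp (\<theta> * inc (Suc i) k y \<omega> - c * real m)))"
      by (simp add: ennreal_mult mult_ac)
    finally show "ennreal (\<bar>\<eta> \<omega>\<bar> ^ (2 * p)) * (L k y \<omega> * stay f (k - 1) y \<omega> * indicator {lam - 1..} (S k y \<omega>)) \<le> \<dots>" .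
  qed
  also have "\<dots> = ennreal (exp \<kappa>) * ((\<integral>\<^sup>+\<omega>. ?h \<omega> * ennreal (\<bar>\<eta> \<omega>\<bar> ^ (2 * p) * exp (\<theta> * inc i (Suc i) y \<omega> - c)) \<partial>P) *
       (\<integral>\<^sup>+\<omega>. ennreal (exp (\<theta> * inc (Suc i) k y \<omega> - c * real m)) \<partial>P))"
    by (subst nn_integral_cmult, measurable)
       (subst nn_integral_orth_mult[OF inc_span g_inc, of "\<lambda>n. ennreal (exp (\<theta> * n - c * real m))"], auto)
  also have "(\<integral>\<^sup>+\<omega>. ennreal (exp (\<theta> * inc (Suc i) k y \<omega> - c * real m)) \<partial>P) = ennreal (exp (\<kappa>\<^sup>2 * real m / 2))"
  proof -
    have "(\<integral>\<^sup>+\<omega>. ennreal (exp (\<theta> * inc (Suc i) k y \<omega> - c * real m)) \<partial>P) =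
      (\<integral>\<^sup>+\<omega>. ennreal (exp (- c * real m)) * ennreal (exp (\<theta> * inc (Suc i) k y \<omega>)) \<partial>P)"
      by (simp add: ennreal_mult[symmetric] flip: exp_add)
    also have "\<dots> = ennreal (exp (- c * real m)) * ennreal (exp (\<theta>\<^sup>2 * var (inc (Suc i) k y) / 2))"
      by (subst nn_integral_cmult) (auto simp: exp_H[OF inc_span])
    also have "\<dots> = ennreal (exp ((\<theta>\<^sup>2 / 2 - c) * real m))"
      using i by (simp add: ennreal_mult[symmetric] var_inc m_def of_nat_diff algebra_simps flip: exp_add)
    finally show ?thesis unfolding \<theta>c by (simp add: mult_ac)
  qed
  also have "ennreal (exp \<kappa>) * ((\<integral>\<^sup>+\<omega>. ?h \<omega> * ennreal (\<bar>\<eta> \<omega>\<bar> ^ (2 * p) * exp (\<theta> * inc i (Suc i) y \<omega> - c)) \<partial>P) * ennreal (exp (\<kappa>\<^sup>2 * real m / 2))) \<le>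
    ennreal (exp \<kappa>) * (ennreal ((abs_moment (2 * (2 * p)) + exp (2 * (\<gamma> + 1)\<^sup>2)) * V) *
      kchain f 0 i (\<lambda>s. ennreal (exp (\<kappa> * (s - lam)))) 0 * ennreal (exp (\<kappa>\<^sup>2 * real m / 2)))"
    using inner unfolding h_eq by (intro mult_left_mono mult_right_mono) auto
  also have "\<dots> \<le> ennreal (exp 1) * (ennreal ((abs_moment (2 * (2 * p)) + exp (2 * (\<gamma> + 1)\<^sup>2)) * V) *
      kchain f 0 i (\<lambda>s. ennreal (exp (\<kappa> * (s - lam)))) 0 * ennreal (exp (\<kappa>\<^sup>2 * real m / 2)))"
    using \<kappa> by (intro mult_right_mono ennreal_leI) auto
  also have "\<dots> = ennreal (tilt_const (2 * p) * exp (\<kappa>\<^sup>2 * real m / 2) * V) * kchain f 0 i (\<lambda>s. ennreal (exp (\<kappa> * (s - lam)))) 0"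
  proof -
    have n: "0 \<le> (abs_moment (2 * (2 * p)) + exp (2 * (\<gamma> + 1)\<^sup>2)) * V" using V abs_moment_nonneg by (intro mult_nonneg_nonneg add_nonneg_nonneg) auto
    have "ennreal (tilt_const (2 * p) * exp (\<kappa>\<^sup>2 * real m / 2) * V) =
      ennreal (exp 1 * (((abs_moment (2 * (2 * p)) + exp (2 * (\<gamma> + 1)\<^sup>2)) * V) * exp (\<kappa>\<^sup>2 * real m / 2)))"
      by (simp only: tilt_const_def mult_ac)
    also have "\<dots> = ennreal (exp 1) * (ennreal ((abs_moment (2 * (2 * p)) + exp (2 * (\<gamma> + 1)\<^sup>2)) * V) * ennreal (exp (\<kappa>\<^sup>2 * real m / 2)))"
      using n by (simp only: ennreal_mult mult_nonneg_nonneg exp_ge_zero)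
    finally show ?thesis by (simp only: mult_ac)
  qed
  finally show ?thesis unfolding \<eta>_def V_def m_def .
qed

text \<open>Layer i varies on the spatial scale exp (- Suc i), while the points are within
  \<open>dim * exp (- k)\<close> times (1/2) ^ h of each other; the linear modulus of \<rho> turns
  the ratio into a variance bound.\<close>

lemma var_dyadic_le:
  fixes p :: 'a and v :: "'a \<Rightarrow> nat" and h :: nat
  assumes "i < k" "0 < s" "s \<le> exp (- real k)" "e \<in> idx 2"
  defines "z \<equiv> vert p (s / 2 ^ h) v" and "z' \<equiv> vert p (s / 2 ^ Suc h) (\<lambda>b. 2 * v b + e b)"
  shows "var (\<lambda>\<omega>. inc i (Suc i) z \<omega> - inc i (Suc i) z' \<omega>) \<le> 2 * modulus * dim * exp (- real (k - Suc i)) * (1/2) ^ h"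
proof -
  have nz: "norm (z - z') \<le> dim * (s * (1/2) ^ h)"
  proof -
    have "norm (z - z') \<le> (\<Sum>b\<in>Basis. \<bar>(z - z') \<bullet> b\<bar>)" by (rule norm_le_l1)
    also have "\<dots> \<le> (\<Sum>b\<in>(Basis::'a set). s * (1/2) ^ h)"
    proof (rule sum_mono)
      fix b :: 'a assume b: "b \<in> Basis"
      then have e: "e b < 2" using assms(4) by (auto simp: idx_def)
      have "(z - z') \<bullet> b = - (s / 2 ^ Suc h * real (e b))"
        using b by (simp add: z_def z'_def inner_diff_left vert_inner field_simps)
      then have "\<bar>(z - z') \<bullet> b\<bar> = s / 2 ^ Suc h * real (e b)" using assms by simp
      also have "\<dots> \<le> s / 2 ^ Suc h * 2" using e assms by (intro mult_left_mono) auto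
      also have "\<dots> = s * (1/2) ^ h" by (simp add: power_divide)
      finally show "\<bar>(z - z') \<bullet> b\<bar> \<le> s * (1/2) ^ h" .
    qed
    finally show ?thesis by (simp add: dim_def)
  qed
  have "var (\<lambda>\<omega>. inc i (Suc i) z \<omega> - inc i (Suc i) z' \<omega>) \<le>
    2 * modulus * exp (real (Suc i)) * norm (z - z') * (real (Suc i) - real i)"
    by (rule var_inc_diff_le) simp
  also have "\<dots> = 2 * modulus * exp (real (Suc i)) * norm (z - z')" by simp
  also have "\<dots> \<le> 2 * modulus * exp (real (Suc i)) * (dim * (exp (- real k) * (1/2) ^ h))"
  proof (intro mult_left_mono)
    have "dim * (s * (1/2) ^ h) \<le> dim * (exp (- real k) * (1/2) ^ h)"
      using assms(3) dim_ge_1 by (intro mult_left_mono mult_right_mono) auto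
    then show "norm (z - z') \<le> dim * (exp (- real k) * (1/2) ^ h)" using nz by simp
  qed (use modulus_pos in auto)
  also have "\<dots> = 2 * modulus * dim * (exp (real (Suc i)) * exp (- real k)) * (1/2) ^ h" by simp
  also have "exp (real (Suc i)) * exp (- real k) = exp (- real (k - Suc i))"
    using assms(1) by (simp add: of_nat_diff flip: exp_add)
  finally show ?thesis .
qed

text \<open>Up to time \<open>a\<close> the barrier is \<open>l\<close> and not \<open>lam\<close>, so that \<open>exp_below\<close> is only under control with
  rate 0, as a survival probability.\<close>

definition weight_rate :: "nat \<Rightarrow> nat \<Rightarrow> real" where
  "weight_rate a i = (if i \<le> a then 0 else 1/2)"

definition weight :: "nat \<Rightarrow> real \<Rightarrow> real \<Rightarrow> nat \<Rightarrow> ennreal" where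
  "weight a l lam i = kchain (barrier a l lam) 0 i (exp_below (weight_rate a i) lam) 0"

text \<open>The tilted weight of paths that respect the barrier before k and come within 1 of
  \<open>lam\<close>, or above it, at time k. The slack 1 is the oscillation allowed in the volume
  comparison.\<close>

definition crossing :: "(nat \<Rightarrow> real) \<Rightarrow> nat \<Rightarrow> real \<Rightarrow> 'a \<Rightarrow> 'w \<Rightarrow> ennreal" where
  "crossing f k lam y \<omega> = L k y \<omega> * stay f (k - 1) y \<omega> * indicator {lam - 1..} (S k y \<omega>)"

lemma measurable_crossing [measurable]: "crossing f k lam y \<in> borel_measurable P"
  unfolding crossing_def by measurable

definition layer_sum :: "nat \<Rightarrow> real \<Rightarrow> real \<Rightarrow> nat \<Rightarrow> ennreal" where
  "layer_sum a l lam k = (\<Sum>i<k. ennreal (exp (- real (k - Suc i))) * weight a l lam i)"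

lemma crossing_le:
  assumes "1 \<le> k"
  shows "(\<integral>\<^sup>+\<omega>. crossing (barrier a l lam) k lam y \<omega> \<partial>P) \<le> ennreal (tilt_const 0) * layer_sum a l lam k"
proof -
  have \<kappa>: "0 \<le> weight_rate a (k - 1)" "weight_rate a (k - 1) \<le> 1" by (auto simp: weight_rate_def)
  have k: "Suc (k - 1) = k" using assms by simp
  \<comment> \<open>The zero difference at order p = 0 contributes 0 ^ 0 = 1, so the moment estimate
    specialises to the mass of \<open>crossing\<close>.\<close>
  have "var (\<lambda>\<omega>. inc (k - 1) (Suc (k - 1)) y \<omega> - inc (k - 1) (Suc (k - 1)) y \<omega>) \<le> 1"
    by (simp add: var_def)
  from tilted_moment_le[OF \<kappa> _ this, where k = k and p = 0 and f = "barrier a l lam" and y = y and lam = lam]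
  have "(\<integral>\<^sup>+\<omega>. crossing (barrier a l lam) k lam y \<omega> \<partial>P) \<le> ennreal (tilt_const 0) * weight a l lam (k - 1)"
    using assms by (simp add: crossing_def[abs_def] weight_def k)
  also have "ennreal (tilt_const 0) * weight a l lam (k - 1) \<le> ennreal (tilt_const 0) * layer_sum a l lam k"
  proof (rule mult_left_mono)
    show "weight a l lam (k - 1) \<le> layer_sum a l lam k"
      unfolding layer_sum_def
      using member_le_sum[of "k - 1" "{..<k}" "\<lambda>i. ennreal (exp (- real (k - Suc i))) * weight a l lam i"] assms by (simp add: k)
  qed simp
  finally show ?thesis .
qed

text \<open>Bounds the total of the weights exp (- m / 4), with m = k - Suc i, that distribute a
  difference over the layers. Their inverse to the power 8 * DIM is exp (2 * dim * m), less than the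
  gain exp (4 * dim * m) from the variances.\<close>

definition layer_weight :: real where "layer_weight = 1 / (1 - exp (- (1/4)))"

lemma layer_weight_pos: "0 < layer_weight"
  by (simp add: layer_weight_def)

lemma sum_exp_le:
  assumes "0 < c"
  shows "(\<Sum>i<k. exp (- c * real (k - Suc i))) \<le> 1 / (1 - exp (- c))"
proof -
  have "(\<Sum>i<k. exp (- c * real (k - Suc i))) = (\<Sum>m<k. exp (- c) ^ m)"
    by (rule sum.reindex_bij_witness[of _ "\<lambda>m. k - Suc m" "\<lambda>i. k - Suc i"]) (auto simp flip: exp_of_nat_mult simp: mult.commute)
  also have "\<dots> \<le> (\<Sum>m. exp (- c) ^ m)"
    using assms by (intro sum_le_suminf summable_geometric) auto
  also have "\<dots> = 1 / (1 - exp (- c))" using assms by (intro suminf_geometric) auto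
  finally show ?thesis .
qed

lemma layer_telescope: "X (real k) \<omega> z - X (real k) \<omega> z' = (X 0 \<omega> z - X 0 \<omega> z') + (\<Sum>i<k. inc i (Suc i) z \<omega> - inc i (Suc i) z' \<omega>)"
  by (induction k) (auto simp: inc_def)

definition pair_const :: real where
  "pair_const = layer_weight ^ (8 * DIM('a)) * (tilt_const (8 * DIM('a)) * (2 * modulus * dim) ^ (4 * DIM('a)))"

lemma tilt_const_nonneg: "0 \<le> tilt_const p"
  unfolding tilt_const_def using abs_moment_nonneg by (intro mult_nonneg_nonneg add_nonneg_nonneg) auto

lemma pair_const_nonneg: "0 \<le> pair_const"
  unfolding pair_const_def using layer_weight_pos tilt_const_nonneg modulus_pos dim_ge_1
  by (intro mult_nonneg_nonneg zero_le_power) auto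

text \<open>The field at time k is the sum of its layers, and layers far above the cell scale are
  almost constant on the cell. In layer i the exponents combine to at most - m, with m = k - Suc i:
  2 * dim * m from the weights, \<kappa> ^ 2 * m / 2 with \<kappa> \<le> 1/2 from the tilt, and - 4
  * dim * m from the variance.\<close>

lemma dyadic_pair_le:
  assumes "1 \<le> k" "0 < s" "s \<le> exp (- real k)" "e \<in> idx 2"
  shows "(\<integral>\<^sup>+\<omega>. ennreal (\<bar>X (real k) \<omega> (vert p (s / 2 ^ h) v) - X (real k) \<omega> (vert p (s / 2 ^ Suc h) (\<lambda>b. 2 * v b + e b))\<bar> ^ (8 * DIM('a))) *
      crossing (barrier a l lam) k lam y \<omega> \<partial>P) \<le>
    ennreal (pair_const * (1/2) ^ (4 * DIM('a) * h)) * layer_sum a l lam k"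
proof -
  define z where "z = vert p (s / 2 ^ h) v"
  define z' where "z' = vert p (s / 2 ^ Suc h) (\<lambda>b. 2 * v b + e b)"
  let ?f = "barrier a l lam" and ?p = "8 * DIM('a)"
  let ?\<eta> = "\<lambda>i \<omega>. inc i (Suc i) z \<omega> - inc i (Suc i) z' \<omega>"
  let ?w = "\<lambda>i. exp (- (1/4) * real (k - Suc i))"
  have [measurable]: "inc a b x \<in> borel_measurable P" for a b x using measurable_H[OF inc_span] .
  have W: "(\<Sum>i<k. ?w i) \<le> layer_weight" unfolding layer_weight_def by (rule sum_exp_le) simp
  have summand: "(\<integral>\<^sup>+\<omega>. ennreal ((\<bar>?\<eta> i \<omega>\<bar> / ?w i) ^ ?p) * crossing ?f k lam y \<omega> \<partial>P) \<le>
    ennreal (tilt_const ?p * (2 * modulus * dim) ^ (4 * DIM('a)) * (1/2) ^ (4 * DIM('a) * h)) *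
      (ennreal (exp (- real (k - Suc i))) * weight a l lam i)" if i: "i < k" for i
  proof -
    define m where "m = real (k - Suc i)"
    define v where "v = 2 * modulus * dim * exp (- m) * (1/2) ^ h"
    have v: "0 < v" using modulus_pos dim_ge_1 by (simp add: v_def)
    let ?\<kappa> = "weight_rate a i"
    have \<kappa>: "0 \<le> ?\<kappa>" "?\<kappa> \<le> 1" "?\<kappa>\<^sup>2 \<le> 1/4" by (auto simp: weight_rate_def power2_eq_square)
    have wp: "(1 / ?w i) ^ ?p = exp (2 * dim * m)"
    proof -
      have "1 / ?w i = exp (1/4 * m)" by (simp add: m_def exp_minus inverse_eq_divide)
      moreover have "exp (1/4 * m) ^ ?p = exp (real ?p * (1/4 * m))" by (rule exp_of_nat_mult[symmetric])
      ultimately show ?thesis by (simp add: dim_def)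
    qed
    have "(\<integral>\<^sup>+\<omega>. ennreal ((\<bar>?\<eta> i \<omega>\<bar> / ?w i) ^ ?p) * crossing ?f k lam y \<omega> \<partial>P) =
      (\<integral>\<^sup>+\<omega>. ennreal (exp (2 * dim * m)) * (ennreal (\<bar>?\<eta> i \<omega>\<bar> ^ (2 * (4 * DIM('a)))) * crossing ?f k lam y \<omega>) \<partial>P)"
    proof (rule nn_integral_cong)
      fix \<omega>
      have "(\<bar>?\<eta> i \<omega>\<bar> / ?w i) ^ ?p = exp (2 * dim * m) * \<bar>?\<eta> i \<omega>\<bar> ^ (2 * (4 * DIM('a)))"
        unfolding wp[symmetric] by (simp add: power_divide)
      then show "ennreal ((\<bar>?\<eta> i \<omega>\<bar> / ?w i) ^ ?p) * crossing ?f k lam y \<omega> =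
        ennreal (exp (2 * dim * m)) * (ennreal (\<bar>?\<eta> i \<omega>\<bar> ^ (2 * (4 * DIM('a)))) * crossing ?f k lam y \<omega>)"
        by (simp only: ennreal_mult exp_ge_zero zero_le_power abs_ge_zero mult.assoc)
    qed
    also have "\<dots> = ennreal (exp (2 * dim * m)) * (\<integral>\<^sup>+\<omega>. ennreal (\<bar>?\<eta> i \<omega>\<bar> ^ (2 * (4 * DIM('a)))) * crossing ?f k lam y \<omega> \<partial>P)"
      by (rule nn_integral_cmult) measurable
    also have "\<dots> \<le> ennreal (exp (2 * dim * m)) * (ennreal (tilt_const (2 * (4 * DIM('a))) * exp (?\<kappa>\<^sup>2 * m / 2) * v ^ (4 * DIM('a))) * weight a l lam i)"
    proof (rule mult_left_mono)
      have "var (?\<eta> i) \<le> v"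
        unfolding z_def z'_def v_def m_def by (rule var_dyadic_le[OF i assms(2-4)])
      from tilted_moment_le[OF \<kappa>(1,2) i this v, where p = "4 * DIM('a)" and f = ?f and y = y and lam = lam]
      show "(\<integral>\<^sup>+\<omega>. ennreal (\<bar>?\<eta> i \<omega>\<bar> ^ (2 * (4 * DIM('a)))) * crossing ?f k lam y \<omega> \<partial>P) \<le>
        ennreal (tilt_const (2 * (4 * DIM('a))) * exp (?\<kappa>\<^sup>2 * m / 2) * v ^ (4 * DIM('a))) * weight a l lam i"
        unfolding crossing_def weight_def m_def .
    qed simp
    also have "\<dots> = ennreal (exp (2 * dim * m) * (tilt_const (2 * (4 * DIM('a))) * exp (?\<kappa>\<^sup>2 * m / 2) * v ^ (4 * DIM('a)))) * weight a l lam i"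
      using tilt_const_nonneg v by (subst mult.assoc[symmetric], subst ennreal_mult[symmetric]) (auto intro!: mult_nonneg_nonneg)
    also have "\<dots> \<le> ennreal (tilt_const ?p * (2 * modulus * dim) ^ (4 * DIM('a)) * (1/2) ^ (4 * DIM('a) * h) * exp (- m)) * weight a l lam i"
    proof (intro mult_right_mono ennreal_leI)
      have vp: "v ^ (4 * DIM('a)) = (2 * modulus * dim) ^ (4 * DIM('a)) * exp (- (4 * dim * m)) * (1/2) ^ (4 * DIM('a) * h)"
      proof -
        have "exp (- m) ^ (4 * DIM('a)) = exp (- (4 * dim * m))" by (simp add: dim_def flip: exp_of_nat_mult)
        moreover have "((1/2::real) ^ h) ^ (4 * DIM('a)) = (1/2) ^ (4 * DIM('a) * h)" by (simp only: power_mult[symmetric] mult.commute)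
        ultimately show ?thesis unfolding v_def by (simp only: power_mult_distrib)
      qed
      have m0: "0 \<le> m" by (simp add: m_def)
      have "exp (2 * dim * m) * exp (?\<kappa>\<^sup>2 * m / 2) * exp (- (4 * dim * m)) \<le> exp (- m)"
      proof -
        have "?\<kappa>\<^sup>2 * m \<le> 1/4 * m" "1 * m \<le> dim * m" using \<kappa>(3) dim_ge_1 m0 by (intro mult_right_mono; simp)+
        moreover have "2 * dim * m + ?\<kappa>\<^sup>2 * m / 2 - 4 * dim * m = ?\<kappa>\<^sup>2 * m / 2 - 2 * (dim * m)" by simp
        ultimately have "2 * dim * m + ?\<kappa>\<^sup>2 * m / 2 - 4 * dim * m \<le> - m" using m0 by linarith
        then show ?thesis by (simp flip: exp_add)
      qed
      then have "(tilt_const ?p * ((2 * modulus * dim) ^ (4 * DIM('a)) * (1/2) ^ (4 * DIM('a) * h))) * (exp (2 * dim * m) * exp (?\<kappa>\<^sup>2 * m / 2) * exp (- (4 * dim * m))) \<le>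
        (tilt_const ?p * ((2 * modulus * dim) ^ (4 * DIM('a)) * (1/2) ^ (4 * DIM('a) * h))) * exp (- m)"
        using tilt_const_nonneg modulus_pos dim_ge_1 by (intro mult_left_mono mult_nonneg_nonneg) auto
      then show "exp (2 * dim * m) * (tilt_const (2 * (4 * DIM('a))) * exp (?\<kappa>\<^sup>2 * m / 2) * v ^ (4 * DIM('a))) \<le>
        tilt_const ?p * (2 * modulus * dim) ^ (4 * DIM('a)) * (1/2) ^ (4 * DIM('a) * h) * exp (- m)"
        unfolding vp by (simp add: mult_ac)
    qed simp
    also have "\<dots> = ennreal (tilt_const ?p * (2 * modulus * dim) ^ (4 * DIM('a)) * (1/2) ^ (4 * DIM('a) * h)) *
      (ennreal (exp (- real (k - Suc i))) * weight a l lam i)"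
      using tilt_const_nonneg modulus_pos dim_ge_1 unfolding m_def
      by (subst ennreal_mult) (auto intro!: mult_nonneg_nonneg simp: mult.assoc)
    finally show ?thesis .
  qed
  have AE: "AE \<omega> in P. X 0 \<omega> z - X 0 \<omega> z' = 0" using X_zero_AE[of z] X_zero_AE[of z'] by eventually_elim simp
  have "(\<integral>\<^sup>+\<omega>. ennreal (\<bar>X (real k) \<omega> z - X (real k) \<omega> z'\<bar> ^ ?p) * crossing ?f k lam y \<omega> \<partial>P) \<le>
    (\<integral>\<^sup>+\<omega>. (\<Sum>i<k. ennreal (layer_weight ^ ?p) * (ennreal ((\<bar>?\<eta> i \<omega>\<bar> / ?w i) ^ ?p) * crossing ?f k lam y \<omega>)) \<partial>P)"
  proof (rule nn_integral_mono_AE, use AE in eventually_elim)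
    fix \<omega> assume "X 0 \<omega> z - X 0 \<omega> z' = 0"
    then have "\<bar>X (real k) \<omega> z - X (real k) \<omega> z'\<bar> ^ ?p = \<bar>\<Sum>i<k. ?\<eta> i \<omega>\<bar> ^ ?p" by (simp add: layer_telescope)
    also have "\<dots> \<le> layer_weight ^ ?p * (\<Sum>i<k. (\<bar>?\<eta> i \<omega>\<bar> / ?w i) ^ ?p)"
      by (rule sum_abs_power_le) (use W in auto)
    finally have "ennreal (\<bar>X (real k) \<omega> z - X (real k) \<omega> z'\<bar> ^ ?p) \<le> ennreal (layer_weight ^ ?p * (\<Sum>i<k. (\<bar>?\<eta> i \<omega>\<bar> / ?w i) ^ ?p))"
      by (rule ennreal_leI)
    also have "\<dots> = (\<Sum>i<k. ennreal (layer_weight ^ ?p) * ennreal ((\<bar>?\<eta> i \<omega>\<bar> / ?w i) ^ ?p))"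
      unfolding sum_distrib_left[symmetric] using layer_weight_pos
      by (subst sum_ennreal) (auto intro!: ennreal_mult sum_nonneg)
    finally have "ennreal (\<bar>X (real k) \<omega> z - X (real k) \<omega> z'\<bar> ^ ?p) * crossing ?f k lam y \<omega> \<le>
      (\<Sum>i<k. ennreal (layer_weight ^ ?p) * ennreal ((\<bar>?\<eta> i \<omega>\<bar> / ?w i) ^ ?p)) * crossing ?f k lam y \<omega>"
      by (rule mult_right_mono) simp
    then show "ennreal (\<bar>X (real k) \<omega> z - X (real k) \<omega> z'\<bar> ^ ?p) * crossing ?f k lam y \<omega> \<le>
      (\<Sum>i<k. ennreal (layer_weight ^ ?p) * (ennreal ((\<bar>?\<eta> i \<omega>\<bar> / ?w i) ^ ?p) * crossing ?f k lam y \<omega>))"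
      by (simp only: sum_distrib_right mult.assoc)
  qed
  also have "\<dots> = (\<Sum>i<k. ennreal (layer_weight ^ ?p) * (\<integral>\<^sup>+\<omega>. ennreal ((\<bar>?\<eta> i \<omega>\<bar> / ?w i) ^ ?p) * crossing ?f k lam y \<omega> \<partial>P))"
    by (subst nn_integral_sum, measurable, intro sum.cong refl nn_integral_cmult, measurable)
  also have "\<dots> \<le> (\<Sum>i<k. ennreal (layer_weight ^ ?p) * (ennreal (tilt_const ?p * (2 * modulus * dim) ^ (4 * DIM('a)) * (1/2) ^ (4 * DIM('a) * h)) *
      (ennreal (exp (- real (k - Suc i))) * weight a l lam i)))"
    by (intro sum_mono mult_left_mono summand) auto
  also have "\<dots> = ennreal (pair_const * (1/2) ^ (4 * DIM('a) * h)) * layer_sum a l lam k"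
  proof -
    have "ennreal (pair_const * (1/2) ^ (4 * DIM('a) * h)) =
      ennreal (layer_weight ^ ?p * (tilt_const ?p * (2 * modulus * dim) ^ (4 * DIM('a)) * (1/2) ^ (4 * DIM('a) * h)))"
      unfolding pair_const_def by (simp only: mult.assoc)
    also have "\<dots> = ennreal (layer_weight ^ ?p) * ennreal (tilt_const ?p * (2 * modulus * dim) ^ (4 * DIM('a)) * (1/2) ^ (4 * DIM('a) * h))"
      using layer_weight_pos tilt_const_nonneg modulus_pos dim_ge_1 by (intro ennreal_mult mult_nonneg_nonneg zero_le_power) auto
    finally show ?thesis unfolding layer_sum_def by (simp only: sum_distrib_left mult.assoc)
  qed
  finally show ?thesis unfolding z_def z'_def .
qed

lemma measurable_dyadic_energy [measurable]: "(\<lambda>\<omega>. dyadic_energy p s (X (real k) \<omega>)) \<in> borel_measurable P"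
  unfolding dyadic_energy_def by measurable

text \<open>At level h the number of cells and the weight each give 2 ^ (DIM * h), and each pair
  decays like (1/2) ^ (4 * DIM * h), so the levels are summable.\<close>

lemma energy_crossing_le:
  assumes "1 \<le> k" "0 < s" "s \<le> exp (- real k)"
  shows "(\<integral>\<^sup>+\<omega>. dyadic_energy p s (X (real k) \<omega>) * crossing (barrier a l lam) k lam y \<omega> \<partial>P) \<le>
    ennreal (2 ^ DIM('a) * pair_const * 2) * layer_sum a l lam k"
proof -
  let ?c = "crossing (barrier a l lam) k lam y"
  let ?A = "layer_sum a l lam k"
  let ?D = "\<lambda>h v e \<omega>. \<bar>X (real k) \<omega> (vert p (s / 2 ^ h) v) - X (real k) \<omega> (vert p (s / 2 ^ Suc h) (\<lambda>b. 2 * v b + e b))\<bar> ^ (8 * DIM('a))"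
  have "(\<integral>\<^sup>+\<omega>. dyadic_energy p s (X (real k) \<omega>) * ?c \<omega> \<partial>P) =
    (\<integral>\<^sup>+\<omega>. (\<Sum>h. (\<Sum>v\<in>idx (2 ^ h). \<Sum>e\<in>idx 2. ennreal (2 ^ (DIM('a) * h) * ?D h v e \<omega>)) * ?c \<omega>) \<partial>P)"
    unfolding dyadic_energy_def by simp
  also have "\<dots> = (\<Sum>h. \<integral>\<^sup>+\<omega>. (\<Sum>v\<in>idx (2 ^ h). \<Sum>e\<in>idx 2. ennreal (2 ^ (DIM('a) * h) * ?D h v e \<omega>)) * ?c \<omega> \<partial>P)"
    by (rule nn_integral_suminf) measurable
  also have "\<dots> \<le> (\<Sum>h. ennreal (2 ^ DIM('a) * pair_const * (1/2) ^ h) * ?A)"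
  proof (rule suminf_le)
    fix h
    have "(\<integral>\<^sup>+\<omega>. (\<Sum>v\<in>idx (2 ^ h). \<Sum>e\<in>idx 2. ennreal (2 ^ (DIM('a) * h) * ?D h v e \<omega>)) * ?c \<omega> \<partial>P) =
      (\<Sum>v\<in>idx (2 ^ h). \<Sum>e\<in>idx 2. ennreal (2 ^ (DIM('a) * h)) * (\<integral>\<^sup>+\<omega>. ennreal (?D h v e \<omega>) * ?c \<omega> \<partial>P))"
      unfolding sum_distrib_right
      by (subst nn_integral_sum, measurable, intro sum.cong refl, subst nn_integral_sum, measurable, intro sum.cong refl,
          subst nn_integral_cmult[symmetric], measurable, intro nn_integral_cong)
         (simp add: ennreal_mult mult.assoc)
    also have "\<dots> \<le> (\<Sum>v\<in>(idx (2 ^ h) :: ('a \<Rightarrow> nat) set). \<Sum>e\<in>(idx 2 :: ('a \<Rightarrow> nat) set). ennreal (2 ^ (DIM('a) * h)) * (ennreal (pair_const * (1/2) ^ (4 * DIM('a) * h)) * ?A))"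
      by (intro sum_mono mult_left_mono dyadic_pair_le assms) auto
    also have "\<dots> = ennreal (2 ^ (DIM('a) * h) * 2 ^ DIM('a) * (2 ^ (DIM('a) * h) * (pair_const * (1/2) ^ (4 * DIM('a) * h)))) * ?A"
      using pair_const_nonneg
      by (simp add: card_idx ennreal_mult power_mult[symmetric] mult.commute[of h] mult.assoc ennreal_power[symmetric])
    also have "\<dots> \<le> ennreal (2 ^ DIM('a) * pair_const * (1/2) ^ h) * ?A"
    proof (intro mult_right_mono ennreal_leI)
      have "2 ^ (DIM('a) * h) * 2 ^ DIM('a) * (2 ^ (DIM('a) * h) * (pair_const * (1/2) ^ (4 * DIM('a) * h))) =
        2 ^ DIM('a) * pair_const * (2 ^ (DIM('a) * h) * 2 ^ (DIM('a) * h) * (1/2) ^ (4 * DIM('a) * h))" by simp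
      also have "2 ^ (DIM('a) * h) * 2 ^ (DIM('a) * h) * (1/2) ^ (4 * DIM('a) * h) = (1/2 :: real) ^ (2 * DIM('a) * h)"
      proof -
        have "(1/2 :: real) ^ (4 * DIM('a) * h) = (1/2) ^ (DIM('a) * h) * (1/2) ^ (DIM('a) * h) * (1/2) ^ (2 * DIM('a) * h)"
        proof -
          have "4 * DIM('a) * h = DIM('a) * h + DIM('a) * h + 2 * DIM('a) * h" by simp
          then show ?thesis by (simp only: power_add)
        qed
        then show ?thesis by (simp add: power_divide)
      qed
      also have "(1/2 :: real) ^ (2 * DIM('a) * h) \<le> (1/2) ^ h" by (intro power_decreasing) auto
      finally show "2 ^ (DIM('a) * h) * 2 ^ DIM('a) * (2 ^ (DIM('a) * h) * (pair_const * (1/2) ^ (4 * DIM('a) * h))) \<le> 2 ^ DIM('a) * pair_const * (1/2) ^ h"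
        using pair_const_nonneg by (simp add: mult_left_mono)
    qed simp
    finally show "(\<integral>\<^sup>+\<omega>. (\<Sum>v\<in>idx (2 ^ h). \<Sum>e\<in>idx 2. ennreal (2 ^ (DIM('a) * h) * ?D h v e \<omega>)) * ?c \<omega> \<partial>P) \<le>
      ennreal (2 ^ DIM('a) * pair_const * (1/2) ^ h) * ?A" .
  qed auto
  also have "\<dots> = ennreal (2 ^ DIM('a) * pair_const * 2) * ?A"
  proof -
    have "(\<Sum>h. ennreal (2 ^ DIM('a) * pair_const * (1/2) ^ h)) = ennreal (2 ^ DIM('a) * pair_const * 2)"
    proof (rule suminf_ennreal_eq)
      show "(\<lambda>h. 2 ^ DIM('a) * pair_const * (1/2) ^ h) sums (2 ^ DIM('a) * pair_const * 2)"
        using sums_mult[OF geometric_sums[of "1/2::real"], of "2 ^ DIM('a) * pair_const"] by simp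
    qed (use pair_const_nonneg in auto)
    then show ?thesis by simp
  qed
  finally show ?thesis .
qed

section \<open>The first crossing of the barrier\<close>

text \<open>If the barrier is crossed at scale \<open>k\<close> somewhere in the cell, then the field is within 1 of the
  crossing level on a substantial part of the cell. This turns the supremum over the cell into an
  integral, to which the one-point tilt applies.\<close>

definition cell_score :: "(nat \<Rightarrow> real) \<Rightarrow> nat \<Rightarrow> real \<Rightarrow> 'a \<Rightarrow> real \<Rightarrow> 'w \<Rightarrow> ennreal" where
  "cell_score f k lam p s \<omega> = ennreal (chain_const TYPE('a) / s ^ DIM('a)) * (1 + dyadic_energy p s (X (real k) \<omega>)) *
    (\<integral>\<^sup>+y. indicator (hcube p s) y * (stay f (k - 1) y \<omega> * indicator {lam - 1..} (S k y \<omega>)) \<partial>lborel)"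

lemma measurable_cell_score [measurable]: "cell_score f k lam p s \<in> borel_measurable P"
  unfolding cell_score_def by measurable

lemma one_le_cell_score:
  assumes \<omega>: "\<omega> \<in> space P" and x: "x \<in> hcube p s" "0 < s" "lam < S k x \<omega>"
    and st: "\<And>y. y \<in> hcube p s \<Longrightarrow> stay f (k - 1) y \<omega> = 1"
  shows "1 \<le> cell_score f k lam p s \<omega>"
proof -
  let ?f = "X (real k) \<omega>" and ?I = "\<integral>\<^sup>+y. indicator (hcube p s) y * (stay f (k - 1) y \<omega> * indicator {lam - 1..} (S k y \<omega>)) \<partial>lborel"
  have cont: "continuous_on UNIV ?f" using continuous_X \<omega> by auto
  have [measurable]: "?f \<in> borel_measurable borel" using cont by (rule borel_measurable_continuous_onI)
  have "emeasure lborel {y \<in> hcube p s. ?f x - 1 \<le> ?f y} = (\<integral>\<^sup>+y. indicator {y \<in> hcube p s. ?f x - 1 \<le> ?f y} y \<partial>lborel)"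
    by (rule nn_integral_indicator[symmetric]) measurable
  also have "\<dots> \<le> ?I"
    using x st by (intro nn_integral_mono) (auto simp: indicator_def S_def)
  finally have vol: "emeasure lborel {y \<in> hcube p s. ?f x - 1 \<le> ?f y} \<le> ?I" .
  have s: "0 < s ^ DIM('a)" using x by simp
  have "1 = ennreal (1 / s ^ DIM('a)) * ennreal (s ^ DIM('a))" using s x(2) by (subst ennreal_mult[symmetric]) auto
  also have "\<dots> \<le> ennreal (1 / s ^ DIM('a)) * (ennreal (chain_const TYPE('a)) * (1 + dyadic_energy p s ?f) * ?I)"
    using cube_volume_le_dyadic_energy[OF x(1,2) cont] mult_left_mono[OF vol]
    by (intro mult_left_mono) (auto intro: order_trans)
  also have "\<dots> = cell_score f k lam p s \<omega>"
  proof -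
    have "ennreal (chain_const TYPE('a) / s ^ DIM('a)) = ennreal (1 / s ^ DIM('a)) * ennreal (chain_const TYPE('a))"
      using s chain_const_ge_1[where 'a='a] by (subst ennreal_mult[symmetric]) auto
    then show ?thesis unfolding cell_score_def by (simp only: mult.assoc)
  qed
  finally show ?thesis .
qed

definition score_const :: real where
  "score_const = chain_const TYPE('a) * (tilt_const 0 + 2 ^ DIM('a) * pair_const * 2)"

lemma score_const_nonneg: "0 \<le> score_const"
  unfolding score_const_def using chain_const_ge_1[where 'a='a] tilt_const_nonneg pair_const_nonneg
  by (intro mult_nonneg_nonneg add_nonneg_nonneg) auto

text \<open>Where S \<ge> lam - 1, the weight L is at least exp (dim * k + \<gamma> * (lam - 1)), so
  removing the tilt gains its inverse. The prefactor 1 / s ^ DIM cancels the volume of the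
  cell.\<close>

lemma cell_score_le:
  assumes "1 \<le> k" "0 < s" "s \<le> exp (- real k)"
  shows "(\<integral>\<^sup>+\<omega>. cell_score (barrier a l lam) k lam p s \<omega> \<partial>P) \<le>
    ennreal (score_const * exp (\<gamma> - dim * real k - \<gamma> * lam)) * layer_sum a l lam k"
proof -
  let ?f = "barrier a l lam" and ?E = "\<lambda>\<omega>. 1 + dyadic_energy p s (X (real k) \<omega>)"
  let ?b = "exp (\<gamma> - dim * real k - \<gamma> * lam)"
  let ?A = "layer_sum a l lam k"
  interpret PL: pair_sigma_finite P lborel ..
  have tilt: "stay ?f (k - 1) y \<omega> * indicator {lam - 1..} (S k y \<omega>) \<le> ennreal ?b * crossing ?f k lam y \<omega>" for y \<omega>
  proof (cases "lam - 1 \<le> S k y \<omega>")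
    case True
    then have "\<gamma> * (lam - 1) \<le> \<gamma> * S k y \<omega>" using gamma_ge by (intro mult_left_mono) auto
    then have "1 \<le> ?b * (exp (dim * real k) * exp (\<gamma> * S k y \<omega>))"
      unfolding exp_add[symmetric] by (simp add: algebra_simps)
    then have "ennreal 1 \<le> ennreal (?b * (exp (dim * real k) * exp (\<gamma> * S k y \<omega>)))" by (rule ennreal_leI)
    also have "\<dots> = ennreal ?b * L k y \<omega>" unfolding L_eq by (simp add: ennreal_mult)
    finally have "1 \<le> ennreal ?b * L k y \<omega>" by simp
    from mult_right_mono[OF this, of "stay ?f (k - 1) y \<omega> * indicator {lam - 1..} (S k y \<omega>)"]
    show ?thesis unfolding crossing_def by (simp add: mult_ac)
  qed simp
  have point: "(\<integral>\<^sup>+\<omega>. ?E \<omega> * (stay ?f (k - 1) y \<omega> * indicator {lam - 1..} (S k y \<omega>)) \<partial>P) \<le>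
    ennreal (?b * (tilt_const 0 + 2 ^ DIM('a) * pair_const * 2)) * ?A" for y
  proof -
    have "(\<integral>\<^sup>+\<omega>. ?E \<omega> * (stay ?f (k - 1) y \<omega> * indicator {lam - 1..} (S k y \<omega>)) \<partial>P) \<le>
      (\<integral>\<^sup>+\<omega>. ?E \<omega> * (ennreal ?b * crossing ?f k lam y \<omega>) \<partial>P)"
      by (intro nn_integral_mono mult_left_mono tilt) auto
    also have "\<dots> = (\<integral>\<^sup>+\<omega>. ennreal ?b * (crossing ?f k lam y \<omega> + dyadic_energy p s (X (real k) \<omega>) * crossing ?f k lam y \<omega>) \<partial>P)"
      by (intro nn_integral_cong) (simp add: distrib_right distrib_left mult_ac)
    also have "\<dots> = ennreal ?b * ((\<integral>\<^sup>+\<omega>. crossing ?f k lam y \<omega> \<partial>P) + (\<integral>\<^sup>+\<omega>. dyadic_energy p s (X (real k) \<omega>) * crossing ?f k lam y \<omega> \<partial>P))"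
      by (subst nn_integral_cmult, measurable, subst nn_integral_add) auto
    also have "\<dots> \<le> ennreal ?b * (ennreal (tilt_const 0) * ?A + ennreal (2 ^ DIM('a) * pair_const * 2) * ?A)"
      by (intro mult_left_mono add_mono crossing_le energy_crossing_le assms) auto
    also have "\<dots> = ennreal (?b * (tilt_const 0 + 2 ^ DIM('a) * pair_const * 2)) * ?A"
    proof -
      have n: "0 \<le> 2 ^ DIM('a) * pair_const * 2" using pair_const_nonneg by simp
      have "ennreal (?b * (tilt_const 0 + 2 ^ DIM('a) * pair_const * 2)) = ennreal ?b * (ennreal (tilt_const 0) + ennreal (2 ^ DIM('a) * pair_const * 2))"
        using n tilt_const_nonneg by (simp only: ennreal_mult add_nonneg_nonneg exp_ge_zero ennreal_plus)
      then show ?thesis by (simp only: mult.assoc distrib_right)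
    qed
    finally show ?thesis .
  qed
  have "(\<integral>\<^sup>+\<omega>. cell_score ?f k lam p s \<omega> \<partial>P) = ennreal (chain_const TYPE('a) / s ^ DIM('a)) *
    (\<integral>\<^sup>+\<omega>. (\<integral>\<^sup>+y. indicator (hcube p s) y * (?E \<omega> * (stay ?f (k - 1) y \<omega> * indicator {lam - 1..} (S k y \<omega>))) \<partial>lborel) \<partial>P)"
  proof -
    let ?G = "\<lambda>\<omega>. \<integral>\<^sup>+y. indicator (hcube p s) y * (?E \<omega> * (stay ?f (k - 1) y \<omega> * indicator {lam - 1..} (S k y \<omega>))) \<partial>lborel"
    have "(\<lambda>\<omega>. \<integral>\<^sup>+y. (\<lambda>q. indicator (hcube p s) (snd q) * (?E (fst q) * (stay ?f (k - 1) (snd q) (fst q) * indicator {lam - 1..} (S k (snd q) (fst q))))) (\<omega>, y) \<partial>lborel) \<in> borel_measurable P"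
      by (rule lborel.borel_measurable_nn_integral_fst) measurable
    then have G: "?G \<in> borel_measurable P" by simp
    have "cell_score ?f k lam p s \<omega> = ennreal (chain_const TYPE('a) / s ^ DIM('a)) * ?G \<omega>" if "\<omega> \<in> space P" for \<omega>
    proof -
      note [measurable] = measurable_stay_lborel[OF that] measurable_S_lborel[OF that]
      have "?G \<omega> = ?E \<omega> * (\<integral>\<^sup>+y. indicator (hcube p s) y * (stay ?f (k - 1) y \<omega> * indicator {lam - 1..} (S k y \<omega>)) \<partial>lborel)"
        by (subst nn_integral_cmult[symmetric]) (auto simp: mult_ac)
      then show ?thesis by (simp only: cell_score_def mult.assoc)
    qed
    then have "(\<integral>\<^sup>+\<omega>. cell_score ?f k lam p s \<omega> \<partial>P) = (\<integral>\<^sup>+\<omega>. ennreal (chain_const TYPE('a) / s ^ DIM('a)) * ?G \<omega> \<partial>P)"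
      by (rule nn_integral_cong)
    also have "\<dots> = ennreal (chain_const TYPE('a) / s ^ DIM('a)) * (\<integral>\<^sup>+\<omega>. ?G \<omega> \<partial>P)"
      by (rule nn_integral_cmult[OF G])
    finally show ?thesis .
  qed
  also have "(\<integral>\<^sup>+\<omega>. (\<integral>\<^sup>+y. indicator (hcube p s) y * (?E \<omega> * (stay ?f (k - 1) y \<omega> * indicator {lam - 1..} (S k y \<omega>))) \<partial>lborel) \<partial>P) =
    (\<integral>\<^sup>+y. (\<integral>\<^sup>+\<omega>. indicator (hcube p s) y * (?E \<omega> * (stay ?f (k - 1) y \<omega> * indicator {lam - 1..} (S k y \<omega>))) \<partial>P) \<partial>lborel)"
    by (rule PL.Fubini'[symmetric]) (unfold case_prod_beta, measurable)
  also have "\<dots> = (\<integral>\<^sup>+y. indicator (hcube p s) y * (\<integral>\<^sup>+\<omega>. ?E \<omega> * (stay ?f (k - 1) y \<omega> * indicator {lam - 1..} (S k y \<omega>)) \<partial>P) \<partial>lborel)"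
    by (intro nn_integral_cong nn_integral_cmult) measurable
  also have "ennreal (chain_const TYPE('a) / s ^ DIM('a)) * \<dots> \<le> ennreal (chain_const TYPE('a) / s ^ DIM('a)) *
    (\<integral>\<^sup>+y. indicator (hcube p s) y * (ennreal (?b * (tilt_const 0 + 2 ^ DIM('a) * pair_const * 2)) * ?A) \<partial>lborel)"
    by (intro mult_left_mono nn_integral_mono point) auto
  also have "(\<integral>\<^sup>+y. indicator (hcube p s) y * (ennreal (?b * (tilt_const 0 + 2 ^ DIM('a) * pair_const * 2)) * ?A) \<partial>lborel) =
    ennreal (s ^ DIM('a)) * (ennreal (?b * (tilt_const 0 + 2 ^ DIM('a) * pair_const * 2)) * ?A)"
    using assms by (subst nn_integral_multc) (auto simp: emeasure_hcube)
  also have "ennreal (chain_const TYPE('a) / s ^ DIM('a)) * (ennreal (s ^ DIM('a)) * (ennreal (?b * (tilt_const 0 + 2 ^ DIM('a) * pair_const * 2)) * ?A)) =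
    ennreal (score_const * ?b) * ?A"
  proof -
    have s: "0 < s ^ DIM('a)" using assms by simp
    have c: "0 \<le> chain_const TYPE('a)" using chain_const_ge_1[where 'a='a] by simp
    have n: "0 \<le> ?b * (tilt_const 0 + 2 ^ DIM('a) * pair_const * 2)"
      using pair_const_nonneg tilt_const_nonneg by (intro mult_nonneg_nonneg add_nonneg_nonneg) auto
    have "ennreal (chain_const TYPE('a) / s ^ DIM('a)) * ennreal (s ^ DIM('a)) = ennreal (chain_const TYPE('a))"
      using s c assms(2) by (subst ennreal_mult[symmetric]) auto
    moreover have "ennreal (chain_const TYPE('a)) * ennreal (?b * (tilt_const 0 + 2 ^ DIM('a) * pair_const * 2)) = ennreal (score_const * ?b)"
      using c n by (subst ennreal_mult[symmetric]) (auto simp: score_const_def mult_ac)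
    ultimately show ?thesis by (simp only: mult.assoc[symmetric])
  qed
  finally show ?thesis .
qed

section \<open>Summation over layers, scales and cells\<close>

lemma sum_exp_from_le: "i \<le> b \<Longrightarrow> (\<Sum>k\<in>{b<..T}. exp (- real (k - Suc i))) \<le> 2 * exp (- real (b - i))"
proof -
  assume i: "i \<le> b"
  have "(\<Sum>k\<in>{b<..T}. exp (- real (k - Suc i))) = (\<Sum>m<T - b. exp (- real (b - i)) * exp (- real m))"
    by (rule sum.reindex_bij_witness[of _ "\<lambda>m. b + Suc m" "\<lambda>k. k - Suc b"])
       (use i in \<open>auto simp: of_nat_diff simp flip: exp_add\<close>)
  also have "\<dots> = exp (- real (b - i)) * (\<Sum>m<T - b. exp (-1) ^ m)"
    by (simp add: sum_distrib_left flip: exp_of_nat_mult)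
  also have "\<dots> \<le> exp (- real (b - i)) * 2"
  proof (rule mult_left_mono)
    have e: "exp (-1 :: real) \<le> 1/2" using exp_ge_add_one_self[of "1::real"] by (simp add: exp_minus field_simps)
    have "(\<Sum>m<T - b. exp (-1 :: real) ^ m) \<le> (\<Sum>m<T - b. (1/2) ^ m)" using e by (intro sum_mono power_mono) auto
    also have "\<dots> \<le> (\<Sum>m. (1/2) ^ m)" by (intro sum_le_suminf summable_geometric) auto
    also have "\<dots> = (2::real)" using suminf_geometric[of "1/2::real"] by simp
    finally show "(\<Sum>m<T - b. exp (-1 :: real) ^ m) \<le> 2" .
  qed simp
  finally show ?thesis by simp
qed

lemma weight_before_le:
  assumes "0 \<le> l" "i \<le> a"
  shows "weight a l lam i \<le> ennreal (500 * (1 + l) / sqrt (real i + 1))"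
  unfolding weight_def kchain_barrier_before[OF assms(2)]
  using kstep_pow_one_le_sqrt_Suc[OF assms(1), of i] assms(2) by (simp add: weight_rate_def)

text \<open>Averaging 1 / sqrt (i + 1) against exp (- (a - i)) keeps the order 1 / sqrt (a + 1).
  With m = a - i, sqrt (a + 1) \<le> (m + 1) * sqrt (i + 1), and m + 1 \<le> 2 * exp (m / 2) is
  absorbed by half of the exponential.\<close>

lemma sum_weight_before_le:
  assumes "0 \<le> l"
  shows "(\<Sum>i\<le>a. ennreal (exp (- real (a - i))) * weight a l lam i) \<le>
    ennreal (1000 / (1 - exp (- (1/2))) * ((1 + l) / sqrt (real a + 1)))"
proof -
  have "(\<Sum>i\<le>a. ennreal (exp (- real (a - i))) * weight a l lam i) \<le>
    (\<Sum>i\<le>a. ennreal (1000 * ((1 + l) / sqrt (real a + 1)) * exp (- (1/2) * real (a - i))))"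
  proof (rule sum_mono)
    fix i assume "i \<in> {..a}"
    then have i: "i \<le> a" by simp
    define m where "m = real (a - i)"
    have ma: "real a = m + real i" "0 \<le> m" using i by (auto simp: m_def of_nat_diff)
    then have m: "real a + 1 \<le> (m + 1) * (real i + 1)" "0 \<le> m" by (auto simp: distrib_left distrib_right)
    have "sqrt (real a + 1) \<le> sqrt ((m + 1) * (real i + 1))" using m by (intro real_sqrt_le_mono) auto
    also have "\<dots> \<le> (m + 1) * sqrt (real i + 1)"
    proof -
      have "sqrt (m + 1) \<le> m + 1" using m by (intro real_le_lsqrt) (auto simp: power2_eq_square)
      then show ?thesis unfolding real_sqrt_mult by (intro mult_right_mono) auto
    qed
    finally have "1 / sqrt (real i + 1) \<le> (m + 1) / sqrt (real a + 1)" by (simp add: field_simps)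
    moreover have "m + 1 \<le> 2 * exp (1/2 * m)"
    proof -
      define E where "E = exp (1/2 * m)"
      have "1 + 1/2 * m \<le> E" unfolding E_def by (rule exp_ge_add_one_self)
      then have "m + 1 \<le> 2 * E" using m(2) by linarith
      then show ?thesis by (simp only: E_def)
    qed
    then have "(m + 1) / sqrt (real a + 1) \<le> 2 * exp (1/2 * m) / sqrt (real a + 1)" by (intro divide_right_mono) auto
    ultimately have "1 / sqrt (real i + 1) \<le> 2 * exp (1/2 * m) / sqrt (real a + 1)" by simp
    then have "500 * (1 + l) * exp (- m) * (1 / sqrt (real i + 1)) \<le> 500 * (1 + l) * exp (- m) * (2 * exp (1/2 * m) / sqrt (real a + 1))"
      using assms by (intro mult_left_mono) auto
    also have "\<dots> = 1000 * ((1 + l) / sqrt (real a + 1)) * (exp (- m) * exp (1/2 * m))" by simp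
    also have "exp (- m) * exp (1/2 * m) = exp (- (1/2) * m)" by (simp flip: exp_add)
    finally have r: "exp (- m) * (500 * (1 + l) / sqrt (real i + 1)) \<le> 1000 * ((1 + l) / sqrt (real a + 1)) * exp (- (1/2) * m)" by (simp add: mult_ac)
    have "ennreal (exp (- m)) * weight a l lam i \<le> ennreal (exp (- m)) * ennreal (500 * (1 + l) / sqrt (real i + 1))"
      by (intro mult_left_mono weight_before_le assms i) simp
    also have "\<dots> = ennreal (exp (- m) * (500 * (1 + l) / sqrt (real i + 1)))"
      using assms by (intro ennreal_mult[symmetric]) auto
    also have "\<dots> \<le> ennreal (1000 * ((1 + l) / sqrt (real a + 1)) * exp (- (1/2) * m))" by (rule ennreal_leI[OF r])
    finally show "ennreal (exp (- real (a - i))) * weight a l lam i \<le>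
      ennreal (1000 * ((1 + l) / sqrt (real a + 1)) * exp (- (1/2) * real (a - i)))" unfolding m_def .
  qed
  also have "\<dots> = ennreal (1000 * ((1 + l) / sqrt (real a + 1)) * (\<Sum>i\<le>a. exp (- (1/2) * real (a - i))))"
    unfolding sum_distrib_left using assms by (intro sum_ennreal) auto
  also have "\<dots> \<le> ennreal (1000 * ((1 + l) / sqrt (real a + 1)) * (1 / (1 - exp (- (1/2)))))"
    using sum_exp_le[of "1/2" "Suc a"] assms
    by (intro ennreal_leI mult_left_mono) (auto simp: lessThan_Suc_atMost)
  also have "1000 * ((1 + l) / sqrt (real a + 1)) * (1 / (1 - exp (- (1/2)))) =
      1000 / (1 - exp (- (1/2))) * ((1 + l) / sqrt (real a + 1))" by simp
  finally show ?thesis .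
qed

definition layer_const :: real where
  "layer_const = 2 * (1000 / (1 - exp (- (1/2)))) + 2 * (green_const (1/2) * 500)"

lemma layer_const_nonneg: "0 \<le> layer_const"
  unfolding layer_const_def using green_const_pos[of "1/2"] by (intro add_nonneg_nonneg mult_nonneg_nonneg divide_nonneg_nonneg) auto

text \<open>In exchanged order, a layer i is charged only by the scales above both a and i, a
  geometric series. Layers up to a then carry a factor decaying in a - i; those after a are summed
  by the Green function.\<close>

lemma sum_layer_sum_le:
  assumes "0 \<le> l"
  shows "(\<Sum>k\<in>{a<..T}. layer_sum a l lam k) \<le> ennreal (layer_const * ((1 + l) / sqrt (real a + 1)))"
proof -
  let ?w = "weight a l lam" and ?r = "(1 + l) / sqrt (real a + 1)"
  have r: "0 \<le> ?r" using assms by simp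
  have "(\<Sum>k\<in>{a<..T}. layer_sum a l lam k) = (\<Sum>k\<in>{a<..T}. \<Sum>i | i \<in> {..<T} \<and> i < k. ennreal (exp (- real (k - Suc i))) * ?w i)"
    unfolding layer_sum_def by (intro sum.cong refl) auto
  also have "\<dots> = (\<Sum>i<T. \<Sum>k | k \<in> {a<..T} \<and> i < k. ennreal (exp (- real (k - Suc i))) * ?w i)"
    by (rule sum.swap_restrict) auto
  also have "\<dots> \<le> (\<Sum>i<T. ennreal (2 * exp (- real (max a i - i))) * ?w i)"
  proof (rule sum_mono)
    fix i
    have "{k. k \<in> {a<..T} \<and> i < k} = {max a i<..T}" by auto
    then have "(\<Sum>k | k \<in> {a<..T} \<and> i < k. ennreal (exp (- real (k - Suc i))) * ?w i) =
      ennreal (\<Sum>k\<in>{max a i<..T}. exp (- real (k - Suc i))) * ?w i"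
      by (simp add: sum_distrib_right[symmetric])
    also have "\<dots> \<le> ennreal (2 * exp (- real (max a i - i))) * ?w i"
      by (intro mult_right_mono ennreal_leI sum_exp_from_le) auto
    finally show "(\<Sum>k | k \<in> {a<..T} \<and> i < k. ennreal (exp (- real (k - Suc i))) * ?w i) \<le> ennreal (2 * exp (- real (max a i - i))) * ?w i" .
  qed
  also have "\<dots> \<le> (\<Sum>i\<in>{..a} \<union> {a<..<T}. ennreal (2 * exp (- real (max a i - i))) * ?w i)"
    by (rule sum_mono2) auto
  also have "\<dots> = (\<Sum>i\<le>a. ennreal (2 * exp (- real (max a i - i))) * ?w i) + (\<Sum>i\<in>{a<..<T}. ennreal (2 * exp (- real (max a i - i))) * ?w i)"
    by (rule sum.union_disjoint) auto
  also have "\<dots> \<le> ennreal 2 * ennreal (1000 / (1 - exp (- (1/2))) * ?r) + ennreal 2 * ennreal (green_const (1/2) * (500 * (1 + l) / sqrt (real a + 1)))"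
  proof (rule add_mono)
    have "(\<Sum>i\<le>a. ennreal (2 * exp (- real (max a i - i))) * ?w i) = ennreal 2 * (\<Sum>i\<le>a. ennreal (exp (- real (a - i))) * ?w i)"
      unfolding sum_distrib_left by (intro sum.cong refl) (simp add: ennreal_mult max_absorb1 mult.assoc)
    also have "\<dots> \<le> ennreal 2 * ennreal (1000 / (1 - exp (- (1/2))) * ?r)"
      by (intro mult_left_mono sum_weight_before_le assms) simp
    finally show "(\<Sum>i\<le>a. ennreal (2 * exp (- real (max a i - i))) * ?w i) \<le> ennreal 2 * ennreal (1000 / (1 - exp (- (1/2))) * ?r)" .
    have "(\<Sum>i\<in>{a<..<T}. ennreal (2 * exp (- real (max a i - i))) * ?w i) = ennreal 2 * (\<Sum>i\<in>{a<..<T}. ?w i)"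
      unfolding sum_distrib_left by (intro sum.cong refl) (auto simp: max_absorb2)
    also have "(\<Sum>i\<in>{a<..<T}. ?w i) = (\<Sum>m<T - Suc a. kchain (barrier a l lam) 0 (a + Suc m) (exp_below (1/2) lam) 0)"
      by (rule sum.reindex_bij_witness[of _ "\<lambda>m. a + Suc m" "\<lambda>i. i - Suc a"])
         (auto simp: weight_def weight_rate_def simp del: kchain.simps)
    also have "ennreal 2 * \<dots> \<le> ennreal 2 * ennreal (green_const (1/2) * (500 * (1 + l) / sqrt (real a + 1)))"
      by (intro mult_left_mono sum_kchain_exp_le assms) auto
    finally show "(\<Sum>i\<in>{a<..<T}. ennreal (2 * exp (- real (max a i - i))) * ?w i) \<le> ennreal 2 * ennreal (green_const (1/2) * (500 * (1 + l) / sqrt (real a + 1)))" .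
  qed
  also have "\<dots> = ennreal (layer_const * ?r)"
  proof -
    have p: "0 \<le> 1000 / (1 - exp (- (1/2))) * ?r" "0 \<le> green_const (1/2) * (500 * (1 + l) / sqrt (real a + 1))"
      using r green_const_pos[of "1/2"] assms by (auto intro!: mult_nonneg_nonneg divide_nonneg_nonneg)
    have "ennreal 2 * ennreal (1000 / (1 - exp (- (1/2))) * ?r) + ennreal 2 * ennreal (green_const (1/2) * (500 * (1 + l) / sqrt (real a + 1))) =
      ennreal (2 * (1000 / (1 - exp (- (1/2))) * ?r) + 2 * (green_const (1/2) * (500 * (1 + l) / sqrt (real a + 1))))"
    proof -
      have "ennreal 2 * ennreal x + ennreal 2 * ennreal y = ennreal (2 * x + 2 * y)" if "0 \<le> x" "0 \<le> y" for x y
        using that by (simp add: ennreal_mult)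
      then show ?thesis using p by blast
    qed
    also have "2 * (1000 / (1 - exp (- (1/2))) * ?r) + 2 * (green_const (1/2) * (500 * (1 + l) / sqrt (real a + 1))) = layer_const * ?r"
    proof -
      have e: "500 * (1 + l) / sqrt (real a + 1) = 500 * ?r" by simp
      show ?thesis unfolding layer_const_def e by (simp only: distrib_right mult.assoc)
    qed
    finally show ?thesis .
  qed
  finally show ?thesis .
qed

text \<open>A cube of side \<open>exp (- a)\<close> is divided into \<open>mesh (k - a)\<close> cells per direction at scale \<open>k\<close>, so
  that the cells have side at most \<open>exp (- k)\<close>.\<close>

definition mesh :: "nat \<Rightarrow> nat" where "mesh m = nat \<lceil>exp (real m)\<rceil>"

lemma mesh: "0 < mesh m" "exp (real m) \<le> real (mesh m)" "real (mesh m) \<le> 2 * exp (real m)"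
proof -
  have e: "1 \<le> exp (real m)" by simp
  show le: "exp (real m) \<le> real (mesh m)" unfolding mesh_def by linarith
  then show "0 < mesh m" using e by (cases "mesh m") auto
  have "real (mesh m) \<le> exp (real m) + 1" unfolding mesh_def using e by linarith
  then show "real (mesh m) \<le> 2 * exp (real m)" using e by linarith
qed

definition total_score :: "nat \<Rightarrow> real \<Rightarrow> real \<Rightarrow> nat \<Rightarrow> 'a \<Rightarrow> 'w \<Rightarrow> ennreal" where
  "total_score a l lam T p \<omega> = (\<Sum>k\<in>{a<..T}. \<Sum>v\<in>idx (mesh (k - a)).
     cell_score (barrier a l lam) k lam (vert p (exp (- real a) / real (mesh (k - a))) v) (exp (- real a) / real (mesh (k - a))) \<omega>)"

lemma measurable_total_score [measurable]: "total_score a l lam T p \<in> borel_measurable P"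
  unfolding total_score_def by measurable

definition total_score_const :: real where
  "total_score_const = 2 ^ DIM('a) * score_const * exp \<gamma> * layer_const"

lemma total_score_const_nonneg: "0 \<le> total_score_const"
  unfolding total_score_const_def using score_const_nonneg layer_const_nonneg by simp

text \<open>At scale k there are at most a multiple of exp (dim * (k - a)) cells, each of score
  proportional to exp (- dim * k). The product is the same for all k, so summability rests on the
  layer sums alone.\<close>

lemma total_score_le:
  assumes "0 \<le> l"
  shows "(\<integral>\<^sup>+\<omega>. total_score a l lam T p \<omega> \<partial>P) \<le>
    ennreal (total_score_const * exp (- dim * real a) * exp (- \<gamma> * lam) * ((1 + l) / sqrt (real a + 1)))"
proof -
  let ?s = "\<lambda>k. exp (- real a) / real (mesh (k - a))"
  let ?c = "2 ^ DIM('a) * score_const * exp \<gamma> * exp (- dim * real a) * exp (- \<gamma> * lam)"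
  have c: "0 \<le> ?c" using score_const_nonneg by simp
  have "(\<integral>\<^sup>+\<omega>. total_score a l lam T p \<omega> \<partial>P) = (\<Sum>k\<in>{a<..T}. \<Sum>v\<in>idx (mesh (k - a)).
     \<integral>\<^sup>+\<omega>. cell_score (barrier a l lam) k lam (vert p (?s k) v) (?s k) \<omega> \<partial>P)"
    unfolding total_score_def by (subst nn_integral_sum, measurable, intro sum.cong refl nn_integral_sum, measurable)
  also have "\<dots> \<le> (\<Sum>k\<in>{a<..T}. \<Sum>v\<in>(idx (mesh (k - a)) :: ('a \<Rightarrow> nat) set). ennreal (score_const * exp (\<gamma> - dim * real k - \<gamma> * lam)) * layer_sum a l lam k)"
  proof (intro sum_mono cell_score_le)
    fix k v assume k: "k \<in> {a<..T}"
    then show "1 \<le> k" by auto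
    show "0 < ?s k" using mesh(1)[of "k - a"] by simp
    have "?s k \<le> exp (- real a) / exp (real (k - a))"
      using mesh[of "k - a"] by (intro divide_left_mono mult_pos_pos) auto
    also have "\<dots> = exp (- real k)" using k by (simp add: of_nat_diff flip: exp_diff)
    finally show "?s k \<le> exp (- real k)" .
  qed
  also have "\<dots> \<le> (\<Sum>k\<in>{a<..T}. ennreal ?c * layer_sum a l lam k)"
  proof (rule sum_mono)
    fix k assume k: "k \<in> {a<..T}"
    have "(\<Sum>v\<in>(idx (mesh (k - a)) :: ('a \<Rightarrow> nat) set). ennreal (score_const * exp (\<gamma> - dim * real k - \<gamma> * lam)) * layer_sum a l lam k) =
      ennreal (real (mesh (k - a)) ^ DIM('a)) * (ennreal (score_const * exp (\<gamma> - dim * real k - \<gamma> * lam)) * layer_sum a l lam k)"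
      by (simp add: card_idx ennreal_power[symmetric] ennreal_of_nat_eq_real_of_nat)
    also have "\<dots> = ennreal (real (mesh (k - a)) ^ DIM('a) * (score_const * exp (\<gamma> - dim * real k - \<gamma> * lam))) * layer_sum a l lam k"
      using score_const_nonneg by (simp add: ennreal_mult mult.assoc)
    also have "\<dots> \<le> ennreal ?c * layer_sum a l lam k"
    proof (intro mult_right_mono ennreal_leI)
      have "real (mesh (k - a)) ^ DIM('a) \<le> (2 * exp (real (k - a))) ^ DIM('a)" by (intro power_mono mesh) auto
      also have "\<dots> = 2 ^ DIM('a) * exp (dim * (real k - real a))"
        using k by (simp add: power_mult_distrib dim_def of_nat_diff flip: exp_of_nat_mult)
      finally have "real (mesh (k - a)) ^ DIM('a) * (score_const * exp (\<gamma> - dim * real k - \<gamma> * lam)) \<le>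
        2 ^ DIM('a) * exp (dim * (real k - real a)) * (score_const * exp (\<gamma> - dim * real k - \<gamma> * lam))"
        using score_const_nonneg by (intro mult_right_mono) auto
      also have "\<dots> = 2 ^ DIM('a) * score_const * (exp (dim * (real k - real a)) * exp (\<gamma> - dim * real k - \<gamma> * lam))" by simp
      also have "exp (dim * (real k - real a)) * exp (\<gamma> - dim * real k - \<gamma> * lam) = exp \<gamma> * exp (- dim * real a) * exp (- \<gamma> * lam)"
        unfolding exp_add[symmetric] by (simp add: algebra_simps)
      finally show "real (mesh (k - a)) ^ DIM('a) * (score_const * exp (\<gamma> - dim * real k - \<gamma> * lam)) \<le> ?c"
        by (simp only: mult.assoc)
    qed simp
    finally show "(\<Sum>v\<in>(idx (mesh (k - a)) :: ('a \<Rightarrow> nat) set). ennreal (score_const * exp (\<gamma> - dim * real k - \<gamma> * lam)) * layer_sum a l lam k) \<le> ennreal ?c * layer_sum a l lam k" .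
  qed
  also have "\<dots> = ennreal ?c * (\<Sum>k\<in>{a<..T}. layer_sum a l lam k)" by (rule sum_distrib_left[symmetric])
  also have "\<dots> \<le> ennreal ?c * ennreal (layer_const * ((1 + l) / sqrt (real a + 1)))"
    by (intro mult_left_mono sum_layer_sum_le assms) simp
  also have "\<dots> = ennreal (?c * (layer_const * ((1 + l) / sqrt (real a + 1))))"
    using c layer_const_nonneg assms by (intro ennreal_mult[symmetric]) auto
  also have "?c * (layer_const * ((1 + l) / sqrt (real a + 1))) =
    total_score_const * exp (- dim * real a) * exp (- \<gamma> * lam) * ((1 + l) / sqrt (real a + 1))"
    unfolding total_score_const_def by (simp only: mult_ac)
  finally show ?thesis .
qed

text \<open>At the first scale where some point of the cube crosses \<open>lam\<close>, all points
  of its cell have respected the barrier so far, and the score of this cell alone is at least 1.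
  Strong induction over k, for all points at once, expresses this choice of first scale.\<close>

lemma below_barrier:
  assumes \<omega>: "\<omega> \<in> space P" and score: "total_score a l lam T p \<omega> < 1"
    and before: "\<And>y j. y \<in> hcube p (exp (- real a)) \<Longrightarrow> 1 \<le> j \<Longrightarrow> j \<le> a \<Longrightarrow> S j y \<omega> \<le> l"
    and k: "a < k" "k \<le> T" and x: "x \<in> hcube p (exp (- real a))"
  shows "S k x \<omega> \<le> lam"
  using k x
proof (induction k arbitrary: x rule: less_induct)
  case (less k)
  show ?case
  proof (rule ccontr)
    assume "\<not> S k x \<omega> \<le> lam"
    then have gt: "lam < S k x \<omega>" by simp
    let ?N = "mesh (k - a)" and ?e = "exp (- real a)"
    let ?v = "cell_of p ?e ?N x"
    let ?s = "?e / real ?N"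
    have v: "?v \<in> idx ?N" by (rule cell_of_idx[OF less.prems(3)]) (auto intro: mesh)
    have xin: "x \<in> hcube (vert p ?s ?v) ?s" by (rule mem_hcube_cell_of[OF less.prems(3)]) (auto intro: mesh)
    have sub: "hcube (vert p ?s ?v) ?s \<subseteq> hcube p ?e" by (rule hcube_vert_subset[OF _ _ v]) (auto intro: mesh)
    have st: "stay (barrier a l lam) (k - 1) y \<omega> = 1" if y: "y \<in> hcube (vert p ?s ?v) ?s" for y
      unfolding stay_eq
    proof (simp, intro ballI)
      fix j assume j: "j \<in> {Suc 0..k - Suc 0}"
      have y': "y \<in> hcube p ?e" using y sub by auto
      show "S j y \<omega> \<le> barrier a l lam j"
      proof (cases "j \<le> a")
        case True
        then show ?thesis using before[OF y', of j] j by (simp add: barrier_def)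
      next
        case False
        then show ?thesis using less.IH[of j y] j y' less.prems by (simp add: barrier_def)
      qed
    qed
    have "1 \<le> cell_score (barrier a l lam) k lam (vert p ?s ?v) ?s \<omega>"
      using mesh(1)[of "k - a"] by (intro one_le_cell_score[OF \<omega> xin _ gt] st) auto
    also have "\<dots> \<le> (\<Sum>v\<in>idx ?N. cell_score (barrier a l lam) k lam (vert p ?s v) ?s \<omega>)"
      using v by (intro member_le_sum) auto
    also have "\<dots> \<le> total_score a l lam T p \<omega>"
      unfolding total_score_def
      using less.prems by (intro member_le_sum[of k "{a<..T}" "\<lambda>k. \<Sum>v\<in>idx (mesh (k - a)).
        cell_score (barrier a l lam) k lam (vert p (exp (- real a) / real (mesh (k - a))) v) (exp (- real a) / real (mesh (k - a))) \<omega>"]) auto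
    finally show False using score by simp
  qed
qed

end

section \<open>The mass of a cube\<close>

lemma norm_diff_hcube_le:
  fixes x :: "'a::euclidean_space"
  assumes "x \<in> hcube p s" "y \<in> hcube p s"
  shows "norm (x - y) \<le> real DIM('a) * s"
proof -
  have "norm (x - y) \<le> (\<Sum>b\<in>Basis. \<bar>(x - y) \<bullet> b\<bar>)" by (rule norm_le_l1)
  also have "\<dots> \<le> (\<Sum>b\<in>(Basis::'a set). s)"
    using assms by (intro sum_mono) (auto simp: hcube_def inner_diff_left abs_le_iff intro: less_imp_le; fastforce)
  finally show ?thesis by simp
qed

lemma emeasure_ge_1_le:
  assumes [measurable]: "U \<in> borel_measurable M"
  shows "emeasure M {\<omega> \<in> space M. 1 \<le> c * U \<omega>} \<le> c * (\<integral>\<^sup>+\<omega>. U \<omega> \<partial>M)"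
  using nn_integral_Markov_inequality[of U "space M" M c]
  by (simp add: nn_integral_set_ennreal cong: nn_integral_cong_simp)

context star_field
begin

definition total_mass :: "nat \<Rightarrow> 'a set \<Rightarrow> 'w \<Rightarrow> ennreal" where
  "total_mass T c \<omega> = (\<integral>\<^sup>+x. indicator c x * L T x \<omega> \<partial>lborel)"

lemma measurable_total_mass [measurable]:
  assumes [measurable]: "c \<in> sets borel"
  shows "total_mass T c \<in> borel_measurable P"
proof -
  have "(\<lambda>\<omega>. \<integral>\<^sup>+x. (\<lambda>p. indicator c (snd p) * L T (snd p) (fst p)) (\<omega>, x) \<partial>lborel) \<in> borel_measurable P"
    by (rule lborel.borel_measurable_nn_integral_fst) measurable
  then show ?thesis unfolding total_mass_def[abs_def] by simp
qed

definition count_const :: real where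
  "count_const = total_score_const + second_moment_const dim"

lemma count_const_nonneg: "0 \<le> count_const"
  unfolding count_const_def using total_score_const_nonneg second_moment_const_nonneg dim_ge_1 by simp

text \<open>If the score is below 1 the truncation removes nothing, so a mass above w forces either
  a score of at least 1 or a large truncated mass, and Markov's inequality bounds both. The
  threshold for T depends on w and l, the bound does not depend on T.\<close>

lemma large_mass_eventually:
  assumes l: "0 \<le> l" and w: "0 < w" and G [measurable]: "G \<in> events"
    and good: "\<And>\<omega> y j. \<omega> \<in> G \<Longrightarrow> y \<in> hcube p (exp (- real a)) \<Longrightarrow> 1 \<le> j \<Longrightarrow> j \<le> a \<Longrightarrow> S j y \<omega> \<le> l"
  shows "\<exists>T0. \<forall>T\<ge>T0. emeasure P {\<omega> \<in> G. ennreal w < ennreal (sqrt (real T)) * total_mass T (hcube p (exp (- real a))) \<omega>} \<le>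
    ennreal (count_const * exp (- dim * real a) * ((1 + l) / sqrt (real a + 1)) / w)"
proof -
  \<comment> \<open>At this level the crossing probability and the Chebyshev bound for the truncated mass are both of
    order \<open>1 / w\<close>.\<close>
  define lam where "lam = ln w / \<gamma>"
  let ?c = "hcube p (exp (- real a))" and ?f = "barrier a l lam"
  let ?r = "exp (- dim * real a) * ((1 + l) / sqrt (real a + 1))"
  have g0: "\<gamma> \<noteq> 0" using gamma_ge by auto
  have el: "exp (\<gamma> * lam) = w" "exp (- \<gamma> * lam) = 1 / w"
    using w g0 by (simp_all add: lam_def exp_minus inverse_eq_divide)
  have r: "0 \<le> ?r" using l by simp
  have cm: "emeasure lborel ?c = ennreal (exp (- dim * real a))"
    by (simp add: emeasure_hcube dim_def flip: exp_of_nat_mult)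
  obtain T0 where T0: "\<And>T. T0 \<le> T \<Longrightarrow> (\<integral>\<^sup>+\<omega>. ennreal (real T) * (trunc_mass ?f T ?c \<omega> * trunc_mass ?f T ?c \<omega>) \<partial>P) \<le>
    emeasure lborel ?c * ennreal (second_moment_const dim * exp (\<gamma> * lam) * ((1 + l) / sqrt (real a + 1)))"
    using second_moment_eventually[of dim l ?c a lam] norm_diff_hcube_le[of _ p "exp (- real a)"] l dim_ge_1 by (force simp: dim_def)
  have "emeasure P {\<omega> \<in> G. ennreal w < ennreal (sqrt (real T)) * total_mass T ?c \<omega>} \<le> ennreal (count_const * ?r / w)"
    if T: "max T0 (Suc a) \<le> T" for T
  proof -
    let ?U = "total_score a l lam T p" and ?M = "\<lambda>\<omega>. ennreal (real T) * (trunc_mass ?f T ?c \<omega> * trunc_mass ?f T ?c \<omega>)"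
    have [measurable]: "?M \<in> borel_measurable P" by measurable
    have sub: "{\<omega> \<in> G. ennreal w < ennreal (sqrt (real T)) * total_mass T ?c \<omega>} \<subseteq>
      {\<omega> \<in> space P. 1 \<le> ?U \<omega>} \<union> {\<omega> \<in> space P. 1 \<le> ennreal (1 / w\<^sup>2) * ?M \<omega>}"
    proof
      fix \<omega> assume \<omega>: "\<omega> \<in> {\<omega> \<in> G. ennreal w < ennreal (sqrt (real T)) * total_mass T ?c \<omega>}"
      then have \<omega>P: "\<omega> \<in> space P" using sets.sets_into_space[OF G] by auto
      show "\<omega> \<in> {\<omega> \<in> space P. 1 \<le> ?U \<omega>} \<union> {\<omega> \<in> space P. 1 \<le> ennreal (1 / w\<^sup>2) * ?M \<omega>}"
      proof (cases "1 \<le> ?U \<omega>")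
        case False
        then have U: "?U \<omega> < 1" by simp
        have "stay ?f T x \<omega> = 1" if x: "x \<in> ?c" for x
          unfolding stay_eq
        proof (simp, intro ballI)
          fix j assume j: "j \<in> {Suc 0..T}"
          show "S j x \<omega> \<le> ?f j"
          proof (cases "j \<le> a")
            case True
            then show ?thesis using good[of \<omega> x j] \<omega> x j by (simp add: barrier_def)
          next
            case False
            then show ?thesis using below_barrier[OF \<omega>P U _ _ _ x, of j] good[of \<omega>] \<omega> j by (simp add: barrier_def)
          qed
        qed
        then have eq: "total_mass T ?c \<omega> = trunc_mass ?f T ?c \<omega>"
          unfolding total_mass_def trunc_mass_def by (intro nn_integral_cong) (auto simp: indicator_def)
        let ?t = "ennreal (sqrt (real T)) * trunc_mass ?f T ?c \<omega>"
        have "ennreal w * ennreal w \<le> ?t * ?t"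
          using \<omega> eq by (intro mult_mono) auto
        also have "\<dots> = ?M \<omega>"
        proof -
          have "ennreal (sqrt (real T)) * ennreal (sqrt (real T)) = ennreal (real T)" by (subst ennreal_mult[symmetric]) auto
          moreover have "x * y * (x * y) = (x * x) * (y * y)" for x y :: ennreal by (simp only: mult_ac)
          ultimately show ?thesis by metis
        qed
        finally have "ennreal (1 / w\<^sup>2) * (ennreal w * ennreal w) \<le> ennreal (1 / w\<^sup>2) * ?M \<omega>" by (rule mult_left_mono) simp
        moreover have "ennreal (1 / w\<^sup>2) * (ennreal w * ennreal w) = 1"
          using w by (simp add: ennreal_mult[symmetric] power2_eq_square)
        ultimately show ?thesis using \<omega>P by simp
      qed (use \<omega>P in auto)
    qed
    have "emeasure P {\<omega> \<in> G. ennreal w < ennreal (sqrt (real T)) * total_mass T ?c \<omega>} \<le>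
      emeasure P ({\<omega> \<in> space P. 1 \<le> ?U \<omega>} \<union> {\<omega> \<in> space P. 1 \<le> ennreal (1 / w\<^sup>2) * ?M \<omega>})"
      by (rule emeasure_mono[OF sub]) measurable
    also have "\<dots> \<le> emeasure P {\<omega> \<in> space P. 1 \<le> ?U \<omega>} + emeasure P {\<omega> \<in> space P. 1 \<le> ennreal (1 / w\<^sup>2) * ?M \<omega>}"
      by (rule emeasure_subadditive) measurable
    also have "\<dots> \<le> ennreal (total_score_const * ?r / w) + ennreal (second_moment_const dim * ?r / w)"
    proof (rule add_mono)
      have "emeasure P {\<omega> \<in> space P. 1 \<le> ?U \<omega>} \<le> (\<integral>\<^sup>+\<omega>. ?U \<omega> \<partial>P)"
        using emeasure_ge_1_le[of ?U P 1] by simp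
      also have "\<dots> \<le> ennreal (total_score_const * exp (- dim * real a) * exp (- \<gamma> * lam) * ((1 + l) / sqrt (real a + 1)))"
        by (rule total_score_le[OF l])
      also have "total_score_const * exp (- dim * real a) * exp (- \<gamma> * lam) * ((1 + l) / sqrt (real a + 1)) = total_score_const * ?r / w"
        unfolding el by (simp add: mult_ac)
      finally show "emeasure P {\<omega> \<in> space P. 1 \<le> ?U \<omega>} \<le> ennreal (total_score_const * ?r / w)" .
      have "emeasure P {\<omega> \<in> space P. 1 \<le> ennreal (1 / w\<^sup>2) * ?M \<omega>} \<le> ennreal (1 / w\<^sup>2) * (\<integral>\<^sup>+\<omega>. ?M \<omega> \<partial>P)"
        by (rule emeasure_ge_1_le) measurable
      also have "\<dots> \<le> ennreal (1 / w\<^sup>2) * (emeasure lborel ?c * ennreal (second_moment_const dim * exp (\<gamma> * lam) * ((1 + l) / sqrt (real a + 1))))"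
        using T by (intro mult_left_mono T0) auto
      also have "\<dots> = ennreal (1 / w\<^sup>2 * (exp (- dim * real a) * (second_moment_const dim * exp (\<gamma> * lam) * ((1 + l) / sqrt (real a + 1)))))"
        unfolding cm using second_moment_const_nonneg[of dim] dim_ge_1 l w
        by (subst ennreal_mult[symmetric], simp, simp, subst ennreal_mult[symmetric]) auto
      also have "1 / w\<^sup>2 * (exp (- dim * real a) * (second_moment_const dim * exp (\<gamma> * lam) * ((1 + l) / sqrt (real a + 1)))) = second_moment_const dim * ?r / w"
        unfolding el using w by (simp add: power2_eq_square mult_ac)
      finally show "emeasure P {\<omega> \<in> space P. 1 \<le> ennreal (1 / w\<^sup>2) * ?M \<omega>} \<le> ennreal (second_moment_const dim * ?r / w)" .
    qed
    also have "\<dots> = ennreal (count_const * ?r / w)"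
      unfolding count_const_def using total_score_const_nonneg second_moment_const_nonneg[of dim] dim_ge_1 r w
      by (subst ennreal_plus[symmetric]) (auto simp: distrib_right add_divide_distrib)
    finally show ?thesis .
  qed
  then show ?thesis by (intro exI[of _ "max T0 (Suc a)"]) (auto simp: mult.assoc)
qed

text \<open>The score of the unit cube over the scales 1 to a, with the level l in the role of
  \<open>lam\<close>. The start at time 0 makes the first-phase barrier an empty condition.\<close>

definition good_event :: "nat \<Rightarrow> real \<Rightarrow> 'w set" where
  "good_event a l = {\<omega> \<in> space P. total_score 0 0 l a 0 \<omega> < 1}"

lemma good_event [measurable]: "good_event a l \<in> events"
  unfolding good_event_def by measurable

lemma good_event_barrier:
  assumes "\<omega> \<in> good_event a l" "y \<in> hcube 0 1" "1 \<le> j" "j \<le> a"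
  shows "S j y \<omega> \<le> l"
  using below_barrier[of \<omega> 0 0 l a 0 j y] assms by (auto simp: good_event_def)

lemma good_event_compl: "emeasure P (space P - good_event a l) \<le> ennreal (total_score_const * exp (- \<gamma> * l))"
proof -
  have "space P - good_event a l = {\<omega> \<in> space P. 1 \<le> total_score 0 0 l a 0 \<omega>}" by (auto simp: good_event_def not_less)
  then have "emeasure P (space P - good_event a l) \<le> (\<integral>\<^sup>+\<omega>. total_score 0 0 l a 0 \<omega> \<partial>P)"
    using emeasure_ge_1_le[of "total_score 0 0 l a 0" P 1] by simp
  also have "\<dots> \<le> ennreal (total_score_const * exp (- \<gamma> * l))"
    using total_score_le[of 0 0 l a 0] by simp
  finally show ?thesis .
qed

end

section \<open>Passage to the limit\<close>

lemma measurable_nn_integral_random_measure: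
  fixes M :: "'w \<Rightarrow> 'a::euclidean_space measure"
  assumes M: "random_measure P M" and f: "f \<in> borel_measurable borel"
  shows "(\<lambda>\<omega>. \<integral>\<^sup>+x. f x \<partial>M \<omega>) \<in> borel_measurable P"
proof -
  have sM: "sets (M \<omega>) = sets borel" if "\<omega> \<in> space P" for \<omega> using M that by (simp add: random_measure_def)
  have mM: "g \<in> borel_measurable (M \<omega>)" if "\<omega> \<in> space P" "g \<in> borel_measurable borel" for g :: "'a \<Rightarrow> ennreal" and \<omega>
    using that(2) measurable_cong_sets[OF sM[OF that(1)] refl, of borel] by blast
  from f show ?thesis
  proof (induction rule: borel_measurable_induct)
    case (cong f g)
    have "f = g" using cong(3) by (auto simp: fun_eq_iff)
    then show ?case using cong(4) by simp
  next
    case (set A)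
    have m: "(\<lambda>\<omega>. emeasure (M \<omega>) A) \<in> borel_measurable P" using M set by (auto simp: random_measure_def)
    have "(\<integral>\<^sup>+x. indicator A x \<partial>M \<omega>) = emeasure (M \<omega>) A" if "\<omega> \<in> space P" for \<omega>
      using set sM[OF that] by (intro nn_integral_indicator) simp
    then show ?case using m by (simp cong: measurable_cong)
  next
    case (mult u c)
    have m: "(\<lambda>\<omega>. c * (\<integral>\<^sup>+x. u x \<partial>M \<omega>)) \<in> borel_measurable P"
      using mult(4) by measurable
    have "(\<integral>\<^sup>+x. c * u x \<partial>M \<omega>) = c * (\<integral>\<^sup>+x. u x \<partial>M \<omega>)" if "\<omega> \<in> space P" for \<omega>
      by (rule nn_integral_cmult[OF mM[OF that mult(2)]])
    then show ?case using m by (simp cong: measurable_cong)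
  next
    case (add u v)
    have m: "(\<lambda>\<omega>. (\<integral>\<^sup>+x. v x \<partial>M \<omega>) + (\<integral>\<^sup>+x. u x \<partial>M \<omega>)) \<in> borel_measurable P"
      using add.IH by measurable
    have "(\<integral>\<^sup>+x. v x + u x \<partial>M \<omega>) = (\<integral>\<^sup>+x. v x \<partial>M \<omega>) + (\<integral>\<^sup>+x. u x \<partial>M \<omega>)" if "\<omega> \<in> space P" for \<omega>
      using add.hyps by (intro nn_integral_add mM that)
    then show ?case using m by (simp cong: measurable_cong)
  next
    case (seq U)
    have m: "(\<lambda>\<omega>. SUP i. (\<integral>\<^sup>+x. U i x \<partial>M \<omega>)) \<in> borel_measurable P" using seq.IH by measurable
    have "(\<integral>\<^sup>+x. (SUP i. U i) x \<partial>M \<omega>) = (SUP i. (\<integral>\<^sup>+x. U i x \<partial>M \<omega>))" if "\<omega> \<in> space P" for \<omega>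
      using seq.hyps unfolding SUP_apply by (intro nn_integral_monotone_convergence_SUP mM that) auto
    then show ?case using m by (simp cong: measurable_cong)
  qed
qed

definition cutoff :: "'a::euclidean_space set \<Rightarrow> nat \<Rightarrow> 'a \<Rightarrow> real" where
  "cutoff U i x = min 1 (real i * infdist x (- U))"

lemma cutoff_bounds: "0 \<le> cutoff U i x" "cutoff U i x \<le> 1"
  by (simp_all add: cutoff_def infdist_nonneg)

lemma cutoff_outside: "x \<notin> U \<Longrightarrow> cutoff U i x = 0"
  by (simp add: cutoff_def)

lemma cutoff_mono: "i \<le> k \<Longrightarrow> cutoff U i x \<le> cutoff U k x"
  unfolding cutoff_def by (intro min.mono mult_right_mono infdist_nonneg) auto

lemma continuous_cutoff: "continuous_on UNIV (cutoff U i)"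
  unfolding cutoff_def by (intro continuous_on_min continuous_on_mult continuous_on_const continuous_on_infdist continuous_on_id)

lemma cutoff_Cc:
  fixes U :: "'a::euclidean_space set"
  assumes "bounded U"
  shows "cutoff U i \<in> Cc"
proof -
  have "supp (cutoff U i) \<subseteq> closure U"
    unfolding supp_def using cutoff_outside[of _ U i] by (intro closure_mono) auto
  moreover have "closed (supp (cutoff U i))" by (simp add: supp_def)
  moreover have "bounded (closure U)" using assms by (rule bounded_closure)
  ultimately have "compact (supp (cutoff U i))" by (meson bounded_subset compact_eq_bounded_closed)
  then show ?thesis by (simp add: Cc_def continuous_cutoff)
qed

lemma SUP_cutoff:
  fixes U :: "'a::euclidean_space set"
  assumes "open U" "U \<noteq> UNIV"
  shows "(SUP i. ennreal (cutoff U i x)) = indicator U x"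
proof (cases "x \<in> U")
  case True
  then have pos: "0 < infdist x (- U)"
    using assms by (intro infdist_pos_not_in_closed) auto
  then obtain i where i: "1 / infdist x (- U) < real i" using reals_Archimedean2 by blast
  then have "cutoff U i x = 1" using pos by (simp add: cutoff_def field_simps)
  then have "1 \<le> (SUP i. ennreal (cutoff U i x))" by (intro SUP_upper2[of i]) auto
  moreover have "(SUP i. ennreal (cutoff U i x)) \<le> 1"
    using cutoff_bounds(2)[of U _ x] by (intro SUP_least) (simp add: ennreal_le_1)
  ultimately have "(SUP i. ennreal (cutoff U i x)) = 1" by (rule order_antisym[rotated])
  then show ?thesis using True by simp
qed (simp add: cutoff_outside)

context star_field
begin

abbreviation approx :: "real \<Rightarrow> 'w \<Rightarrow> 'a measure" where
  "approx t \<omega> \<equiv> density lborel (\<lambda>x. ennreal (sqrt t * exp (\<gamma> * X t \<omega> x - dim * t)))"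

text \<open>A limit above 2 * w forces the approximation above w unless the two differ by at least
  w; the latter has vanishing probability. Only the sequence of integer times is used.\<close>

lemma nn_integral_limit_le:
  fixes M :: "'w \<Rightarrow> 'a measure"
  assumes M: "random_measure P M" and lim: "weak_star_limit_in_probability P approx M"
    and G [measurable]: "G \<in> events" and w: "0 < w" and c [measurable]: "c \<in> sets borel"
    and \<phi>: "\<phi> \<in> Cc" "\<And>x. 0 \<le> \<phi> x" "\<And>x. \<phi> x \<le> indicator c x"
    and ev: "\<exists>T0. \<forall>T\<ge>T0. emeasure P {\<omega> \<in> G. ennreal w < ennreal (sqrt (real T)) * total_mass T c \<omega>} \<le> b"
  shows "emeasure P {\<omega> \<in> G. ennreal (2 * w) < (\<integral>\<^sup>+x. \<phi> x \<partial>M \<omega>)} \<le> b"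
proof (rule ennreal_le_epsilon)
  fix e :: real assume "0 < e"
  have \<phi>m [measurable]: "\<phi> \<in> borel_measurable borel"
    using \<phi>(1) by (auto simp: Cc_def intro: borel_measurable_continuous_onI)
  have sM: "sets (M \<omega>) = sets borel" if "\<omega> \<in> space P" for \<omega> using M that by (simp add: random_measure_def)
  have \<phi>M: "\<phi> \<in> borel_measurable (M \<omega>)" if "\<omega> \<in> space P" for \<omega>
    using \<phi>m measurable_cong_sets[OF sM[OF that] refl, of borel] by blast
  have \<phi>N: "\<phi> \<in> borel_measurable (approx t \<omega>)" for t \<omega> by simp
  have GP: "G \<subseteq> space P" by (rule sets.sets_into_space[OF G])
  obtain T0 where T0: "\<And>T. T0 \<le> T \<Longrightarrow> emeasure P {\<omega> \<in> G. ennreal w < ennreal (sqrt (real T)) * total_mass T c \<omega>} \<le> b"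
    using ev by blast
  let ?A = "\<lambda>t. {\<omega> \<in> space P. \<exists>\<phi>'\<in>{\<phi>}. w \<le> \<bar>(LINT x|approx t \<omega>. \<phi>' x) - (LINT x|M \<omega>. \<phi>' x)\<bar>}"
  have "((\<lambda>t. measure P (?A t)) \<longlongrightarrow> 0) at_top"
    using lim[unfolded weak_star_limit_in_probability_def, rule_format, of "{\<phi>}" w] \<phi>(1) w by simp
  then have "(\<lambda>T. measure P (?A (real T))) \<longlonglongrightarrow> 0"
    by (rule filterlim_compose[OF _ filterlim_real_sequentially])
  then have "\<forall>\<^sub>F T in sequentially. measure P (?A (real T)) < e" using \<open>0 < e\<close> by (rule order_tendstoD)
  then obtain T1 where T1: "\<And>T. T1 \<le> T \<Longrightarrow> measure P (?A (real T)) < e" by (auto simp: eventually_sequentially)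
  define T where "T = max T0 T1"
  have nnA: "(\<integral>\<^sup>+x. \<phi> x \<partial>approx (real T) \<omega>) = (\<integral>\<^sup>+x. ennreal (sqrt (real T)) * (L T x \<omega> * ennreal (\<phi> x)) \<partial>lborel)"
    if \<omega>: "\<omega> \<in> space P" for \<omega>
  proof -
    have [measurable]: "X (real T) \<omega> \<in> borel_measurable borel"
      using continuous_X[of "real T", OF _ \<omega>] by (intro borel_measurable_continuous_onI) simp
    have "(\<integral>\<^sup>+x. \<phi> x \<partial>approx (real T) \<omega>) = (\<integral>\<^sup>+x. ennreal (sqrt (real T) * exp (\<gamma> * X (real T) \<omega> x - dim * real T)) * ennreal (\<phi> x) \<partial>lborel)"
      by (rule nn_integral_density) auto
    then show ?thesis unfolding L_def by (simp add: ennreal_mult mult.assoc)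
  qed
  have nnN: "(\<integral>\<^sup>+x. \<phi> x \<partial>approx (real T) \<omega>) \<le> ennreal (sqrt (real T)) * total_mass T c \<omega>" if \<omega>: "\<omega> \<in> space P" for \<omega>
  proof -
    note [measurable] = measurable_L_lborel[OF \<omega>]
    have "ennreal (\<phi> x) \<le> indicator c x" for x
      using \<phi>(3)[of x] by (auto simp: indicator_def ennreal_le_1 ennreal_neg split: if_splits)
    then have "(\<integral>\<^sup>+x. \<phi> x \<partial>approx (real T) \<omega>) \<le> (\<integral>\<^sup>+x. ennreal (sqrt (real T)) * (L T x \<omega> * indicator c x) \<partial>lborel)"
      unfolding nnA[OF \<omega>] by (intro nn_integral_mono mult_left_mono) auto
    also have "\<dots> = ennreal (sqrt (real T)) * total_mass T c \<omega>"
      unfolding total_mass_def by (subst nn_integral_cmult) (measurable, simp add: mult.commute)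
    finally show ?thesis .
  qed
  have fin: "(\<integral>\<^sup>+x. \<phi> x \<partial>M \<omega>) < \<infinity>" if \<omega>: "\<omega> \<in> space P" for \<omega>
  proof -
    have K: "compact (supp \<phi>)" using \<phi>(1) by (simp add: Cc_def)
    have Ks: "supp \<phi> \<in> sets (M \<omega>)" using K sM[OF \<omega>] by (simp add: borel_compact)
    have "(\<integral>\<^sup>+x. \<phi> x \<partial>M \<omega>) \<le> (\<integral>\<^sup>+x. indicator (supp \<phi>) x \<partial>M \<omega>)"
    proof (rule nn_integral_mono)
      fix x
      have "\<phi> x \<le> 1" using order_trans[OF \<phi>(3)[of x] indicator_le_1] .
      moreover have "x \<notin> supp \<phi> \<Longrightarrow> \<phi> x = 0" using subsetD[OF closure_subset, of x "{x. \<phi> x \<noteq> 0}"] unfolding supp_def by fastforce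
      ultimately show "ennreal (\<phi> x) \<le> indicator (supp \<phi>) x" by (auto simp: indicator_def ennreal_le_1)
    qed
    also have "\<dots> = emeasure (M \<omega>) (supp \<phi>)" by (rule nn_integral_indicator[OF Ks])
    also have "\<dots> < \<infinity>" using M \<omega> K by (simp add: random_measure_def)
    finally show ?thesis .
  qed
  \<comment> \<open>A set that is not an event has \<open>measure\<close> 0 by convention, so
    convergence in probability bounds this set only once it is known to be measurable.\<close>
  have mA: "?A (real T) \<in> events"
  proof -
    have "(\<lambda>\<omega>. LINT x|M \<omega>. \<phi> x) \<in> borel_measurable P"
    proof -
      have "(\<lambda>\<omega>. enn2real (\<integral>\<^sup>+x. ennreal (\<phi> x) \<partial>M \<omega>)) \<in> borel_measurable P"
        using measurable_nn_integral_random_measure[OF M, of "\<lambda>x. ennreal (\<phi> x)"] by measurable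
      moreover have "(LINT x|M \<omega>. \<phi> x) = enn2real (\<integral>\<^sup>+x. ennreal (\<phi> x) \<partial>M \<omega>)" if "\<omega> \<in> space P" for \<omega>
        by (rule integral_eq_nn_integral[OF \<phi>M[OF that]]) (simp add: \<phi>(2))
      ultimately show ?thesis by (subst measurable_cong) assumption+
    qed
    moreover have "(\<lambda>\<omega>. LINT x|approx (real T) \<omega>. \<phi> x) \<in> borel_measurable P"
    proof -
      have "(\<lambda>\<omega>. \<integral>\<^sup>+x. (\<lambda>p. ennreal (sqrt (real T)) * (L T (snd p) (fst p) * ennreal (\<phi> (snd p)))) (\<omega>, x) \<partial>lborel) \<in> borel_measurable P"
        by (rule lborel.borel_measurable_nn_integral_fst) measurable
      then have "(\<lambda>\<omega>. enn2real (\<integral>\<^sup>+x. ennreal (sqrt (real T)) * (L T x \<omega> * ennreal (\<phi> x)) \<partial>lborel)) \<in> borel_measurable P"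
        by simp
      moreover have "(LINT x|approx (real T) \<omega>. \<phi> x) = enn2real (\<integral>\<^sup>+x. ennreal (sqrt (real T)) * (L T x \<omega> * ennreal (\<phi> x)) \<partial>lborel)"
        if "\<omega> \<in> space P" for \<omega>
        unfolding nnA[OF that, symmetric] by (rule integral_eq_nn_integral[OF \<phi>N]) (simp add: \<phi>(2))
      ultimately show ?thesis by (subst measurable_cong) assumption+
    qed
    ultimately show ?thesis by simp
  qed
  have "{\<omega> \<in> G. ennreal (2 * w) < (\<integral>\<^sup>+x. \<phi> x \<partial>M \<omega>)} \<subseteq> ?A (real T) \<union> {\<omega> \<in> G. ennreal w < ennreal (sqrt (real T)) * total_mass T c \<omega>}"
  proof
    fix \<omega> assume \<omega>: "\<omega> \<in> {\<omega> \<in> G. ennreal (2 * w) < (\<integral>\<^sup>+x. \<phi> x \<partial>M \<omega>)}"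
    then have \<omega>P: "\<omega> \<in> space P" using GP by auto
    show "\<omega> \<in> ?A (real T) \<union> {\<omega> \<in> G. ennreal w < ennreal (sqrt (real T)) * total_mass T c \<omega>}"
    proof (cases "\<omega> \<in> ?A (real T)")
      case False
      then have d: "\<bar>(LINT x|approx (real T) \<omega>. \<phi> x) - (LINT x|M \<omega>. \<phi> x)\<bar> < w" using \<omega>P by auto
      have "(LINT x|M \<omega>. \<phi> x) = enn2real (\<integral>\<^sup>+x. ennreal (\<phi> x) \<partial>M \<omega>)"
        by (rule integral_eq_nn_integral[OF \<phi>M[OF \<omega>P]]) (simp add: \<phi>(2))
      moreover have "2 * w < enn2real (\<integral>\<^sup>+x. ennreal (\<phi> x) \<partial>M \<omega>)"
        using \<omega> fin[OF \<omega>P] w by (cases "\<integral>\<^sup>+x. ennreal (\<phi> x) \<partial>M \<omega>") (auto simp: ennreal_less_iff)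
      ultimately have "w < (LINT x|approx (real T) \<omega>. \<phi> x)" using d by linarith
      also have "(LINT x|approx (real T) \<omega>. \<phi> x) = enn2real (\<integral>\<^sup>+x. ennreal (\<phi> x) \<partial>approx (real T) \<omega>)"
        by (rule integral_eq_nn_integral[OF \<phi>N]) (simp add: \<phi>(2))
      finally have "ennreal w < (\<integral>\<^sup>+x. ennreal (\<phi> x) \<partial>approx (real T) \<omega>)"
        using w by (cases "\<integral>\<^sup>+x. ennreal (\<phi> x) \<partial>approx (real T) \<omega>") (auto simp: ennreal_less_iff)
      then show ?thesis using nnN[OF \<omega>P] \<omega> by (auto intro: less_le_trans)
    qed simp
  qed
  then have "emeasure P {\<omega> \<in> G. ennreal (2 * w) < (\<integral>\<^sup>+x. \<phi> x \<partial>M \<omega>)} \<le>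
    emeasure P (?A (real T) \<union> {\<omega> \<in> G. ennreal w < ennreal (sqrt (real T)) * total_mass T c \<omega>})"
    using mA by (intro emeasure_mono) auto
  also have "\<dots> \<le> emeasure P (?A (real T)) + emeasure P {\<omega> \<in> G. ennreal w < ennreal (sqrt (real T)) * total_mass T c \<omega>}"
    using mA by (intro emeasure_subadditive) auto
  also have "\<dots> \<le> ennreal e + b"
  proof (rule add_mono)
    have "measure P (?A (real T)) \<le> e" using T1[of T] by (simp add: T_def)
    then show "emeasure P (?A (real T)) \<le> ennreal e" unfolding emeasure_eq_measure by (rule ennreal_leI)
    show "emeasure P {\<omega> \<in> G. ennreal w < ennreal (sqrt (real T)) * total_mass T c \<omega>} \<le> b"
      using T0[of T] by (simp add: T_def)
  qed
  finally show "emeasure P {\<omega> \<in> G. ennreal (2 * w) < (\<integral>\<^sup>+x. \<phi> x \<partial>M \<omega>)} \<le> b + ennreal e" by (simp add: add.commute)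
qed

text \<open>The cutoffs increase to the indicator of the open set, and because the inequality is
  strict the corresponding events increase to the event for U.\<close>

lemma emeasure_limit_le:
  fixes M :: "'w \<Rightarrow> 'a measure"
  assumes M: "random_measure P M" and lim: "weak_star_limit_in_probability P approx M"
    and G [measurable]: "G \<in> events" and w: "0 < w" and c [measurable]: "c \<in> sets borel"
    and U: "open U" "bounded U" "U \<subseteq> c"
    and ev: "\<exists>T0. \<forall>T\<ge>T0. emeasure P {\<omega> \<in> G. ennreal w < ennreal (sqrt (real T)) * total_mass T c \<omega>} \<le> b"
  shows "emeasure P {\<omega> \<in> G. ennreal (2 * w) < emeasure (M \<omega>) U} \<le> b"
proof -
  have GP: "G \<subseteq> space P" by (rule sets.sets_into_space[OF G])
  have sM: "sets (M \<omega>) = sets borel" if "\<omega> \<in> space P" for \<omega> using M that by (simp add: random_measure_def)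
  have "U \<noteq> UNIV" using U(2) not_bounded_UNIV by auto
  let ?I = "\<lambda>i \<omega>. \<integral>\<^sup>+x. ennreal (cutoff U i x) \<partial>M \<omega>"
  let ?E = "\<lambda>i. {\<omega> \<in> G. ennreal (2 * w) < ?I i \<omega>}"
  have [measurable]: "cutoff U i \<in> borel_measurable borel" for i
    by (rule borel_measurable_continuous_onI[OF continuous_cutoff])
  have Im [measurable]: "?I i \<in> borel_measurable P" for i
    by (rule measurable_nn_integral_random_measure[OF M]) measurable
  have SUP: "(SUP i. ?I i \<omega>) = emeasure (M \<omega>) U" if \<omega>: "\<omega> \<in> space P" for \<omega>
  proof -
    have "(SUP i. ?I i \<omega>) = (\<integral>\<^sup>+x. (SUP i. ennreal (cutoff U i x)) \<partial>M \<omega>)"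
    proof (rule nn_integral_monotone_convergence_SUP[symmetric])
      show "incseq (\<lambda>i x. ennreal (cutoff U i x))"
        by (auto simp: incseq_def le_fun_def intro!: ennreal_leI cutoff_mono)
      have "(\<lambda>x. ennreal (cutoff U i x)) \<in> borel_measurable borel" for i by measurable
      then show "(\<lambda>x. ennreal (cutoff U i x)) \<in> borel_measurable (M \<omega>)" for i
        using measurable_cong_sets[OF sM[OF \<omega>] refl, of borel] by blast
    qed
    also have "\<dots> = (\<integral>\<^sup>+x. indicator U x \<partial>M \<omega>)" by (simp only: SUP_cutoff[OF U(1) \<open>U \<noteq> UNIV\<close>])
    also have "\<dots> = emeasure (M \<omega>) U" using U(1) sM[OF \<omega>] by (intro nn_integral_indicator) simp
    finally show ?thesis .
  qed
  have "{\<omega> \<in> G. ennreal (2 * w) < emeasure (M \<omega>) U} = (\<Union>i. ?E i)"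
  proof (rule set_eqI)
    fix \<omega>
    show "\<omega> \<in> {\<omega> \<in> G. ennreal (2 * w) < emeasure (M \<omega>) U} \<longleftrightarrow> \<omega> \<in> (\<Union>i. ?E i)"
    proof (cases "\<omega> \<in> G")
      case True
      then show ?thesis using SUP[OF subsetD[OF GP True], symmetric] by (simp only: less_SUP_iff mem_Collect_eq UN_iff) auto
    qed simp
  qed
  also have "emeasure P (\<Union>i. ?E i) = (SUP i. emeasure P (?E i))"
  proof (rule SUP_emeasure_incseq[symmetric])
    show "incseq ?E"
    proof (rule incseq_SucI, rule subsetI)
      fix i \<omega> assume "\<omega> \<in> ?E i"
      moreover have "?I i \<omega> \<le> ?I (Suc i) \<omega>" by (intro nn_integral_mono ennreal_leI cutoff_mono) simp
      ultimately show "\<omega> \<in> ?E (Suc i)" by (auto intro: less_le_trans)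
    qed
    show "range ?E \<subseteq> events" by auto
  qed
  also have "\<dots> \<le> b"
  proof (rule SUP_least)
    fix i
    show "emeasure P (?E i) \<le> b"
    proof (rule nn_integral_limit_le[OF M lim G w c cutoff_Cc[OF U(2)] cutoff_bounds(1) _ ev])
      fix x show "cutoff U i x \<le> indicator c x"
        using cutoff_bounds(2)[of U i x] cutoff_outside[of x U i] U(3) by (cases "x \<in> U") (auto simp: indicator_def)
    qed
  qed
  finally show ?thesis .
qed

end

section \<open>Tails and moments of the power variation\<close>

lemma ennreal_le_suminf: "f i \<le> (\<Sum>i. f i :: ennreal)"
  using sum_le_suminf[of f "{i}"] by (simp add: summableI)

text \<open>Dyadic summation: between 2 ^ i and 2 ^ Suc i the power is at most (2 powr q) ^ Suc i,
  and the logarithm becomes at most i + 1 as ln 2 < 1. With \<theta> = 2 powr q / 2 < 1 the series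
  is the derivative of the geometric one.\<close>

lemma (in prob_space) nn_integral_powr_le_of_tail:
  fixes Z :: "'a \<Rightarrow> real"
  assumes q: "0 < q" "q < 1" and C: "0 \<le> C" and Z [measurable]: "Z \<in> borel_measurable M"
    and Z0: "\<And>\<omega>. 0 \<le> Z \<omega>"
    and tail: "\<And>z. 1 \<le> z \<Longrightarrow> emeasure M {\<omega> \<in> space M. z < Z \<omega>} \<le> ennreal (C * (1 + ln z) / z)"
  shows "(\<integral>\<^sup>+\<omega>. ennreal (Z \<omega> powr q) \<partial>M) \<le> ennreal (1 + C * 2 powr q * (1 / (1 - 2 powr q / 2)\<^sup>2))"
proof -
  define \<theta> where "\<theta> = 2 powr q / (2::real)"
  have "2 powr q < 2 powr (1::real)" using q by (intro powr_less_mono) auto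
  then have \<theta>: "0 \<le> \<theta>" "\<theta> < 1" by (simp_all add: \<theta>_def)
  let ?A = "\<lambda>i::nat. {\<omega> \<in> space M. 2 ^ i < Z \<omega>}"
  let ?c = "\<lambda>i::nat. (2 powr q) ^ Suc i :: real"
  have "(\<integral>\<^sup>+\<omega>. ennreal (Z \<omega> powr q) \<partial>M) \<le> (\<integral>\<^sup>+\<omega>. 1 + (\<Sum>i. ennreal (?c i) * indicator (?A i) \<omega>) \<partial>M)"
  proof (rule nn_integral_mono)
    fix \<omega> assume \<omega>: "\<omega> \<in> space M"
    show "ennreal (Z \<omega> powr q) \<le> 1 + (\<Sum>i. ennreal (?c i) * indicator (?A i) \<omega>)"
    proof (cases "Z \<omega> \<le> 1")
      case True
      then have "Z \<omega> powr q \<le> 1" using Z0[of \<omega>] q by (simp add: powr_le1)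
      then have "ennreal (Z \<omega> powr q) \<le> 1" by (simp add: ennreal_le_1)
      then show ?thesis by (rule order_trans) simp
    next
      case False
      obtain m where m: "Z \<omega> < 2 ^ m" using real_arch_pow[of 2 "Z \<omega>"] by auto
      define i where "i = (LEAST i. Z \<omega> \<le> 2 ^ Suc i)"
      have "Z \<omega> \<le> 2 ^ Suc m" using m power_increasing[of m "Suc m" "2::real"] by linarith
      then have i: "Z \<omega> \<le> 2 ^ Suc i" unfolding i_def by (rule LeastI)
      have i2: "2 ^ i < Z \<omega>"
      proof (cases i)
        case (Suc k)
        then have "\<not> Z \<omega> \<le> 2 ^ Suc k" unfolding i_def by (intro not_less_Least) simp
        then show ?thesis using Suc by simp
      qed (use False in simp)
      have "Z \<omega> powr q \<le> (2 ^ Suc i) powr q" using i Z0 q by (intro powr_mono2) auto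
      also have "(2 ^ Suc i) powr q = ?c i" by (simp add: powr_mult powr_powr powr_power mult.commute[of q] flip: powr_realpow)
      finally have "ennreal (Z \<omega> powr q) \<le> ennreal (?c i) * indicator (?A i) \<omega>"
        using i2 \<omega> by (simp add: ennreal_leI)
      also have "\<dots> \<le> (\<Sum>i. ennreal (?c i) * indicator (?A i) \<omega>)"
        by (rule ennreal_le_suminf)
      finally show ?thesis by (rule order_trans) simp
    qed
  qed
  also have "\<dots> = 1 + (\<Sum>i. ennreal (?c i) * emeasure M (?A i))"
    by (simp add: nn_integral_add nn_integral_suminf nn_integral_cmult_indicator emeasure_space_1)
  also have "\<dots> \<le> 1 + (\<Sum>i. ennreal (C * 2 powr q * (real (Suc i) * \<theta> ^ i)))"
  proof (intro add_left_mono suminf_le summableI)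
    fix i
    have "emeasure M (?A i) \<le> ennreal (C * (1 + ln (2 ^ i)) / 2 ^ i)" by (rule tail) simp
    also have "\<dots> \<le> ennreal (C * real (Suc i) / 2 ^ i)"
      using C ln_2_less_1 by (intro ennreal_leI divide_right_mono mult_left_mono) (auto simp: ln_realpow mult_left_le)
    finally have "ennreal (?c i) * emeasure M (?A i) \<le> ennreal (?c i) * ennreal (C * real (Suc i) / 2 ^ i)"
      by (rule mult_left_mono) simp
    also have "\<dots> = ennreal (?c i * (C * real (Suc i) / 2 ^ i))" using C by (intro ennreal_mult[symmetric]) auto
    also have "?c i * (C * real (Suc i) / 2 ^ i) = C * 2 powr q * (real (Suc i) * \<theta> ^ i)"
      by (simp add: \<theta>_def power_divide mult_ac)
    finally show "ennreal (?c i) * emeasure M (?A i) \<le> ennreal (C * 2 powr q * (real (Suc i) * \<theta> ^ i))" .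
  qed
  also have "(\<Sum>i. ennreal (C * 2 powr q * (real (Suc i) * \<theta> ^ i))) = ennreal (C * 2 powr q * (1 / (1 - \<theta>)\<^sup>2))"
  proof (rule suminf_ennreal_eq)
    show "0 \<le> C * 2 powr q * (real (Suc i) * \<theta> ^ i)" for i using C \<theta> by simp
    show "(\<lambda>i. C * 2 powr q * (real (Suc i) * \<theta> ^ i)) sums (C * 2 powr q * (1 / (1 - \<theta>)\<^sup>2))"
      using \<theta> by (intro sums_mult geometric_deriv_sums) simp
  qed
  also have "1 + ennreal (C * 2 powr q * (1 / (1 - \<theta>)\<^sup>2)) = ennreal (1 + C * 2 powr q * (1 / (1 - \<theta>)\<^sup>2))"
    using C by (subst ennreal_plus) auto
  finally show ?thesis unfolding \<theta>_def .
qed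

text \<open>The 1 counts the summands above y; the rest is the geometric series for the truncated
  \<beta>-th powers, with ratio below 1 because \<beta> > 1.\<close>

definition truncation_const :: "real \<Rightarrow> real" where
  "truncation_const \<beta> = 1 + 2 / (1 - 2 powr (1 - \<beta>))"

lemma truncation_const_nonneg: "1 < \<beta> \<Longrightarrow> 0 \<le> truncation_const \<beta>"
  using powr_le1[of "1 - \<beta>" 2] powr_less_mono[of "1 - \<beta>" 0 "2::real"] by (simp add: truncation_const_def)

text \<open>Turns a power into a combination of indicators, so that its expectation is read off from
  the tails at the levels 1 / 2 ^ Suc i.\<close>

lemma powr_le_dyadic_sum:
  fixes x :: real
  assumes x: "0 \<le> x" "x \<le> 1" and \<beta>: "0 < \<beta>"
  shows "ennreal (x powr \<beta>) \<le> (\<Sum>i. ennreal ((2 powr (- \<beta>)) ^ i) * indicator {1 / 2 ^ Suc i<..} x)"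
proof (cases "x = 0")
  case False
  then have x0: "0 < x" using x by simp
  obtain m where m: "1 / x < 2 ^ m" using real_arch_pow[of 2 "1 / x"] by auto
  define i where "i = (LEAST i. 1 / 2 ^ Suc i < x)"
  have "1 / x < 2 ^ Suc m" using m by (rule less_le_trans) simp
  then have "1 / 2 ^ Suc m < x" using x0 by (simp add: field_simps)
  then have i: "1 / 2 ^ Suc i < x" unfolding i_def by (rule LeastI)
  have i2: "x \<le> 1 / 2 ^ i"
  proof (cases i)
    case (Suc k)
    then have "\<not> 1 / 2 ^ Suc k < x" unfolding i_def by (intro not_less_Least) simp
    then show ?thesis using Suc by simp
  qed (use x in simp)
  have "x powr \<beta> \<le> (1 / 2 ^ i) powr \<beta>" using i2 x \<beta> by (intro powr_mono2) auto
  also have "(1 / 2 ^ i) powr \<beta> = (2 powr (- \<beta>)) ^ i"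
    by (simp add: powr_divide powr_minus powr_powr powr_power power_one_over inverse_eq_divide mult.commute flip: powr_realpow)
  finally have "ennreal (x powr \<beta>) \<le> ennreal ((2 powr (- \<beta>)) ^ i) * indicator {1 / 2 ^ Suc i<..} x"
    using i by (simp add: ennreal_leI)
  also have "\<dots> \<le> (\<Sum>i. ennreal ((2 powr (- \<beta>)) ^ i) * indicator {1 / 2 ^ Suc i<..} x)"
    by (rule ennreal_le_suminf)
  finally show ?thesis .
qed simp

text \<open>Either one summand exceeds y, or all lie below and the sum of (m j / y) powr \<beta> is
  at least 1; a union bound and Markov's inequality treat the two cases. The summands may be
  arbitrarily dependent. The truncated part uses the tail D / w at arbitrarily small levels
  w.\<close>

lemma emeasure_sum_powr_le:
  fixes m :: "'j \<Rightarrow> 'w \<Rightarrow> real"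
  assumes J: "finite J" and m [measurable]: "\<And>j. j \<in> J \<Longrightarrow> m j \<in> borel_measurable N" and m0: "\<And>j \<omega>. 0 \<le> m j \<omega>"
    and G [measurable]: "G \<in> sets N" and D: "0 \<le> D"
    and tail: "\<And>j w. j \<in> J \<Longrightarrow> 0 < w \<Longrightarrow> emeasure N {\<omega> \<in> G. w < m j \<omega>} \<le> ennreal (D / w)"
    and y: "0 < y" and \<beta>: "1 < \<beta>"
  shows "emeasure N {\<omega> \<in> G. y powr \<beta> < (\<Sum>j\<in>J. m j \<omega> powr \<beta>)} \<le> ennreal (real (card J) * (D / y) * truncation_const \<beta>)"
proof -
  define \<theta> where "\<theta> = (2::real) powr (1 - \<beta>)"
  have \<theta>: "0 \<le> \<theta>" "\<theta> < 1" using powr_less_mono[of "1 - \<beta>" 0 "2::real"] \<beta> by (simp_all add: \<theta>_def)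
  have GN: "G \<subseteq> space N" by (rule sets.sets_into_space[OF G])
  let ?B = "\<lambda>j i. {\<omega> \<in> G. y / 2 ^ Suc i < m j \<omega>}"
  let ?F = "\<lambda>\<omega>. \<Sum>j\<in>J. \<Sum>i. ennreal ((2 powr (- \<beta>)) ^ i) * indicator (?B j i) \<omega>"
  have Bm [measurable]: "?B j i \<in> sets N" if "j \<in> J" for j i
  proof -
    have "?B j i = G \<inter> {\<omega> \<in> space N. y / 2 ^ Suc i < m j \<omega>}" using GN by auto
    then show ?thesis using m[OF that] by simp
  qed
  have Am: "{\<omega> \<in> G. y < m j \<omega>} \<in> sets N" if "j \<in> J" for j
  proof -
    have "{\<omega> \<in> G. y < m j \<omega>} = G \<inter> {\<omega> \<in> space N. y < m j \<omega>}" using GN by auto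
    then show ?thesis using m[OF that] by simp
  qed
  have Fm [measurable]: "?F \<in> borel_measurable N" by measurable
  have sub: "{\<omega> \<in> G. y powr \<beta> < (\<Sum>j\<in>J. m j \<omega> powr \<beta>)} \<subseteq> (\<Union>j\<in>J. {\<omega> \<in> G. y < m j \<omega>}) \<union> {\<omega> \<in> space N. 1 \<le> ?F \<omega>}"
  proof
    fix \<omega> assume \<omega>: "\<omega> \<in> {\<omega> \<in> G. y powr \<beta> < (\<Sum>j\<in>J. m j \<omega> powr \<beta>)}"
    show "\<omega> \<in> (\<Union>j\<in>J. {\<omega> \<in> G. y < m j \<omega>}) \<union> {\<omega> \<in> space N. 1 \<le> ?F \<omega>}"
    proof (cases "\<exists>j\<in>J. y < m j \<omega>")
      case False
      have "1 \<le> (\<Sum>j\<in>J. m j \<omega> powr \<beta>) / y powr \<beta>" using \<omega> y by (simp add: le_divide_eq)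
      also have "\<dots> = (\<Sum>j\<in>J. (m j \<omega> / y) powr \<beta>)" using y m0 by (simp add: sum_divide_distrib powr_divide)
      finally have "1 \<le> ennreal (\<Sum>j\<in>J. (m j \<omega> / y) powr \<beta>)" by simp
      also have "\<dots> = (\<Sum>j\<in>J. ennreal ((m j \<omega> / y) powr \<beta>))" by (rule sum_ennreal[symmetric]) simp
      also have "\<dots> \<le> ?F \<omega>"
      proof (rule sum_mono)
        fix j assume "j \<in> J"
        then have "m j \<omega> / y \<le> 1" using False y by (simp add: not_less)
        then have "ennreal ((m j \<omega> / y) powr \<beta>) \<le> (\<Sum>i. ennreal ((2 powr (- \<beta>)) ^ i) * indicator {1 / 2 ^ Suc i<..} (m j \<omega> / y))"
          using m0 y \<beta> by (intro powr_le_dyadic_sum) auto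
        also have "\<dots> = (\<Sum>i. ennreal ((2 powr (- \<beta>)) ^ i) * indicator (?B j i) \<omega>)"
        proof (intro arg_cong[where f=suminf] ext arg_cong2[where f="(*)"] refl)
          fix i show "indicator {1 / 2 ^ Suc i<..} (m j \<omega> / y) = (indicator (?B j i) \<omega> :: ennreal)"
            using \<omega> y by (simp add: indicator_def field_simps)
        qed
        finally show "ennreal ((m j \<omega> / y) powr \<beta>) \<le> (\<Sum>i. ennreal ((2 powr (- \<beta>)) ^ i) * indicator (?B j i) \<omega>)" .
      qed
      finally show ?thesis using \<omega> GN by auto
    qed (use \<omega> in auto)
  qed
  have "emeasure N (\<Union>j\<in>J. {\<omega> \<in> G. y < m j \<omega>}) \<le> (\<Sum>j\<in>J. emeasure N {\<omega> \<in> G. y < m j \<omega>})"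
    using Am J by (intro emeasure_subadditive_finite) auto
  also have "\<dots> \<le> (\<Sum>j\<in>J. ennreal (D / y))" by (intro sum_mono tail y)
  also have "\<dots> = ennreal (real (card J) * (D / y))" using D y by (simp add: ennreal_of_nat_eq_real_of_nat) (subst ennreal_mult[symmetric]; simp)
  finally have b1: "emeasure N (\<Union>j\<in>J. {\<omega> \<in> G. y < m j \<omega>}) \<le> ennreal (real (card J) * (D / y))" .
  have "emeasure N {\<omega> \<in> space N. 1 \<le> ?F \<omega>} \<le> (\<integral>\<^sup>+\<omega>. ?F \<omega> \<partial>N)"
    using emeasure_ge_1_le[of ?F N 1] by simp
  also have "\<dots> = (\<Sum>j\<in>J. \<Sum>i. ennreal ((2 powr (- \<beta>)) ^ i) * emeasure N (?B j i))"
    by (subst nn_integral_sum, measurable) (intro sum.cong refl, simp add: nn_integral_suminf nn_integral_cmult_indicator)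
  also have "\<dots> \<le> (\<Sum>j\<in>J. ennreal (D / y * 2 * (1 / (1 - \<theta>))))"
  proof (rule sum_mono)
    fix j assume j: "j \<in> J"
    have "(\<Sum>i. ennreal ((2 powr (- \<beta>)) ^ i) * emeasure N (?B j i)) \<le> (\<Sum>i. ennreal (D / y * 2 * \<theta> ^ i))"
    proof (intro suminf_le summableI)
      fix i
      have "ennreal ((2 powr (- \<beta>)) ^ i) * emeasure N (?B j i) \<le> ennreal ((2 powr (- \<beta>)) ^ i) * ennreal (D / (y / 2 ^ Suc i))"
        using tail[OF j, of "y / 2 ^ Suc i"] y by (intro mult_left_mono) auto
      also have "\<dots> = ennreal ((2 powr (- \<beta>)) ^ i * (D / (y / 2 ^ Suc i)))" using D y by (intro ennreal_mult[symmetric]) auto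
      also have "(2 powr (- \<beta>)) ^ i * (D / (y / 2 ^ Suc i)) = D / y * 2 * (2 powr (- \<beta>) * 2) ^ i"
        by (simp add: power_mult_distrib)
      also have "2 powr (- \<beta>) * 2 = \<theta>" using powr_add[of 2 "- \<beta>" 1] by (simp add: \<theta>_def)
      finally show "ennreal ((2 powr (- \<beta>)) ^ i) * emeasure N (?B j i) \<le> ennreal (D / y * 2 * \<theta> ^ i)" .
    qed
    also have "\<dots> = ennreal (D / y * 2 * (1 / (1 - \<theta>)))"
      using \<theta> D y by (intro suminf_ennreal_eq sums_mult geometric_sums) auto
    finally show "(\<Sum>i. ennreal ((2 powr (- \<beta>)) ^ i) * emeasure N (?B j i)) \<le> ennreal (D / y * 2 * (1 / (1 - \<theta>)))" .
  qed
  also have "\<dots> = ennreal (real (card J) * (D / y * 2 * (1 / (1 - \<theta>))))"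
    using D y \<theta> by (simp add: ennreal_of_nat_eq_real_of_nat) (subst ennreal_mult[symmetric]; simp)
  finally have b2: "emeasure N {\<omega> \<in> space N. 1 \<le> ?F \<omega>} \<le> ennreal (real (card J) * (D / y * 2 * (1 / (1 - \<theta>))))" .
  have "emeasure N {\<omega> \<in> G. y powr \<beta> < (\<Sum>j\<in>J. m j \<omega> powr \<beta>)} \<le>
      emeasure N ((\<Union>j\<in>J. {\<omega> \<in> G. y < m j \<omega>}) \<union> {\<omega> \<in> space N. 1 \<le> ?F \<omega>})"
    using sub Am J by (intro emeasure_mono sets.Un sets.finite_UN) auto
  also have "\<dots> \<le> emeasure N (\<Union>j\<in>J. {\<omega> \<in> G. y < m j \<omega>}) + emeasure N {\<omega> \<in> space N. 1 \<le> ?F \<omega>}"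
    using Am J by (intro emeasure_subadditive sets.finite_UN) auto
  also have "\<dots> \<le> ennreal (real (card J) * (D / y)) + ennreal (real (card J) * (D / y * 2 * (1 / (1 - \<theta>))))"
    by (rule add_mono[OF b1 b2])
  also have "\<dots> = ennreal (real (card J) * (D / y) + real (card J) * (D / y * 2 * (1 / (1 - \<theta>))))"
    using D y \<theta> by (intro ennreal_plus[symmetric]) auto
  also have "real (card J) * (D / y) + real (card J) * (D / y * 2 * (1 / (1 - \<theta>))) = real (card J) * (D / y) * truncation_const \<beta>"
    by (simp add: truncation_const_def \<theta>_def algebra_simps)
  finally show ?thesis .
qed

lemma bounded_hcube:
  fixes p :: "'a::euclidean_space"
  shows "bounded (hcube p s)"
proof (rule bounded_subset[OF bounded_cbox])
  show "hcube p s \<subseteq> cbox p (p + s *\<^sub>R One)"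
    by (auto simp: hcube_def mem_box inner_simps less_imp_le)
qed

context star_field
begin

definition tail_const :: "real \<Rightarrow> real" where
  "tail_const \<beta> = total_score_const + 2 * exp dim * count_const * truncation_const \<beta>"

lemma tail_const_nonneg: "1 < \<beta> \<Longrightarrow> 0 \<le> tail_const \<beta>"
  unfolding tail_const_def using total_score_const_nonneg count_const_nonneg truncation_const_nonneg by simp

lemma variation_tail:
  fixes M :: "'w \<Rightarrow> 'a measure"
  assumes M: "random_measure P M" and lim: "weak_star_limit_in_probability P approx M"
    and J: "finite J" "real (card J) \<le> exp (dim * (real a + 1))"
    and U: "\<And>j. j \<in> J \<Longrightarrow> open (U j)" "\<And>j. j \<in> J \<Longrightarrow> U j \<subseteq> hcube (p j) (exp (- real a))"
    and p: "\<And>j. j \<in> J \<Longrightarrow> hcube (p j) (exp (- real a)) \<subseteq> hcube 0 1"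
    and \<beta>: "1 < \<beta>" and z: "1 \<le> z"
  shows "emeasure P {\<omega> \<in> space P. z < sqrt (real a + 1) * (\<Sum>j\<in>J. measure (M \<omega>) (U j) powr \<beta>) powr (1 / \<beta>)} \<le>
    ennreal (tail_const \<beta> * (1 + ln z) / z)"
proof -
  define l where "l = ln z / \<gamma>"
  have g: "1 \<le> \<gamma>" by (rule gamma_ge)
  have l: "0 \<le> l" "l \<le> ln z" using z g by (simp_all add: l_def divide_le_eq mult_left_le mult_le_cancel_left1)
  have el: "exp (- \<gamma> * l) = 1 / z" using g z by (simp add: l_def exp_minus inverse_eq_divide)
  define s where "s = sqrt (real a + 1)"
  have s: "0 < s" by (simp add: s_def)
  define y where "y = z / s"
  have y: "0 < y" using s z by (simp add: y_def)
  define D where "D = 2 * count_const * exp (- dim * real a) * ((1 + l) / s)"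
  have D: "0 \<le> D" using count_const_nonneg l s by (simp add: D_def)
  let ?G = "good_event a l"
  let ?V = "\<lambda>\<omega>. \<Sum>j\<in>J. measure (M \<omega>) (U j) powr \<beta>"
  have GP: "?G \<subseteq> space P" by (rule sets.sets_into_space[OF good_event])
  have Um: "(\<lambda>\<omega>. emeasure (M \<omega>) (U j)) \<in> borel_measurable P" if "j \<in> J" for j
    using M U(1)[OF that] by (simp add: random_measure_def)
  have mm [measurable]: "(\<lambda>\<omega>. measure (M \<omega>) (U j)) \<in> borel_measurable P" if "j \<in> J" for j
    unfolding measure_def using Um[OF that] by measurable
  have tail: "emeasure P {\<omega> \<in> ?G. w < measure (M \<omega>) (U j)} \<le> ennreal (D / w)" if j: "j \<in> J" and w: "0 < w" for j w
  proof -
    have "bounded (U j)" by (rule bounded_subset[OF bounded_hcube U(2)[OF j]])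
    \<comment> \<open>The level is halved because passing to the limit doubles it.\<close>
    moreover have "\<exists>T0. \<forall>T\<ge>T0. emeasure P {\<omega> \<in> ?G. ennreal (w / 2) < ennreal (sqrt (real T)) * total_mass T (hcube (p j) (exp (- real a))) \<omega>} \<le>
      ennreal (count_const * exp (- dim * real a) * ((1 + l) / sqrt (real a + 1)) / (w / 2))"
      using p[OF j] w by (intro large_mass_eventually l good_event good_event_barrier[of _ a l]) auto
    ultimately have "emeasure P {\<omega> \<in> ?G. ennreal (2 * (w / 2)) < emeasure (M \<omega>) (U j)} \<le>
      ennreal (count_const * exp (- dim * real a) * ((1 + l) / sqrt (real a + 1)) / (w / 2))"
      using w U[OF j] by (intro emeasure_limit_le[OF M lim good_event _ hcube_borel]) auto
    also have "count_const * exp (- dim * real a) * ((1 + l) / sqrt (real a + 1)) / (w / 2) = D / w"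
      by (simp add: D_def s_def)
    finally have b: "emeasure P {\<omega> \<in> ?G. ennreal w < emeasure (M \<omega>) (U j)} \<le> ennreal (D / w)" by simp
    have m1: "{\<omega> \<in> ?G. ennreal w < emeasure (M \<omega>) (U j)} \<in> events"
    proof -
      have "{\<omega> \<in> ?G. ennreal w < emeasure (M \<omega>) (U j)} = ?G \<inter> {\<omega> \<in> space P. ennreal w < emeasure (M \<omega>) (U j)}" using GP by auto
      then show ?thesis using Um[OF j] good_event by simp
    qed
    have "{\<omega> \<in> ?G. w < measure (M \<omega>) (U j)} \<subseteq> {\<omega> \<in> ?G. ennreal w < emeasure (M \<omega>) (U j)}"
    proof safe
      fix \<omega> assume "w < measure (M \<omega>) (U j)"
      then show "ennreal w < emeasure (M \<omega>) (U j)"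
        using w unfolding measure_def by (cases "emeasure (M \<omega>) (U j)") (auto simp: ennreal_less_iff)
    qed
    then show ?thesis using emeasure_mono[OF _ m1] b by (meson order_trans)
  qed
  have Vm: "{\<omega> \<in> ?G. y powr \<beta> < ?V \<omega>} \<in> events"
  proof -
    have "{\<omega> \<in> ?G. y powr \<beta> < ?V \<omega>} = ?G \<inter> {\<omega> \<in> space P. y powr \<beta> < ?V \<omega>}" using GP by auto
    moreover have "?V \<in> borel_measurable P" by measurable
    ultimately show ?thesis using good_event by simp
  qed
  have "{\<omega> \<in> space P. z < s * ?V \<omega> powr (1 / \<beta>)} \<subseteq> (space P - ?G) \<union> {\<omega> \<in> ?G. y powr \<beta> < ?V \<omega>}"
  proof
    fix \<omega> assume \<omega>: "\<omega> \<in> {\<omega> \<in> space P. z < s * ?V \<omega> powr (1 / \<beta>)}"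
    then have "y < ?V \<omega> powr (1 / \<beta>)" using s by (simp add: y_def divide_less_eq mult.commute)
    then have "y powr \<beta> < (?V \<omega> powr (1 / \<beta>)) powr \<beta>" using y \<beta> by (intro powr_less_mono2) auto
    then have "y powr \<beta> < ?V \<omega>" using \<beta> by (simp add: powr_powr sum_nonneg)
    then show "\<omega> \<in> (space P - ?G) \<union> {\<omega> \<in> ?G. y powr \<beta> < ?V \<omega>}" using \<omega> by auto
  qed
  then have "emeasure P {\<omega> \<in> space P. z < s * ?V \<omega> powr (1 / \<beta>)} \<le> emeasure P ((space P - ?G) \<union> {\<omega> \<in> ?G. y powr \<beta> < ?V \<omega>})"
    using Vm good_event by (intro emeasure_mono sets.Un) auto
  also have "\<dots> \<le> emeasure P (space P - ?G) + emeasure P {\<omega> \<in> ?G. y powr \<beta> < ?V \<omega>}"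
    using Vm good_event by (intro emeasure_subadditive) auto
  also have "\<dots> \<le> ennreal (total_score_const * exp (- \<gamma> * l)) + ennreal (real (card J) * (D / y) * truncation_const \<beta>)"
    using mm tail by (intro add_mono good_event_compl emeasure_sum_powr_le[OF J(1) _ _ good_event D _ y \<beta>]) auto
  also have "\<dots> = ennreal (total_score_const * exp (- \<gamma> * l) + real (card J) * (D / y) * truncation_const \<beta>)"
    using total_score_const_nonneg D y truncation_const_nonneg[OF \<beta>] by (intro ennreal_plus[symmetric]) auto
  also have "\<dots> \<le> ennreal (tail_const \<beta> * (1 + ln z) / z)"
  proof (rule ennreal_leI)
    \<comment> \<open>The number of cubes cancels exp (- dim * a) up to the factor
      \<open>exp dim\<close>, and the \<open>s\<close> in y = z / s cancels the survival factor 1 /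
      s in D.\<close>
    have "real (card J) * (D / y) \<le> exp (dim * (real a + 1)) * (D / y)" using J(2) D y by (intro mult_right_mono) auto
    also have "\<dots> = 2 * exp dim * count_const * ((1 + l) / z) * (exp (dim * real a) * exp (- dim * real a))"
      using s z by (simp add: D_def y_def distrib_left exp_add field_simps)
    also have "\<dots> = 2 * exp dim * count_const * ((1 + l) / z)" by (simp flip: exp_add)
    also have "\<dots> \<le> 2 * exp dim * count_const * ((1 + ln z) / z)"
      using l z count_const_nonneg by (intro mult_left_mono divide_right_mono) auto
    finally have "real (card J) * (D / y) * truncation_const \<beta> \<le> 2 * exp dim * count_const * ((1 + ln z) / z) * truncation_const \<beta>"
      by (rule mult_right_mono) (rule truncation_const_nonneg[OF \<beta>])
    moreover have "total_score_const * exp (- \<gamma> * l) \<le> total_score_const * ((1 + ln z) / z)"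
      unfolding el using z total_score_const_nonneg by (intro mult_left_mono divide_right_mono) auto
    ultimately have "total_score_const * exp (- \<gamma> * l) + real (card J) * (D / y) * truncation_const \<beta> \<le>
      total_score_const * ((1 + ln z) / z) + 2 * exp dim * count_const * ((1 + ln z) / z) * truncation_const \<beta>" by linarith
    also have "\<dots> = tail_const \<beta> * (1 + ln z) / z" by (simp add: tail_const_def algebra_simps add_divide_distrib)
    finally show "total_score_const * exp (- \<gamma> * l) + real (card J) * (D / y) * truncation_const \<beta> \<le> tail_const \<beta> * (1 + ln z) / z" .
  qed
  finally show ?thesis unfolding s_def .
qed

end

section \<open>Subcubes of the unit cube and the uniform moment bound\<close>

lemma mem_subcube:
  assumes "0 < n"
  shows "x \<in> subcube n j \<longleftrightarrow> (\<forall>i. real (j $ i) / real n < x $ i \<and> x $ i < (real (j $ i) + 1) / real n)"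
proof
  assume "x \<in> subcube n j"
  then show "\<forall>i. real (j $ i) / real n < x $ i \<and> x $ i < (real (j $ i) + 1) / real n"
    using assms by (auto simp: subcube_def unit_cube_def field_simps)
next
  assume x: "\<forall>i. real (j $ i) / real n < x $ i \<and> x $ i < (real (j $ i) + 1) / real n"
  let ?y = "real n *\<^sub>R x - (\<chi> i. real (j $ i))"
  have "?y \<in> unit_cube" using x assms by (auto simp: unit_cube_def field_simps)
  moreover have "x = (1 / real n) *\<^sub>R ((\<chi> i. real (j $ i)) + ?y)" using assms by simp
  ultimately show "x \<in> subcube n j" unfolding subcube_def by blast
qed

lemma open_subcube: "0 < n \<Longrightarrow> open (subcube n j)"
proof -
  assume n: "0 < n"
  have "subcube n j = (\<Inter>i. {x. real (j $ i) / real n < x $ i} \<inter> {x. x $ i < (real (j $ i) + 1) / real n})"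
    using mem_subcube[OF n, of _ j] by auto
  also have "open \<dots>" by (intro open_INT ballI open_Int open_Collect_less continuous_intros) auto
  finally show ?thesis .
qed

lemma card_cube_indices: "finite (cube_indices n :: (nat ^ 'd::finite) set)"
  "card (cube_indices n :: (nat ^ 'd::finite) set) = n ^ CARD('d)"
proof -
  have b: "bij_betw vec_nth (cube_indices n :: (nat ^ 'd) set) (PiE UNIV (\<lambda>_. {..<n}))"
    by (rule bij_betw_byWitness[where f'="vec_lambda"]) (auto simp: cube_indices_def PiE_def vec_lambda_inverse)
  show "finite (cube_indices n :: (nat ^ 'd) set)" using bij_betw_finite[OF b] by (simp add: finite_PiE)
  show "card (cube_indices n :: (nat ^ 'd) set) = n ^ CARD('d)" using bij_betw_same_card[OF b] by (simp add: card_PiE)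
qed

theorem corollary1p2:
  fixes P :: "'w measure"
    and \<rho> :: "real ^ 'd::finite \<Rightarrow> real"
    and X :: "real \<Rightarrow> 'w \<Rightarrow> real ^ 'd \<Rightarrow> real"
    and M :: "'w \<Rightarrow> (real ^ 'd) measure"
    and \<beta> r :: real
  assumes "prob_space P"
    and "seed_covariance \<rho>"
    and "star_scale_martingale_decomposition P \<rho> X"
    and "critical_chaos P X M"
    and "\<beta> > 1"
    and "0 < r" and "r < 1 / \<beta>"
  shows "(SUP n\<in>{1..}. \<integral>\<^sup>+ \<omega>. ennreal (renormalised_variation M \<beta> n \<omega> powr r) \<partial>P) < \<infinity>"
proof -
  interpret star_field P \<rho> X using assms by (simp add: star_field_def star_field_axioms_def)
  have gam: "critical_gamma TYPE('d) = \<gamma>" by (simp add: critical_gamma_def \<gamma>_def)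
  have ap: "critical_approx X = approx" by (simp add: fun_eq_iff critical_approx_def gam dim_def)
  have M: "random_measure P M" and lim: "weak_star_limit_in_probability P approx M"
    using assms(4) by (simp_all add: critical_chaos_def ap)
  have q: "0 < \<beta> * r" "\<beta> * r < 1" using assms(5-7) by (simp_all add: field_simps)
  let ?K = "1 + tail_const \<beta> * 2 powr (\<beta> * r) * (1 / (1 - 2 powr (\<beta> * r) / 2)\<^sup>2)"
  have "(\<integral>\<^sup>+ \<omega>. ennreal (renormalised_variation M \<beta> n \<omega> powr r) \<partial>P) \<le> ennreal ?K" if n: "1 \<le> n" for n :: nat
  proof -
    \<comment> \<open>Rounding down makes the side exp (- a) at least 1 / n, so one cube covers each
      subcube, while n ^ CARD('d) still is at most exp (dim * (a + 1)).\<close>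
    define a where "a = nat \<lfloor>ln (real n)\<rfloor>"
    define s where "s = exp (- real a)"
    have ln0: "0 \<le> ln (real n)" using n by simp
    have a: "real a \<le> ln (real n)" "ln (real n) \<le> real a + 1"
      using ln0 unfolding a_def by linarith+
    have s: "1 / real n \<le> s" "s \<le> 1"
    proof -
      have "exp (- ln (real n)) \<le> s" unfolding s_def using a by simp
      then show "1 / real n \<le> s" using n by (simp add: exp_minus inverse_eq_divide)
    qed (simp add: s_def)
    let ?J = "cube_indices n :: (nat ^ 'd) set"
    \<comment> \<open>The covering cube has side \<open>s \<ge> 1 / n\<close> and is shifted inwards, because the barrier is only
      available in the unit cube.\<close>
    let ?p = "\<lambda>j :: nat ^ 'd. \<chi> i. min (real (j $ i) / real n) (1 - s)"
    let ?Z = "\<lambda>\<omega>. sqrt (real a + 1) * (\<Sum>j\<in>?J. measure (M \<omega>) (subcube n j) powr \<beta>) powr (1 / \<beta>)"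
    have hc: "hcube q t = {x. \<forall>i. q $ i \<le> x $ i \<and> x $ i < q $ i + t}" for q :: "real ^ 'd" and t
      by (auto simp: hcube_def Basis_vec_def inner_axis)
    have cards: "real (card ?J) \<le> exp (dim * (real a + 1))"
    proof -
      have "real (card ?J) = exp (ln (real n)) ^ CARD('d)" using n by (simp add: card_cube_indices)
      also have "\<dots> = exp (dim * ln (real n))" by (simp add: dim_def flip: exp_of_nat_mult)
      also have "\<dots> \<le> exp (dim * (real a + 1))" using a dim_ge_1 by (simp add: mult_left_mono)
      finally show ?thesis .
    qed
    have sub: "subcube n j \<subseteq> hcube (?p j) s" if "j \<in> ?J" for j
    proof
      fix x assume "x \<in> subcube n j"
      then have x: "real (j $ i) / real n < x $ i" "x $ i < (real (j $ i) + 1) / real n" for i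
        using n by (simp_all add: mem_subcube)
      have "?p j $ i \<le> x $ i \<and> x $ i < ?p j $ i + s" for i
      proof -
        have "j $ i < n" using that by (simp add: cube_indices_def)
        then have "real (j $ i) + 1 \<le> real n" by linarith
        then have "(real (j $ i) + 1) / real n \<le> 1" using n by simp
        then have "x $ i < 1" using x(2)[of i] by linarith
        moreover have "x $ i < real (j $ i) / real n + s" using x(2)[of i] s(1) by (simp add: add_divide_distrib)
        ultimately show ?thesis using x(1)[of i] by (simp add: min_def)
      qed
      then show "x \<in> hcube (?p j) s" by (simp add: hc)
    qed
    have incl: "hcube (?p j) s \<subseteq> hcube 0 1" for j
    proof
      fix x assume "x \<in> hcube (?p j) s"
      then have x: "min (real (j $ i) / real n) (1 - s) \<le> x $ i" "x $ i < min (real (j $ i) / real n) (1 - s) + s" for i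
        by (simp_all add: hc)
      have "0 \<le> x $ i \<and> x $ i < 1" for i
      proof -
        have "0 \<le> min (real (j $ i) / real n) (1 - s)" using s(2) by simp
        then show ?thesis using x[of i] by linarith
      qed
      then show "x \<in> hcube 0 1" by (simp add: hc)
    qed
    have mm [measurable]: "(\<lambda>\<omega>. measure (M \<omega>) (subcube n j)) \<in> borel_measurable P" for j
    proof -
      have "(\<lambda>\<omega>. emeasure (M \<omega>) (subcube n j)) \<in> borel_measurable P"
        using M open_subcube[of n j] n by (simp add: random_measure_def)
      then show ?thesis unfolding measure_def by measurable
    qed
    have "(\<integral>\<^sup>+\<omega>. ennreal (?Z \<omega> powr (\<beta> * r)) \<partial>P) \<le> ennreal ?K"
    proof (rule nn_integral_powr_le_of_tail[OF q tail_const_nonneg[OF assms(5)]])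
      show "?Z \<in> borel_measurable P" by measurable
      show "emeasure P {\<omega> \<in> space P. z < ?Z \<omega>} \<le> ennreal (tail_const \<beta> * (1 + ln z) / z)" if "1 \<le> z" for z
        using variation_tail[OF M lim _ cards, where U = "subcube n" and p = ?p, OF _ _ _ _ assms(5) that]
          card_cube_indices(1) open_subcube[of n] n sub incl unfolding s_def by auto
    qed simp
    moreover have "renormalised_variation M \<beta> n \<omega> powr r \<le> ?Z \<omega> powr (\<beta> * r)" for \<omega>
    proof -
      let ?V = "\<Sum>j\<in>?J. measure (M \<omega>) (subcube n j) powr \<beta>"
      have V: "0 \<le> ?V" by (simp add: sum_nonneg)
      have "?Z \<omega> powr \<beta> = ((real a + 1) powr (1 / 2)) powr \<beta> * (?V powr (1 / \<beta>)) powr \<beta>"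
        by (simp add: powr_mult powr_half_sqrt)
      also have "\<dots> = (real a + 1) powr (\<beta> / 2) * ?V" using V assms(5) by (simp add: powr_powr)
      finally have Z: "?Z \<omega> powr \<beta> = (real a + 1) powr (\<beta> / 2) * ?V" .
      \<comment> \<open>Uses ln n \<le> a + 1. At n = 1 the left-hand side is 0 since its prefactor
        is 0.\<close>
      have "renormalised_variation M \<beta> n \<omega> \<le> ?Z \<omega> powr \<beta>"
        unfolding Z renormalised_variation_def using a(2) ln0 V assms(5) by (intro mult_right_mono powr_mono2) auto
      then have "renormalised_variation M \<beta> n \<omega> powr r \<le> (?Z \<omega> powr \<beta>) powr r"
        using V assms(6) by (intro powr_mono2) (auto simp: renormalised_variation_def)
      then show ?thesis by (simp add: powr_powr)
    qed
    ultimately show ?thesis by (meson ennreal_leI nn_integral_mono order_trans)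
  qed
  then have "(SUP n\<in>{1..}. \<integral>\<^sup>+ \<omega>. ennreal (renormalised_variation M \<beta> n \<omega> powr r) \<partial>P) \<le> ennreal ?K"
    by (intro SUP_least) auto
  also have "\<dots> < \<infinity>" by simp
  finally show ?thesis .
qed

end
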